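(* Let $d\ge 3$ and let $(\varphi_\alpha)_{\alpha\in\mathbb Z^d}$ be the infinite-volume discrete Gaussian Free Field on $\mathbb Z^d$, i.e. the centered Gaussian field with covariance $\mathsf{E}[\varphi_\alpha\varphi_\beta]=g(\alpha,\beta)$, where $g$ is the Green's function of the simple random walk on $\mathbb Z^d$. For $n\in\mathbb N$ let $N=n^d$, $V_N=[0,n-1]^d\cap\mathbb Z^d$, $E=[0,1]^d\times(-\infty,+\infty]$, and, with $g(0):=g(0,0)$, $$b_N=\sqrt{g(0)}\left[\sqrt{2\log N}-\frac{\log\log N+\log(4\pi)}{2\sqrt{2\log N}}\right],\qquad a_N=\frac{g(0)}{b_N}.$$ Define the point process on $E$ $$\eta_n(\cdot)=\sum_{\alpha\in V_N}\varepsilon_{\left(\frac{\alpha}{n},\,\frac{\varphi_\alpha-b_N}{a_N}\right)}(\cdot).$$ Then, as $n\to+\infty$, $\eta_n$ converges in distribution on $\mathcal M_p(E)$ to $\eta$, where $\eta$ is a Poisson random measure on $E$ with intensity measure $\mathrm dt\otimes(e^{-z}\,\mathrm dz)$, with $\mathrm dt\otimes \mathrm dz$ the Lebesgue measure on $E$.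
   Context: The Green's function of the simple random walk is $g(\alpha,\beta)=\mathbb E_\alpha\left[\sum_{m\ge 0}\mathbf 1_{\{S_m=\beta\}}\right]$, where $(S_m)_{m\ge0}$ under $\mathbb P_\alpha$ is the discrete-time simple (nearest-neighbour, symmetric) random walk on $\mathbb Z^d$ started at $\alpha$; it is finite for $d\ge3$, and $g(0)=g(0,0)$ is the variance of each $\varphi_\alpha$. For $x\in E$, $\varepsilon_x$ denotes the point measure giving mass one to sets containing $x$ and zero to other sets. The interval $(-\infty,+\infty]$ carries its usual topology, in which sets $[z,+\infty]$, $z\in\mathbb R$, are compact; so compact subsets of $E$ are the closed subsets contained in some $[0,1]^d\times[z,+\infty]$. $\mathcal M_p(E)$ is the set of Radon point measures on $E$ (integer-valued measures, finite on compact sets) endowed with the topology of vague convergence (convergence of integrals of nonnegative continuous compactly supported functions on $E$). The intensity measure of $\eta$ gives no mass to $[0,1]^d\times\{+\infty\}$. The quantities $b_N,a_N$ are considered for $n$ large enough that they are well defined and $b_N>0$. *)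

theory Defs
  imports "HOL-Probability.Probability"
begin

section \<open>Random elements of a topological space\<close>

definition borel_of :: "'a topology \<Rightarrow> 'a measure" where
  "borel_of T = sigma (topspace T) {U. openin T U}"

definition converges_in_distribution ::
  "'a topology \<Rightarrow> 'w measure \<Rightarrow> (nat \<Rightarrow> 'w \<Rightarrow> 'a) \<Rightarrow> 'p measure \<Rightarrow> ('p \<Rightarrow> 'a) \<Rightarrow> bool" where
  "converges_in_distribution T M X P Y \<longleftrightarrow>
     (\<forall>n. X n \<in> M \<rightarrow>\<^sub>M borel_of T) \<and> Y \<in> P \<rightarrow>\<^sub>M borel_of T \<and>
     (\<forall>F :: 'a \<Rightarrow> real. continuous_map T euclideanreal F \<and> bounded (F ` topspace T) \<longrightarrow>
        (\<lambda>n. \<integral>\<omega>. F (X n \<omega>) \<partial>M) \<longlonglongrightarrow> (\<integral>\<omega>. F (Y \<omega>) \<partial>P))"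


section \<open>Point measures and the vague topology\<close>

text \<open>A set \<open>E\<close> carries the subspace topology, and a measure on \<open>E\<close> has
  \<open>restrict_space borel E\<close> as its measurable space. Subsets of \<open>E\<close> are compact in \<open>E\<close>
  iff they are compact in the ambient type.\<close>

definition radon_point_measures :: "'a::topological_space set \<Rightarrow> 'a measure set" where
  "radon_point_measures E =
     {\<mu>. sets \<mu> = sets (restrict_space borel E) \<and>
         (\<forall>A \<in> sets \<mu>. emeasure \<mu> A \<in> insert \<infinity> (range of_nat)) \<and>
         (\<forall>K. compact K \<and> K \<subseteq> E \<longrightarrow> emeasure \<mu> K < \<infinity>)}"

definition compact_support_functions :: "'a::topological_space set \<Rightarrow> ('a \<Rightarrow> real) set" where
  "compact_support_functions E =
     {f. continuous_on E f \<and> (\<forall>x\<in>E. 0 \<le> f x) \<and>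
         (\<exists>K. compact K \<and> K \<subseteq> E \<and> (\<forall>x\<in>E - K. f x = 0))}"

definition vague_topology :: "'a::topological_space set \<Rightarrow> 'a measure topology" where
  "vague_topology E = topology_generated_by
     {{\<mu> \<in> radon_point_measures E. (\<integral>x. f x \<partial>\<mu>) \<in> U} |f U.
        f \<in> compact_support_functions E \<and> open U}"

definition sum_of_point_masses ::
  "'a::topological_space set \<Rightarrow> 'i set \<Rightarrow> ('i \<Rightarrow> 'a) \<Rightarrow> 'a measure" where
  "sum_of_point_masses E I x = measure_of E (sets (restrict_space borel E))
     (\<lambda>A. \<Sum>i\<in>I. emeasure (return (restrict_space borel E) (x i)) A)"

lemma emeasure_sum_of_point_masses:
  assumes "A \<in> sets (restrict_space borel E)"
  shows "emeasure (sum_of_point_masses E I x) A = (\<Sum>i\<in>I. indicator A (x i))"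
proof -
  let ?S = "sets (restrict_space borel E)"
  let ?\<mu> = "\<lambda>A. \<Sum>i\<in>I. emeasure (return (restrict_space borel E) (x i)) A"
  have sp: "space (restrict_space borel E) = E" by (simp add: space_restrict_space)
  have sa: "sigma_algebra E ?S"
    using sets.sigma_algebra_axioms[of "restrict_space borel E"] by (simp add: sp)
  have ca: "countably_additive ?S ?\<mu>"
  proof (rule countably_additiveI)
    fix B :: "nat \<Rightarrow> _" assume B: "range B \<subseteq> ?S" "disjoint_family B"
    have "(\<Sum>n. ?\<mu> (B n)) = (\<Sum>i\<in>I. \<Sum>n. emeasure (return (restrict_space borel E) (x i)) (B n))"
      by (rule suminf_sum) auto
    also have "\<dots> = ?\<mu> (\<Union>n. B n)"
      using B by (intro sum.cong refl suminf_emeasure) auto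
    finally show "(\<Sum>n. ?\<mu> (B n)) = ?\<mu> (\<Union>n. B n)" .
  qed
  have "emeasure (sum_of_point_masses E I x) A = ?\<mu> A"
    unfolding sum_of_point_masses_def
    by (rule emeasure_measure_of_sigma[OF sa _ ca assms]) (simp add: positive_def)
  then show ?thesis using assms by simp
qed

definition poisson_random_measure ::
  "'p measure \<Rightarrow> 'a::topological_space set \<Rightarrow> 'a measure \<Rightarrow> ('p \<Rightarrow> 'a measure) \<Rightarrow> bool" where
  "poisson_random_measure P E \<mu> \<eta> \<longleftrightarrow>
     prob_space P \<and> \<eta> \<in> P \<rightarrow>\<^sub>M borel_of (vague_topology E) \<and>
     (\<forall>A \<in> sets (restrict_space borel E). emeasure \<mu> A < \<infinity> \<longrightarrow>
        (\<forall>k::nat. measure P {\<omega> \<in> space P. emeasure (\<eta> \<omega>) A = of_nat k} =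
                  exp (- measure \<mu> A) * measure \<mu> A ^ k / fact k)) \<and>
     (\<forall>A \<in> sets (restrict_space borel E). emeasure \<mu> A = \<infinity> \<longrightarrow>
        (AE \<omega> in P. emeasure (\<eta> \<omega>) A = \<infinity>)) \<and>
     (\<forall>m::nat. \<forall>A. (\<forall>i<m. A i \<in> sets (restrict_space borel E)) \<and> disjoint_family_on A {..<m} \<longrightarrow>
        prob_space.indep_vars P (\<lambda>_. borel) (\<lambda>i \<omega>. emeasure (\<eta> \<omega>) (A i)) {..<m})"


section \<open>Simple random walk and its Green's function\<close>

definition lattice_units :: "(int ^ 'd::finite) set" where
  "lattice_units = {axis i s |i s. s \<in> {1, -1}}"

definition srw_steps :: "(nat \<Rightarrow> int ^ 'd::finite) measure" where
  "srw_steps = Pi\<^sub>M UNIV (\<lambda>_. measure_pmf (pmf_of_set lattice_units))"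

definition srw :: "int ^ 'd::finite \<Rightarrow> nat \<Rightarrow> (nat \<Rightarrow> int ^ 'd) \<Rightarrow> int ^ 'd" where
  "srw \<alpha> m \<xi> = \<alpha> + (\<Sum>k<m. \<xi> k)"

text \<open>The expectation is taken in \<open>[0,\<infinity>]\<close>; it is finite in dimension at least three.\<close>

definition green :: "int ^ 'd::finite \<Rightarrow> int ^ 'd \<Rightarrow> real" where
  "green \<alpha> \<beta> = enn2real (\<integral>\<^sup>+ \<xi>. (\<Sum>m. indicator {\<beta>} (srw \<alpha> m \<xi>)) \<partial>srw_steps)"


section \<open>The discrete Gaussian free field\<close>

text \<open>Constants are included as degenerate Gaussian variables.\<close>

definition gaussian_variable :: "'w measure \<Rightarrow> ('w \<Rightarrow> real) \<Rightarrow> bool" where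
  "gaussian_variable M X \<longleftrightarrow> X \<in> borel_measurable M \<and>
     (\<exists>m. (AE \<omega> in M. X \<omega> = m) \<or>
          (\<exists>\<sigma>>0. distributed M lborel X (\<lambda>x. ennreal (normal_density m \<sigma> x))))"

definition gaussian_field :: "'w measure \<Rightarrow> ('i \<Rightarrow> 'w \<Rightarrow> real) \<Rightarrow> bool" where
  "gaussian_field M \<phi> \<longleftrightarrow> prob_space M \<and>
     (\<forall>J c. finite J \<longrightarrow> gaussian_variable M (\<lambda>\<omega>. \<Sum>\<alpha>\<in>J. c \<alpha> * \<phi> \<alpha> \<omega>))"

definition discrete_gff :: "'w measure \<Rightarrow> (int ^ 'd::finite \<Rightarrow> 'w \<Rightarrow> real) \<Rightarrow> bool" where
  "discrete_gff M \<phi> \<longleftrightarrow> gaussian_field M \<phi> \<and>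
     (\<forall>\<alpha>. (\<integral>\<omega>. \<phi> \<alpha> \<omega> \<partial>M) = 0) \<and>
     (\<forall>\<alpha> \<beta>. (\<integral>\<omega>. \<phi> \<alpha> \<omega> * \<phi> \<beta> \<omega> \<partial>M) = green \<alpha> \<beta>)"


section \<open>The extremal point process\<close>

definition state_space :: "((real ^ 'd::finite) \<times> ereal) set" where
  "state_space = cbox 0 1 \<times> {-\<infinity><..}"

definition lattice_box :: "nat \<Rightarrow> (int ^ 'd::finite) set" where
  "lattice_box n = {\<alpha>. \<forall>i. 0 \<le> \<alpha> $ i \<and> \<alpha> $ i \<le> int n - 1}"

text \<open>The parameter \<open>v\<close> stands for the variance \<open>g(0)\<close>. For small \<open>N\<close> the values below may be
  artefacts of the conventions for \<open>ln\<close> and division; they have the intended meaning for all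
  sufficiently large \<open>N\<close>.\<close>

definition centering :: "real \<Rightarrow> real \<Rightarrow> real" where
  "centering v N = sqrt v *
     (sqrt (2 * ln N) - (ln (ln N) + ln (4 * pi)) / (2 * sqrt (2 * ln N)))"

definition scaling :: "real \<Rightarrow> real \<Rightarrow> real" where
  "scaling v N = v / centering v N"

definition extremal_process ::
  "(int ^ 'd::finite \<Rightarrow> 'w \<Rightarrow> real) \<Rightarrow> nat \<Rightarrow> 'w \<Rightarrow> ((real ^ 'd) \<times> ereal) measure" where
  "extremal_process \<phi> n \<omega> =
     (let N = real (n ^ CARD('d)); v = green (0 :: int ^ 'd) 0 in
      sum_of_point_masses state_space (lattice_box n)
        (\<lambda>\<alpha>. (\<chi> i. real_of_int (\<alpha> $ i) / real n,
              ereal ((\<phi> \<alpha> \<omega> - centering v N) / scaling v N))))"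

text \<open>Being an image of a measure on pairs of finite points, the intensity gives no mass to
  points with second coordinate \<open>+\<infinity>\<close>.\<close>

definition limit_intensity :: "((real ^ 'd::finite) \<times> ereal) measure" where
  "limit_intensity =
     distr (restrict_space lborel (cbox 0 1) \<Otimes>\<^sub>M density lborel (\<lambda>z. ennreal (exp (- z))))
       (restrict_space borel state_space) (\<lambda>(t, z). (t, ereal z))"

end

theory Submission
  imports
    Defs
    "HOL-Complex_Analysis.Cauchy_Integral_Formula"
    "HOL-Real_Asymp.Real_Asymp"
begin

text \<open>For every \<open>m\<close> the slab \<open>[0,1]\<^sup>d \<times> [-m,+\<infinity>]\<close> is cut into finitely many cells: cubes of side \<open>1/m\<close> times
  half-open intervals of length \<open>1/m\<close>, and one unbounded interval \<open>[m,+\<infinity>]\<close> on top.  An open set of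
  the vague topology that contains a point measure \<open>\<mu>\<close> contains, for all large \<open>m\<close>, every Radon point
  measure with the same numbers of points in the cells of level \<open>m\<close> (lemma
  \<open>count_neighbourhood\<close>).  A bounded continuous function is therefore almost a function of the cell
  counts, of which the limit puts nearly all its mass on finitely many values, and convergence in
  distribution reduces to convergence of the joint law of the cell counts for each fixed \<open>m\<close> (lemma
  \<open>convergence_from_cell_counts\<close>).

  The joint law of the counts of disjoint sets is determined by their joint factorial moments through
  Bonferroni inequalities; if these moments converge to products \<open>\<Prod> \<mu>\<^sub>q\<close>, the counts converge to
  independent Poisson variables (lemma \<open>poisson_limit_of_factorial_moments\<close>).  A factorial moment is
  the sum, over tuples of distinct sites of the box, of the probability that each site of the tuple
  falls into its prescribed cell.  The whole problem is to show that this sum behaves as if the field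
  were independent.  Tuples are split according to a distance \<open>l = n\<^sup>\<delta>\<close> with small \<open>\<delta> > 0\<close>.

  If all sites are at mutual distance at least \<open>l\<close>, their covariances are at most of order \<open>l\<^sup>-\<^sup>1\<^sup>/\<^sup>2\<close>
  (lemma \<open>green_decay\<close>, from Fourier inversion of the transition probabilities), smaller than every
  negative power of the logarithm of the volume.  Regressing one site on the others, the regression coefficients are
  of the order of the covariances, the residual is independent of the other sites (lemma
  \<open>uncorrelated_imp_indep\<close>) and, on the event that the other fields are at most \<open>ln N\<close> in
  absolute value, the regression
  term moves the level by a negligible amount.  Peeling off one site at a time shows that \<open>N\<^sup>k\<close> times
  the probability of the event tends to the product of the limiting weights, uniformly in the tuple
  (lemma \<open>far_factorization\<close>).  Summation over the sites gives a Riemann sum for Lebesgue measure.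

  If some sites are closer than \<open>l\<close>, choose a maximal \<open>l\<close>-separated subset of the tuple, of \<open>c\<close> sites;
  there are at most \<open>N\<^sup>c\<close> times a small power of \<open>N\<close> such tuples.  Distinct sites have correlation at
  most some \<open>\<rho> < 1\<close> (lemma \<open>correlation_gap\<close>), so that requiring exceedance at one additional site
  lowers the probability from about \<open>N\<^sup>-\<^sup>c\<close> to \<open>N\<close> to the power \<open>- c - (1 - \<rho>)\<^sup>2 / 2\<close> (lemma
  \<open>cluster_exponent\<close>).  For \<open>\<delta>\<close> small this beats the number of tuples, and their contribution
  vanishes (lemma \<open>close_lists_negligible\<close>).\<close>

section \<open>Counting selections and Bonferroni inequalities\<close>

text \<open>For random sets the expected number of selections is a joint factorial moment of their cardinalities.\<close>

definition selections :: "'a set list \<Rightarrow> 'a list set" where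
  "selections Ds = {as. distinct as \<and> list_all2 (\<in>) as Ds}"

definition falling :: "nat \<Rightarrow> nat \<Rightarrow> nat" where
  "falling n k = (\<Prod>i<k. n - i)"

lemma falling_0 [simp]: "falling n 0 = 1"
  by (simp add: falling_def)

lemma falling_Suc: "falling n (Suc k) = falling n k * (n - k)"
  by (simp add: falling_def)

lemma falling_eq_binomial: "falling n k = fact k * (n choose k)"
proof (induction k)
  case (Suc k)
  have "Suc k * (n choose Suc k) = (n choose k) * (n - k)"
  proof (cases "k < n")
    case True
    then show ?thesis
      using binomial_absorb_comp[of n k] binomial_absorption[of k n] by (simp add: mult.commute)
  next
    case False then show ?thesis by simp
  qed
  note h = this
  have "falling n (Suc k) = fact k * ((n choose k) * (n - k))"
    by (simp only: falling_Suc Suc mult.assoc)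
  also have "\<dots> = fact (Suc k) * (n choose Suc k)"
    by (simp only: h[symmetric] fact_Suc of_nat_id mult_ac)
  finally show ?case .
qed auto

lemma selections_Nil [simp]: "selections [] = {[]}"
  by (auto simp: selections_def)

lemma selections_Cons:
  "selections (D # Ds) = (\<lambda>(as, a). a # as) ` (SIGMA as:selections Ds. D - set as)"
proof -
  have "x \<in> (\<lambda>(as, a). a # as) ` (SIGMA as:selections Ds. D - set as)"
    if "x \<in> selections (D # Ds)" for x
  proof -
    from that obtain a as where "x = a # as" "a \<in> D" "list_all2 (\<in>) as Ds" "distinct as" "a \<notin> set as"
      unfolding selections_def by (auto simp: list_all2_Cons2)
    then show ?thesis by (intro image_eqI[of _ _ "(as, a)"]) (auto simp: selections_def)
  qed
  then show ?thesis by (auto simp: selections_def)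
qed

lemma finite_selections:
  assumes "\<And>D. D \<in> set Ds \<Longrightarrow> finite D"
  shows "finite (selections Ds)"
  using assms by (induction Ds) (auto simp: selections_Cons)

lemma card_selections_Cons:
  assumes "\<And>D. D \<in> set (D' # Ds) \<Longrightarrow> finite D"
  shows "card (selections (D' # Ds)) = (\<Sum>as\<in>selections Ds. card (D' - set as))"
proof -
  have "inj_on (\<lambda>(as, a). a # as) (SIGMA as:selections Ds. D' - set as)"
    by (auto simp: inj_on_def)
  then have "card (selections (D' # Ds)) = card (SIGMA as:selections Ds. D' - set as)"
    unfolding selections_Cons by (rule card_image)
  also have "\<dots> = (\<Sum>as\<in>selections Ds. card (D' - set as))"
    using assms by (intro card_SigmaI) (auto intro!: finite_selections)
  finally show ?thesis .
qed

text \<open>Linearity in each slot; it lets moments that involve the union of all cells be expanded into moments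
  that involve single cells only.\<close>

lemma card_selections_insert_Union:
  assumes "finite Q" "disjoint_family_on S Q" "\<And>q. q \<in> Q \<Longrightarrow> finite (S q)"
    and "\<And>D. D \<in> set Ds \<union> set Es \<Longrightarrow> finite D"
  shows "card (selections (Ds @ (\<Union>q\<in>Q. S q) # Es)) = (\<Sum>q\<in>Q. card (selections (Ds @ S q # Es)))"
proof -
  have eq: "selections (Ds @ (\<Union>q\<in>Q. S q) # Es) = (\<Union>q\<in>Q. selections (Ds @ S q # Es))"
  proof -
    have mem: "as \<in> selections (Ds @ D # Es) \<longleftrightarrow> distinct as \<and>
        (\<exists>xs y zs. as = xs @ y # zs \<and> length xs = length Ds \<and> list_all2 (\<in>) xs Ds \<and> y \<in> D \<and> list_all2 (\<in>) zs Es)" for as D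
    proof -
      have "list_all2 (\<in>) as (Ds @ D # Es) \<longleftrightarrow> (\<exists>us vs. as = us @ vs \<and> length us = length Ds \<and> list_all2 (\<in>) us Ds \<and> list_all2 (\<in>) vs (D # Es))"
      proof
        assume "list_all2 (\<in>) as (Ds @ D # Es)"
        then obtain us vs where "as = us @ vs" "length us = length Ds" "list_all2 (\<in>) us Ds" "list_all2 (\<in>) vs (D # Es)"
          unfolding list_all2_append2 by auto
        then show "\<exists>us vs. as = us @ vs \<and> length us = length Ds \<and> list_all2 (\<in>) us Ds \<and> list_all2 (\<in>) vs (D # Es)"
          by (intro exI conjI)
      next
        assume "\<exists>us vs. as = us @ vs \<and> length us = length Ds \<and> list_all2 (\<in>) us Ds \<and> list_all2 (\<in>) vs (D # Es)"
        then show "list_all2 (\<in>) as (Ds @ D # Es)" by (elim exE conjE) (simp only: list_all2_appendI)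
      qed
      also have "\<dots> \<longleftrightarrow> (\<exists>us y vs. as = us @ y # vs \<and> length us = length Ds \<and> list_all2 (\<in>) us Ds \<and> y \<in> D \<and> list_all2 (\<in>) vs Es)"
        unfolding list_all2_Cons2 by (intro iffI; elim exE conjE; intro exI conjI; assumption?; simp?)
      finally show ?thesis unfolding selections_def by simp
    qed
    show ?thesis by (rule set_eqI) (simp only: mem UN_iff, blast)
  qed
  have disj: "selections (Ds @ S q # Es) \<inter> selections (Ds @ S q' # Es) = {}"
    if "q \<in> Q" "q' \<in> Q" "q \<noteq> q'" for q q'
  proof -
    have "S q \<inter> S q' = {}" using assms(2) that by (auto simp: disjoint_family_on_def)
    moreover have "as ! length Ds \<in> S r" if "as \<in> selections (Ds @ S r # Es)" for as r
      using that list_all2_nthD2[of "(\<in>)" as "Ds @ S r # Es" "length Ds"]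
      by (auto simp: selections_def)
    ultimately show ?thesis by blast
  qed
  show ?thesis
    unfolding eq
  proof (intro card_UN_disjoint ballI impI)
    show "finite (selections (Ds @ S q # Es))" if "q \<in> Q" for q
      using assms(3,4) that by (intro finite_selections) auto
  qed (use assms(1) disj in blast)+
qed

lemma card_set_selection_Int:
  assumes "as \<in> selections (map S cs)" "disjoint_family_on S Q" "set cs \<subseteq> Q" "q \<in> Q"
  shows "card (set as \<inter> S q) = count_list cs q"
  using assms(1,3)
proof (induction cs arbitrary: as)
  case (Cons c cs)
  then obtain a as' where as: "as = a # as'" "as' \<in> selections (map S cs)" "a \<in> S c" "a \<notin> set as'"
    by (auto simp: selections_Cons)
  have "a \<in> S q \<longleftrightarrow> c = q"
    using assms(2,4) as(3) Cons.prems(2) by (auto simp: disjoint_family_on_def)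
  then show ?case using Cons as by (auto simp: Int_insert_left)
qed auto

text \<open>The entries already chosen remove exactly \<open>count_list cs q\<close> elements from \<open>S q\<close>, by disjointness.\<close>

lemma card_selections_labels:
  assumes fin: "finite Q" and disj: "disjoint_family_on S Q" and finS: "\<And>q. q \<in> Q \<Longrightarrow> finite (S q)"
    and "set cs \<subseteq> Q"
  shows "card (selections (map S cs)) = (\<Prod>q\<in>Q. falling (card (S q)) (count_list cs q))"
  using assms(4)
proof (induction cs)
  case (Cons c cs)
  have c: "c \<in> Q" using Cons.prems by auto
  have "card (selections (map S (c # cs))) = (\<Sum>as\<in>selections (map S cs). card (S c - set as))"
    using Cons.prems finS by (simp only: list.map) (intro card_selections_Cons, auto)
  also have "\<dots> = (\<Sum>as\<in>selections (map S cs). card (S c) - count_list cs c)"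
    using Cons.prems card_set_selection_Int[OF _ disj _ c, of _ cs] finS[OF c]
    by (intro sum.cong refl) (auto simp: card_Diff_subset_Int Int_commute)
  also have "\<dots> = (\<Prod>q\<in>Q. falling (card (S q)) (count_list cs q)) * (card (S c) - count_list cs c)"
    using Cons by simp
  also have "\<dots> = (\<Prod>q\<in>Q. falling (card (S q)) (count_list (c # cs) q))"
  proof -
    have "(\<Prod>q\<in>Q. falling (card (S q)) (count_list (c # cs) q)) =
      falling (card (S c)) (Suc (count_list cs c)) * (\<Prod>q\<in>Q-{c}. falling (card (S q)) (count_list cs q))"
    proof -
      have "(\<Prod>q\<in>Q-{c}. falling (card (S q)) (count_list (c # cs) q))
        = (\<Prod>q\<in>Q-{c}. falling (card (S q)) (count_list cs q))"
        by (intro prod.cong) auto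
      then show ?thesis using prod.remove[OF fin c, of "\<lambda>q. falling (card (S q)) (count_list (c # cs) q)"]
        by simp
    qed
    then show ?thesis
      using fin c prod.remove[of Q c "\<lambda>q. falling (card (S q)) (count_list cs q)"]
      by (simp add: falling_Suc)
  qed
  finally show ?case .
qed simp

lemma card_selections_replicate_Union:
  assumes fin: "finite Q" and finS: "\<And>q. q \<in> Q \<Longrightarrow> finite (S q)" and cs: "set cs \<subseteq> Q"
  shows "card (selections (replicate j (\<Union>q\<in>Q. S q) @ map S cs))
    = card (selections (map S cs)) * falling (card (\<Union>q\<in>Q. S q) - length cs) j"
proof (induction j)
  case (Suc j)
  let ?U = "\<Union>q\<in>Q. S q"
  let ?Ds = "replicate j ?U @ map S cs"
  have finU: "finite ?U" using fin finS by auto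
  have sub: "set as \<subseteq> ?U \<and> card (set as) = j + length cs" if "as \<in> selections ?Ds" for as
  proof -
    have "list_all2 (\<in>) as ?Ds" "distinct as" using that by (auto simp: selections_def)
    moreover have "\<forall>D\<in>set ?Ds. D \<subseteq> ?U" using cs by auto
    ultimately show ?thesis
    proof (intro conjI subsetI)
      fix a assume "a \<in> set as"
      then obtain i where i: "i < length as" "a = as ! i" by (auto simp: in_set_conv_nth)
      have l: "length as = length ?Ds" using \<open>list_all2 (\<in>) as ?Ds\<close> by (rule list_all2_lengthD)
      have "?Ds ! i \<in> set ?Ds" using i l by (metis nth_mem)
      moreover have "a \<in> ?Ds ! i" using \<open>list_all2 (\<in>) as ?Ds\<close> i by (auto simp: list_all2_conv_all_nth)
      ultimately show "a \<in> ?U" using \<open>\<forall>D\<in>set ?Ds. D \<subseteq> ?U\<close> by blast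
    next
      show "card (set as) = j + length cs"
        using distinct_card[OF \<open>distinct as\<close>] list_all2_lengthD[OF \<open>list_all2 (\<in>) as ?Ds\<close>] by simp
    qed
  qed
  have "card (selections (?U # ?Ds)) = (\<Sum>as\<in>selections ?Ds. card (?U - set as))"
    using finU finS cs by (subst card_selections_Cons) (auto split: if_splits)
  also have "\<dots> = (\<Sum>as\<in>selections ?Ds. card ?U - length cs - j)"
    using sub finU by (intro sum.cong refl) (auto simp: card_Diff_subset)
  finally show ?case using Suc by (simp add: falling_Suc)
qed simp

lemma alternating_binomial_partial_sum:
  "(\<Sum>j\<le>J. (-1) ^ j * real (Suc k choose j)) = (-1) ^ J * real (k choose J)"
  by (induction J) (auto simp: algebra_simps)

text \<open>Bonferroni's inequality for the event that no one of \<open>m\<close> elements is left over.\<close>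

lemma bonferroni_binomial:
  "\<bar>(if m = 0 then 1 else 0) - (\<Sum>j\<le>J. (-1) ^ j * real (m choose j))\<bar> \<le> real (m choose Suc J)"
proof (cases m)
  case 0
  have "(\<Sum>j\<le>J. (-1) ^ j * real (0 choose j)) = (\<Sum>j\<le>J. if j = 0 then 1 else 0)"
    by (intro sum.cong) (auto simp: binomial_eq_0)
  then show ?thesis using 0 by simp
next
  case (Suc k)
  then show ?thesis by (simp only: alternating_binomial_partial_sum) (auto simp: abs_mult)
qed

lemma sum_count_list: "finite Q \<Longrightarrow> set cs \<subseteq> Q \<Longrightarrow> (\<Sum>q\<in>Q. count_list cs q) = length cs"
proof (induction cs)
  case (Cons c cs)
  have "(\<Sum>q\<in>Q. count_list (c # cs) q) = (\<Sum>q\<in>Q. count_list cs q + (if c = q then 1 else 0))"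
    by (intro sum.cong) auto
  with Cons show ?case by (simp add: sum.distrib)
qed simp

text \<open>The counts equal the prescribed ones exactly if there is a selection with these labels and no element of
  the union is left over.  The \<open>j\<close> additional slots of \<open>N j\<close> range over the elements left over, so
  dividing by the factorial of \<open>j\<close> turns \<open>N j\<close> into a multiple of a binomial coefficient and the claim becomes
  a multiple of \<open>bonferroni_binomial\<close>.\<close>

lemma bonferroni_counts:
  assumes fin: "finite Q" and disj: "disjoint_family_on S Q" and finS: "\<And>q. q \<in> Q \<Longrightarrow> finite (S q)"
    and cs: "set cs \<subseteq> Q"
  defines "N \<equiv> \<lambda>j. real (card (selections (replicate j (\<Union>q\<in>Q. S q) @ map S cs)))"
  shows "\<bar>(if \<forall>q\<in>Q. card (S q) = count_list cs q then \<Prod>q\<in>Q. fact (count_list cs q) else 0)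
      - (\<Sum>j\<le>J. (-1) ^ j * N j / fact j)\<bar> \<le> N (Suc J) / fact (Suc J)"
proof -
  define m where "m = card (\<Union>q\<in>Q. S q) - length cs"
  define N0 where "N0 = (\<Prod>q\<in>Q. falling (card (S q)) (count_list cs q))"
  have cU: "card (\<Union>q\<in>Q. S q) = (\<Sum>q\<in>Q. card (S q))"
    using fin finS disj by (intro card_UN_disjoint) (auto simp: disjoint_family_on_def)
  have lcs: "length cs = (\<Sum>q\<in>Q. count_list cs q)"
    using sum_count_list[OF fin cs] by simp
  have "N j = real (card (selections (map S cs)) * falling m j)" for j
    using card_selections_replicate_Union[where S = S, OF fin finS cs, of j] by (simp only: N_def m_def)
  then have N: "N j = real N0 * (fact j * real (m choose j))" for j
    by (simp add: card_selections_labels[where S = S, OF fin disj finS cs] N0_def falling_eq_binomial[of m j])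
  have lhs: "(if \<forall>q\<in>Q. card (S q) = count_list cs q then \<Prod>q\<in>Q. fact (count_list cs q) else 0)
    = real N0 * (if m = 0 then 1 else 0)"
  proof (cases "\<forall>q\<in>Q. count_list cs q \<le> card (S q)")
    case True
    have "m = 0 \<longleftrightarrow> (\<forall>q\<in>Q. card (S q) = count_list cs q)"
    proof
      assume m0: "m = 0"
      show "\<forall>q\<in>Q. card (S q) = count_list cs q"
      proof (rule ccontr)
        assume "\<not> ?thesis"
        then have "\<exists>q\<in>Q. count_list cs q < card (S q)" using True by force
        with True have "(\<Sum>q\<in>Q. count_list cs q) < (\<Sum>q\<in>Q. card (S q))"
          by (intro sum_strict_mono_ex1 fin) auto
        with m0 show False by (simp add: m_def cU lcs)
      qed
    qed (simp add: m_def cU lcs)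
    moreover have "real N0 = (\<Prod>q\<in>Q. fact (count_list cs q))" if "\<forall>q\<in>Q. card (S q) = count_list cs q"
    proof -
      have "N0 = (\<Prod>q\<in>Q. fact (count_list cs q))"
        unfolding N0_def using that by (intro prod.cong) (auto simp: falling_eq_binomial)
      then show ?thesis by simp
    qed
    ultimately show ?thesis by auto
  next
    case False
    then obtain q where q: "q \<in> Q" "card (S q) < count_list cs q" by force
    then have "N0 = 0" unfolding N0_def
      by (intro prod_zero[OF fin]) (auto simp: falling_eq_binomial binomial_eq_0 intro!: bexI[of _ q])
    then show ?thesis using q by auto
  qed
  have "real N0 * (if m = 0 then 1 else 0) - (\<Sum>j\<le>J. (-1) ^ j * N j / fact j)
    = real N0 * ((if m = 0 then 1 else 0) - (\<Sum>j\<le>J. (-1) ^ j * real (m choose j)))"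
    by (simp add: N algebra_simps sum_distrib_left)
  then have "\<bar>real N0 * (if m = 0 then 1 else 0) - (\<Sum>j\<le>J. (-1) ^ j * N j / fact j)\<bar>
    = real N0 * \<bar>(if m = 0 then 1 else 0) - (\<Sum>j\<le>J. (-1) ^ j * real (m choose j))\<bar>"
    by (simp add: abs_mult)
  also have "\<dots> \<le> real N0 * real (m choose Suc J)"
    by (intro mult_left_mono bonferroni_binomial) simp
  also have "\<dots> = N (Suc J) / fact (Suc J)"
    by (simp only: N) (simp del: fact_Suc binomial_Suc_Suc)
  finally show ?thesis by (simp only: lhs)
qed

section \<open>Moment generating functions determine laws\<close>

lemma abs_power_le_exp: "\<bar>x\<bar> ^ n / fact n \<le> exp \<bar>x::real\<bar>"
proof -
  have "(\<lambda>n. \<bar>x\<bar> ^ n / fact n) sums exp \<bar>x\<bar>"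
    using exp_converges[of "\<bar>x\<bar>"] by (simp add: divide_inverse mult.commute)
  then have s: "summable (\<lambda>n. \<bar>x\<bar> ^ n / fact n)" "(\<Sum>n. \<bar>x\<bar> ^ n / fact n) = exp \<bar>x\<bar>"
    by (auto simp: sums_iff)
  have "(\<Sum>i\<in>{n}. \<bar>x\<bar> ^ i / fact i) \<le> (\<Sum>n. \<bar>x\<bar> ^ n / fact n)"
    by (intro sum_le_suminf s) auto
  then show ?thesis by (simp add: s)
qed

lemma integrable_exp_abs:
  fixes M :: "real measure"
  assumes "sets M = sets borel" "\<And>t. integrable M (\<lambda>x. exp (t * x))"
  shows "integrable M (\<lambda>x. exp (t * \<bar>x\<bar>))"
proof (rule Bochner_Integration.integrable_bound)
  show "integrable M (\<lambda>x. exp (t * x) + exp (- t * x))"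
    by (intro Bochner_Integration.integrable_add assms(2))
  show "(\<lambda>x. exp (t * \<bar>x\<bar>)) \<in> borel_measurable M"
    using assms(1) by (auto simp: measurable_cong_sets[OF assms(1) refl])
  show "AE x in M. norm (exp (t * \<bar>x\<bar>)) \<le> norm (exp (t * x) + exp (- t * x))"
  proof (rule AE_I2)
    fix x
    have "\<bar>exp (t * x) + exp (- t * x)\<bar> = exp (t * x) + exp (- t * x)"
      by (intro abs_of_pos add_pos_pos exp_gt_zero)
    then show "norm (exp (t * \<bar>x\<bar>)) \<le> norm (exp (t * x) + exp (- t * x))"
      unfolding real_norm_def by (simp add: abs_if)
  qed
qed

text \<open>Expanding the exponential under the integral is justified by the finiteness of all real exponential
  moments, and shows that the moment generating function is entire.\<close>

lemma mgf_power_series: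
  fixes M :: "real measure" and z :: complex
  assumes M: "sets M = sets borel" and int: "\<And>t. integrable M (\<lambda>x. exp (t * x))"
  shows "(\<lambda>n. of_real ((\<integral>x. x ^ n \<partial>M) / fact n) * z ^ n) sums (\<integral>x. exp (z * of_real x) \<partial>M)"
proof -
  let ?f = "\<lambda>n x. (z * of_real x) ^ n /\<^sub>R fact n"
  have meas [measurable]: "?f n \<in> borel_measurable M" for n
    by (simp add: measurable_cong_sets[OF M refl])
  have nf: "norm (?f n x) = \<bar>norm z * x\<bar> ^ n / fact n" for n x
    by (simp add: norm_power norm_mult abs_mult divide_inverse mult.commute)
  have pw: "integrable M (\<lambda>x. x ^ n)" for n
  proof (rule Bochner_Integration.integrable_bound)
    show "integrable M (\<lambda>x. fact n * exp (1 * \<bar>x\<bar>))"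
      using integrable_exp_abs[OF M int, of 1] by simp
    show "(\<lambda>x. x ^ n) \<in> borel_measurable M" by (simp add: measurable_cong_sets[OF M refl])
    show "AE x in M. norm (x ^ n) \<le> norm (fact n * exp (1 * \<bar>x\<bar>))"
      using abs_power_le_exp[of _ n] by (intro AE_I2) (simp add: field_simps power_abs)
  qed
  have fi: "integrable M (?f n)" for n
    using pw[of n] by (simp add: power_mult_distrib of_real_power[symmetric] del: of_real_power)
  have "(\<lambda>n. \<integral>x. ?f n x \<partial>M) sums (\<integral>x. (\<Sum>n. ?f n x) \<partial>M)"
  proof (rule sums_integral[OF fi])
    show "AE x in M. summable (\<lambda>n. norm (?f n x))"
    proof (rule AE_I2)
      fix x
      show "summable (\<lambda>n. norm (?f n x))"
        unfolding nf using summable_exp[of "\<bar>norm z * x\<bar>"] by (simp add: divide_inverse mult.commute)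
    qed
    show "summable (\<lambda>n. \<integral>x. norm (?f n x) \<partial>M)"
    proof (rule summableI_nonneg_bounded)
      fix n
      have "(\<Sum>i<n. \<integral>x. norm (?f i x) \<partial>M) = (\<integral>x. (\<Sum>i<n. norm (?f i x)) \<partial>M)"
        using fi by (intro Bochner_Integration.integral_sum[symmetric] integrable_norm)
      also have "\<dots> \<le> (\<integral>x. exp (norm z * \<bar>x\<bar>) \<partial>M)"
      proof (rule integral_mono)
        show "integrable M (\<lambda>x. \<Sum>i<n. norm (?f i x))"
          by (intro Bochner_Integration.integrable_sum integrable_norm fi)
        show "integrable M (\<lambda>x. exp (norm z * \<bar>x\<bar>))" by (rule integrable_exp_abs[OF M int])
        fix x
        have "(\<lambda>i. \<bar>norm z * x\<bar> ^ i / fact i) sums exp \<bar>norm z * x\<bar>"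
          using exp_converges[of "\<bar>norm z * x\<bar>"] by (simp add: divide_inverse mult.commute)
        then have "(\<Sum>i<n. \<bar>norm z * x\<bar> ^ i / fact i) \<le> exp \<bar>norm z * x\<bar>"
          using sum_le_suminf[of "\<lambda>i. \<bar>norm z * x\<bar> ^ i / fact i" "{..<n}"] by (auto simp: sums_iff)
        then show "(\<Sum>i<n. norm (?f i x)) \<le> exp (norm z * \<bar>x\<bar>)"
          unfolding nf by (simp add: abs_mult)
      qed
      finally show "(\<Sum>i<n. \<integral>x. norm (?f i x) \<partial>M) \<le> (\<integral>x. exp (norm z * \<bar>x\<bar>) \<partial>M)" .
    qed auto
  qed
  moreover have "(\<integral>x. ?f n x \<partial>M) = of_real ((\<integral>x. x ^ n \<partial>M) / fact n) * z ^ n" for n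
  proof -
    have "(\<integral>x. ?f n x \<partial>M) = (\<integral>x. (z ^ n /\<^sub>R fact n) * complex_of_real (x ^ n) \<partial>M)"
      by (simp add: power_mult_distrib)
    also have "\<dots> = (z ^ n /\<^sub>R fact n) * of_real (\<integral>x. x ^ n \<partial>M)"
      by (simp only: integral_mult_right_zero integral_complex_of_real)
    finally show ?thesis by (simp add: scaleR_conv_of_real field_simps)
  qed
  moreover have "(\<Sum>n. ?f n x) = exp (z * of_real x)" for x
    using exp_converges[of "z * of_real x"] by (simp add: sums_iff)
  ultimately show ?thesis by simp
qed

text \<open>The difference of the two generating functions is a power series that vanishes on the real line, hence
  everywhere by isolation of zeros; on the imaginary axis this says that the characteristic functions
  agree.\<close>

lemma mgf_unique:
  assumes "real_distribution M1" "real_distribution M2"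
    and int1: "\<And>t. integrable M1 (\<lambda>x. exp (t * x))" and int2: "\<And>t. integrable M2 (\<lambda>x. exp (t * x))"
    and eq: "\<And>t. (\<integral>x. exp (t * x) \<partial>M1) = (\<integral>x. exp (t * x) \<partial>M2)"
  shows "M1 = M2"
proof (rule Levy_uniqueness[OF assms(1,2)])
  interpret M1: real_distribution M1 by fact
  interpret M2: real_distribution M2 by fact
  have s1: "sets M1 = sets borel" and s2: "sets M2 = sets borel" by auto
  define a where "a n = complex_of_real ((\<integral>x. x ^ n \<partial>M1) / fact n) - of_real ((\<integral>x. x ^ n \<partial>M2) / fact n)" for n
  define F where "F z = (\<integral>x. exp (z * of_real x) \<partial>M1) - (\<integral>x. exp (z * of_real x) \<partial>M2)" for z :: complex
  have ser: "(\<lambda>n. a n * z ^ n) sums F z" for z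
    using sums_diff[OF mgf_power_series[OF s1 int1, of z] mgf_power_series[OF s2 int2, of z]]
    by (simp add: a_def F_def left_diff_distrib)
  have real0: "F (of_real t) = 0" for t
  proof -
    have "(\<integral>x. exp (complex_of_real t * of_real x) \<partial>M) = of_real (\<integral>x. exp (t * x) \<partial>M)" for M :: "real measure"
      by (simp only: of_real_mult[symmetric] exp_of_real integral_complex_of_real)
    then show ?thesis by (simp add: F_def eq)
  qed
  have F0: "F 0 = 0" using real0[of 0] by simp
  have a0: "a n = 0" for n
  proof (cases "n = 0")
    case True
    have "(\<lambda>n. a n * 0 ^ n) sums 0" using ser[of 0] F0 by simp
    then show ?thesis using True by simp
  next
    case False
    show ?thesis
    proof (rule ccontr)
      assume "a n \<noteq> 0"
      then obtain s where s: "0 < s" "\<And>z. z \<in> cball 0 s - {0} \<Longrightarrow> F z \<noteq> 0"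
        using powser_0_nonzero[of 1 0 a F n] ser F0 False by auto
      show False using s(2)[of "of_real s"] s(1) real0[of s] by auto
    qed
  qed
  have "F z = 0" for z
  proof -
    have "(\<lambda>n. 0) sums F z" using ser[of z] by (simp add: a0)
    then show ?thesis using sums_unique2[OF sums_zero] by metis
  qed
  then have "F (\<i> * of_real t) = 0" for t by blast
  then show "char M1 = char M2"
    by (auto simp: char_def F_def fun_eq_iff mult.assoc)
qed

text \<open>A weighted form of \<open>mgf_unique\<close>: after normalization, \<open>h1\<close> and \<open>h2\<close> are densities of
  probability measures under which \<open>X\<close> has the same generating function.\<close>

lemma integral_indicator_eq_if_mgf_eq:
  fixes M :: "'a measure" and X h1 h2 :: "'a \<Rightarrow> real"
  assumes [measurable]: "X \<in> borel_measurable M" "h1 \<in> borel_measurable M" "h2 \<in> borel_measurable M"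
    and nn: "\<And>\<omega>. h1 \<omega> \<ge> 0" "\<And>\<omega>. h2 \<omega> \<ge> 0"
    and int: "\<And>t. integrable M (\<lambda>\<omega>. h1 \<omega> * exp (t * X \<omega>))" "\<And>t. integrable M (\<lambda>\<omega>. h2 \<omega> * exp (t * X \<omega>))"
    and eq: "\<And>t. (\<integral>\<omega>. h1 \<omega> * exp (t * X \<omega>) \<partial>M) = (\<integral>\<omega>. h2 \<omega> * exp (t * X \<omega>) \<partial>M)"
    and B [measurable]: "B \<in> sets borel"
  shows "(\<integral>\<omega>. h1 \<omega> * indicator B (X \<omega>) \<partial>M) = (\<integral>\<omega>. h2 \<omega> * indicator B (X \<omega>) \<partial>M)"
proof -
  have i1: "integrable M h1" and i2: "integrable M h2" using int[of 0] by auto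
  define c where "c = (\<integral>\<omega>. h1 \<omega> \<partial>M)"
  have c2: "c = (\<integral>\<omega>. h2 \<omega> \<partial>M)" using eq[of 0] by (simp add: c_def)
  have "c \<ge> 0" unfolding c_def using nn by simp
  show ?thesis
  proof (cases "c = 0")
    case True
    have "AE \<omega> in M. h1 \<omega> = 0" using integral_nonneg_eq_0_iff_AE[OF i1] nn True by (simp add: c_def)
    moreover have "AE \<omega> in M. h2 \<omega> = 0" using integral_nonneg_eq_0_iff_AE[OF i2] nn True by (simp add: c2)
    ultimately have "(\<integral>\<omega>. h1 \<omega> * indicator B (X \<omega>) \<partial>M) = (\<integral>\<omega>. 0 \<partial>M)"
      "(\<integral>\<omega>. h2 \<omega> * indicator B (X \<omega>) \<partial>M) = (\<integral>\<omega>. 0 \<partial>M)"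
      by (intro integral_cong_AE; measurable; auto)+
    then show ?thesis by simp
  next
    case False
    with \<open>c \<ge> 0\<close> have c: "c > 0" by simp
    define D where "D h = distr (density M (\<lambda>\<omega>. ennreal (h \<omega> / c))) borel X" for h
    have rd: "real_distribution (D h)" and intD: "integrable (D h) (\<lambda>x. exp (t * x))"
      and eqD: "(\<integral>x. exp (t * x) \<partial>D h) = (\<integral>\<omega>. h \<omega> * exp (t * X \<omega>) \<partial>M) / c"
      and mD: "measure (D h) B = (\<integral>\<omega>. h \<omega> * indicator B (X \<omega>) \<partial>M) / c"
      if h [measurable]: "h \<in> borel_measurable M" and hn: "\<And>\<omega>. h \<omega> \<ge> 0"
        and hi: "\<And>t. integrable M (\<lambda>\<omega>. h \<omega> * exp (t * X \<omega>))" and hc: "(\<integral>\<omega>. h \<omega> \<partial>M) = c" for h t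
    proof -
      have "integrable M h" using hi[of 0] by simp
      then have "(\<integral>\<^sup>+\<omega>. ennreal (h \<omega> / c) \<partial>M) = 1"
        using hn c hc by (subst nn_integral_eq_integral) auto
      then have "prob_space (density M (\<lambda>\<omega>. ennreal (h \<omega> / c)))"
        by (intro prob_spaceI) (simp add: emeasure_density)
      then have "prob_space (D h)" unfolding D_def by (rule prob_space.prob_space_distr) measurable
      then show rdh: "real_distribution (D h)"
        by (simp add: real_distribution_def real_distribution_axioms_def D_def)
      show "integrable (D h) (\<lambda>x. exp (t * x))"
        unfolding D_def using hi[of t] hn c
        by (subst integrable_distr_eq) (auto simp: integrable_real_density)
      show "(\<integral>x. exp (t * x) \<partial>D h) = (\<integral>\<omega>. h \<omega> * exp (t * X \<omega>) \<partial>M) / c"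
        unfolding D_def using hn c by (subst integral_distr) (auto simp: integral_real_density)
      interpret D: real_distribution "D h" by (rule rdh)
      have "measure (D h) B = (\<integral>x. indicator B x \<partial>D h)" by (simp add: D_def)
      also have "\<dots> = (\<integral>\<omega>. h \<omega> * indicator B (X \<omega>) \<partial>M) / c"
        unfolding D_def using hn c by (subst integral_distr) (auto simp: integral_real_density)
      finally show "measure (D h) B = (\<integral>\<omega>. h \<omega> * indicator B (X \<omega>) \<partial>M) / c" .
    qed
    have "D h1 = D h2"
      by (rule mgf_unique) (use rd intD eqD nn int eq c_def c2 in \<open>auto\<close>)
    then show ?thesis using mD[of h1] mD[of h2] nn int c_def c2 c by simp
  qed
qed

section \<open>Normal tails at extreme levels\<close>

definition normal_tail :: "real \<Rightarrow> real" where
  "normal_tail x = measure (density lborel std_normal_density) {x..}"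

lemma std_normal_density_has_derivative:
  "(std_normal_density has_real_derivative - x * std_normal_density x) (at x)"
proof -
  have "((\<lambda>x. exp (- x\<^sup>2 / 2)) has_real_derivative exp (- x\<^sup>2 / 2) * (- x)) (at x)"
    by (auto intro!: derivative_eq_intros)
  from DERIV_cmult[OF this, of "1 / sqrt (2 * pi)"] show ?thesis
    unfolding std_normal_density_def by (simp add: mult_ac)
qed

lemma ennreal_normal_tail: "ennreal (normal_tail x) = (\<integral>\<^sup>+t\<in>{x..}. ennreal (std_normal_density t) \<partial>lborel)"
proof -
  interpret prob_space "density lborel std_normal_density"
    by (rule prob_space_normal_density) simp
  have "ennreal (normal_tail x) = emeasure (density lborel std_normal_density) {x..}"
    by (simp add: normal_tail_def emeasure_eq_measure)
  also have "\<dots> = (\<integral>\<^sup>+t\<in>{x..}. ennreal (std_normal_density t) \<partial>lborel)"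
    by (subst emeasure_density) auto
  finally show ?thesis .
qed

text \<open>Insert the factor \<open>t / x \<ge> 1\<close>, which makes the integrand a derivative.\<close>

lemma normal_tail_upper:
  assumes "x > 0"
  shows "normal_tail x \<le> std_normal_density x / x"
proof -
  have "ennreal (normal_tail x) \<le> (\<integral>\<^sup>+t\<in>{x..}. ennreal (t / x * std_normal_density t) \<partial>lborel)"
    unfolding ennreal_normal_tail
  proof (intro nn_integral_mono)
    fix t
    show "ennreal (std_normal_density t) * indicator {x..} t \<le> ennreal (t / x * std_normal_density t) * indicator {x..} t"
    proof (cases "x \<le> t")
      case True
      then have "1 * std_normal_density t \<le> t / x * std_normal_density t"
        using assms by (intro mult_right_mono) (auto simp: field_simps)
      then show ?thesis using True by (auto intro: ennreal_leI)
    qed auto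
  qed
  also have "\<dots> = ennreal (0 - (- std_normal_density x / x))"
  proof (rule nn_integral_FTC_atLeast[where F = "\<lambda>t. - std_normal_density t / x" and T = 0])
    show "((\<lambda>t. - std_normal_density t / x) has_real_derivative t / x * std_normal_density t) (at t)" for t
      by (rule DERIV_cong[OF DERIV_cdivide[OF DERIV_minus[OF std_normal_density_has_derivative]]]) simp
    show "((\<lambda>t. - std_normal_density t / x) \<longlongrightarrow> 0) at_top"
      unfolding std_normal_density_def using assms by real_asymp
  qed (use assms in auto)
  finally show ?thesis using assms by (simp add: ennreal_le_iff)
qed

text \<open>Insert the factor \<open>1 - 3 / t\<^sup>4 \<le> 1\<close>, which makes the integrand a derivative.\<close>

lemma normal_tail_lower:
  assumes "x \<ge> 2"
  shows "normal_tail x \<ge> (1 / x - 1 / x ^ 3) * std_normal_density x"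
proof -
  have le1: "3 / t ^ 4 \<le> 1" if "t \<ge> 2" for t :: real
  proof -
    have "2 ^ 4 \<le> t ^ 4" using that by (intro power_mono) auto
    then show ?thesis using that by (simp add: field_simps)
  qed
  have dinv: "((\<lambda>t. 1 / t - 1 / t ^ 3) has_real_derivative - 1 / t\<^sup>2 + 3 / t ^ 4) (at t)" if "t > 0" for t :: real
  proof -
    have "((\<lambda>t. 1 / t) has_real_derivative (0 * t - 1 * 1) / (t * t)) (at t)"
      by (rule DERIV_divide) (use that in \<open>auto intro!: derivative_eq_intros\<close>)
    moreover have "((\<lambda>t. 1 / t ^ 3) has_real_derivative (0 * t ^ 3 - 1 * (3 * t\<^sup>2)) / (t ^ 3 * t ^ 3)) (at t)"
      by (rule DERIV_divide) (use that in \<open>auto intro!: derivative_eq_intros\<close>)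
    ultimately have "((\<lambda>t. 1 / t - 1 / t ^ 3) has_real_derivative
      (0 * t - 1 * 1) / (t * t) - (0 * t ^ 3 - 1 * (3 * t\<^sup>2)) / (t ^ 3 * t ^ 3)) (at t)"
      by (rule DERIV_diff)
    moreover have "(0 * t - 1 * 1) / (t * t) - (0 * t ^ 3 - 1 * (3 * t\<^sup>2)) / (t ^ 3 * t ^ 3) = - 1 / t\<^sup>2 + 3 / t ^ 4"
      using that by (simp add: power2_eq_square power3_eq_cube power4_eq_xxxx)
    ultimately show ?thesis by (simp only:)
  qed
  have "ennreal (0 - (- ((1 / x - 1 / x ^ 3) * std_normal_density x)))
      = (\<integral>\<^sup>+t\<in>{x..}. ennreal ((1 - 3 / t ^ 4) * std_normal_density t) \<partial>lborel)"
  proof (rule nn_integral_FTC_atLeast[where F = "\<lambda>t. - ((1 / t - 1 / t ^ 3) * std_normal_density t)" and T = 0, symmetric])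
    fix t assume t: "x \<le> t"
    have "((\<lambda>t. - ((1 / t - 1 / t ^ 3) * std_normal_density t)) has_real_derivative
      - ((- 1 / t\<^sup>2 + 3 / t ^ 4) * std_normal_density t + (- t * std_normal_density t) * (1 / t - 1 / t ^ 3))) (at t)"
      by (intro DERIV_minus DERIV_mult std_normal_density_has_derivative dinv) (use t assms in auto)
    moreover have "- ((- 1 / t\<^sup>2 + 3 / t ^ 4) * std_normal_density t + (- t * std_normal_density t) * (1 / t - 1 / t ^ 3))
      = (1 - 3 / t ^ 4) * std_normal_density t"
      using t assms by (simp add: field_simps eval_nat_numeral)
    ultimately show "((\<lambda>t. - ((1 / t - 1 / t ^ 3) * std_normal_density t)) has_real_derivative
      (1 - 3 / t ^ 4) * std_normal_density t) (at t)" by simp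
    show "0 \<le> (1 - 3 / t ^ 4) * std_normal_density t" using le1[of t] t assms by simp
  next
    show "((\<lambda>t. - ((1 / t - 1 / t ^ 3) * std_normal_density t)) \<longlongrightarrow> 0) at_top"
      unfolding std_normal_density_def by real_asymp
  qed auto
  also have "\<dots> \<le> ennreal (normal_tail x)"
    unfolding ennreal_normal_tail
  proof (intro nn_integral_mono)
    fix t
    show "ennreal ((1 - 3 / t ^ 4) * std_normal_density t) * indicator {x..} t \<le> ennreal (std_normal_density t) * indicator {x..} t"
    proof (cases "x \<le> t")
      case True
      then have "(1 - 3 / t ^ 4) * std_normal_density t \<le> 1 * std_normal_density t"
        using assms by (intro mult_right_mono) (auto simp: field_simps)
      then show ?thesis using True by (auto intro: ennreal_leI)
    qed auto
  qed
  finally show ?thesis by (simp add: ennreal_le_iff normal_tail_def)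
qed

lemma normal_tail_antimono: "x \<le> y \<Longrightarrow> normal_tail y \<le> normal_tail x"
proof -
  interpret prob_space "density lborel std_normal_density"
    by (rule prob_space_normal_density) simp
  show "x \<le> y \<Longrightarrow> normal_tail y \<le> normal_tail x"
    unfolding normal_tail_def by (intro finite_measure_mono) auto
qed

text \<open>The centering of the maximum of \<open>N\<close> independent standard normal variables.  The centering and scaling
  for variance \<open>v\<close> are \<open>sqrt v\<close> times it and \<open>sqrt v\<close> divided by it.\<close>

definition unit_centering :: "real \<Rightarrow> real" where
  "unit_centering N = sqrt (2 * ln N) - (ln (ln N) + ln (4 * pi)) / (2 * sqrt (2 * ln N))"

lemma centering_eq: "centering v N = sqrt v * unit_centering N"
  by (simp add: centering_def unit_centering_def)

lemma scaling_eq: "v > 0 \<Longrightarrow> scaling v N = sqrt v / unit_centering N"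
proof -
  assume "v > 0"
  then have "v / (sqrt v * unit_centering N) = (sqrt v * sqrt v) / (sqrt v * unit_centering N)" by simp
  also have "\<dots> = sqrt v / unit_centering N" using \<open>v > 0\<close> by (simp del: real_sqrt_mult_self)
  finally show ?thesis by (simp add: scaling_def centering_eq)
qed

lemma unit_centering_over_sqrt: "((\<lambda>N. unit_centering N / sqrt (2 * ln N)) \<longlongrightarrow> 1) at_top"
  unfolding unit_centering_def by real_asymp

lemma unit_centering_at_top: "filterlim unit_centering at_top at_top"
  unfolding unit_centering_def by real_asymp

text \<open>The correction in the centering cancels the factor \<open>1 / (x * sqrt (2 * pi))\<close> in front of the normal tail.\<close>

lemma unit_centering_square:
  "((\<lambda>N. (unit_centering N)\<^sup>2 / 2 - ln N + ln (ln N) / 2 + ln (4 * pi) / 2) \<longlongrightarrow> 0) at_top"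
proof -
  have "((\<lambda>N::real. ((ln (ln N) + ln (4 * pi)) / 2)\<^sup>2 / (4 * ln N)) \<longlongrightarrow> 0) at_top"
    by real_asymp
  moreover have "eventually (\<lambda>N. ((ln (ln N) + ln (4 * pi)) / 2)\<^sup>2 / (4 * ln N) =
     (unit_centering N)\<^sup>2 / 2 - ln N + ln (ln N) / 2 + ln (4 * pi) / 2) at_top"
    using eventually_gt_at_top[of 1]
  proof eventually_elim
    case (elim N)
    define s where "s = sqrt (2 * ln N)"
    define h where "h = (ln (ln N) + ln (4 * pi)) / 2"
    have L: "ln N > 0" using elim by simp
    have s: "s > 0" "s\<^sup>2 = 2 * ln N" using L by (auto simp: s_def)
    have "unit_centering N = s - h / s" unfolding unit_centering_def s_def h_def by simp
    then have "(unit_centering N)\<^sup>2 = s\<^sup>2 - 2 * h + h\<^sup>2 / s\<^sup>2"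
      using s(1) by (simp add: power2_diff power_divide)
    then show ?case using s(2) L unfolding h_def[symmetric] by (simp add: h_def field_simps)
  qed
  ultimately show ?thesis by (rule Lim_transform_eventually)
qed

lemma exp_half_ln: "x > 0 \<Longrightarrow> exp (ln x / 2) = sqrt x"
  by (rule real_sqrt_unique[symmetric]) (simp_all add: power2_eq_square exp_add[symmetric])

text \<open>The Gumbel asymptotics of the normal tail.  The error \<open>\<delta>\<close> is allowed because the regression on other sites
  perturbs both the level and the variance.\<close>

lemma scaled_normal_tail_tendsto:
  fixes N x \<delta> :: "nat \<Rightarrow> real"
  assumes N: "filterlim N at_top sequentially"
    and \<delta>: "(\<lambda>n. \<delta> n * unit_centering (N n)) \<longlonglongrightarrow> 0"
    and x: "\<forall>\<^sub>F n in sequentially. x n = unit_centering (N n) + z / unit_centering (N n) + \<delta> n"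
  shows "(\<lambda>n. N n * normal_tail (x n)) \<longlonglongrightarrow> exp (- z)"
proof -
  define \<beta> where "\<beta> n = unit_centering (N n)" for n
  define d where "d n = (x n)\<^sup>2 / 2 - ln (N n) + ln (ln (N n)) / 2 + ln (4 * pi) / 2" for n
  have \<beta>: "filterlim \<beta> at_top sequentially"
    unfolding \<beta>_def by (rule filterlim_compose[OF unit_centering_at_top N])
  have inv: "(\<lambda>n. 1 / \<beta> n) \<longlonglongrightarrow> 0"
    using tendsto_inverse_0_at_top[OF \<beta>] by (simp add: divide_inverse)
  have \<delta>0: "\<delta> \<longlonglongrightarrow> 0"
  proof -
    have "(\<lambda>n. (\<delta> n * \<beta> n) * (1 / \<beta> n)) \<longlonglongrightarrow> 0 * 0"
      using \<delta> inv unfolding \<beta>_def by (intro tendsto_mult)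
    moreover have "\<forall>\<^sub>F n in sequentially. (\<delta> n * \<beta> n) * (1 / \<beta> n) = \<delta> n"
      using filterlim_at_top_dense[THEN iffD1, OF \<beta>, rule_format, of 0] by eventually_elim simp
    ultimately show ?thesis by (simp add: filterlim_cong[OF refl refl])
  qed
  have b2: "(\<lambda>n. (\<beta> n)\<^sup>2 / 2 - ln (N n) + ln (ln (N n)) / 2 + ln (4 * pi) / 2) \<longlonglongrightarrow> 0"
    unfolding \<beta>_def by (rule filterlim_compose[OF unit_centering_square N])
  have bs: "(\<lambda>n. \<beta> n / sqrt (2 * ln (N n))) \<longlonglongrightarrow> 1"
    unfolding \<beta>_def by (rule filterlim_compose[OF unit_centering_over_sqrt N])
  have pos: "\<forall>\<^sub>F n in sequentially. \<beta> n > 0"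
    using filterlim_at_top_dense[THEN iffD1, OF \<beta>, rule_format, of 0] .
  have d: "d \<longlonglongrightarrow> z"
  proof -
    have "(\<lambda>n. ((\<beta> n)\<^sup>2 / 2 - ln (N n) + ln (ln (N n)) / 2 + ln (4 * pi) / 2) + z + z\<^sup>2 / 2 * (1 / \<beta> n)\<^sup>2
       + (\<delta> n * \<beta> n) + \<delta> n * z * (1 / \<beta> n) + (\<delta> n)\<^sup>2 / 2) \<longlonglongrightarrow> 0 + z + z\<^sup>2 / 2 * 0\<^sup>2 + 0 + 0 * z * 0 + 0\<^sup>2 / 2"
      using \<delta> unfolding \<beta>_def[symmetric] by (intro tendsto_intros b2 inv \<delta>0) auto
    moreover have "\<forall>\<^sub>F n in sequentially. ((\<beta> n)\<^sup>2 / 2 - ln (N n) + ln (ln (N n)) / 2 + ln (4 * pi) / 2) + z + z\<^sup>2 / 2 * (1 / \<beta> n)\<^sup>2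
       + (\<delta> n * \<beta> n) + \<delta> n * z * (1 / \<beta> n) + (\<delta> n)\<^sup>2 / 2 = d n"
      using x pos
    proof eventually_elim
      case (elim n)
      have "x n = \<beta> n + z / \<beta> n + \<delta> n" using elim by (simp add: \<beta>_def)
      moreover have "(\<beta> n + z / \<beta> n + \<delta> n)\<^sup>2 = (\<beta> n)\<^sup>2 + 2 * z + z\<^sup>2 * (1 / \<beta> n)\<^sup>2 + 2 * \<delta> n * \<beta> n + 2 * \<delta> n * z * (1 / \<beta> n) + (\<delta> n)\<^sup>2"
        using elim(2) by (simp add: power2_eq_square field_simps)
      ultimately show ?case by (simp add: d_def field_simps)
    qed
    ultimately show ?thesis by (simp add: filterlim_cong[OF refl refl])
  qed
  have xtop: "filterlim x at_top sequentially"
  proof -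
    have "(\<lambda>n. z * (1 / \<beta> n) + \<delta> n) \<longlonglongrightarrow> z * 0 + 0" by (intro tendsto_intros inv \<delta>0)
    then have "filterlim (\<lambda>n. (z * (1 / \<beta> n) + \<delta> n) + \<beta> n) at_top sequentially"
      by (rule filterlim_tendsto_add_at_top[OF _ \<beta>])
    then show ?thesis
      by (rule filterlim_cong[THEN iffD1, OF refl refl, rotated])
        (use x in \<open>auto elim!: eventually_mono simp: \<beta>_def\<close>)
  qed
  have invx: "(\<lambda>n. 1 / x n) \<longlonglongrightarrow> 0"
    using tendsto_inverse_0_at_top[OF xtop] by (simp add: divide_inverse)
  have xb: "(\<lambda>n. x n / \<beta> n) \<longlonglongrightarrow> 1"
  proof -
    have "(\<lambda>n. 1 + z * (1 / \<beta> n) * (1 / \<beta> n) + \<delta> n * (1 / \<beta> n)) \<longlonglongrightarrow> 1 + z * 0 * 0 + 0 * 0"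
      by (intro tendsto_intros inv \<delta>0)
    moreover have "\<forall>\<^sub>F n in sequentially. 1 + z * (1 / \<beta> n) * (1 / \<beta> n) + \<delta> n * (1 / \<beta> n) = x n / \<beta> n"
      using x pos
    proof eventually_elim
      case (elim n)
      have "x n / \<beta> n = \<beta> n / \<beta> n + z / \<beta> n / \<beta> n + \<delta> n / \<beta> n"
        using elim(1) by (simp only: \<beta>_def add_divide_distrib)
      then show ?case using elim(2) by simp
    qed
    ultimately show ?thesis by (simp add: filterlim_cong[OF refl refl])
  qed
  have ratio: "(\<lambda>n. sqrt (2 * ln (N n)) / x n) \<longlonglongrightarrow> 1"
  proof -
    have "(\<lambda>n. 1 / ((\<beta> n / sqrt (2 * ln (N n))) * (x n / \<beta> n))) \<longlonglongrightarrow> 1 / (1 * 1)"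
      by (intro tendsto_intros bs xb) auto
    moreover have "\<forall>\<^sub>F n in sequentially. 1 / ((\<beta> n / sqrt (2 * ln (N n))) * (x n / \<beta> n)) = sqrt (2 * ln (N n)) / x n"
      using pos by eventually_elim (simp add: field_simps)
    ultimately show ?thesis by (simp add: filterlim_cong[OF refl refl])
  qed
  have Nbig: "\<forall>\<^sub>F n in sequentially. N n > 1" and x2: "\<forall>\<^sub>F n in sequentially. x n > 2"
    using filterlim_at_top_dense[THEN iffD1, OF N, rule_format, of 1]
      filterlim_at_top_dense[THEN iffD1, OF xtop, rule_format, of 2] .
  have main: "\<forall>\<^sub>F n in sequentially. N n * (std_normal_density (x n) / x n) = exp (- d n) * (sqrt (2 * ln (N n)) / x n)"
    using Nbig x2
  proof eventually_elim
    case (elim n)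
    have L: "ln (N n) > 0" using elim by simp
    have "exp (- d n) = exp (- (x n)\<^sup>2 / 2) * N n / (exp (ln (ln (N n)) / 2) * exp (ln (4 * pi) / 2))"
    proof -
      have "- d n = (- (x n)\<^sup>2 / 2 + ln (N n)) - (ln (ln (N n)) / 2 + ln (4 * pi) / 2)" by (simp add: d_def)
      then show ?thesis using elim by (simp only: exp_diff exp_add) simp
    qed
    also have "exp (ln (ln (N n)) / 2) = sqrt (ln (N n))"
      by (rule exp_half_ln[OF L])
    also have "exp (ln (4 * pi) / 2) = sqrt (4 * pi)"
      by (rule exp_half_ln) simp
    finally have "exp (- d n) = exp (- (x n)\<^sup>2 / 2) * N n / (sqrt (ln (N n)) * sqrt (4 * pi))" .
    moreover have "sqrt (2 * ln (N n)) * sqrt (2 * pi) = sqrt (ln (N n)) * sqrt (4 * pi)"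
      by (simp add: real_sqrt_mult[symmetric])
    moreover have "sqrt (2 * pi) > 0" "sqrt (ln (N n)) * sqrt (4 * pi) > 0" using L by auto
    ultimately show ?case using elim unfolding std_normal_density_def
      by (simp add: field_simps)
  qed
  have up: "(\<lambda>n. exp (- d n) * (sqrt (2 * ln (N n)) / x n)) \<longlonglongrightarrow> exp (- z)"
    using tendsto_mult[OF tendsto_exp[OF tendsto_minus[OF d]] ratio] by simp
  have lo: "(\<lambda>n. exp (- d n) * (sqrt (2 * ln (N n)) / x n) * (1 - (1 / x n)\<^sup>2)) \<longlonglongrightarrow> exp (- z)"
    using tendsto_mult[OF up tendsto_diff[OF tendsto_const[of 1] tendsto_power[OF invx, of 2]]] by simp
  show ?thesis
  proof (rule tendsto_sandwich[OF _ _ lo up])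
    show "\<forall>\<^sub>F n in sequentially. N n * normal_tail (x n) \<le> exp (- d n) * (sqrt (2 * ln (N n)) / x n)"
      using main Nbig x2
    proof eventually_elim
      case (elim n)
      have "N n * normal_tail (x n) \<le> N n * (std_normal_density (x n) / x n)"
        using elim by (intro mult_left_mono normal_tail_upper) auto
      then show ?case using elim by simp
    qed
    show "\<forall>\<^sub>F n in sequentially. exp (- d n) * (sqrt (2 * ln (N n)) / x n) * (1 - (1 / x n)\<^sup>2) \<le> N n * normal_tail (x n)"
      using main Nbig x2
    proof eventually_elim
      case (elim n)
      have "N n * ((1 / x n - 1 / x n ^ 3) * std_normal_density (x n)) \<le> N n * normal_tail (x n)"
        using elim by (intro mult_left_mono normal_tail_lower) auto
      moreover have "N n * ((1 / x n - 1 / x n ^ 3) * std_normal_density (x n))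
        = N n * (std_normal_density (x n) / x n) * (1 - (1 / x n)\<^sup>2)"
        using elim by (simp add: field_simps eval_nat_numeral)
      ultimately show ?case using elim by simp
    qed
  qed
qed

section \<open>Linear statistics of the Gaussian field\<close>

lemma normal_mgf:
  assumes "\<sigma> > 0"
  shows "integrable lborel (\<lambda>x. normal_density 0 \<sigma> x * exp x)"
    and "(\<integral>x. normal_density 0 \<sigma> x * exp x \<partial>lborel) = exp (\<sigma>\<^sup>2 / 2)"
proof -
  have eq: "normal_density 0 \<sigma> x * exp x = exp (\<sigma>\<^sup>2 / 2) * normal_density (\<sigma>\<^sup>2) \<sigma> x" for x
  proof -
    have "- (x - 0)\<^sup>2 / (2 * \<sigma>\<^sup>2) + x = \<sigma>\<^sup>2 / 2 + - (x - \<sigma>\<^sup>2)\<^sup>2 / (2 * \<sigma>\<^sup>2)"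
      using assms by (simp add: field_simps power2_eq_square)
    then have "exp (- (x - 0)\<^sup>2 / (2 * \<sigma>\<^sup>2)) * exp x = exp (\<sigma>\<^sup>2 / 2) * exp (- (x - \<sigma>\<^sup>2)\<^sup>2 / (2 * \<sigma>\<^sup>2))"
      by (simp only: exp_add[symmetric])
    then show ?thesis unfolding normal_density_def by (simp only: mult.assoc mult.left_commute)
  qed
  show "integrable lborel (\<lambda>x. normal_density 0 \<sigma> x * exp x)"
    unfolding eq using assms by (intro integrable_mult_right integrable_normal_density) auto
  show "(\<integral>x. normal_density 0 \<sigma> x * exp x \<partial>lborel) = exp (\<sigma>\<^sup>2 / 2)"
    unfolding eq using assms by simp
qed

lemma (in prob_space) gaussian_variable_square_integrable:
  assumes "gaussian_variable M X"
  shows "integrable M X" and "integrable M (\<lambda>\<omega>. (X \<omega>)\<^sup>2)"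
proof -
  have X [measurable]: "X \<in> borel_measurable M" using assms by (auto simp: gaussian_variable_def)
  from assms consider m where "AE \<omega> in M. X \<omega> = m"
    | m \<sigma> where "\<sigma> > 0" "distributed M lborel X (\<lambda>x. ennreal (normal_density m \<sigma> x))"
    by (auto simp: gaussian_variable_def)
  then have "integrable M X \<and> integrable M (\<lambda>\<omega>. (X \<omega>)\<^sup>2)"
  proof cases
    case 1
    then have "integrable M X \<longleftrightarrow> integrable M (\<lambda>_. m)" 
      by (intro integrable_cong_AE) auto
    moreover have "integrable M (\<lambda>\<omega>. (X \<omega>)\<^sup>2) \<longleftrightarrow> integrable M (\<lambda>_. m\<^sup>2)"
      using 1 by (intro integrable_cong_AE) auto
    ultimately show ?thesis by simp
  next
    case 2
    have i: "integrable M (\<lambda>\<omega>. (X \<omega> - m) ^ k)" for k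
      using distributed_integrable[OF 2(2), of "\<lambda>x. (x - m) ^ k"] integrable_normal_moment[OF 2(1), of m k] by simp
    have "integrable M (\<lambda>\<omega>. (X \<omega> - m) ^ 1 + m)" by (intro Bochner_Integration.integrable_add i) auto
    moreover have "integrable M (\<lambda>\<omega>. (X \<omega> - m) ^ 2 + 2 * m * (X \<omega> - m) ^ 1 + m\<^sup>2)"
      by (intro Bochner_Integration.integrable_add integrable_mult_right i) auto
    moreover have "(\<lambda>\<omega>. (X \<omega> - m) ^ 2 + 2 * m * (X \<omega> - m) ^ 1 + m\<^sup>2) = (\<lambda>\<omega>. (X \<omega>)\<^sup>2)"
      by (auto simp: fun_eq_iff power2_eq_square algebra_simps)
    ultimately show ?thesis by simp
  qed
  then show "integrable M X" "integrable M (\<lambda>\<omega>. (X \<omega>)\<^sup>2)" by auto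
qed

locale gff =
  fixes M :: "'w measure" and \<phi> :: "int ^ 'd::finite \<Rightarrow> 'w \<Rightarrow> real"
  assumes gff: "discrete_gff M \<phi>"

sublocale gff \<subseteq> prob_space M
  using gff by (simp add: discrete_gff_def gaussian_field_def)

context gff begin

definition lin :: "(int ^ 'd \<Rightarrow> real) \<Rightarrow> (int ^ 'd) set \<Rightarrow> 'w \<Rightarrow> real" where
  "lin c J \<omega> = (\<Sum>\<alpha>\<in>J. c \<alpha> * \<phi> \<alpha> \<omega>)"

definition quad :: "(int ^ 'd \<Rightarrow> real) \<Rightarrow> (int ^ 'd) set \<Rightarrow> real" where
  "quad c J = (\<Sum>\<alpha>\<in>J. \<Sum>\<beta>\<in>J. c \<alpha> * c \<beta> * green \<alpha> \<beta>)"

lemma gaussian_lin: "finite J \<Longrightarrow> gaussian_variable M (lin c J)"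
  using gff unfolding discrete_gff_def gaussian_field_def lin_def[abs_def] by blast

lemma gaussian_phi: "gaussian_variable M (\<phi> \<alpha>)"
  using gaussian_lin[of "{\<alpha>}" "\<lambda>_. 1"] by (simp add: lin_def[abs_def])

lemma phi_measurable [measurable]: "\<phi> \<alpha> \<in> borel_measurable M"
  using gaussian_phi by (simp add: gaussian_variable_def)

lemma lin_measurable [measurable]: "lin c J \<in> borel_measurable M"
  unfolding lin_def[abs_def] by measurable

lemma integrable_phi_phi: "integrable M (\<lambda>\<omega>. \<phi> \<alpha> \<omega> * \<phi> \<beta> \<omega>)"
proof (rule Bochner_Integration.integrable_bound)
  show "integrable M (\<lambda>\<omega>. (\<phi> \<alpha> \<omega>)\<^sup>2 + (\<phi> \<beta> \<omega>)\<^sup>2)"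
    using gaussian_variable_square_integrable(2)[OF gaussian_phi] by auto
  show "AE \<omega> in M. norm (\<phi> \<alpha> \<omega> * \<phi> \<beta> \<omega>) \<le> norm ((\<phi> \<alpha> \<omega>)\<^sup>2 + (\<phi> \<beta> \<omega>)\<^sup>2)"
  proof (rule AE_I2)
    fix \<omega>
    have "2 * \<bar>\<phi> \<alpha> \<omega>\<bar> * \<bar>\<phi> \<beta> \<omega>\<bar> \<le> \<bar>\<phi> \<alpha> \<omega>\<bar>\<^sup>2 + \<bar>\<phi> \<beta> \<omega>\<bar>\<^sup>2" by (rule sum_squares_bound)
    moreover have "0 \<le> \<bar>\<phi> \<alpha> \<omega>\<bar> * \<bar>\<phi> \<beta> \<omega>\<bar>" by simp
    ultimately have "\<bar>\<phi> \<alpha> \<omega>\<bar> * \<bar>\<phi> \<beta> \<omega>\<bar> \<le> \<bar>\<phi> \<alpha> \<omega>\<bar>\<^sup>2 + \<bar>\<phi> \<beta> \<omega>\<bar>\<^sup>2" by linarith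
    then show "norm (\<phi> \<alpha> \<omega> * \<phi> \<beta> \<omega>) \<le> norm ((\<phi> \<alpha> \<omega>)\<^sup>2 + (\<phi> \<beta> \<omega>)\<^sup>2)"
      by (simp add: abs_mult)
  qed
qed simp

lemma covariance: "(\<integral>\<omega>. \<phi> \<alpha> \<omega> * \<phi> \<beta> \<omega> \<partial>M) = green \<alpha> \<beta>"
  using gff by (simp add: discrete_gff_def)

lemma green_commute: "green \<alpha> \<beta> = green \<beta> (\<alpha> :: int ^ 'd)"
  unfolding covariance[symmetric] by (simp add: mult.commute)

lemma integral_lin: "finite J \<Longrightarrow> (\<integral>\<omega>. lin c J \<omega> \<partial>M) = 0"
  using gff gaussian_variable_square_integrable(1)[OF gaussian_phi]
  unfolding lin_def by (subst Bochner_Integration.integral_sum) (auto simp: discrete_gff_def)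

lemma integral_lin_square: "(\<integral>\<omega>. (lin c J \<omega>)\<^sup>2 \<partial>M) = quad c J"
proof -
  have "(lin c J \<omega>)\<^sup>2 = (\<Sum>\<alpha>\<in>J. \<Sum>\<beta>\<in>J. c \<alpha> * c \<beta> * (\<phi> \<alpha> \<omega> * \<phi> \<beta> \<omega>))" for \<omega>
    by (simp add: lin_def power2_eq_square sum_product algebra_simps)
  then show ?thesis
    using integrable_phi_phi by (simp add: Bochner_Integration.integral_sum covariance quad_def)
qed

text \<open>A Gaussian variable is constant or has a normal density; its mean and variance are then identified by
  integration.\<close>

lemma lin_cases:
  assumes "finite J"
  obtains (degenerate) "quad c J = 0" "AE \<omega> in M. lin c J \<omega> = 0"
    | (normal) "quad c J > 0" "distributed M lborel (lin c J) (\<lambda>x. ennreal (normal_density 0 (sqrt (quad c J)) x))"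
proof -
  from gaussian_lin[OF assms, of c] consider m where "AE \<omega> in M. lin c J \<omega> = m"
    | m \<sigma> where "\<sigma> > 0" "distributed M lborel (lin c J) (\<lambda>x. ennreal (normal_density m \<sigma> x))"
    by (auto simp: gaussian_variable_def)
  then show ?thesis
  proof cases
    case 1
    have "(\<integral>\<omega>. lin c J \<omega> \<partial>M) = (\<integral>\<omega>. m \<partial>M)" by (rule integral_cong_AE) (use 1 in auto)
    then have m: "m = 0" by (simp add: integral_lin[OF assms] prob_space)
    have "(\<integral>\<omega>. (lin c J \<omega>)\<^sup>2 \<partial>M) = (\<integral>\<omega>. 0 \<partial>M)" by (rule integral_cong_AE) (use 1 m in auto)
    then have "quad c J = 0" by (simp add: integral_lin_square)
    then show ?thesis using degenerate 1 m by simp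
  next
    case 2
    have m: "m = 0" using normal_distributed_expectation[OF 2] integral_lin[OF assms] by simp
    have "quad c J = \<sigma>\<^sup>2"
      using normal_distributed_variance[OF 2] by (simp add: integral_lin[OF assms] integral_lin_square)
    then show ?thesis using normal 2 m by simp
  qed
qed

lemma quad_nonneg: "0 \<le> quad c J"
  unfolding integral_lin_square[symmetric] by simp

lemma lin_mgf:
  assumes "finite J"
  shows "integrable M (\<lambda>\<omega>. exp (lin c J \<omega>))" and "(\<integral>\<omega>. exp (lin c J \<omega>) \<partial>M) = exp (quad c J / 2)"
proof -
  have "integrable M (\<lambda>\<omega>. exp (lin c J \<omega>)) \<and> (\<integral>\<omega>. exp (lin c J \<omega>) \<partial>M) = exp (quad c J / 2)"
    using assms
  proof (cases rule: lin_cases[of J c])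
    case degenerate
    have "integrable M (\<lambda>\<omega>. exp (lin c J \<omega>)) \<longleftrightarrow> integrable M (\<lambda>\<omega>. 1 :: real)"
      by (rule integrable_cong_AE) (use degenerate in auto)
    moreover have "(\<integral>\<omega>. exp (lin c J \<omega>) \<partial>M) = (\<integral>\<omega>. 1 \<partial>M)"
      by (rule integral_cong_AE) (use degenerate in auto)
    ultimately show ?thesis using degenerate by (simp add: prob_space)
  next
    case normal
    have s: "sqrt (quad c J) > 0" using normal by simp
    show ?thesis
      using distributed_integrable[OF normal(2), of exp] distributed_integral[OF normal(2), of exp]
        normal_mgf[OF s] normal(1) by simp
  qed
  then show "integrable M (\<lambda>\<omega>. exp (lin c J \<omega>))" "(\<integral>\<omega>. exp (lin c J \<omega>) \<partial>M) = exp (quad c J / 2)"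
    by auto
qed

lemma lin_cmult: "lin (\<lambda>\<alpha>. s * c \<alpha>) J \<omega> = s * lin c J \<omega>"
  by (simp add: lin_def sum_distrib_left mult.assoc)

lemma quad_cmult: "quad (\<lambda>\<alpha>. s * c \<alpha>) J = s\<^sup>2 * quad c J"
  by (simp add: quad_def sum_distrib_left power2_eq_square algebra_simps)

text \<open>The Chernoff bound; unlike a tail asymptotic it needs only an upper bound on the variance.\<close>

lemma lin_tail_le:
  assumes "finite J" "x \<ge> 0" "quad c J \<le> V" "V > 0"
  shows "prob {\<omega> \<in> space M. x \<le> lin c J \<omega>} \<le> exp (- x\<^sup>2 / (2 * V))"
proof -
  define s where "s = x / V"
  have s: "s \<ge> 0" using assms by (simp add: s_def)
  have "prob {\<omega> \<in> space M. x \<le> lin c J \<omega>} \<le> prob {\<omega> \<in> space M. exp (s * x) \<le> exp (lin (\<lambda>\<alpha>. s * c \<alpha>) J \<omega>)}"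
    using s by (intro finite_measure_mono) (auto simp: lin_cmult intro!: mult_left_mono)
  also have "\<dots> \<le> (\<integral>\<omega>. exp (lin (\<lambda>\<alpha>. s * c \<alpha>) J \<omega>) \<partial>M) / exp (s * x)"
    by (rule integral_Markov_inequality_measure[where A = "space M"]) (use lin_mgf[OF assms(1)] in auto)
  also have "\<dots> = exp (s\<^sup>2 * quad c J / 2 - s * x)"
    by (simp add: lin_mgf[OF assms(1)] quad_cmult exp_diff)
  also have "\<dots> \<le> exp (s\<^sup>2 * V / 2 - s * x)"
    using assms by (simp add: mult_left_mono)
  also have "s\<^sup>2 * V / 2 - s * x = - x\<^sup>2 / (2 * V)"
    using assms by (simp add: s_def power2_eq_square field_simps)
  finally show ?thesis .
qed

lemma lin_tail_eq:
  assumes "finite J" "quad c J > 0"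
  shows "prob {\<omega> \<in> space M. x \<le> lin c J \<omega>} = normal_tail (x / sqrt (quad c J))"
  using assms(1)
proof (cases rule: lin_cases[of J c])
  case normal
  let ?s = "sqrt (quad c J)"
  have s: "?s > 0" using assms by simp
  have "distributed M lborel (\<lambda>\<omega>. (lin c J \<omega> - 0) / ?s) (\<lambda>x. ennreal (std_normal_density x))"
    using normal_standard_normal_convert[OF s, of "lin c J" 0] normal(2) by simp
  then have d: "distr M lborel (\<lambda>\<omega>. lin c J \<omega> / ?s) = density lborel (\<lambda>x. ennreal (std_normal_density x))"
    by (simp add: distributed_def)
  have "normal_tail (x / ?s) = measure (distr M lborel (\<lambda>\<omega>. lin c J \<omega> / ?s)) {x / ?s..}"
    by (simp add: normal_tail_def d)
  also have "\<dots> = prob ((\<lambda>\<omega>. lin c J \<omega> / ?s) -` {x / ?s..} \<inter> space M)"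
    by (rule measure_distr) auto
  also have "(\<lambda>\<omega>. lin c J \<omega> / ?s) -` {x / ?s..} \<inter> space M = {\<omega> \<in> space M. x \<le> lin c J \<omega>}"
    using s by (auto simp: divide_le_cancel)
  finally show ?thesis by simp
qed (use assms in simp)

text \<open>Joint normality is available only through linear combinations, so independence is derived from
  generating functions.  An exponential of a combination supported on \<open>K\<close> is carried along as a weight.
  First the exponential of \<open>lin e J\<close> is replaced by the indicator of \<open>B\<close>; then, one site of \<open>K\<close> at a time,
  the exponential weight at this site is replaced by the indicator of \<open>A \<alpha>\<close>.  Each replacement is an instance of
  \<open>integral_indicator_eq_if_mgf_eq\<close>.\<close>

lemma uncorrelated_imp_indep:
  assumes J: "finite J" and K: "K \<subseteq> J"
    and orth: "\<And>\<alpha>. \<alpha> \<in> K \<Longrightarrow> (\<Sum>\<beta>\<in>J. e \<beta> * green \<beta> \<alpha>) = 0"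
    and B [measurable]: "B \<in> sets borel" and A [measurable]: "\<And>\<alpha>. A \<alpha> \<in> sets borel"
  shows "prob {\<omega> \<in> space M. lin e J \<omega> \<in> B \<and> (\<forall>\<alpha>\<in>K. \<phi> \<alpha> \<omega> \<in> A \<alpha>)}
    = prob {\<omega> \<in> space M. lin e J \<omega> \<in> B} * prob {\<omega> \<in> space M. \<forall>\<alpha>\<in>K. \<phi> \<alpha> \<omega> \<in> A \<alpha>}"
proof -
  have finK: "finite K" using J K finite_subset by blast
  define p where "p = prob {\<omega> \<in> space M. lin e J \<omega> \<in> B}"
  define I where "I F \<omega> = (\<Prod>\<alpha>\<in>F. indicator (A \<alpha>) (\<phi> \<alpha> \<omega>) :: real)" for F \<omega>
  have I_meas [measurable]: "I F \<in> borel_measurable M" for F unfolding I_def[abs_def] by measurable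
  have I01: "0 \<le> I F \<omega>" "I F \<omega> \<le> 1" for F \<omega>
    unfolding I_def by (auto intro!: prod_nonneg prod_le_1)
  have p_eq: "p = (\<integral>\<omega>. indicator B (lin e J \<omega>) \<partial>M)"
  proof -
    have "p = (\<integral>\<omega>. indicator {\<omega> \<in> space M. lin e J \<omega> \<in> B} \<omega> \<partial>M)"
      unfolding p_def by simp
    also have "\<dots> = (\<integral>\<omega>. indicator B (lin e J \<omega>) \<partial>M)"
      by (intro Bochner_Integration.integral_cong) (auto simp: indicator_def)
    finally show ?thesis .
  qed
  have p0: "p \<ge> 0" by (simp add: p_def)
  have quad_orth: "quad (\<lambda>\<alpha>. s \<alpha> + t * e \<alpha>) J = quad s J + t\<^sup>2 * quad e J" if s: "\<And>\<alpha>. \<alpha> \<notin> K \<Longrightarrow> s \<alpha> = 0" for s t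
  proof -
    have z1: "(\<Sum>\<alpha>\<in>J. \<Sum>\<beta>\<in>J. s \<alpha> * e \<beta> * green \<alpha> \<beta>) = 0"
    proof (rule sum.neutral, intro ballI)
      fix \<alpha>
      have "(\<Sum>\<beta>\<in>J. s \<alpha> * e \<beta> * green \<alpha> \<beta>) = s \<alpha> * (\<Sum>\<beta>\<in>J. e \<beta> * green \<beta> \<alpha>)"
        by (simp add: sum_distrib_left mult.assoc green_commute[of \<alpha>])
      then show "(\<Sum>\<beta>\<in>J. s \<alpha> * e \<beta> * green \<alpha> \<beta>) = 0" using orth[of \<alpha>] s[of \<alpha>] by (cases "\<alpha> \<in> K") auto
    qed
    have z2: "(\<Sum>\<alpha>\<in>J. \<Sum>\<beta>\<in>J. e \<alpha> * s \<beta> * green \<alpha> \<beta>) = 0"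
      using z1 by (subst sum.swap) (simp add: mult_ac green_commute[of _ "_ :: int ^ 'd"])
    have "quad (\<lambda>\<alpha>. s \<alpha> + t * e \<alpha>) J = quad s J + t\<^sup>2 * quad e J
      + t * (\<Sum>\<alpha>\<in>J. \<Sum>\<beta>\<in>J. s \<alpha> * e \<beta> * green \<alpha> \<beta>) + t * (\<Sum>\<alpha>\<in>J. \<Sum>\<beta>\<in>J. e \<alpha> * s \<beta> * green \<alpha> \<beta>)"
      unfolding quad_def sum_distrib_left sum.distrib[symmetric]
      by (intro sum.cong refl) (simp add: power2_eq_square algebra_simps)
    then show ?thesis by (simp add: z1 z2)
  qed
  have int: "integrable M (\<lambda>\<omega>. h \<omega> * exp (lin s J \<omega>))" if h [measurable]: "h \<in> borel_measurable M"
    and hb: "\<And>\<omega>. \<bar>h \<omega>\<bar> \<le> 1" for h s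
  proof (rule Bochner_Integration.integrable_bound[OF lin_mgf(1)[OF J, of s]])
    show "AE \<omega> in M. norm (h \<omega> * exp (lin s J \<omega>)) \<le> norm (exp (lin s J \<omega>))"
      using hb by (intro AE_I2) (simp add: abs_mult mult_left_le_one_le)
  qed measurable
  have lin_upd: "lin (s(\<alpha> := s \<alpha> + t)) J \<omega> = lin s J \<omega> + t * \<phi> \<alpha> \<omega>" if "\<alpha> \<in> J" for s \<alpha> t \<omega>
  proof -
    have "lin (s(\<alpha> := s \<alpha> + t)) J \<omega> = (\<Sum>\<beta>\<in>J. s \<beta> * \<phi> \<beta> \<omega> + (if \<beta> = \<alpha> then t * \<phi> \<alpha> \<omega> else 0))"
      unfolding lin_def by (intro sum.cong) (auto simp: algebra_simps)
    also have "\<dots> = lin s J \<omega> + t * \<phi> \<alpha> \<omega>" using that J by (simp add: sum.distrib lin_def)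
    finally show ?thesis .
  qed
  have claim: "(\<integral>\<omega>. indicator B (lin e J \<omega>) * I F \<omega> * exp (lin s J \<omega>) \<partial>M) = p * (\<integral>\<omega>. I F \<omega> * exp (lin s J \<omega>) \<partial>M)"
    if "finite F" "F \<subseteq> K" "\<And>\<alpha>. \<alpha> \<notin> K \<Longrightarrow> s \<alpha> = 0" for F s
    using that
  proof (induction F arbitrary: s rule: finite_induct)
    case empty
    have l: "exp (lin s J \<omega>) * exp (t * lin e J \<omega>) = exp (lin (\<lambda>\<alpha>. s \<alpha> + t * e \<alpha>) J \<omega>)" for t \<omega>
    proof -
      have "lin s J \<omega> + t * lin e J \<omega> = lin (\<lambda>\<alpha>. s \<alpha> + t * e \<alpha>) J \<omega>"
        by (simp add: lin_def sum_distrib_left sum.distrib[symmetric] algebra_simps)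
      then show ?thesis by (simp add: exp_add[symmetric])
    qed
    have l2: "exp (t * lin e J \<omega>) = exp (lin (\<lambda>\<alpha>. t * e \<alpha>) J \<omega>)" for t \<omega> by (simp add: lin_cmult)
    have "(\<integral>\<omega>. exp (lin s J \<omega>) * indicator B (lin e J \<omega>) \<partial>M)
      = (\<integral>\<omega>. exp (quad s J / 2) * indicator B (lin e J \<omega>) \<partial>M)"
    proof (rule integral_indicator_eq_if_mgf_eq)
      fix t
      show "integrable M (\<lambda>\<omega>. exp (lin s J \<omega>) * exp (t * lin e J \<omega>))"
        unfolding l by (rule lin_mgf(1)[OF J])
      show "integrable M (\<lambda>\<omega>. exp (quad s J / 2) * exp (t * lin e J \<omega>))"
        unfolding l2 by (intro integrable_mult_right lin_mgf(1)[OF J])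
      show "(\<integral>\<omega>. exp (lin s J \<omega>) * exp (t * lin e J \<omega>) \<partial>M) = (\<integral>\<omega>. exp (quad s J / 2) * exp (t * lin e J \<omega>) \<partial>M)"
      proof -
        have "(\<integral>\<omega>. exp (lin s J \<omega>) * exp (t * lin e J \<omega>) \<partial>M) = exp (quad s J / 2 + t\<^sup>2 * quad e J / 2)"
          unfolding l by (simp add: lin_mgf(2)[OF J] quad_orth[OF empty(2)] add_divide_distrib)
        moreover have "(\<integral>\<omega>. exp (quad s J / 2) * exp (t * lin e J \<omega>) \<partial>M) = exp (quad s J / 2) * exp (t\<^sup>2 * quad e J / 2)"
          unfolding l2 integral_mult_right_zero lin_mgf(2)[OF J] quad_cmult by simp
        ultimately show ?thesis by (simp add: exp_add)
      qed
    qed auto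
    then show ?case by (simp add: I_def lin_mgf(2)[OF J] p_eq mult.commute)
  next
    case (insert \<alpha> F)
    have \<alpha>: "\<alpha> \<in> K" "\<alpha> \<in> J" "\<alpha> \<notin> F" using insert K by auto
    have e: "x * exp (lin s J \<omega>) * exp (t * \<phi> \<alpha> \<omega>) = x * exp (lin (s(\<alpha> := s \<alpha> + t)) J \<omega>)" for x t \<omega>
      by (simp add: lin_upd[OF \<alpha>(2)] exp_add)
    have bI: "\<bar>indicator B x * I F \<omega>\<bar> \<le> 1" "\<bar>I F \<omega>\<bar> \<le> 1" for x :: real and \<omega>
      using I01[of F \<omega>] by (auto simp: indicator_def)
    have "(\<integral>\<omega>. (indicator B (lin e J \<omega>) * I F \<omega> * exp (lin s J \<omega>)) * indicator (A \<alpha>) (\<phi> \<alpha> \<omega>) \<partial>M)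
      = (\<integral>\<omega>. (p * I F \<omega> * exp (lin s J \<omega>)) * indicator (A \<alpha>) (\<phi> \<alpha> \<omega>) \<partial>M)"
    proof (rule integral_indicator_eq_if_mgf_eq)
      fix t
      show "integrable M (\<lambda>\<omega>. indicator B (lin e J \<omega>) * I F \<omega> * exp (lin s J \<omega>) * exp (t * \<phi> \<alpha> \<omega>))"
        unfolding e by (rule int) (auto simp: bI)
      show "integrable M (\<lambda>\<omega>. p * I F \<omega> * exp (lin s J \<omega>) * exp (t * \<phi> \<alpha> \<omega>))"
        unfolding e mult.assoc[of p] by (intro integrable_mult_right int) (auto simp: bI)
      show "(\<integral>\<omega>. indicator B (lin e J \<omega>) * I F \<omega> * exp (lin s J \<omega>) * exp (t * \<phi> \<alpha> \<omega>) \<partial>M)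
        = (\<integral>\<omega>. p * I F \<omega> * exp (lin s J \<omega>) * exp (t * \<phi> \<alpha> \<omega>) \<partial>M)"
      proof -
        have "(\<integral>\<omega>. indicator B (lin e J \<omega>) * I F \<omega> * exp (lin (s(\<alpha> := s \<alpha> + t)) J \<omega>) \<partial>M)
          = p * (\<integral>\<omega>. I F \<omega> * exp (lin (s(\<alpha> := s \<alpha> + t)) J \<omega>) \<partial>M)"
          by (rule insert.IH) (use insert.prems \<alpha> in auto)
        then show ?thesis unfolding e by (simp only: mult.assoc integral_mult_right_zero)
      qed
    qed (use I01 p0 in auto)
    moreover have "I (insert \<alpha> F) \<omega> = I F \<omega> * indicator (A \<alpha>) (\<phi> \<alpha> \<omega>)" for \<omega>
      using insert by (simp add: I_def)
    ultimately show ?case by (simp add: mult_ac)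
  qed
  have Ieq: "I K \<omega> = indicator {\<omega>. \<forall>\<alpha>\<in>K. \<phi> \<alpha> \<omega> \<in> A \<alpha>} \<omega>" for \<omega>
    using finK by (auto simp: I_def indicator_def)
  have "prob {\<omega> \<in> space M. lin e J \<omega> \<in> B \<and> (\<forall>\<alpha>\<in>K. \<phi> \<alpha> \<omega> \<in> A \<alpha>)}
    = (\<integral>\<omega>. indicator {\<omega> \<in> space M. lin e J \<omega> \<in> B \<and> (\<forall>\<alpha>\<in>K. \<phi> \<alpha> \<omega> \<in> A \<alpha>)} \<omega> \<partial>M)"
    using finK by simp
  also have "\<dots> = (\<integral>\<omega>. indicator B (lin e J \<omega>) * I K \<omega> \<partial>M)"
    by (intro Bochner_Integration.integral_cong) (auto simp: Ieq indicator_def)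
  also have "\<dots> = p * (\<integral>\<omega>. I K \<omega> \<partial>M)"
    using claim[OF finK order_refl, of "\<lambda>_. 0"] by (simp add: lin_def)
  also have "(\<integral>\<omega>. I K \<omega> \<partial>M) = (\<integral>\<omega>. indicator {\<omega> \<in> space M. \<forall>\<alpha>\<in>K. \<phi> \<alpha> \<omega> \<in> A \<alpha>} \<omega> \<partial>M)"
    by (intro Bochner_Integration.integral_cong) (auto simp: Ieq indicator_def)
  also have "\<dots> = prob {\<omega> \<in> space M. \<forall>\<alpha>\<in>K. \<phi> \<alpha> \<omega> \<in> A \<alpha>}"
    using finK by simp
  finally show ?thesis by (simp add: p_def)
qed

end

section \<open>Fourier analysis on the circle\<close>

text \<open>The normalized uniform distribution on \<open>[-\<pi>,\<pi>]\<close>, as a measure on the whole real line.\<close>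

definition circle :: "real measure" where
  "circle = density lborel (\<lambda>x. ennreal (indicator {- pi..pi} x / (2 * pi)))"

lemma sets_circle [measurable_cong, simp]: "sets circle = sets borel"
  by (simp add: circle_def)

lemma prob_space_circle: "prob_space circle"
proof (rule prob_spaceI)
  have "emeasure circle (space circle) = (\<integral>\<^sup>+x. ennreal (1 / (2 * pi)) * indicator {- pi..pi} x \<partial>lborel)"
    unfolding circle_def by (simp add: emeasure_density) (intro nn_integral_cong, simp split: split_indicator)
  also have "\<dots> = ennreal (1 / (2 * pi)) * ennreal (2 * pi)"
    by (subst nn_integral_cmult_indicator) auto
  also have "\<dots> = 1" by (subst ennreal_mult[symmetric]) auto
  finally show "emeasure circle (space circle) = 1" .
qed

interpretation circle: prob_space circle by (rule prob_space_circle)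

lemma integral_circle:
  fixes f :: "real \<Rightarrow> 'a::{real_normed_field, banach, second_countable_topology}"
  assumes [measurable]: "f \<in> borel_measurable borel"
  shows "(\<integral>x. f x \<partial>circle) = (1 / (2 * pi)) *\<^sub>R (\<integral>x. indicator {- pi..pi} x *\<^sub>R f x \<partial>lborel)"
proof -
  have "(\<integral>x. f x \<partial>circle) = (\<integral>x. (indicator {- pi..pi} x / (2 * pi)) *\<^sub>R f x \<partial>lborel)"
    unfolding circle_def by (rule integral_density) auto
  also have "\<dots> = (\<integral>x. of_real (1 / (2 * pi)) * (indicator {- pi..pi} x *\<^sub>R f x) \<partial>lborel)"
    by (intro Bochner_Integration.integral_cong) (auto simp: scaleR_conv_of_real)
  finally show ?thesis by (simp only: integral_mult_right_zero scaleR_conv_of_real)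
qed

lemma circle_character:
  "(\<integral>t. iexp (t * real_of_int k) \<partial>circle) = (if k = 0 then 1 else 0)"
proof (cases "k = 0")
  case True then show ?thesis by (simp add: circle.prob_space)
next
  case False
  define F where "F z = exp (\<i> * of_int k * z) / (\<i> * of_int k)" for z
  have "((\<lambda>t. F (of_real t)) has_vector_derivative iexp (t * real_of_int k)) (at t within {- pi..pi})" for t :: real
  proof (rule has_vector_derivative_real_field)
    show "(F has_field_derivative iexp (t * real_of_int k)) (at (complex_of_real t))"
      unfolding F_def using False by (auto intro!: derivative_eq_intros simp: mult_ac)
  qed
  moreover have "continuous_on {- pi..pi} (\<lambda>t. iexp (t * real_of_int k))"
    by (intro continuous_intros)
  ultimately have "(\<integral>t. indicator {- pi..pi} t *\<^sub>R iexp (t * real_of_int k) \<partial>lborel) = F (of_real pi) - F (of_real (- pi))"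
    by (intro integral_FTC_Icc) auto
  also have "\<dots> = 0"
  proof -
    have "exp (\<i> * of_int k * of_real pi) = exp (\<i> * of_int k * of_real (- pi))"
    proof (subst exp_eq, intro exI)
      show "\<i> * of_int k * of_real pi = \<i> * of_int k * of_real (- pi) + of_real (real_of_int (2 * k) * pi) * \<i>"
        by (simp add: algebra_simps)
    qed
    then show ?thesis by (simp add: F_def)
  qed
  finally have "(\<integral>t. indicator {- pi..pi} t *\<^sub>R iexp (t * real_of_int k) \<partial>lborel) = 0" .
  then show ?thesis using False by (subst integral_circle) auto
qed

text \<open>Up to \<open>\<pi> / 3\<close> the difference is increasing, because there the cosine is at least one half; beyond that
  point the sine already exceeds \<open>\<pi> / 4\<close>.\<close>

lemma half_le_sin:
  assumes "0 \<le> y" "y \<le> pi / 2"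
  shows "y / 2 \<le> sin y"
proof (cases "y \<le> pi / 3")
  case True
  have "sin 0 - 0 / 2 \<le> sin y - y / 2"
  proof (rule DERIV_nonneg_imp_nondecreasing[OF assms(1)])
    fix x assume x: "0 \<le> x" "x \<le> y"
    have "cos (pi / 3) \<le> cos x" using x True pi_gt_zero by (subst cos_mono_le_eq) auto
    then have "0 \<le> cos x - 1 / 2" by (simp add: cos_60)
    moreover have "((\<lambda>x. sin x - x / 2) has_real_derivative cos x - 1 / 2) (at x)"
      by (auto intro!: derivative_eq_intros)
    ultimately show "\<exists>D. ((\<lambda>x. sin x - x / 2) has_real_derivative D) (at x) \<and> 0 \<le> D" by blast
  qed
  then show ?thesis by simp
next
  case False
  have "sin (pi / 3) \<le> sin y" using False assms by (subst sin_mono_le_eq) auto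
  moreover have "17 / 10 \<le> sqrt 3" by (rule real_le_rsqrt) (simp add: power2_eq_square)
  moreover have "pi < 32 / 10" using pi_approx by simp
  ultimately show ?thesis using assms by (simp add: sin_60)
qed

lemma sin_square_ge:
  assumes "\<bar>y\<bar> \<le> pi / 2"
  shows "y\<^sup>2 / 4 \<le> (sin y)\<^sup>2"
proof -
  have "\<bar>y\<bar> / 2 \<le> sin \<bar>y\<bar>" using half_le_sin[of "\<bar>y\<bar>"] assms by simp
  then have "(\<bar>y\<bar> / 2)\<^sup>2 \<le> (sin \<bar>y\<bar>)\<^sup>2" by (intro power_mono) auto
  moreover have "(sin \<bar>y\<bar>)\<^sup>2 = (sin y)\<^sup>2" by (auto simp: abs_if)
  ultimately show ?thesis by (simp add: power_divide)
qed

text \<open>On \<open>[-\<pi>,\<pi>]\<close> the square of the sine vanishes at \<open>-\<pi>\<close>, \<open>0\<close> and \<open>\<pi>\<close>, and grows quadratically around each of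
  these points; the integrand is dominated by a multiple of three normal densities.\<close>

lemma circle_gaussian_bound:
  assumes t: "t > 0"
  shows "(\<integral>x. exp (- t * (sin x)\<^sup>2) \<partial>circle) \<le> 3 / sqrt t"
proof -
  define s where "s = sqrt (2 / t)"
  have s: "s > 0" "s\<^sup>2 = 2 / t" using t by (auto simp: s_def)
  define K where "K = sqrt (2 * pi * s\<^sup>2)"
  have Kpos: "K > 0" using s(1) by (simp add: K_def)
  have nd: "exp (- t * (x - c)\<^sup>2 / 4) = K * normal_density c s x" for x c
  proof -
    have "normal_density c s x = exp (- (x - c)\<^sup>2 / (2 * s\<^sup>2)) / K"
      by (simp add: normal_density_def K_def)
    moreover have "- (x - c)\<^sup>2 / (2 * s\<^sup>2) = - t * (x - c)\<^sup>2 / 4" using t by (simp add: s field_simps)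
    ultimately show ?thesis using Kpos by simp
  qed
  have K: "K = sqrt (4 * pi / t)" by (simp add: K_def s)
  have ptw: "indicator {- pi..pi} x * exp (- t * (sin x)\<^sup>2) \<le> K * normal_density (- pi) s x + K * normal_density 0 s x + K * normal_density pi s x" for x
  proof (cases "x \<in> {- pi..pi}")
    case True
    have ex: "exp (- t * (sin x)\<^sup>2) \<le> K * normal_density c s x" if "\<bar>x - c\<bar> \<le> pi / 2" "(sin (x - c))\<^sup>2 = (sin x)\<^sup>2" for c
    proof -
      have "t * ((x - c)\<^sup>2 / 4) \<le> t * (sin x)\<^sup>2"
        using sin_square_ge[OF that(1)] that(2) t by (intro mult_left_mono) auto
      then show ?thesis unfolding nd[symmetric] by simp
    qed
    have nn: "0 \<le> K * normal_density c s x" for c using Kpos s by simp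
    have "- pi \<le> x" "x \<le> pi" using True by auto
    then consider "\<bar>x - (- pi)\<bar> \<le> pi / 2" | "\<bar>x - 0\<bar> \<le> pi / 2" | "\<bar>x - pi\<bar> \<le> pi / 2"
      unfolding abs_le_iff by linarith
    then show ?thesis
    proof cases
      case 1
      then show ?thesis using ex[of "- pi"] nn[of 0] nn[of pi] nn[of "-pi"] True by simp
    next
      case 2
      then show ?thesis using ex[of 0] nn[of 0] nn[of pi] nn[of "-pi"] True by simp
    next
      case 3
      then show ?thesis using ex[of pi] nn[of 0] nn[of pi] nn[of "-pi"] True by (simp add: sin_diff)
    qed
  next
    case False
    then show ?thesis using Kpos s by simp
  qed
  have "(\<integral>x. exp (- t * (sin x)\<^sup>2) \<partial>circle) = 1 / (2 * pi) * (\<integral>x. indicator {- pi..pi} x * exp (- t * (sin x)\<^sup>2) \<partial>lborel)"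
    by (subst integral_circle) auto
  also have "\<dots> \<le> 1 / (2 * pi) * (\<integral>x. K * normal_density (- pi) s x + K * normal_density 0 s x + K * normal_density pi s x \<partial>lborel)"
  proof (intro mult_left_mono integral_mono)
    show "integrable lborel (\<lambda>x. indicator {- pi..pi} x * exp (- t * (sin x)\<^sup>2))"
    proof (rule Bochner_Integration.integrable_bound)
      show "integrable lborel (\<lambda>x. indicator {- pi..pi} x :: real)" by simp
      show "AE x in lborel. norm (indicator {- pi..pi} x * exp (- t * (sin x)\<^sup>2)) \<le> norm (indicator {- pi..pi} x :: real)"
        using t by (intro AE_I2) (auto simp: indicator_def)
    qed measurable
    show "integrable lborel (\<lambda>x. K * normal_density (- pi) s x + K * normal_density 0 s x + K * normal_density pi s x)"
      using s by (intro Bochner_Integration.integrable_add integrable_mult_right integrable_normal_density) auto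
  qed (use ptw in auto)
  also have "\<dots> = 1 / (2 * pi) * (3 * K)"
    using s by simp
  also have "\<dots> \<le> 3 / sqrt t"
  proof -
    have "K = 2 * sqrt pi / sqrt t" by (simp add: K real_sqrt_mult real_sqrt_divide)
    moreover have "sqrt pi \<le> pi"
      by (rule real_le_lsqrt) (use pi_ge_two in \<open>auto simp: power2_eq_square\<close>)
    ultimately show ?thesis using t by (simp add: field_simps)
  qed
  finally show ?thesis .
qed

section \<open>Transition probabilities of the walk by Fourier inversion\<close>

lemma finite_lattice_units: "finite (lattice_units :: (int ^ 'd::finite) set)"
  and lattice_units_nonempty: "(lattice_units :: (int ^ 'd) set) \<noteq> {}"
  and sum_lattice_units: "(\<Sum>u\<in>(lattice_units :: (int ^ 'd) set). f u) = (\<Sum>i\<in>UNIV. f (axis i 1) + f (axis i (-1)) :: complex)"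
  and card_lattice_units: "card (lattice_units :: (int ^ 'd) set) = 2 * CARD('d)"
proof -
  have eq: "(lattice_units :: (int ^ 'd) set) = (\<lambda>(i, s). axis i s) ` (UNIV \<times> {1, -1})"
    by (auto simp: lattice_units_def)
  have inj: "inj_on (\<lambda>(i, s). axis i s :: int ^ 'd) (UNIV \<times> {1, -1})"
    by (auto simp: inj_on_def axis_eq_axis)
  show "finite (lattice_units :: (int ^ 'd) set)" "(lattice_units :: (int ^ 'd) set) \<noteq> {}" unfolding eq by auto
  show "card (lattice_units :: (int ^ 'd) set) = 2 * CARD('d)"
    unfolding eq card_image[OF inj] card_cartesian_product by simp
  show "(\<Sum>u\<in>(lattice_units :: (int ^ 'd) set). f u) = (\<Sum>i\<in>UNIV. f (axis i 1) + f (axis i (-1)))"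
  proof -
    have "(\<Sum>u\<in>(lattice_units :: (int ^ 'd) set). f u) = (\<Sum>(i, s)\<in>UNIV \<times> {1, -1}. f (axis i s))"
      unfolding eq sum.reindex[OF inj] by (simp add: o_def case_prod_unfold)
    also have "\<dots> = (\<Sum>i\<in>UNIV. \<Sum>s\<in>{1, -1}. f (axis i s))"
      by (rule sum.cartesian_product[symmetric])
    finally show ?thesis by simp
  qed
qed

definition l1 :: "int ^ 'd::finite \<Rightarrow> nat" where
  "l1 x = (\<Sum>i\<in>UNIV. nat \<bar>x $ i\<bar>)"

lemma l1_triangle: "l1 (x + y) \<le> l1 x + l1 y"
proof -
  have "nat \<bar>(x + y) $ i\<bar> \<le> nat \<bar>x $ i\<bar> + nat \<bar>y $ i\<bar>" for i
    unfolding vector_add_component by arith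
  then show ?thesis unfolding l1_def by (simp add: sum.distrib[symmetric] sum_mono)
qed

lemma l1_minus: "l1 (- x) = l1 x" by (simp add: l1_def)

lemma l1_diff_commute: "l1 (x - y) = l1 (y - x)"
  using l1_minus[of "x - y"] by simp

lemma l1_eq_0_iff: "l1 x = 0 \<longleftrightarrow> x = 0"
  by (auto simp: l1_def vec_eq_iff)

lemma l1_unit: "u \<in> lattice_units \<Longrightarrow> l1 u = 1"
proof -
  assume "u \<in> lattice_units"
  then obtain i s where u: "u = axis i s" "s = 1 \<or> s = -1" by (auto simp: lattice_units_def)
  have "l1 u = (\<Sum>j\<in>UNIV. if j = i then 1 else 0)"
    unfolding l1_def using u by (intro sum.cong) (auto simp: axis_def)
  then show ?thesis by simp
qed

definition torus :: "('d::finite \<Rightarrow> real) measure" where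
  "torus = Pi\<^sub>M UNIV (\<lambda>_. circle)"

definition character :: "('d::finite \<Rightarrow> real) \<Rightarrow> int ^ 'd \<Rightarrow> complex" where
  "character \<theta> y = (\<Prod>j\<in>UNIV. iexp (\<theta> j * real_of_int (y $ j)))"

lemma character_add: "character \<theta> (x + y) = character \<theta> x * character \<theta> y"
  by (simp add: character_def prod.distrib[symmetric] exp_add[symmetric] algebra_simps)

lemma character_0 [simp]: "character \<theta> 0 = 1"
  by (simp add: character_def)

lemma character_sum: "character \<theta> (\<Sum>k<m. \<xi> k) = (\<Prod>k<m. character \<theta> (\<xi> k))" for m :: nat
  by (induction m) (auto simp: character_add)

lemma norm_character [simp]: "norm (character \<theta> y) = 1"
  by (simp add: character_def prod_norm[symmetric])

lemma character_axis: "character \<theta> (axis i s) = iexp (\<theta> i * real_of_int s)"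
proof -
  have "character \<theta> (axis i s) = (\<Prod>j\<in>UNIV. if j = i then iexp (\<theta> i * real_of_int s) else 1)"
    unfolding character_def by (intro prod.cong) (auto simp: axis_def)
  then show ?thesis by simp
qed

lemma prob_space_torus: "prob_space torus"
  unfolding torus_def by (intro prob_space_PiM prob_space_circle)

lemma product_sigma_finite_circle: "product_sigma_finite (\<lambda>_. circle)"
  by unfold_locales

lemma torus_character: "(\<integral>\<theta>. character \<theta> y \<partial>torus) = (if y = 0 then 1 else 0)"
proof -
  interpret product_sigma_finite "\<lambda>_::'a. circle" by (rule product_sigma_finite_circle)
  have "(\<integral>\<theta>. character \<theta> y \<partial>torus) = (\<Prod>j\<in>UNIV. \<integral>t. iexp (t * real_of_int (y $ j)) \<partial>circle)"
    unfolding character_def torus_def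
    by (rule product_integral_prod) (auto intro!: circle.integrable_const_bound[where B = 1])
  also have "\<dots> = (\<Prod>j\<in>UNIV. if y $ j = 0 then 1 else 0)"
    by (intro prod.cong refl circle_character)
  also have "\<dots> = (if y = 0 then 1 else 0)"
    by (auto simp: vec_eq_iff intro!: prod.neutral)
  finally show ?thesis .
qed

text \<open>The characteristic function of one step of the walk.\<close>

definition step_character :: "('d::finite \<Rightarrow> real) \<Rightarrow> complex" where
  "step_character \<theta> = (\<integral>u. character \<theta> u \<partial>measure_pmf (pmf_of_set lattice_units))"

lemma step_character_eq:
  "step_character \<theta> = of_real ((\<Sum>i\<in>UNIV. cos (\<theta> i)) / real CARD('d))" for \<theta> :: "'d::finite \<Rightarrow> real"
proof -
  have "step_character \<theta> = (\<Sum>u\<in>lattice_units. character \<theta> u) / of_nat (card (lattice_units :: (int ^ 'd) set))"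
  proof -
    have "step_character \<theta> = (\<Sum>u\<in>(lattice_units :: (int ^ 'd) set). pmf (pmf_of_set lattice_units) u *\<^sub>R character \<theta> u)"
      unfolding step_character_def
      by (rule integral_measure_pmf) (simp_all add: finite_lattice_units lattice_units_nonempty)
    also have "\<dots> = (\<Sum>u\<in>lattice_units. character \<theta> u / of_nat (card (lattice_units :: (int ^ 'd) set)))"
      by (intro sum.cong refl) (simp add: finite_lattice_units lattice_units_nonempty scaleR_conv_of_real)
    finally show ?thesis by (simp only: sum_divide_distrib)
  qed
  also have "\<dots> = (\<Sum>i\<in>UNIV. 2 * of_real (cos (\<theta> i))) / of_nat (2 * CARD('d))"
    unfolding sum_lattice_units card_lattice_units character_axis
    by (intro arg_cong2[where f = "(/)"] sum.cong refl) (simp add: cos_of_real[symmetric] cos_exp_eq)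
  also have "\<dots> = of_real ((\<Sum>i\<in>UNIV. cos (\<theta> i)) / real CARD('d))"
    by (simp add: sum_distrib_left[symmetric])
  finally show ?thesis .
qed

text \<open>From \<open>\<bar>cos x\<bar> \<le> 1 - (sin x)\<^sup>2 / 2\<close>.  The sine, rather than the distance to the origin, appears because the
  walk is periodic: the step character has modulus one also at \<open>(\<pi>,\<dots>,\<pi>)\<close>.\<close>

lemma norm_step_character_le:
  "norm (step_character \<theta>) \<le> (\<Prod>i\<in>UNIV. exp (- (1 / (2 * real CARD('d))) * (sin (\<theta> i))\<^sup>2))" for \<theta> :: "'d::finite \<Rightarrow> real"
proof -
  have c: "\<bar>cos x\<bar> \<le> 1 - (sin x)\<^sup>2 / 2" for x :: real
  proof -
    have "0 \<le> (1 - \<bar>cos x\<bar>)\<^sup>2" by simp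
    then show ?thesis by (simp add: sin_squared_eq power2_diff field_simps)
  qed
  have "norm (step_character \<theta>) = \<bar>\<Sum>i\<in>UNIV. cos (\<theta> i)\<bar> / real CARD('d)"
    unfolding step_character_eq norm_of_real by simp
  also have "\<dots> \<le> (\<Sum>i\<in>UNIV. 1 - (sin (\<theta> i))\<^sup>2 / 2) / real CARD('d)"
    by (intro divide_right_mono order_trans[OF sum_abs] sum_mono c) auto
  also have "\<dots> = 1 + (- (\<Sum>i\<in>UNIV. (sin (\<theta> i))\<^sup>2) / (2 * real CARD('d)))"
    by (simp add: sum_subtractf sum_divide_distrib[symmetric] diff_divide_distrib)
  also have "\<dots> \<le> exp (- (\<Sum>i\<in>UNIV. (sin (\<theta> i))\<^sup>2) / (2 * real CARD('d)))"
    by (rule exp_ge_add_one_self)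
  also have "- (\<Sum>i\<in>UNIV. (sin (\<theta> i))\<^sup>2) / (2 * real CARD('d)) = (\<Sum>i\<in>UNIV. - (1 / (2 * real CARD('d))) * (sin (\<theta> i))\<^sup>2)"
    by (simp add: sum_divide_distrib sum_negf)
  finally show ?thesis by (simp add: exp_sum)
qed

lemma prob_space_srw_steps: "prob_space (srw_steps :: (nat \<Rightarrow> int ^ 'd::finite) measure)"
  unfolding srw_steps_def by (intro prob_space_PiM measure_pmf.prob_space_axioms)

lemma measurable_step: "(\<lambda>\<xi>. f (\<xi> k)) \<in> srw_steps \<rightarrow>\<^sub>M N" if "f \<in> UNIV \<rightarrow> space N"
proof -
  have "(\<lambda>\<xi>. \<xi> k) \<in> srw_steps \<rightarrow>\<^sub>M measure_pmf (pmf_of_set lattice_units)"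
    unfolding srw_steps_def by (rule measurable_component_singleton) simp
  moreover have "f \<in> measure_pmf (pmf_of_set lattice_units) \<rightarrow>\<^sub>M N" using that by simp
  ultimately show ?thesis by (rule measurable_compose)
qed

lemma walk_measurable: "(\<lambda>\<xi>. \<Sum>k<m. \<xi> k) \<in> srw_steps \<rightarrow>\<^sub>M count_space (UNIV :: (int ^ 'd::finite) set)"
proof (induction m)
  case (Suc m)
  have "(\<lambda>\<xi>. (\<Sum>k<m. \<xi> k) + \<xi> m) \<in> srw_steps \<rightarrow>\<^sub>M count_space (UNIV :: (int ^ 'd) set)"
    by (rule measurable_compose_countable[OF _ Suc, of "\<lambda>x \<xi>. x + \<xi> m"])
       (rule measurable_step[where f = "\<lambda>u. _ + u"], simp)
  then show ?case by simp
qed simp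

lemma walk_character:
  "(\<integral>\<xi>. character \<theta> (\<Sum>k<m. \<xi> k) \<partial>srw_steps) = step_character \<theta> ^ m" for \<theta> :: "'d::finite \<Rightarrow> real"
proof -
  let ?p = "measure_pmf (pmf_of_set (lattice_units :: (int ^ 'd) set))"
  interpret product_prob_space "\<lambda>_. ?p" "UNIV :: nat set" by unfold_locales
  have r: "distr srw_steps (Pi\<^sub>M {..<m} (\<lambda>_. ?p)) (\<lambda>x. restrict x {..<m}) = Pi\<^sub>M {..<m} (\<lambda>_. ?p)"
    unfolding srw_steps_def by (rule distr_PiM_restrict_finite) simp_all
  have mm: "(\<lambda>x. restrict x {..<m}) \<in> srw_steps \<rightarrow>\<^sub>M Pi\<^sub>M {..<m} (\<lambda>_. ?p)"
    unfolding srw_steps_def by (rule measurable_restrict_subset) simp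
  have mf: "(\<lambda>x. \<Prod>k<m. character \<theta> (x k)) \<in> borel_measurable (Pi\<^sub>M {..<m} (\<lambda>_. ?p))"
    by (intro borel_measurable_prod measurable_compose[OF measurable_component_singleton]) auto
  have "(\<integral>\<xi>. character \<theta> (\<Sum>k<m. \<xi> k) \<partial>srw_steps) = (\<integral>\<xi>. (\<Prod>k<m. character \<theta> (restrict \<xi> {..<m} k)) \<partial>srw_steps)"
    by (simp add: character_sum)
  also have "\<dots> = (\<integral>x. (\<Prod>k<m. character \<theta> (x k)) \<partial>distr srw_steps (Pi\<^sub>M {..<m} (\<lambda>_. ?p)) (\<lambda>x. restrict x {..<m}))"
    by (rule integral_distr[OF mm mf, symmetric])
  also have "\<dots> = (\<Prod>k<m. \<integral>u. character \<theta> u \<partial>?p)"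
    unfolding r by (rule product_integral_prod) (auto intro!: integrable_measure_pmf_finite simp: finite_lattice_units lattice_units_nonempty)
  finally show ?thesis by (simp add: step_character_def)
qed

definition walk_prob :: "nat \<Rightarrow> int ^ 'd::finite \<Rightarrow> real" where
  "walk_prob m x = measure srw_steps {\<xi> \<in> space srw_steps. (\<Sum>k<m. \<xi> k) = x}"

text \<open>Fourier inversion: the integral of a character over the torus is the indicator of the origin.\<close>

lemma walk_prob_fourier:
  "complex_of_real (walk_prob m x) = (\<integral>\<theta>. step_character \<theta> ^ m * character \<theta> (- x) \<partial>torus)" for x :: "int ^ 'd::finite"
proof -
  interpret S: prob_space "srw_steps :: (nat \<Rightarrow> int ^ 'd) measure" by (rule prob_space_srw_steps)
  interpret T: prob_space "torus :: ('d \<Rightarrow> real) measure" by (rule prob_space_torus)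
  interpret pair_sigma_finite "srw_steps :: (nat \<Rightarrow> int ^ 'd) measure" "torus :: ('d \<Rightarrow> real) measure" by unfold_locales
  interpret P: prob_space "(srw_steps :: (nat \<Rightarrow> int ^ 'd) measure) \<Otimes>\<^sub>M (torus :: ('d \<Rightarrow> real) measure)"
    by (intro prob_space_pair S.prob_space_axioms T.prob_space_axioms)
  let ?W = "\<lambda>\<xi>. (\<Sum>k<m. \<xi> k) + (- x)"
  have [measurable]: "{\<xi> \<in> space srw_steps. (\<Sum>k<m. \<xi> k) = x} \<in> sets srw_steps"
    using measurable_sets[OF walk_measurable, of "{x}" m] by (simp add: vimage_def Int_def conj_commute)
  have coord: "(\<lambda>\<xi>. real_of_int (?W \<xi> $ j)) \<in> borel_measurable srw_steps" for j :: 'd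
    by (rule measurable_compose[OF walk_measurable[of m], where g = "\<lambda>y. real_of_int ((y + - x) $ j)"]) simp
  have [measurable]: "(\<lambda>p. real_of_int (?W (fst p) $ j)) \<in> borel_measurable (srw_steps \<Otimes>\<^sub>M (torus :: ('d \<Rightarrow> real) measure))" for j :: 'd
    by (rule measurable_compose[OF measurable_fst coord])
  have [measurable]: "(\<lambda>p. snd p j) \<in> borel_measurable ((srw_steps :: (nat \<Rightarrow> int ^ 'd) measure) \<Otimes>\<^sub>M torus)" for j :: 'd
    by (rule measurable_compose[OF measurable_snd]) (simp add: torus_def)
  have "(\<lambda>p. character (snd p) (?W (fst p))) \<in> borel_measurable (srw_steps \<Otimes>\<^sub>M torus)"
    unfolding character_def by measurable
  then have int: "integrable (srw_steps \<Otimes>\<^sub>M torus) (\<lambda>(\<xi>, \<theta>). character \<theta> (?W \<xi>))"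
    by (intro P.integrable_const_bound[where B = 1]) (simp_all add: case_prod_unfold)
  have "walk_prob m x = (\<integral>\<xi>. indicator {\<xi> \<in> space srw_steps. (\<Sum>k<m. \<xi> k) = x} \<xi> \<partial>srw_steps)"
    by (simp add: walk_prob_def)
  then have "complex_of_real (walk_prob m x)
      = (\<integral>\<xi>. complex_of_real (indicator {\<xi> \<in> space srw_steps. (\<Sum>k<m. \<xi> k) = x} \<xi>) \<partial>srw_steps)"
    by (simp only: integral_complex_of_real)
  also have "\<dots> = (\<integral>\<xi>. (\<integral>\<theta>. character \<theta> (?W \<xi>) \<partial>torus) \<partial>srw_steps)"
    by (intro Bochner_Integration.integral_cong refl) (auto simp: torus_character indicator_def)
  also have "\<dots> = (\<integral>\<theta>. (\<integral>\<xi>. character \<theta> (?W \<xi>) \<partial>srw_steps) \<partial>torus)"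
    by (rule Fubini_integral[OF int, symmetric])
  also have "\<dots> = (\<integral>\<theta>. step_character \<theta> ^ m * character \<theta> (- x) \<partial>torus)"
    unfolding character_add by (simp add: walk_character)
  finally show ?thesis .
qed

lemma walk_prob_le_power:
  fixes x :: "int ^ 'd::finite"
  assumes m: "m > 0"
  shows "walk_prob m x \<le> (\<integral>t. exp (- (real m / (2 * real CARD('d))) * (sin t)\<^sup>2) \<partial>circle) ^ CARD('d)"
proof -
  interpret T: prob_space "torus :: ('d \<Rightarrow> real) measure" by (rule prob_space_torus)
  interpret product_sigma_finite "\<lambda>_::'d. circle" by (rule product_sigma_finite_circle)
  let ?c = "real m / (2 * real CARD('d))"
  let ?f = "\<lambda>t. exp (- ?c * (sin t)\<^sup>2)"
  have fint: "integrable circle ?f"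
    by (rule circle.integrable_const_bound[where B = 1]) auto
  have "walk_prob m x = norm (complex_of_real (walk_prob m x))"
    by (simp add: walk_prob_def)
  also have "\<dots> \<le> (\<integral>\<theta>. (\<Prod>i\<in>UNIV. ?f (\<theta> i)) \<partial>(torus :: ('d \<Rightarrow> real) measure))"
  proof -
    have i1: "integrable torus (\<lambda>\<theta>::'d \<Rightarrow> real. \<Prod>i\<in>UNIV. ?f (\<theta> i))"
      unfolding torus_def by (rule product_integrable_prod) (use fint in simp_all)
    have [measurable]: "(\<lambda>\<theta>::'d \<Rightarrow> real. \<theta> j) \<in> borel_measurable torus" for j by (simp add: torus_def)
    have b: "norm (step_character \<theta> ^ m * character \<theta> (- x)) \<le> (\<Prod>i\<in>UNIV. ?f (\<theta> i))" for \<theta>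
    proof -
      have "norm (step_character \<theta> ^ m * character \<theta> (- x)) = norm (step_character \<theta>) ^ m"
        by (simp add: norm_mult norm_power)
      also have "\<dots> \<le> (\<Prod>i\<in>UNIV. exp (- (1 / (2 * real CARD('d))) * (sin (\<theta> i))\<^sup>2)) ^ m"
        by (intro power_mono norm_step_character_le) auto
      also have "\<dots> = (\<Prod>i\<in>UNIV. ?f (\<theta> i))"
        unfolding prod_power_distrib exp_of_nat_mult[symmetric] by simp
      finally show ?thesis .
    qed
    have me: "(\<lambda>\<theta>. step_character \<theta> ^ m * character \<theta> (- x)) \<in> borel_measurable torus"
      unfolding step_character_eq character_def by measurable
    have i2: "integrable torus (\<lambda>\<theta>. step_character \<theta> ^ m * character \<theta> (- x))"
    proof (rule T.integrable_const_bound[where B = 1, OF AE_I2 me])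
      fix \<theta> :: "'d \<Rightarrow> real"
      have "(\<Prod>i\<in>UNIV. ?f (\<theta> i)) \<le> 1" by (intro prod_le_1) auto
      with b[of \<theta>] show "norm (step_character \<theta> ^ m * character \<theta> (- x)) \<le> 1" by linarith
    qed
    have "norm (complex_of_real (walk_prob m x)) \<le> (\<integral>\<theta>. norm (step_character \<theta> ^ m * character \<theta> (- x)) \<partial>torus)"
      unfolding walk_prob_fourier by (rule integral_norm_bound)
    also have "\<dots> \<le> (\<integral>\<theta>. (\<Prod>i\<in>UNIV. ?f (\<theta> i)) \<partial>(torus :: ('d \<Rightarrow> real) measure))"
      by (intro integral_mono i1 integrable_norm[OF i2] b)
    finally show ?thesis .
  qed
  also have "\<dots> = (\<Prod>i\<in>(UNIV :: 'd set). \<integral>t. ?f t \<partial>circle)"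
    unfolding torus_def by (rule product_integral_prod) (use fint in simp_all)
  finally show ?thesis by simp
qed

section \<open>Decay of the Green's function\<close>

lemma walk_prob_bounds: "0 \<le> walk_prob m x" "walk_prob m x \<le> 1" for x :: "int ^ 'd::finite"
proof -
  interpret prob_space "srw_steps :: (nat \<Rightarrow> int ^ 'd) measure" by (rule prob_space_srw_steps)
  show "0 \<le> walk_prob m x" "walk_prob m x \<le> 1" by (auto simp: walk_prob_def)
qed

text \<open>The bound with exponent \<open>d / 2\<close> is weakened to \<open>3 / 2\<close>, which is summable and covers every dimension at
  least three.\<close>

lemma heat_kernel_bound:
  assumes d: "CARD('d::finite) \<ge> 3"
  shows "\<exists>C>0. \<forall>m. \<forall>x :: int ^ 'd. walk_prob m x \<le> C / (real (m + 1) * sqrt (real (m + 1)))"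
proof -
  define A where "A = 3 * sqrt (2 * real CARD('d))"
  have A: "A > 0" by (simp add: A_def)
  have bound: "walk_prob m x \<le> A ^ 3 / (real m * sqrt (real m))" if m: "m > 0" for m and x :: "int ^ 'd"
  proof -
    define b where "b = (\<integral>t. exp (- (real m / (2 * real CARD('d))) * (sin t)\<^sup>2) \<partial>circle)"
    have b0: "0 \<le> b" unfolding b_def by (intro Bochner_Integration.integral_nonneg) simp
    have b1: "b \<le> 1"
    proof -
      have "b \<le> (\<integral>t. 1 \<partial>circle)" unfolding b_def
        by (intro integral_mono circle.integrable_const_bound[where B = 1]) auto
      then show ?thesis by (simp add: circle.prob_space)
    qed
    have "b \<le> 3 / sqrt (real m / (2 * real CARD('d)))"
      unfolding b_def by (rule circle_gaussian_bound) (use m in simp)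
    then have bA: "b \<le> A / sqrt (real m)" by (simp add: A_def real_sqrt_divide)
    have "walk_prob m x \<le> b ^ CARD('d)" unfolding b_def by (rule walk_prob_le_power[OF m])
    also have "\<dots> \<le> b ^ 3" by (rule power_decreasing[OF d b0 b1])
    also have "\<dots> \<le> (A / sqrt (real m)) ^ 3" by (rule power_mono[OF bA b0])
    also have "\<dots> = A ^ 3 / (real m * sqrt (real m))"
      by (simp add: power_divide power3_eq_cube)
    finally show ?thesis .
  qed
  (* The summand 1 takes care of m = 0; passing from m to m + 1 costs at most a factor 4. *)
  define C where "C = 1 + 4 * A ^ 3"
  have "C > 0" using A by (simp add: C_def add_pos_pos)
  moreover have "walk_prob m x \<le> C / (real (m + 1) * sqrt (real (m + 1)))" for m and x :: "int ^ 'd"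
  proof (cases "m = 0")
    case True
    have "1 \<le> C" using A by (simp add: C_def)
    then show ?thesis using walk_prob_bounds(2)[of m x] True by simp
  next
    case False
    then have m: "m > 0" by simp
    have "real (m + 1) * sqrt (real (m + 1)) \<le> (2 * real m) * sqrt (4 * real m)"
      using m by (intro mult_mono real_sqrt_le_mono) auto
    also have "\<dots> = 4 * (real m * sqrt (real m))" by (simp add: real_sqrt_mult)
    finally have le: "real (m + 1) * sqrt (real (m + 1)) \<le> 4 * (real m * sqrt (real m))" .
    have "walk_prob m x \<le> A ^ 3 / (real m * sqrt (real m))" by (rule bound[OF m])
    also have "\<dots> = 4 * A ^ 3 / (4 * (real m * sqrt (real m)))" by simp
    also have "\<dots> \<le> 4 * A ^ 3 / (real (m + 1) * sqrt (real (m + 1)))"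
      using A m le by (intro divide_left_mono) auto
    also have "\<dots> \<le> C / (real (m + 1) * sqrt (real (m + 1)))"
      using A by (intro divide_right_mono) (auto simp: C_def)
    finally show ?thesis .
  qed
  ultimately show ?thesis by blast
qed

text \<open>A telescoping majorant of \<open>m\<^sup>-\<^sup>3\<^sup>/\<^sup>2\<close>.\<close>

lemma inverse_sqrt_telescope:
  "1 / (real (m + 1) * sqrt (real (m + 1))) \<le> 6 * (1 / sqrt (real (m + 1)) - 1 / sqrt (real (m + 2)))"
proof -
  define a where "a = sqrt (real (m + 1))"
  define b where "b = sqrt (real (m + 2))"
  have a: "a > 0" "a\<^sup>2 = real (m + 1)" and b: "b > 0" "b\<^sup>2 = real (m + 2)" by (auto simp: a_def b_def)
  have ab: "a \<le> b" by (simp add: a_def b_def)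
  have "b\<^sup>2 \<le> (3 / 2 * a)\<^sup>2" using a b by (simp add: power_mult_distrib field_simps)
  then have b32: "b \<le> 3 / 2 * a" by (rule power2_le_imp_le) (use a in simp)
  have "(b - a) * (b + a) = 1" using a b by (simp add: algebra_simps power2_eq_square)
  then have diff: "b - a = 1 / (b + a)" using a b by (simp add: eq_divide_eq)
  have "1 / a - 1 / b = (b - a) / (a * b)" using a b by (simp add: diff_divide_distrib)
  also have "\<dots> = 1 / ((a * b) * (b + a))" by (simp add: diff)
  also have "\<dots> \<ge> 1 / (6 * (a\<^sup>2 * a))"
  proof -
    have "(a * b) * (b + a) \<le> (a * (3 / 2 * a)) * (3 / 2 * a + a)"
      using a b b32 by (intro mult_mono add_mono) auto
    also have "\<dots> \<le> 6 * (a\<^sup>2 * a)" using a by (simp add: power2_eq_square)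
    finally show ?thesis using a b by (intro divide_left_mono) auto
  qed
  finally have "1 / (6 * (a\<^sup>2 * a)) \<le> 1 / a - 1 / b" .
  then have "6 * (1 / (6 * (a\<^sup>2 * a))) \<le> 6 * (1 / a - 1 / b)" by (intro mult_left_mono) simp_all
  moreover have "6 * (1 / (6 * (a\<^sup>2 * a))) = 1 / (a\<^sup>2 * a)" by simp
  ultimately have "1 / (a\<^sup>2 * a) \<le> 6 * (1 / a - 1 / b)" by (simp only:)
  then show ?thesis by (simp add: a_def b_def)
qed

lemma walk_prob_outside:
  fixes x :: "int ^ 'd::finite"
  assumes "m < l1 x"
  shows "walk_prob m x = 0"
proof -
  interpret prob_space "srw_steps :: (nat \<Rightarrow> int ^ 'd) measure" by (rule prob_space_srw_steps)
  have "AE \<xi> in srw_steps. \<xi> k \<in> (lattice_units :: (int ^ 'd) set)" for k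
    unfolding srw_steps_def
    by (rule AE_PiM_component)
       (auto intro!: AE_pmfI measure_pmf.prob_space_axioms simp: finite_lattice_units lattice_units_nonempty)
  then have "AE \<xi> in srw_steps. \<forall>k. \<xi> k \<in> (lattice_units :: (int ^ 'd) set)" by (simp add: AE_all_countable)
  then have "AE \<xi> in srw_steps. \<not> (\<Sum>k<m. \<xi> k) = x"
  proof eventually_elim
    case (elim \<xi>)
    have "l1 (\<Sum>k<j. \<xi> k) \<le> j" for j :: nat
    proof (induction j)
      case (Suc j)
      have "l1 ((\<Sum>k<j. \<xi> k) + \<xi> j) \<le> l1 (\<Sum>k<j. \<xi> k) + l1 (\<xi> j)" by (rule l1_triangle)
      then show ?case using Suc elim l1_unit[of "\<xi> j"] by simp
    qed (simp add: l1_def)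
    from this[of m] show ?case using assms by auto
  qed
  then show ?thesis unfolding walk_prob_def by (rule prob_eq_0_AE)
qed

lemma green_eq_suminf:
  fixes \<alpha> \<beta> :: "int ^ 'd::finite"
  shows "green \<alpha> \<beta> = enn2real (\<Sum>m. ennreal (walk_prob m (\<beta> - \<alpha>)))"
proof -
  interpret prob_space "srw_steps :: (nat \<Rightarrow> int ^ 'd) measure" by (rule prob_space_srw_steps)
  have ev: "{\<xi> \<in> space srw_steps. (\<Sum>k<m. \<xi> k) = x} \<in> sets srw_steps" for m :: nat and x :: "int ^ 'd"
    using measurable_sets[OF walk_measurable, of "{x}" m] by (simp add: vimage_def Int_def conj_commute)
  have eq: "indicator {\<beta>} (srw \<alpha> m \<xi>) = (indicator {\<xi> \<in> space srw_steps. (\<Sum>k<m. \<xi> k) = \<beta> - \<alpha>} \<xi> :: ennreal)"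
    if "\<xi> \<in> space srw_steps" for m \<xi>
    using that by (auto simp: srw_def indicator_def algebra_simps)
  have "(\<integral>\<^sup>+ \<xi>. (\<Sum>m. indicator {\<beta>} (srw \<alpha> m \<xi>)) \<partial>srw_steps)
      = (\<integral>\<^sup>+ \<xi>. (\<Sum>m. indicator {\<xi> \<in> space srw_steps. (\<Sum>k<m. \<xi> k) = \<beta> - \<alpha>} \<xi>) \<partial>srw_steps)"
    by (intro nn_integral_cong suminf_cong eq)
  also have "\<dots> = (\<Sum>m. \<integral>\<^sup>+ \<xi>. indicator {\<xi> \<in> space srw_steps. (\<Sum>k<m. \<xi> k) = \<beta> - \<alpha>} \<xi> \<partial>srw_steps)"
    using ev by (intro nn_integral_suminf) auto
  also have "\<dots> = (\<Sum>m. ennreal (walk_prob m (\<beta> - \<alpha>)))"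
    using ev by (simp add: walk_prob_def emeasure_eq_measure)
  finally show ?thesis by (simp add: green_def)
qed

lemma green_translate: "green \<alpha> \<beta> = green 0 (\<beta> - \<alpha>)"
  by (simp add: green_eq_suminf)

text \<open>The true order is \<open>\<bar>x\<bar>\<^sup>2\<^sup>-\<^sup>d\<close>.  This weaker bound is enough below, where distances are powers of
  \<open>n\<close> and covariances only have to beat logarithms; it follows from the decay of the transition probabilities
  and the fact that the walk needs at least \<open>l1 (\<beta> - \<alpha>)\<close> steps.\<close>

lemma green_decay_summable:
  assumes d: "CARD('d::finite) \<ge> 3"
  shows "\<exists>C>0. \<forall>\<alpha> \<beta> :: int ^ 'd. green \<alpha> \<beta> \<le> C / sqrt (1 + real (l1 (\<beta> - \<alpha>))) \<and>
    (\<Sum>m. ennreal (walk_prob m (\<beta> - \<alpha>))) < \<infinity>"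
proof -
  obtain C where C: "C > 0" "\<And>m (x :: int ^ 'd). walk_prob m x \<le> C / (real (m + 1) * sqrt (real (m + 1)))"
    using heat_kernel_bound[OF d] by blast
  define a where "a m = 1 / sqrt (real (m + 1))" for m :: nat
  have a_anti: "a (Suc m) \<le> a m" for m unfolding a_def by (intro divide_left_mono) auto
  have a0: "a m \<ge> 0" for m by (simp add: a_def)
  (* The terms with m < l1 x vanish, and the sum telescopes from l1 x on. *)
  have bound: "(\<Sum>m<n. walk_prob m x) \<le> 6 * C * (a (l1 x) - a (max n (l1 x)))" for n and x :: "int ^ 'd"
  proof (induction n)
    case (Suc n)
    show ?case
    proof (cases "n < l1 x")
      case True
      then show ?thesis using Suc walk_prob_outside[OF True] by (simp add: max_def)
    next
      case False
      have "walk_prob n x \<le> C * (1 / (real (n + 1) * sqrt (real (n + 1))))" using C(2)[of n x] by simp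
      also have "\<dots> \<le> C * (6 * (a n - a (Suc n)))"
        unfolding a_def using inverse_sqrt_telescope[of n] C(1) by (intro mult_left_mono) auto
      finally show ?thesis using Suc False by (simp add: max_def algebra_simps)
    qed
  qed simp
  have le: "(\<Sum>m. ennreal (walk_prob m x)) \<le> ennreal (6 * C * a (l1 x))" for x :: "int ^ 'd"
  proof (rule suminf_le_const)
    fix n
    have "(\<Sum>m<n. ennreal (walk_prob m x)) = ennreal (\<Sum>m<n. walk_prob m x)"
      by (rule sum_ennreal) (rule walk_prob_bounds)
    also have "(\<Sum>m<n. walk_prob m x) \<le> 6 * C * a (l1 x)"
    proof (rule order_trans[OF bound])
      show "6 * C * (a (l1 x) - a (max n (l1 x))) \<le> 6 * C * a (l1 x)"
        using C a0[of "max n (l1 x)"] by (intro mult_left_mono) auto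
    qed
    finally show "(\<Sum>m<n. ennreal (walk_prob m x)) \<le> ennreal (6 * C * a (l1 x))" by (simp add: ennreal_leI)
  qed auto
  have "green \<alpha> \<beta> \<le> 6 * C / sqrt (1 + real (l1 (\<beta> - \<alpha>)))" for \<alpha> \<beta> :: "int ^ 'd"
  proof -
    have "green \<alpha> \<beta> \<le> enn2real (ennreal (6 * C * a (l1 (\<beta> - \<alpha>))))"
      unfolding green_eq_suminf by (intro enn2real_mono le) auto
    then show ?thesis using C a0 by (simp add: a_def add.commute)
  qed
  moreover have "(\<Sum>m. ennreal (walk_prob m x)) < \<infinity>" for x :: "int ^ 'd"
    by (rule le_less_trans[OF le]) simp
  ultimately show ?thesis using C(1) by (intro exI[of _ "6 * C"]) auto
qed

lemma green_decay:
  assumes "CARD('d::finite) \<ge> 3"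
  shows "\<exists>C>0. \<forall>\<alpha> \<beta> :: int ^ 'd. green \<alpha> \<beta> \<le> C / sqrt (1 + real (l1 (\<beta> - \<alpha>)))"
  using green_decay_summable[OF assms] by blast

lemma green_nonneg: "0 \<le> green \<alpha> \<beta>"
  by (simp add: green_def)

lemma green_0_pos:
  assumes "CARD('d::finite) \<ge> 3"
  shows "0 < green 0 (0 :: int ^ 'd)"
proof -
  interpret prob_space "srw_steps :: (nat \<Rightarrow> int ^ 'd) measure" by (rule prob_space_srw_steps)
  have "walk_prob 0 (0 :: int ^ 'd) = 1" by (simp add: walk_prob_def prob_space)
  moreover have "(\<Sum>m<1. ennreal (walk_prob m (0 :: int ^ 'd))) \<le> (\<Sum>m. ennreal (walk_prob m (0 :: int ^ 'd)))"
    by (rule sum_le_suminf) auto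
  ultimately have "1 \<le> (\<Sum>m. ennreal (walk_prob m (0 :: int ^ 'd)))" by simp
  then have "0 < (\<Sum>m. ennreal (walk_prob m (0 :: int ^ 'd)))"
    by (rule less_le_trans[OF zero_less_one])
  moreover have "(\<Sum>m. ennreal (walk_prob m (0 - 0 :: int ^ 'd))) < \<infinity>"
    using green_decay_summable[OF assms] by blast
  ultimately show ?thesis
    unfolding green_eq_suminf by (simp add: enn2real_positive_iff)
qed

section \<open>Correlations of the field in transient dimensions\<close>

lemma finite_card_vec_box:
  fixes A :: "'d::finite \<Rightarrow> int set"
  assumes "\<And>i. finite (A i)"
  shows "finite {x :: int ^ 'd. \<forall>i. x $ i \<in> A i}" and "card {x :: int ^ 'd. \<forall>i. x $ i \<in> A i} = (\<Prod>i\<in>UNIV. card (A i))"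
proof -
  have bij: "bij_betw vec_nth {x :: int ^ 'd. \<forall>i. x $ i \<in> A i} (Pi\<^sub>E UNIV A)"
  proof (rule bij_betwI[where g = vec_lambda])
  qed auto
  have fin: "finite (Pi\<^sub>E UNIV A)" using assms by (intro finite_PiE) auto
  show "finite {x :: int ^ 'd. \<forall>i. x $ i \<in> A i}"
    using bij_betw_finite[OF bij] fin by blast
  show "card {x :: int ^ 'd. \<forall>i. x $ i \<in> A i} = (\<Prod>i\<in>UNIV. card (A i))"
    using bij_betw_same_card[OF bij] by (simp add: card_PiE)
qed

lemma l1_component_le: "\<bar>x $ i\<bar> \<le> int (l1 x)"
proof -
  have "nat \<bar>x $ i\<bar> \<le> l1 x" unfolding l1_def by (rule member_le_sum) auto
  then show ?thesis by linarith
qed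

lemma finite_l1_ball: "finite {x :: int ^ 'd::finite. l1 (x - y) \<le> R}"
  and card_l1_ball: "card {x :: int ^ 'd. l1 (x - y) \<le> R} \<le> (2 * R + 1) ^ CARD('d)"
proof -
  let ?A = "\<lambda>i. {y $ i - int R..y $ i + int R}"
  have sub: "{x :: int ^ 'd. l1 (x - y) \<le> R} \<subseteq> {x. \<forall>i. x $ i \<in> ?A i}"
  proof (intro subsetI CollectI allI)
    fix x i assume "x \<in> {x :: int ^ 'd. l1 (x - y) \<le> R}"
    then have "\<bar>(x - y) $ i\<bar> \<le> int R" using l1_component_le[of "x - y" i] by simp
    then show "x $ i \<in> ?A i" by auto
  qed
  have fin: "finite {x :: int ^ 'd. \<forall>i. x $ i \<in> ?A i}" by (rule finite_card_vec_box) simp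
  show "finite {x :: int ^ 'd. l1 (x - y) \<le> R}" by (rule finite_subset[OF sub fin])
  have "card {x :: int ^ 'd. l1 (x - y) \<le> R} \<le> card {x :: int ^ 'd. \<forall>i. x $ i \<in> ?A i}"
    by (rule card_mono[OF fin sub])
  also have "\<dots> = (\<Prod>i\<in>(UNIV :: 'd set). 2 * R + 1)"
  proof -
    have "nat (2 * int R + 1) = 2 * R + 1" by arith
    then have "card (?A i) = 2 * R + 1" for i by (simp add: algebra_simps)
    then show ?thesis by (subst finite_card_vec_box) simp_all
  qed
  finally show "card {x :: int ^ 'd. l1 (x - y) \<le> R} \<le> (2 * R + 1) ^ CARD('d)" by simp
qed

lemma finite_lattice_box: "finite (lattice_box n :: (int ^ 'd::finite) set)"
  and card_lattice_box: "card (lattice_box n :: (int ^ 'd) set) = n ^ CARD('d)"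
proof -
  have eq: "(lattice_box n :: (int ^ 'd) set) = {x. \<forall>i. x $ i \<in> {0..int n - 1}}"
    by (auto simp: lattice_box_def)
  show "finite (lattice_box n :: (int ^ 'd) set)" unfolding eq by (rule finite_card_vec_box) simp
  show "card (lattice_box n :: (int ^ 'd) set) = n ^ CARD('d)"
    unfolding eq by (subst finite_card_vec_box) auto
qed

text \<open>Dimension at least three makes the walk transient and the Green's function finite.\<close>

locale transient_gff = gff M \<phi> for M :: "'w measure" and \<phi> :: "int ^ 'd::finite \<Rightarrow> 'w \<Rightarrow> real" +
  assumes dim: "CARD('d) \<ge> 3"
begin

text \<open>The common variance \<open>g(0)\<close> of the field at all sites.\<close>

definition v :: real where "v = green (0 :: int ^ 'd) 0"

lemma v_pos: "v > 0"
  unfolding v_def by (rule green_0_pos[OF dim])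

lemma green_diag [simp]: "green \<alpha> \<alpha> = v" for \<alpha> :: "int ^ 'd"
  using green_translate[of \<alpha> \<alpha>] by (simp add: v_def)

lemma quad_pair: "\<alpha> \<noteq> \<beta> \<Longrightarrow> quad c {\<alpha>, \<beta>} = (c \<alpha>)\<^sup>2 * v + (c \<beta>)\<^sup>2 * v + 2 * c \<alpha> * c \<beta> * green \<alpha> \<beta>"
  by (simp add: quad_def power2_eq_square green_commute[of \<beta> \<alpha>] algebra_simps)

lemma green_le_v: "green \<alpha> \<beta> \<le> v" for \<alpha> \<beta> :: "int ^ 'd"
proof (cases "\<alpha> = \<beta>")
  case False
  then show ?thesis using quad_nonneg[of "\<lambda>x. if x = \<alpha> then 1 else -1" "{\<alpha>, \<beta>}"] by (simp add: quad_pair)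
qed simp

text \<open>If the correlation with a site \<open>x \<noteq> 0\<close> were one, the fields at \<open>0, x, 2x, \<dots>\<close> would coincide almost surely,
  and the covariance could not decay along this sequence.\<close>

lemma green_less_v:
  fixes x :: "int ^ 'd"
  assumes x: "x \<noteq> 0"
  shows "green 0 x < v"
proof (rule ccontr)
  assume "\<not> green 0 x < v"
  then have gx: "green 0 x = v" using green_le_v[of 0 x] by simp
  define y :: "nat \<Rightarrow> int ^ 'd" where "y k = (\<chi> i. int k * x $ i)" for k
  have ydiff: "y (Suc k) - y k = x" for k by (simp add: y_def vec_eq_iff algebra_simps)
  have "AE \<omega> in M. \<phi> (y (Suc k)) \<omega> = \<phi> (y k) \<omega>" for k
  proof -
    have ne: "y k \<noteq> y (Suc k)" using ydiff[of k] x by auto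
    let ?c = "\<lambda>a. if a = y k then 1 else -1 :: real"
    have "green (y k) (y (Suc k)) = v" using green_translate[of "y k" "y (Suc k)"] ydiff gx by simp
    then have "quad ?c {y k, y (Suc k)} = 0" using ne by (simp add: quad_pair)
    then have "AE \<omega> in M. lin ?c {y k, y (Suc k)} \<omega> = 0"
      by (cases rule: lin_cases[of "{y k, y (Suc k)}" ?c, OF finite.insertI[OF finite.insertI[OF finite.emptyI]]]) auto
    then show ?thesis by eventually_elim (use ne in \<open>simp add: lin_def\<close>)
  qed
  then have "AE \<omega> in M. \<forall>k. \<phi> (y (Suc k)) \<omega> = \<phi> (y k) \<omega>" by (simp add: AE_all_countable)
  then have "AE \<omega> in M. \<forall>k. \<phi> (y k) \<omega> = \<phi> (y 0) \<omega>"
  proof eventually_elim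
    case (elim \<omega>)
    show ?case
    proof
      fix k show "\<phi> (y k) \<omega> = \<phi> (y 0) \<omega>" by (induction k) (use elim in auto)
    qed
  qed
  then have yk: "green (y 0) (y k) = v" for k
    unfolding covariance[symmetric] green_diag[of "y 0", symmetric]
    by (intro integral_cong_AE) (auto elim!: eventually_mono)
  obtain C where C: "C > 0" "\<And>\<alpha> \<beta> :: int ^ 'd. green \<alpha> \<beta> \<le> C / sqrt (1 + real (l1 (\<beta> - \<alpha>)))"
    using green_decay[OF dim] by blast
  have l1y: "l1 (y k - y 0) \<ge> k" for k
  proof -
    have "l1 (y k - y 0) = (\<Sum>i\<in>UNIV. k * nat \<bar>x $ i\<bar>)"
      unfolding l1_def by (intro sum.cong) (auto simp: y_def abs_mult nat_mult_distrib)
    then have "l1 (y k - y 0) = k * l1 x" by (simp add: l1_def sum_distrib_left)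
    moreover have "l1 x \<ge> 1" using x l1_eq_0_iff[of x] by linarith
    ultimately show ?thesis by simp
  qed
  obtain k :: nat where k: "(C / v)\<^sup>2 < real k" using reals_Archimedean2 by blast
  have kpos: "0 < real k" using k zero_le_power2[of "C / v"] by linarith
  have "v \<le> C / sqrt (1 + real (l1 (y k - y 0)))" using C(2)[of "y 0" "y k"] yk by simp
  also have "\<dots> \<le> C / sqrt (real k)"
    using C(1) l1y[of k] kpos by (intro divide_left_mono real_sqrt_le_mono) (auto intro!: mult_pos_pos)
  also have "\<dots> < v"
  proof -
    have "C / v < sqrt (real k)" by (rule real_less_rsqrt[OF k])
    moreover have "sqrt (real k) > 0" using kpos by simp
    ultimately show ?thesis using v_pos by (simp add: field_simps)
  qed
  finally show False by simp
qed

text \<open>Far away the correlation is at most one half by \<open>green_decay\<close>; only finitely many translates remain, to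
  which \<open>green_less_v\<close> applies.\<close>

lemma correlation_gap: "\<exists>\<rho>\<ge>0. \<rho> < 1 \<and> (\<forall>\<alpha> \<beta> :: int ^ 'd. \<alpha> \<noteq> \<beta> \<longrightarrow> green \<alpha> \<beta> \<le> \<rho> * v)"
proof -
  obtain C where C: "C > 0" "\<And>\<alpha> \<beta> :: int ^ 'd. green \<alpha> \<beta> \<le> C / sqrt (1 + real (l1 (\<beta> - \<alpha>)))"
    using green_decay[OF dim] by blast
  obtain R :: nat where R: "(2 * C / v)\<^sup>2 < real R" using reals_Archimedean2 by blast
  (* One half covers all far sites, the image covers the near ones. *)
  define F where "F = insert (1 / 2) ((\<lambda>x. green 0 x / v) ` ({x :: int ^ 'd. l1 (x - 0) \<le> R} - {0}))"
  have finF: "finite F" unfolding F_def using finite_l1_ball[of "0 :: int ^ 'd" R] by simp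
  have F1: "\<forall>a\<in>F. a < 1" using green_less_v v_pos by (auto simp: F_def)
  define \<rho> where "\<rho> = Max F"
  have "\<rho> < 1" unfolding \<rho>_def using finF F1 by (subst Max_less_iff) (auto simp: F_def)
  have half: "1 / 2 \<le> \<rho>" unfolding \<rho>_def using finF by (intro Max_ge) (auto simp: F_def)
  have "green \<alpha> \<beta> \<le> \<rho> * v" if "\<alpha> \<noteq> \<beta>" for \<alpha> \<beta> :: "int ^ 'd"
  proof (cases "l1 (\<beta> - \<alpha>) \<le> R")
    case True
    then have "green 0 (\<beta> - \<alpha>) / v \<in> F" using that by (auto simp: F_def)
    then have "green 0 (\<beta> - \<alpha>) / v \<le> \<rho>" unfolding \<rho>_def using finF by (intro Max_ge)
    then show ?thesis using v_pos green_translate[of \<alpha> \<beta>] by (simp add: field_simps)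
  next
    case False
    then have lt: "(2 * C / v)\<^sup>2 < 1 + real (l1 (\<beta> - \<alpha>))" using R by linarith
    have "2 * C / v < sqrt (1 + real (l1 (\<beta> - \<alpha>)))" by (rule real_less_rsqrt[OF lt])
    then have "2 * C < v * sqrt (1 + real (l1 (\<beta> - \<alpha>)))" using v_pos by (simp add: pos_divide_less_eq mult.commute)
    then have "C / sqrt (1 + real (l1 (\<beta> - \<alpha>))) \<le> 1 / 2 * v"
      by (simp add: pos_divide_le_eq add_pos_nonneg)
    also have "\<dots> \<le> \<rho> * v" using half v_pos by (intro mult_right_mono) auto
    finally show ?thesis using C(2)[of \<alpha> \<beta>] by linarith
  qed
  then show ?thesis using half \<open>\<rho> < 1\<close> by (intro exI[of _ \<rho>]) auto
qed

text \<open>Existence is by elimination of one site at a time: \<open>a\<close> regresses \<open>\<alpha>\<close> and \<open>b\<close> regresses the new site \<open>\<kappa>\<close>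
  on the old ones, and the residual variance \<open>r\<close> of \<open>\<kappa>\<close> is positive.  The bound on the coefficients comes from diagonal
  dominance of the covariance matrix, read off from the equation at the largest coefficient.\<close>

lemma regression_coefficients:
  fixes K :: "(int ^ 'd) set"
  assumes fin: "finite K" and \<epsilon>: "\<epsilon> \<ge> 0" "real (card K) * \<epsilon> \<le> v / 2" "\<epsilon> \<le> v / 2"
    and off: "\<And>\<beta> \<gamma>. \<beta> \<in> insert \<alpha> K \<Longrightarrow> \<gamma> \<in> insert \<alpha> K \<Longrightarrow> \<beta> \<noteq> \<gamma> \<Longrightarrow> green \<beta> \<gamma> \<le> \<epsilon>"
    and \<alpha>: "\<alpha> \<notin> K"
  shows "\<exists>c. (\<forall>\<beta>\<in>K. (\<Sum>\<gamma>\<in>K. c \<gamma> * green \<gamma> \<beta>) = green \<alpha> \<beta>) \<and> (\<forall>\<gamma>\<in>K. \<bar>c \<gamma>\<bar> \<le> 2 * \<epsilon> / v)"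
  using assms
proof (induction K arbitrary: \<alpha> rule: finite_induct)
  case (insert \<kappa> K)
  have cardK: "real (card K) * \<epsilon> \<le> v / 2"
  proof -
    have "real (card K) * \<epsilon> \<le> real (card (insert \<kappa> K)) * \<epsilon>"
      using insert.hyps insert.prems(1) by (intro mult_right_mono) auto
    then show ?thesis using insert.prems(2) by linarith
  qed
  obtain a where a: "\<And>\<beta>. \<beta> \<in> K \<Longrightarrow> (\<Sum>\<gamma>\<in>K. a \<gamma> * green \<gamma> \<beta>) = green \<alpha> \<beta>"
  proof -
    have "\<exists>c. (\<forall>\<beta>\<in>K. (\<Sum>\<gamma>\<in>K. c \<gamma> * green \<gamma> \<beta>) = green \<alpha> \<beta>) \<and> (\<forall>\<gamma>\<in>K. \<bar>c \<gamma>\<bar> \<le> 2 * \<epsilon> / v)"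
    proof (rule insert.IH[OF insert.prems(1) cardK insert.prems(3)])
      show "green \<beta> \<gamma> \<le> \<epsilon>" if "\<beta> \<in> insert \<alpha> K" "\<gamma> \<in> insert \<alpha> K" "\<beta> \<noteq> \<gamma>" for \<beta> \<gamma>
        by (rule insert.prems(4)) (use that in blast)+
      show "\<alpha> \<notin> K" using insert.prems(5) by blast
    qed
    then show ?thesis using that by blast
  qed
  obtain b where b: "\<And>\<beta>. \<beta> \<in> K \<Longrightarrow> (\<Sum>\<gamma>\<in>K. b \<gamma> * green \<gamma> \<beta>) = green \<kappa> \<beta>" "\<And>\<gamma>. \<gamma> \<in> K \<Longrightarrow> \<bar>b \<gamma>\<bar> \<le> 2 * \<epsilon> / v"
  proof -
    have "\<exists>c. (\<forall>\<beta>\<in>K. (\<Sum>\<gamma>\<in>K. c \<gamma> * green \<gamma> \<beta>) = green \<kappa> \<beta>) \<and> (\<forall>\<gamma>\<in>K. \<bar>c \<gamma>\<bar> \<le> 2 * \<epsilon> / v)"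
    proof (rule insert.IH[OF insert.prems(1) cardK insert.prems(3)])
      show "green \<beta> \<gamma> \<le> \<epsilon>" if "\<beta> \<in> insert \<kappa> K" "\<gamma> \<in> insert \<kappa> K" "\<beta> \<noteq> \<gamma>" for \<beta> \<gamma>
        by (rule insert.prems(4)) (use that in blast)+
    qed (rule insert.hyps(2))
    then show ?thesis using that by blast
  qed
  define r where "r = v - (\<Sum>\<gamma>\<in>K. b \<gamma> * green \<gamma> \<kappa>)"
  define t where "t = (green \<alpha> \<kappa> - (\<Sum>\<gamma>\<in>K. a \<gamma> * green \<gamma> \<kappa>)) / r"
  have "(\<Sum>\<gamma>\<in>K. b \<gamma> * green \<gamma> \<kappa>) \<le> (\<Sum>\<gamma>\<in>K. 2 * \<epsilon> / v * \<epsilon>)"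
  proof (rule sum_mono)
    fix \<gamma> assume \<gamma>: "\<gamma> \<in> K"
    have "b \<gamma> * green \<gamma> \<kappa> \<le> \<bar>b \<gamma>\<bar> * green \<gamma> \<kappa>" by (intro mult_right_mono green_nonneg) auto
    also have "\<dots> \<le> 2 * \<epsilon> / v * \<epsilon>"
    proof (intro mult_mono green_nonneg b(2) \<gamma>)
      show "green \<gamma> \<kappa> \<le> \<epsilon>" by (rule insert.prems(4)) (use \<gamma> insert.hyps(2) in auto)
      show "0 \<le> 2 * \<epsilon> / v" using insert.prems(1) v_pos by simp
    qed
    finally show "b \<gamma> * green \<gamma> \<kappa> \<le> 2 * \<epsilon> / v * \<epsilon>" .
  qed
  also have "\<dots> = (real (card K) * \<epsilon>) * (2 * \<epsilon> / v)" by simp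
  also have "\<dots> \<le> v / 2 * (2 * \<epsilon> / v)"
    using cardK insert.prems(1) v_pos by (intro mult_right_mono) auto
  also have "\<dots> \<le> v / 2" using insert.prems(3) v_pos by simp
  finally have r: "r > 0" using v_pos unfolding r_def by linarith
  (* The residual of \<kappa> enters with the coefficient t that removes the covariance with \<kappa>. *)
  define c where "c \<gamma> = (if \<gamma> = \<kappa> then t else a \<gamma> - t * b \<gamma>)" for \<gamma>
  have csum: "(\<Sum>\<gamma>\<in>insert \<kappa> K. c \<gamma> * green \<gamma> \<beta>) = t * green \<kappa> \<beta> + (\<Sum>\<gamma>\<in>K. a \<gamma> * green \<gamma> \<beta>) - t * (\<Sum>\<gamma>\<in>K. b \<gamma> * green \<gamma> \<beta>)" for \<beta>
  proof -
    have "(\<Sum>\<gamma>\<in>K. c \<gamma> * green \<gamma> \<beta>) = (\<Sum>\<gamma>\<in>K. a \<gamma> * green \<gamma> \<beta> - t * (b \<gamma> * green \<gamma> \<beta>))"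
      using insert.hyps by (intro sum.cong) (auto simp: c_def algebra_simps)
    then show ?thesis using insert.hyps by (simp add: c_def sum_subtractf sum_distrib_left)
  qed
  have sys: "(\<Sum>\<gamma>\<in>insert \<kappa> K. c \<gamma> * green \<gamma> \<beta>) = green \<alpha> \<beta>" if "\<beta> \<in> insert \<kappa> K" for \<beta>
  proof (cases "\<beta> = \<kappa>")
    case True
    have "t * v - t * (\<Sum>\<gamma>\<in>K. b \<gamma> * green \<gamma> \<kappa>) = t * r" by (simp add: r_def algebra_simps)
    also have "\<dots> = green \<alpha> \<kappa> - (\<Sum>\<gamma>\<in>K. a \<gamma> * green \<gamma> \<kappa>)" using r by (simp add: t_def)
    finally show ?thesis unfolding csum using True by simp
  next
    case False
    then show ?thesis unfolding csum using that a b(1) by simp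
  qed
  have "\<bar>c \<gamma>\<bar> \<le> 2 * \<epsilon> / v" if "\<gamma> \<in> insert \<kappa> K" for \<gamma>
  proof -
    let ?K = "insert \<kappa> K"
    define m where "m = Max ((\<lambda>\<gamma>. \<bar>c \<gamma>\<bar>) ` ?K)"
    have mge: "\<bar>c \<gamma>\<bar> \<le> m" if "\<gamma> \<in> ?K" for \<gamma>
      unfolding m_def using insert.hyps that by (intro Max_ge) auto
    have "m \<in> (\<lambda>\<gamma>. \<bar>c \<gamma>\<bar>) ` ?K" unfolding m_def using insert.hyps by (intro Max_in) auto
    then obtain \<beta> where \<beta>: "\<beta> \<in> ?K" "\<bar>c \<beta>\<bar> = m" by auto
    have m0: "m \<ge> 0" using \<beta> by linarith
    have "c \<beta> * v = green \<alpha> \<beta> - (\<Sum>\<gamma>\<in>?K - {\<beta>}. c \<gamma> * green \<gamma> \<beta>)"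
      using sys[OF \<beta>(1)] sum.remove[of ?K \<beta> "\<lambda>\<gamma>. c \<gamma> * green \<gamma> \<beta>"] insert.hyps \<beta> by simp
    then have "\<bar>c \<beta> * v\<bar> \<le> \<bar>green \<alpha> \<beta>\<bar> + \<bar>\<Sum>\<gamma>\<in>?K - {\<beta>}. c \<gamma> * green \<gamma> \<beta>\<bar>" by linarith
    also have "\<bar>\<Sum>\<gamma>\<in>?K - {\<beta>}. c \<gamma> * green \<gamma> \<beta>\<bar> \<le> (\<Sum>\<gamma>\<in>?K - {\<beta>}. m * \<epsilon>)"
    proof (rule order_trans[OF sum_abs], rule sum_mono)
      fix \<gamma> assume "\<gamma> \<in> ?K - {\<beta>}"
      then have \<gamma>: "\<gamma> \<in> ?K" "\<gamma> \<noteq> \<beta>" by auto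
      have "green \<gamma> \<beta> \<le> \<epsilon>" by (rule insert.prems(4)) (use \<gamma> \<beta>(1) in auto)
      then show "\<bar>c \<gamma> * green \<gamma> \<beta>\<bar> \<le> m * \<epsilon>"
        unfolding abs_mult using mge[OF \<gamma>(1)] m0 green_nonneg[of \<gamma> \<beta>]
        by (intro mult_mono) simp_all
    qed
    also have "(\<Sum>\<gamma>\<in>?K - {\<beta>}. m * \<epsilon>) \<le> (\<Sum>\<gamma>\<in>?K. m * \<epsilon>)"
      using insert.hyps m0 insert.prems(1) by (intro sum_mono2) auto
    also have "\<dots> = m * (real (card ?K) * \<epsilon>)" by simp
    also have "\<dots> \<le> m * (v / 2)" using insert.prems(2) m0 by (intro mult_left_mono) auto
    also have "\<bar>green \<alpha> \<beta>\<bar> \<le> \<epsilon>"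
    proof -
      have "green \<alpha> \<beta> \<le> \<epsilon>" by (rule insert.prems(4)) (use \<beta>(1) insert.prems(5) in auto)
      then show ?thesis using green_nonneg[of \<alpha> \<beta>] by simp
    qed
    finally have "m * v \<le> \<epsilon> + m * (v / 2)" using v_pos \<beta>(2) by (simp add: abs_mult)
    then have "m \<le> 2 * \<epsilon> / v" using v_pos by (simp add: field_simps)
    then show ?thesis using mge[OF that] by linarith
  qed
  with sys show ?case by blast
qed auto

end

section \<open>Conditioning one site on distant sites\<close>

text \<open>The pair \<open>(z, Some w)\<close> stands for the interval \<open>[z, w)\<close>, and \<open>(z, None)\<close> for \<open>[z, \<infinity>)\<close>, on the height scale.\<close>

type_synonym window = "real \<times> real option"

fun window_weight :: "window \<Rightarrow> real" where
  "window_weight (z, w) = exp (- z) - (case w of None \<Rightarrow> 0 | Some w \<Rightarrow> exp (- w))"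

fun proper_window :: "window \<Rightarrow> bool" where
  "proper_window (z, w) \<longleftrightarrow> (case w of None \<Rightarrow> True | Some w \<Rightarrow> z \<le> w)"

context transient_gff begin

definition vol :: "nat \<Rightarrow> real" where "vol n = real (n ^ CARD('d))"

definition level :: "nat \<Rightarrow> real \<Rightarrow> real" where
  "level n z = centering v (vol n) + scaling v (vol n) * z"

definition window_set :: "nat \<Rightarrow> window \<Rightarrow> real set" where
  "window_set n J = {y. level n (fst J) \<le> y \<and> (case snd J of None \<Rightarrow> True | Some w \<Rightarrow> y < level n w)}"

lemma window_set_simp [simp]:
  "window_set n (z, w) = {y. level n z \<le> y \<and> (case w of None \<Rightarrow> True | Some w \<Rightarrow> y < level n w)}"
  by (simp add: window_set_def)

text \<open>Distinctness is part of the notion, so that a list of sites with a repetition counts as close.\<close>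

definition far :: "real \<Rightarrow> (int ^ 'd) list \<Rightarrow> bool" where
  "far l as \<longleftrightarrow> distinct as \<and> (\<forall>\<alpha>\<in>set as. \<forall>\<beta>\<in>set as. \<alpha> \<noteq> \<beta> \<longrightarrow> l \<le> real (l1 (\<beta> - \<alpha>)))"

lemma vol_at_top: "filterlim vol at_top sequentially"
proof -
  have "filterlim (\<lambda>n. real n) at_top sequentially" by (rule filterlim_real_sequentially)
  then have "filterlim (\<lambda>n. real n ^ CARD('d)) at_top sequentially"
    by (rule filterlim_pow_at_top[rotated]) simp
  then show ?thesis by (simp add: vol_def[abs_def])
qed

lemma unit_centering_vol_at_top: "filterlim (\<lambda>n. unit_centering (vol n)) at_top sequentially"
  by (rule filterlim_compose[OF unit_centering_at_top vol_at_top])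

lemma level_eq: "level n z = sqrt v * (unit_centering (vol n) + z / unit_centering (vol n))"
  by (simp add: level_def centering_eq scaling_eq[OF v_pos] algebra_simps)

lemma window_set_measurable [measurable]: "window_set n J \<in> sets borel"
proof (cases J)
  case (Pair z w)
  then show ?thesis by (cases w) auto
qed

text \<open>Neither a vanishing shift of the height nor a change of the standard deviation that is small compared to the
  inverse square of the centering affects the limit.\<close>

lemma scaled_level_tail_tendsto:
  assumes \<delta>: "\<delta> \<longlonglongrightarrow> 0" and \<tau>: "\<And>n. \<tau> n > 0"
    and gap: "(\<lambda>n. (sqrt v / \<tau> n - 1) * (unit_centering (vol n))\<^sup>2) \<longlonglongrightarrow> 0"
  shows "(\<lambda>n. vol n * normal_tail (level n (z + \<delta> n) / \<tau> n)) \<longlonglongrightarrow> exp (- z)"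
proof (rule scaled_normal_tail_tendsto[OF vol_at_top])
  let ?d = "\<lambda>n. \<delta> n / unit_centering (vol n) + (sqrt v / \<tau> n - 1) * (unit_centering (vol n) + (z + \<delta> n) / unit_centering (vol n))"
  have pos: "\<forall>\<^sub>F n in sequentially. unit_centering (vol n) > 1"
    using filterlim_at_top_dense[THEN iffD1, OF unit_centering_vol_at_top, rule_format, of 1] .
  have g0: "(\<lambda>n. sqrt v / \<tau> n - 1) \<longlonglongrightarrow> 0"
  proof (rule Lim_null_comparison[OF _ tendsto_rabs_zero[OF gap]])
    show "\<forall>\<^sub>F n in sequentially. norm (sqrt v / \<tau> n - 1) \<le> \<bar>(sqrt v / \<tau> n - 1) * (unit_centering (vol n))\<^sup>2\<bar>"
      using pos
    proof eventually_elim
      case (elim n)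
      have "1 \<le> (unit_centering (vol n))\<^sup>2" using elim by (simp add: one_le_power)
      then have "\<bar>sqrt v / \<tau> n - 1\<bar> * 1 \<le> \<bar>sqrt v / \<tau> n - 1\<bar> * (unit_centering (vol n))\<^sup>2" by (intro mult_left_mono) auto
      then show ?case by (simp add: abs_mult)
    qed
  qed
  have "(\<lambda>n. \<delta> n + ((sqrt v / \<tau> n - 1) * (unit_centering (vol n))\<^sup>2 + (sqrt v / \<tau> n - 1) * (z + \<delta> n))) \<longlonglongrightarrow> 0 + (0 + 0 * (z + 0))"
    by (intro tendsto_intros \<delta> gap g0)
  moreover have "\<forall>\<^sub>F n in sequentially. \<delta> n + ((sqrt v / \<tau> n - 1) * (unit_centering (vol n))\<^sup>2 + (sqrt v / \<tau> n - 1) * (z + \<delta> n)) = ?d n * unit_centering (vol n)"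
    using pos
  proof eventually_elim
    case (elim n)
    then have "?d n * unit_centering (vol n) = \<delta> n + (sqrt v / \<tau> n - 1) * ((unit_centering (vol n) + (z + \<delta> n) / unit_centering (vol n)) * unit_centering (vol n))"
      by (simp add: distrib_right)
    also have "(unit_centering (vol n) + (z + \<delta> n) / unit_centering (vol n)) * unit_centering (vol n) = (unit_centering (vol n))\<^sup>2 + (z + \<delta> n)"
    proof -
      have "(z + \<delta> n) / unit_centering (vol n) * unit_centering (vol n) = z + \<delta> n" using elim by simp
      then show ?thesis by (simp only: distrib_right power2_eq_square)
    qed
    finally show ?case by (simp add: distrib_left)
  qed
  ultimately show "(\<lambda>n. ?d n * unit_centering (vol n)) \<longlonglongrightarrow> 0" by (simp add: filterlim_cong[OF refl refl])
  show "\<forall>\<^sub>F n in sequentially. level n (z + \<delta> n) / \<tau> n = unit_centering (vol n) + z / unit_centering (vol n) + ?d n"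
  proof (rule always_eventually, rule allI)
    fix n
    define g where "g = sqrt v / \<tau> n"
    have "level n (z + \<delta> n) / \<tau> n = g * (unit_centering (vol n) + (z + \<delta> n) / unit_centering (vol n))"
      by (simp add: level_eq g_def)
    also have "\<dots> = (unit_centering (vol n) + (z + \<delta> n) / unit_centering (vol n)) + (g - 1) * (unit_centering (vol n) + (z + \<delta> n) / unit_centering (vol n))"
      by (simp add: left_diff_distrib)
    finally show "level n (z + \<delta> n) / \<tau> n = unit_centering (vol n) + z / unit_centering (vol n) + ?d n"
      by (simp add: g_def add_divide_distrib)
  qed
qed

text \<open>The tail is monotone in the standard deviation \<open>t\<close>, so the two extreme values control all values between
  them.\<close>

lemma level_tail_uniform:
  assumes \<delta>: "\<delta> \<longlonglongrightarrow> 0" and \<tau>: "\<And>n. \<tau> n > 0"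
    and gap: "(\<lambda>n. (sqrt v / \<tau> n - 1) * (unit_centering (vol n))\<^sup>2) \<longlonglongrightarrow> 0" and e: "e > 0"
  shows "\<forall>\<^sub>F n in sequentially. \<forall>t. \<tau> n \<le> t \<and> t \<le> sqrt v \<longrightarrow> \<bar>vol n * normal_tail (level n (z + \<delta> n) / t) - exp (- z)\<bar> < e"
proof -
  have lo: "(\<lambda>n. vol n * normal_tail (level n (z + \<delta> n) / \<tau> n)) \<longlonglongrightarrow> exp (- z)"
    by (rule scaled_level_tail_tendsto[OF \<delta> \<tau> gap])
  have up: "(\<lambda>n. vol n * normal_tail (level n (z + \<delta> n) / sqrt v)) \<longlonglongrightarrow> exp (- z)"
    by (rule scaled_level_tail_tendsto[OF \<delta>, of "\<lambda>_. sqrt v"]) (use v_pos in auto)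
  have d1: "\<forall>\<^sub>F n in sequentially. \<bar>\<delta> n\<bar> < 1"
    using tendstoD[OF \<delta>, of 1] by simp
  have u: "\<forall>\<^sub>F n in sequentially. unit_centering (vol n) > \<bar>z\<bar> + 1"
    using filterlim_at_top_dense[THEN iffD1, OF unit_centering_vol_at_top, rule_format, of "\<bar>z\<bar> + 1"] .
  show ?thesis
    using tendstoD[OF lo e] tendstoD[OF up e] d1 u
  proof eventually_elim
    case (elim n)
    show ?case
    proof (intro allI impI)
      fix t assume t: "\<tau> n \<le> t \<and> t \<le> sqrt v"
      have un: "unit_centering (vol n) > 1" "unit_centering (vol n) > \<bar>z\<bar> + 1" using elim by auto
      have "- (z + \<delta> n) \<le> \<bar>z\<bar> + 1" using elim by auto
      also have "\<dots> \<le> (\<bar>z\<bar> + 1) * unit_centering (vol n)" using un by (simp add: mult_le_cancel_left1)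
      also have "\<dots> \<le> unit_centering (vol n) * unit_centering (vol n)" using un by (intro mult_right_mono) auto
      finally have "0 \<le> unit_centering (vol n) * unit_centering (vol n) + (z + \<delta> n)" by simp
      then have "0 \<le> (unit_centering (vol n) * unit_centering (vol n) + (z + \<delta> n)) / unit_centering (vol n)" using un by simp
      then have "0 \<le> unit_centering (vol n) + (z + \<delta> n) / unit_centering (vol n)" using un by (simp add: add_divide_distrib)
      then have l0: "0 \<le> level n (z + \<delta> n)" unfolding level_eq using v_pos by simp
      have "normal_tail (level n (z + \<delta> n) / \<tau> n) \<le> normal_tail (level n (z + \<delta> n) / t)"
        by (intro normal_tail_antimono divide_left_mono) (use t \<tau>[of n] l0 in \<open>auto intro!: mult_pos_pos\<close>)
      then have a: "vol n * normal_tail (level n (z + \<delta> n) / \<tau> n) \<le> vol n * normal_tail (level n (z + \<delta> n) / t)"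
        by (intro mult_left_mono) (simp_all add: vol_def)
      have "normal_tail (level n (z + \<delta> n) / t) \<le> normal_tail (level n (z + \<delta> n) / sqrt v)"
        by (intro normal_tail_antimono divide_left_mono) (use t \<tau>[of n] l0 v_pos in \<open>auto intro!: mult_pos_pos\<close>)
      then have b: "vol n * normal_tail (level n (z + \<delta> n) / t) \<le> vol n * normal_tail (level n (z + \<delta> n) / sqrt v)"
        by (intro mult_left_mono) (simp_all add: vol_def)
      show "\<bar>vol n * normal_tail (level n (z + \<delta> n) / t) - exp (- z)\<bar> < e"
        using a b elim(1,2) by (simp add: dist_real_def abs_less_iff)
    qed
  qed
qed

definition upper_tail :: "nat \<Rightarrow> real \<Rightarrow> real option \<Rightarrow> real" where
  "upper_tail n t w = (case w of None \<Rightarrow> 0 | Some w \<Rightarrow> normal_tail (level n w / t))"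

lemma lin_window_eq:
  assumes J: "finite J" and q: "quad e J > 0" and le: "proper_window (z, w)" and u: "unit_centering (vol n) > 0"
  shows "prob {\<omega> \<in> space M. lin e J \<omega> \<in> window_set n (z, w)} = normal_tail (level n z / sqrt (quad e J)) - upper_tail n (sqrt (quad e J)) w"
proof (cases w)
  case None
  then show ?thesis using lin_tail_eq[OF J q, of "level n z"] by (simp add: upper_tail_def)
next
  case (Some y)
  have lv: "level n z \<le> level n y"
    unfolding level_eq using le Some u v_pos by (intro mult_left_mono add_left_mono divide_right_mono) auto
  have "{\<omega> \<in> space M. lin e J \<omega> \<in> window_set n (z, w)} = {\<omega> \<in> space M. level n z \<le> lin e J \<omega>} - {\<omega> \<in> space M. level n y \<le> lin e J \<omega>}"
    using Some by auto
  also have "prob \<dots> = prob {\<omega> \<in> space M. level n z \<le> lin e J \<omega>} - prob {\<omega> \<in> space M. level n y \<le> lin e J \<omega>}"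
    by (rule finite_measure_Diff) (use lv in auto)
  finally show ?thesis using Some by (simp add: upper_tail_def lin_tail_eq[OF J q])
qed

text \<open>The lower bound also covers windows that have become improper after both ends were shifted.\<close>

lemma lin_window_lower:
  assumes J: "finite J" and q: "quad e J > 0"
  shows "prob {\<omega> \<in> space M. lin e J \<omega> \<in> window_set n (z, w)} \<ge> normal_tail (level n z / sqrt (quad e J)) - upper_tail n (sqrt (quad e J)) w"
proof (cases w)
  case None
  then show ?thesis using lin_tail_eq[OF J q, of "level n z"] by (simp add: upper_tail_def)
next
  case (Some y)
  let ?A = "{\<omega> \<in> space M. level n z \<le> lin e J \<omega>}" and ?B = "{\<omega> \<in> space M. level n y \<le> lin e J \<omega>}"
  have "prob ?A \<le> prob ({\<omega> \<in> space M. lin e J \<omega> \<in> window_set n (z, w)} \<union> ?B)"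
  proof (intro finite_measure_mono)
    show "?A \<subseteq> {\<omega> \<in> space M. lin e J \<omega> \<in> window_set n (z, w)} \<union> ?B" using Some by auto
    show "{\<omega> \<in> space M. lin e J \<omega> \<in> window_set n (z, w)} \<union> ?B \<in> events" using Some by simp
  qed
  also have "\<dots> \<le> prob {\<omega> \<in> space M. lin e J \<omega> \<in> window_set n (z, w)} + prob ?B"
    by (intro measure_Un_le) (simp_all add: Some)
  finally show ?thesis using Some by (simp add: upper_tail_def lin_tail_eq[OF J q])
qed

lemma phi_abs_tail:
  assumes "T \<ge> 0"
  shows "prob {\<omega> \<in> space M. T < \<bar>\<phi> \<gamma> \<omega>\<bar>} \<le> 2 * exp (- T\<^sup>2 / (2 * v))"
proof -
  have l: "lin (\<lambda>_. s) {\<gamma>} \<omega> = s * \<phi> \<gamma> \<omega>" for s \<omega> by (simp add: lin_def)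
  have q: "quad (\<lambda>_. s) {\<gamma>} = s * s * v" for s by (simp add: quad_def)
  have "prob {\<omega> \<in> space M. T < \<bar>\<phi> \<gamma> \<omega>\<bar>} \<le> prob ({\<omega> \<in> space M. T \<le> lin (\<lambda>_. 1) {\<gamma>} \<omega>} \<union> {\<omega> \<in> space M. T \<le> lin (\<lambda>_. -1) {\<gamma>} \<omega>})"
    by (intro finite_measure_mono) (auto simp: l)
  also have "\<dots> \<le> prob {\<omega> \<in> space M. T \<le> lin (\<lambda>_. 1) {\<gamma>} \<omega>} + prob {\<omega> \<in> space M. T \<le> lin (\<lambda>_. -1) {\<gamma>} \<omega>}"
    by (intro measure_Un_le) auto
  also have "\<dots> \<le> exp (- T\<^sup>2 / (2 * v)) + exp (- T\<^sup>2 / (2 * v))"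
    by (intro add_mono lin_tail_le) (use assms v_pos in \<open>auto simp: q\<close>)
  finally show ?thesis by simp
qed

text \<open>The regression residual \<open>Z\<close> of \<open>\<phi> \<alpha>\<close> on the sites in \<open>K\<close> is independent of them.  Unless some site of
  \<open>K\<close> exceeds \<open>T\<close> in absolute value, which costs at most \<open>err\<close>, the regression term is at most
  \<open>card K * (2 * \<epsilon> / v) * T\<close>; in units of the height scale this is \<open>\<delta>\<close>.  So the event for \<open>\<phi> \<alpha>\<close> lies between events
  for \<open>Z\<close> with ends moved by \<open>\<delta>\<close>.  The standard deviation \<open>t\<close> of \<open>Z\<close> differs little from \<open>sqrt v\<close>.\<close>

lemma conditioned_window:
  fixes K :: "(int ^ 'd) set"
  assumes K: "finite K" and \<alpha>: "\<alpha> \<notin> K"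
    and \<epsilon>: "\<epsilon> \<ge> 0" "real (card K) * \<epsilon> \<le> v / 2" "\<epsilon> \<le> v / 2"
    and off: "\<And>\<beta> \<gamma>. \<beta> \<in> insert \<alpha> K \<Longrightarrow> \<gamma> \<in> insert \<alpha> K \<Longrightarrow> \<beta> \<noteq> \<gamma> \<Longrightarrow> green \<beta> \<gamma> \<le> \<epsilon>"
    and u: "unit_centering (vol n) > 0" and T: "T \<ge> 0" and A [measurable]: "\<And>\<gamma>. A \<gamma> \<in> sets borel"
    and le: "proper_window (z, w)"
  defines "\<delta> \<equiv> real (card K) * (2 * \<epsilon> / v) * T * unit_centering (vol n) / sqrt v"
    and "pE \<equiv> prob {\<omega> \<in> space M. \<forall>\<gamma>\<in>K. \<phi> \<gamma> \<omega> \<in> A \<gamma>}"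
    and "pW \<equiv> prob {\<omega> \<in> space M. \<phi> \<alpha> \<omega> \<in> window_set n (z, w) \<and> (\<forall>\<gamma>\<in>K. \<phi> \<gamma> \<omega> \<in> A \<gamma>)}"
    and "err \<equiv> real (card K) * (2 * exp (- T\<^sup>2 / (2 * v)))"
  shows "\<exists>t. sqrt (v - 2 * real (card K) * \<epsilon>\<^sup>2 / v) \<le> t \<and> t \<le> sqrt v \<and>
     pW \<le> (normal_tail (level n (z - \<delta>) / t) - upper_tail n t (map_option (\<lambda>w. w + \<delta>) w)) * pE + err \<and>
     pW \<ge> (normal_tail (level n (z + \<delta>) / t) - upper_tail n t (map_option (\<lambda>w. w - \<delta>) w)) * pE - err"
proof -
  obtain c where c: "\<And>\<beta>. \<beta> \<in> K \<Longrightarrow> (\<Sum>\<gamma>\<in>K. c \<gamma> * green \<gamma> \<beta>) = green \<alpha> \<beta>" "\<And>\<gamma>. \<gamma> \<in> K \<Longrightarrow> \<bar>c \<gamma>\<bar> \<le> 2 * \<epsilon> / v"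
    using regression_coefficients[OF K \<epsilon> off \<alpha>] by blast
  define J where "J = insert \<alpha> K"
  have J: "finite J" "K \<subseteq> J" using K by (auto simp: J_def)
  define e where "e \<gamma> = (if \<gamma> = \<alpha> then 1 else - c \<gamma>)" for \<gamma>
  have sumJ: "(\<Sum>\<gamma>\<in>J. e \<gamma> * f \<gamma>) = f \<alpha> - (\<Sum>\<gamma>\<in>K. c \<gamma> * f \<gamma>)" for f :: "int ^ 'd \<Rightarrow> real"
  proof -
    have "(\<Sum>\<gamma>\<in>K. e \<gamma> * f \<gamma>) = (\<Sum>\<gamma>\<in>K. - (c \<gamma> * f \<gamma>))"
      by (intro sum.cong) (use \<alpha> in \<open>auto simp: e_def\<close>)
    then show ?thesis using K \<alpha> by (simp add: J_def e_def sum_negf)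
  qed
  have orth: "(\<Sum>\<gamma>\<in>J. e \<gamma> * green \<gamma> \<beta>) = 0" if "\<beta> \<in> K" for \<beta>
    unfolding sumJ using c(1)[OF that] by simp
  have quad: "quad e J = v - (\<Sum>\<gamma>\<in>K. c \<gamma> * green \<gamma> \<alpha>)"
  proof -
    have "quad e J = (\<Sum>\<beta>\<in>J. e \<beta> * (\<Sum>\<gamma>\<in>J. e \<gamma> * green \<gamma> \<beta>))"
      unfolding quad_def by (subst sum.swap) (simp add: sum_distrib_left mult_ac)
    also have "\<dots> = (\<Sum>\<gamma>\<in>J. e \<gamma> * green \<gamma> \<alpha>)"
      unfolding sumJ[of "\<lambda>\<beta>. (\<Sum>\<gamma>\<in>J. e \<gamma> * green \<gamma> \<beta>)"] by (simp add: orth)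
    also have "\<dots> = v - (\<Sum>\<gamma>\<in>K. c \<gamma> * green \<gamma> \<alpha>)" unfolding sumJ by simp
    finally show ?thesis .
  qed
  have cg: "(\<Sum>\<gamma>\<in>K. c \<gamma> * green \<gamma> \<alpha>) \<le> 2 * real (card K) * \<epsilon>\<^sup>2 / v"
  proof -
    have "(\<Sum>\<gamma>\<in>K. c \<gamma> * green \<gamma> \<alpha>) \<le> (\<Sum>\<gamma>\<in>K. 2 * \<epsilon> / v * \<epsilon>)"
    proof (rule sum_mono)
      fix \<gamma> assume \<gamma>: "\<gamma> \<in> K"
      have "green \<gamma> \<alpha> \<le> \<epsilon>" by (rule off) (use \<gamma> \<alpha> in auto)
      moreover have "c \<gamma> * green \<gamma> \<alpha> \<le> \<bar>c \<gamma>\<bar> * green \<gamma> \<alpha>" by (intro mult_right_mono green_nonneg) auto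
      moreover have "\<bar>c \<gamma>\<bar> * green \<gamma> \<alpha> \<le> 2 * \<epsilon> / v * \<epsilon>"
        by (intro mult_mono c(2)[OF \<gamma>] green_nonneg calculation(1)) (use \<epsilon> v_pos in auto)
      ultimately show "c \<gamma> * green \<gamma> \<alpha> \<le> 2 * \<epsilon> / v * \<epsilon>" by linarith
    qed
    then show ?thesis by (simp add: power2_eq_square mult_ac)
  qed
  have small: "2 * real (card K) * \<epsilon>\<^sup>2 / v \<le> v / 2"
  proof -
    have "2 * real (card K) * \<epsilon>\<^sup>2 / v = (real (card K) * \<epsilon>) * (2 * \<epsilon> / v)" by (simp add: power2_eq_square)
    also have "\<dots> \<le> v / 2 * (2 * \<epsilon> / v)" using \<epsilon> v_pos by (intro mult_right_mono) auto
    also have "\<dots> \<le> v / 2" using \<epsilon> v_pos by simp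
    finally show ?thesis .
  qed
  have qpos: "quad e J > 0" using quad cg small v_pos by linarith
  define t where "t = sqrt (quad e J)"
  have quad_le: "quad e J \<le> v"
  proof -
    define e' where "e' \<gamma> = (if \<gamma> = \<alpha> then 0 else c \<gamma>)" for \<gamma>
    have "quad e' J = (\<Sum>\<beta>\<in>J. e' \<beta> * (\<Sum>\<gamma>\<in>J. e' \<gamma> * green \<gamma> \<beta>))"
      unfolding quad_def by (subst sum.swap) (simp add: sum_distrib_left mult_ac)
    also have "\<dots> = (\<Sum>\<beta>\<in>J. e' \<beta> * (\<Sum>\<gamma>\<in>K. c \<gamma> * green \<gamma> \<beta>))"
    proof -
      have "(\<Sum>\<gamma>\<in>J. e' \<gamma> * green \<gamma> \<beta>) = (\<Sum>\<gamma>\<in>K. c \<gamma> * green \<gamma> \<beta>)" for \<beta>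
      proof -
        have "(\<Sum>\<gamma>\<in>K. e' \<gamma> * green \<gamma> \<beta>) = (\<Sum>\<gamma>\<in>K. c \<gamma> * green \<gamma> \<beta>)"
          using \<alpha> by (intro sum.cong) (auto simp: e'_def)
        then show ?thesis using K \<alpha> by (simp add: J_def e'_def)
      qed
      then show ?thesis by simp
    qed
    also have "\<dots> = (\<Sum>\<beta>\<in>K. c \<beta> * green \<beta> \<alpha>)"
    proof -
      have "(\<Sum>\<beta>\<in>K. e' \<beta> * (\<Sum>\<gamma>\<in>K. c \<gamma> * green \<gamma> \<beta>)) = (\<Sum>\<beta>\<in>K. c \<beta> * green \<beta> \<alpha>)"
        using \<alpha> c(1) green_commute[of \<alpha>] by (intro sum.cong) (auto simp: e'_def)
      then show ?thesis using K \<alpha> by (simp add: J_def e'_def)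
    qed
    finally show ?thesis using quad quad_nonneg[of e' J] by simp
  qed
  have t: "sqrt (v - 2 * real (card K) * \<epsilon>\<^sup>2 / v) \<le> t" "t \<le> sqrt v"
    using quad cg quad_le by (auto simp: t_def)
  have \<delta>0: "\<delta> \<ge> 0" unfolding \<delta>_def using \<epsilon> T u v_pos by simp
  have shift: "level n (y + s * \<delta>) = level n y + s * (real (card K) * (2 * \<epsilon> / v) * T)" for y s
  proof -
    have "sqrt v * (s * \<delta> / unit_centering (vol n)) = s * (real (card K) * (2 * \<epsilon> / v) * T)"
      using u v_pos by (simp add: \<delta>_def)
    moreover have "level n (y + s * \<delta>) = level n y + sqrt v * (s * \<delta> / unit_centering (vol n))"
      by (simp add: level_eq add_divide_distrib distrib_left)
    ultimately show ?thesis by simp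
  qed
  define E where "E = {\<omega> \<in> space M. \<forall>\<gamma>\<in>K. \<phi> \<gamma> \<omega> \<in> A \<gamma>}"
  define Bad where "Bad = (\<Union>\<gamma>\<in>K. {\<omega> \<in> space M. T < \<bar>\<phi> \<gamma> \<omega>\<bar>})"
  have [measurable]: "E \<in> events" unfolding E_def using K by measurable
  have ev_Bad: "Bad \<in> events" unfolding Bad_def using K by measurable
  have pBad: "prob Bad \<le> err"
  proof -
    have "prob Bad \<le> (\<Sum>\<gamma>\<in>K. prob {\<omega> \<in> space M. T < \<bar>\<phi> \<gamma> \<omega>\<bar>})"
      unfolding Bad_def by (rule finite_measure_subadditive_finite) (use K in auto)
    also have "\<dots> \<le> (\<Sum>\<gamma>\<in>K. 2 * exp (- T\<^sup>2 / (2 * v)))" by (intro sum_mono phi_abs_tail T)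
    finally show ?thesis by (simp add: err_def)
  qed
  have near: "\<bar>\<phi> \<alpha> \<omega> - lin e J \<omega>\<bar> \<le> real (card K) * (2 * \<epsilon> / v) * T" if "\<omega> \<in> space M - Bad" for \<omega>
  proof -
    have "\<phi> \<alpha> \<omega> - lin e J \<omega> = (\<Sum>\<gamma>\<in>K. c \<gamma> * \<phi> \<gamma> \<omega>)" unfolding lin_def sumJ by simp
    also have "\<bar>\<dots>\<bar> \<le> (\<Sum>\<gamma>\<in>K. 2 * \<epsilon> / v * T)"
    proof (rule order_trans[OF sum_abs], rule sum_mono)
      fix \<gamma> assume \<gamma>: "\<gamma> \<in> K"
      then have "\<bar>\<phi> \<gamma> \<omega>\<bar> \<le> T" using that by (force simp: Bad_def)
      then show "\<bar>c \<gamma> * \<phi> \<gamma> \<omega>\<bar> \<le> 2 * \<epsilon> / v * T"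
        unfolding abs_mult by (intro mult_mono c(2)[OF \<gamma>]) (use \<epsilon> v_pos in auto)
    qed
    finally show ?thesis by simp
  qed
  have indep: "prob {\<omega> \<in> space M. lin e J \<omega> \<in> B \<and> (\<forall>\<gamma>\<in>K. \<phi> \<gamma> \<omega> \<in> A \<gamma>)} = prob {\<omega> \<in> space M. lin e J \<omega> \<in> B} * pE"
    if "B \<in> sets borel" for B
    unfolding pE_def by (rule uncorrelated_imp_indep[OF J orth that A])
  have ev_phi: "{\<omega> \<in> space M. \<phi> \<alpha> \<omega> \<in> window_set n (z, w) \<and> (\<forall>\<gamma>\<in>K. \<phi> \<gamma> \<omega> \<in> A \<gamma>)} \<in> events"
    using K by measurable
  have ev_lin: "{\<omega> \<in> space M. lin e J \<omega> \<in> window_set n W \<and> (\<forall>\<gamma>\<in>K. \<phi> \<gamma> \<omega> \<in> A \<gamma>)} \<in> events" for W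
    using K by measurable
  have up: "pW \<le> (normal_tail (level n (z - \<delta>) / t) - upper_tail n t (map_option (\<lambda>w. w + \<delta>) w)) * pE + err"
  proof -
    let ?W = "(z - \<delta>, map_option (\<lambda>w. w + \<delta>) w)"
    have "pW \<le> prob ({\<omega> \<in> space M. lin e J \<omega> \<in> window_set n ?W \<and> (\<forall>\<gamma>\<in>K. \<phi> \<gamma> \<omega> \<in> A \<gamma>)} \<union> Bad)"
      unfolding pW_def
    proof (intro finite_measure_mono subsetI)
      fix \<omega> assume \<omega>: "\<omega> \<in> {\<omega> \<in> space M. \<phi> \<alpha> \<omega> \<in> window_set n (z, w) \<and> (\<forall>\<gamma>\<in>K. \<phi> \<gamma> \<omega> \<in> A \<gamma>)}"
      show "\<omega> \<in> {\<omega> \<in> space M. lin e J \<omega> \<in> window_set n ?W \<and> (\<forall>\<gamma>\<in>K. \<phi> \<gamma> \<omega> \<in> A \<gamma>)} \<union> Bad"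
      proof (cases "\<omega> \<in> Bad")
        case False
        then have "\<bar>\<phi> \<alpha> \<omega> - lin e J \<omega>\<bar> \<le> real (card K) * (2 * \<epsilon> / v) * T" using near \<omega> by auto
        then show ?thesis using \<omega> shift[of z "-1"] shift[of "the w" 1] by (auto split: option.splits)
      qed simp
    qed (intro sets.Un ev_lin ev_Bad)
    also have "\<dots> \<le> prob {\<omega> \<in> space M. lin e J \<omega> \<in> window_set n ?W \<and> (\<forall>\<gamma>\<in>K. \<phi> \<gamma> \<omega> \<in> A \<gamma>)} + prob Bad"
      by (intro measure_Un_le ev_lin ev_Bad)
    also have "prob {\<omega> \<in> space M. lin e J \<omega> \<in> window_set n ?W \<and> (\<forall>\<gamma>\<in>K. \<phi> \<gamma> \<omega> \<in> A \<gamma>)}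
      = prob {\<omega> \<in> space M. lin e J \<omega> \<in> window_set n ?W} * pE"
      by (rule indep) measurable
    also have "prob {\<omega> \<in> space M. lin e J \<omega> \<in> window_set n ?W}
      = normal_tail (level n (z - \<delta>) / t) - upper_tail n t (map_option (\<lambda>w. w + \<delta>) w)"
      unfolding t_def by (rule lin_window_eq[OF J(1) qpos _ u]) (use le \<delta>0 in \<open>auto split: option.splits\<close>)
    finally show ?thesis using pBad by linarith
  qed
  have lo: "pW \<ge> (normal_tail (level n (z + \<delta>) / t) - upper_tail n t (map_option (\<lambda>w. w - \<delta>) w)) * pE - err"
  proof -
    let ?W = "(z + \<delta>, map_option (\<lambda>w. w - \<delta>) w)"
    have "(normal_tail (level n (z + \<delta>) / t) - upper_tail n t (map_option (\<lambda>w. w - \<delta>) w)) * pE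
      \<le> prob {\<omega> \<in> space M. lin e J \<omega> \<in> window_set n ?W} * pE"
      unfolding t_def by (intro mult_right_mono lin_window_lower[OF J(1) qpos]) (simp add: pE_def)
    also have "\<dots> = prob {\<omega> \<in> space M. lin e J \<omega> \<in> window_set n ?W \<and> (\<forall>\<gamma>\<in>K. \<phi> \<gamma> \<omega> \<in> A \<gamma>)}"
      by (rule indep[symmetric]) measurable
    also have "\<dots> \<le> prob ({\<omega> \<in> space M. \<phi> \<alpha> \<omega> \<in> window_set n (z, w) \<and> (\<forall>\<gamma>\<in>K. \<phi> \<gamma> \<omega> \<in> A \<gamma>)} \<union> Bad)"
    proof (intro finite_measure_mono subsetI)
      fix \<omega> assume \<omega>: "\<omega> \<in> {\<omega> \<in> space M. lin e J \<omega> \<in> window_set n ?W \<and> (\<forall>\<gamma>\<in>K. \<phi> \<gamma> \<omega> \<in> A \<gamma>)}"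
      show "\<omega> \<in> {\<omega> \<in> space M. \<phi> \<alpha> \<omega> \<in> window_set n (z, w) \<and> (\<forall>\<gamma>\<in>K. \<phi> \<gamma> \<omega> \<in> A \<gamma>)} \<union> Bad"
      proof (cases "\<omega> \<in> Bad")
        case False
        then have "\<bar>\<phi> \<alpha> \<omega> - lin e J \<omega>\<bar> \<le> real (card K) * (2 * \<epsilon> / v) * T" using near \<omega> by auto
        then show ?thesis using \<omega> shift[of z 1] shift[of "the w" "-1"] by (auto split: option.splits)
      qed simp
    qed (intro sets.Un ev_phi ev_Bad)
    also have "\<dots> \<le> pW + prob Bad" unfolding pW_def by (intro measure_Un_le ev_phi ev_Bad)
    finally show ?thesis using pBad by linarith
  qed
  show ?thesis using t up lo by blast
qed

end

section \<open>Asymptotic independence at far apart sites\<close>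

text \<open>Used with \<open>x = ln N\<close>: the truncation error is smaller than every power of the volume.\<close>

lemma gaussian_beats_exponential:
  fixes c v :: real
  assumes "v > 0"
  shows "((\<lambda>x. exp (c * x - x\<^sup>2 / (2 * v))) \<longlongrightarrow> 0) at_top"
  using assms by real_asymp

lemma window_weight_nonneg: "proper_window J \<Longrightarrow> 0 \<le> window_weight J"
  by (cases J) (auto split: option.splits)

context transient_gff begin

lemma vol_pos: "n > 0 \<Longrightarrow> vol n > 0"
  by (simp add: vol_def)

text \<open>Turns the condition on a list into a condition on the set of its entries, the form needed to condition on
  them.\<close>

lemma list_all2_distinct_iff:
  assumes "length as = length zs" "distinct as"
  shows "list_all2 P as zs \<longleftrightarrow> (\<forall>\<gamma>\<in>set as. P \<gamma> (the (map_of (zip as zs) \<gamma>)))"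
proof -
  have m: "map_of (zip as zs) (as ! i) = Some (zs ! i)" if "i < length as" for i
    using assms that by (intro map_of_is_SomeI) (auto simp: set_zip)
  have "(\<forall>\<gamma>\<in>set as. P \<gamma> (the (map_of (zip as zs) \<gamma>))) \<longleftrightarrow> (\<forall>i<length as. P (as ! i) (the (map_of (zip as zs) (as ! i))))"
    by (metis in_set_conv_nth)
  also have "\<dots> \<longleftrightarrow> (\<forall>i<length as. P (as ! i) (zs ! i))" by (simp add: m)
  finally show ?thesis using assms(1) by (simp add: list_all2_conv_all_nth)
qed

text \<open>Induction on the list, with \<open>conditioned_window\<close> at the first site and truncation at \<open>T = ln N\<close>.  The hypothesis \<open>lim\<close>
  is exactly what makes the shift \<open>\<delta>\<close> vanish.\<close>

lemma far_factorization:
  assumes dec: "\<And>n \<alpha> \<beta>. l n \<le> real (l1 (\<beta> - \<alpha> :: int ^ 'd)) \<Longrightarrow> green \<alpha> \<beta> \<le> \<epsilon> n"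
    and \<epsilon>0: "\<And>n. 0 \<le> \<epsilon> n"
    and lim: "(\<lambda>n. \<epsilon> n * ln (vol n) * unit_centering (vol n)) \<longlonglongrightarrow> 0"
    and proper: "\<forall>J\<in>set zs. proper_window J"
    and e: "e > 0"
  shows "\<forall>\<^sub>F n in sequentially. \<forall>as. length as = length zs \<and> far (l n) as \<longrightarrow>
    \<bar>vol n ^ length zs * prob {\<omega> \<in> space M. list_all2 (\<lambda>\<alpha> J. \<phi> \<alpha> \<omega> \<in> window_set n J) as zs}
      - prod_list (map window_weight zs)\<bar> < e"
  using proper e
proof (induction zs arbitrary: e)
  case Nil
  then show ?case by (simp add: prob_space)
next
  case (Cons J zs)
  obtain z w where J: "J = (z, w)" by (cases J)
  define k where "k = length zs"
  define \<Lambda> where "\<Lambda> = prod_list (map window_weight zs)"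
  define wt where "wt = window_weight J"
  define ww where "ww = (case w of None \<Rightarrow> 0 | Some w \<Rightarrow> exp (- w))"
  have wt: "wt = exp (- z) - ww" by (simp add: wt_def J ww_def)
  have pr: "proper_window (z, w)" "\<forall>J\<in>set zs. proper_window J" using Cons.prems(1) J by auto
  have wt0: "wt \<ge> 0" unfolding wt_def using Cons.prems(1) by (intro window_weight_nonneg) simp
  have \<Lambda>0: "\<Lambda> \<ge> 0" unfolding \<Lambda>_def 
  proof (rule prod_list_nonneg)
    fix x assume "x \<in> set (map window_weight zs)"
    then obtain J' where "J' \<in> set zs" "x = window_weight J'" unfolding set_map by (elim imageE)
    then show "0 \<le> x" using pr(2) window_weight_nonneg[of J'] by blast
  qed
  define e1 where "e1 = min 1 (e / (wt + \<Lambda> + 3))"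
  have e1: "e1 > 0" "e1 \<le> 1" using Cons.prems(2) wt0 \<Lambda>0 by (auto simp: e1_def)
  have e1e: "e1 * (wt + \<Lambda> + 2) < e"
  proof -
    have "e1 * (wt + \<Lambda> + 2) < e1 * (wt + \<Lambda> + 3)" using e1 by simp
    also have "\<dots> \<le> e / (wt + \<Lambda> + 3) * (wt + \<Lambda> + 3)"
      using wt0 \<Lambda>0 by (intro mult_right_mono) (auto simp: e1_def)
    also have "\<dots> = e" using wt0 \<Lambda>0 by simp
    finally show ?thesis .
  qed
  let ?u = "\<lambda>n. unit_centering (vol n)"
  have ev_u: "\<forall>\<^sub>F n in sequentially. ?u n > 1"
    using filterlim_at_top_dense[THEN iffD1, OF unit_centering_vol_at_top, rule_format, of 1] .
  have lnvol: "filterlim (\<lambda>n. ln (vol n)) at_top sequentially"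
    by (rule filterlim_compose[OF ln_at_top vol_at_top])
  have ev_ln: "\<forall>\<^sub>F n in sequentially. ln (vol n) > 1"
    using filterlim_at_top_dense[THEN iffD1, OF lnvol, rule_format, of 1] .
  have eu: "(\<lambda>n. \<epsilon> n * ?u n) \<longlonglongrightarrow> 0"
  proof (rule Lim_null_comparison[OF _ lim])
    show "\<forall>\<^sub>F n in sequentially. norm (\<epsilon> n * ?u n) \<le> \<epsilon> n * ln (vol n) * ?u n"
      using ev_u ev_ln
    proof eventually_elim
      case (elim n)
      have "\<epsilon> n * 1 * ?u n \<le> \<epsilon> n * ln (vol n) * ?u n"
        using elim \<epsilon>0[of n] by (intro mult_right_mono mult_left_mono) auto
      then show ?case using elim \<epsilon>0[of n] by simp
    qed
  qed
  have e0: "\<epsilon> \<longlonglongrightarrow> 0"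
  proof (rule Lim_null_comparison[OF _ eu])
    show "\<forall>\<^sub>F n in sequentially. norm (\<epsilon> n) \<le> \<epsilon> n * ?u n"
      using ev_u
    proof eventually_elim
      case (elim n)
      have "\<epsilon> n * 1 \<le> \<epsilon> n * ?u n" using elim \<epsilon>0[of n] by (intro mult_left_mono) auto
      then show ?case using \<epsilon>0[of n] by simp
    qed
  qed
  define \<delta> where "\<delta> n = real k * (2 * \<epsilon> n / v) * ln (vol n) * ?u n / sqrt v" for n
  have \<delta>: "\<delta> \<longlonglongrightarrow> 0"
  proof -
    have "(\<lambda>n. (real k * 2 / v / sqrt v) * (\<epsilon> n * ln (vol n) * ?u n)) \<longlonglongrightarrow> (real k * 2 / v / sqrt v) * 0"
      by (intro tendsto_intros lim)
    then show ?thesis by (simp add: \<delta>_def[abs_def] mult_ac)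
  qed
  have \<delta>m: "(\<lambda>n. - \<delta> n) \<longlonglongrightarrow> 0" using tendsto_minus[OF \<delta>] by simp
  (* The maximum with v / 2 keeps the lower bound of the standard deviation positive for all n. *)
  define \<tau> where "\<tau> n = sqrt (max (v / 2) (v - 2 * real k * (\<epsilon> n)\<^sup>2 / v))" for n
  have \<tau>: "\<tau> n > 0" for n using v_pos by (simp add: \<tau>_def less_max_iff_disj)
  have kee: "(\<lambda>n. 2 * real k * (\<epsilon> n)\<^sup>2 / v\<^sup>2) \<longlonglongrightarrow> 2 * real k * 0\<^sup>2 / v\<^sup>2"
    by (intro tendsto_intros e0) (use v_pos in auto)
  then have ev_x: "\<forall>\<^sub>F n in sequentially. 2 * real k * (\<epsilon> n)\<^sup>2 / v\<^sup>2 < 1 / 2"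
    by (intro order_tendstoD(2)[where y = 0]) auto
  have \<tau>_eq: "\<tau> n = sqrt v * sqrt (1 - 2 * real k * (\<epsilon> n)\<^sup>2 / v\<^sup>2)" "\<tau> n = sqrt (v - 2 * real k * (\<epsilon> n)\<^sup>2 / v)"
    if "2 * real k * (\<epsilon> n)\<^sup>2 / v\<^sup>2 < 1 / 2" for n
  proof -
    have eq: "v - 2 * real k * (\<epsilon> n)\<^sup>2 / v = v * (1 - 2 * real k * (\<epsilon> n)\<^sup>2 / v\<^sup>2)"
      using v_pos by (simp add: right_diff_distrib power2_eq_square)
    have "v * (1 / 2) \<le> v * (1 - 2 * real k * (\<epsilon> n)\<^sup>2 / v\<^sup>2)" using that v_pos by (intro mult_left_mono) auto
    then have "max (v / 2) (v - 2 * real k * (\<epsilon> n)\<^sup>2 / v) = v - 2 * real k * (\<epsilon> n)\<^sup>2 / v" unfolding eq by simp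
    then show "\<tau> n = sqrt (v - 2 * real k * (\<epsilon> n)\<^sup>2 / v)" by (simp only: \<tau>_def)
    then show "\<tau> n = sqrt v * sqrt (1 - 2 * real k * (\<epsilon> n)\<^sup>2 / v\<^sup>2)" by (simp only: eq real_sqrt_mult)
  qed
  (* With x = 2 k \<epsilon>^2 / v^2 this is 1 / sqrt (1 - x) - 1 \<le> x for x < 1 / 2. *)
  have gap: "(\<lambda>n. (sqrt v / \<tau> n - 1) * (?u n)\<^sup>2) \<longlonglongrightarrow> 0"
  proof (rule Lim_null_comparison)
    have "(\<lambda>n. 2 * real k / v\<^sup>2 * (\<epsilon> n * ?u n)\<^sup>2) \<longlonglongrightarrow> 2 * real k / v\<^sup>2 * 0\<^sup>2"
      by (intro tendsto_intros eu)
    then show "(\<lambda>n. 2 * real k / v\<^sup>2 * (\<epsilon> n * ?u n)\<^sup>2) \<longlonglongrightarrow> 0" by simp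
    show "\<forall>\<^sub>F n in sequentially. norm ((sqrt v / \<tau> n - 1) * (?u n)\<^sup>2) \<le> 2 * real k / v\<^sup>2 * (\<epsilon> n * ?u n)\<^sup>2"
      using ev_x
    proof eventually_elim
      case (elim n)
      define x where "x = 2 * real k * (\<epsilon> n)\<^sup>2 / v\<^sup>2"
      have x: "0 \<le> x" "x < 1 / 2" using elim by (auto simp: x_def)
      define s where "s = sqrt (1 - x)"
      have s: "0 < s" "s \<le> 1" "s\<^sup>2 = 1 - x" using x by (auto simp: s_def)
      have "sqrt v / \<tau> n = 1 / s" unfolding \<tau>_eq(1)[OF elim] x_def[symmetric] s_def[symmetric] using v_pos by simp
      moreover have "1 / s - 1 \<le> x"
      proof -
        have "x\<^sup>2 \<le> x * (1 / 2)" unfolding power2_eq_square using x by (intro mult_left_mono) auto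
        then have "0 \<le> 1 - x - x\<^sup>2" using x by linarith
        then have "0 \<le> x * (1 - x - x\<^sup>2)" using x by (intro mult_nonneg_nonneg)
        then have "1 \<le> 1 + x * (1 - x - x\<^sup>2)" by linarith
        also have "\<dots> = ((1 + x) * s)\<^sup>2"
          unfolding power_mult_distrib s(3) by (simp add: power2_eq_square algebra_simps)
        finally have "1\<^sup>2 \<le> ((1 + x) * s)\<^sup>2" by simp
        then have "1 \<le> (1 + x) * s" by (rule power2_le_imp_le) (use x s in simp)
        then have "1 / s \<le> 1 + x" using s by (simp add: pos_divide_le_eq)
        then show ?thesis by simp
      qed
      moreover have "0 \<le> 1 / s - 1" using s by simp
      ultimately have "\<bar>sqrt v / \<tau> n - 1\<bar> \<le> x" by simp
      then have "\<bar>sqrt v / \<tau> n - 1\<bar> * (?u n)\<^sup>2 \<le> x * (?u n)\<^sup>2" by (intro mult_right_mono) auto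
      then show ?case by (simp add: abs_mult x_def power_mult_distrib mult_ac)
    qed
  qed
  (* The truncation error survives multiplication by the volume to the power k + 1. *)
  have trunc: "(\<lambda>n. vol n ^ Suc k * (real k * (2 * exp (- (ln (vol n))\<^sup>2 / (2 * v))))) \<longlonglongrightarrow> 0"
  proof -
    have "(\<lambda>n. exp (real (Suc k) * ln (vol n) - (ln (vol n))\<^sup>2 / (2 * v))) \<longlonglongrightarrow> 0"
      by (rule filterlim_compose[OF gaussian_beats_exponential[OF v_pos] lnvol])
    then have "(\<lambda>n. real k * 2 * exp (real (Suc k) * ln (vol n) - (ln (vol n))\<^sup>2 / (2 * v))) \<longlonglongrightarrow> 0"
      by (rule tendsto_mult_right_zero)
    moreover have "\<forall>\<^sub>F n in sequentially. real k * 2 * exp (real (Suc k) * ln (vol n) - (ln (vol n))\<^sup>2 / (2 * v))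
      = vol n ^ Suc k * (real k * (2 * exp (- (ln (vol n))\<^sup>2 / (2 * v))))"
      using eventually_gt_at_top[of 0]
    proof eventually_elim
      case (elim n)
      have "exp (real (Suc k) * ln (vol n)) = vol n ^ Suc k"
        using vol_pos[OF elim] by (simp only: exp_of_nat_mult exp_ln)
      moreover have "exp (real (Suc k) * ln (vol n) - (ln (vol n))\<^sup>2 / (2 * v))
        = exp (real (Suc k) * ln (vol n)) * exp (- (ln (vol n))\<^sup>2 / (2 * v))"
        by (subst exp_add[symmetric]) simp
      ultimately show ?case by (simp only: mult_ac)
    qed
    ultimately show ?thesis by (rule Lim_transform_eventually)
  qed
  have ev_k: "\<forall>\<^sub>F n in sequentially. real k * \<epsilon> n < v / 2"
  proof -
    have "(\<lambda>n. real k * \<epsilon> n) \<longlonglongrightarrow> real k * 0" by (intro tendsto_intros e0)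
    then show ?thesis using v_pos by (intro order_tendstoD(2)[where y = 0]) auto
  qed
  have ev_1: "\<forall>\<^sub>F n in sequentially. \<epsilon> n < v / 2"
    using e0 v_pos by (intro order_tendstoD(2)[where y = 0]) auto
  have ev_w: "\<forall>\<^sub>F n in sequentially. \<forall>t. \<tau> n \<le> t \<and> t \<le> sqrt v \<longrightarrow>
      \<bar>vol n * upper_tail n t (map_option (\<lambda>w. w + d n) w) - ww\<bar> < e1 / 2" if d: "d \<longlonglongrightarrow> 0" for d
  proof (cases w)
    case None
    then show ?thesis using e1 by (simp add: upper_tail_def ww_def)
  next
    case (Some y)
    then show ?thesis using level_tail_uniform[OF d \<tau> gap, of "e1 / 2" y] e1 by (simp add: upper_tail_def ww_def)
  qed
  have e2: "e1 / 2 > 0" using e1 by simp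
  show ?case
    using Cons.IH[OF pr(2) e1(1)] tendstoD[OF trunc e1(1)] ev_k ev_1 ev_x ev_u ev_ln
      level_tail_uniform[OF \<delta> \<tau> gap e2, of z] level_tail_uniform[OF \<delta>m \<tau> gap e2, of z] ev_w[OF \<delta>] ev_w[OF \<delta>m]
      eventually_gt_at_top[of 0]
  proof eventually_elim
    case (elim n)
    note IH = elim(1) and tr = elim(2) and k1 = elim(3) and k2 = elim(4) and x = elim(5) and u = elim(6) and ln1 = elim(7)
      and tp = elim(8) and tm = elim(9) and wp = elim(10) and wm = elim(11) and n0 = elim(12)
    show ?case
    proof (intro allI impI, elim conjE)
      fix bs assume len: "length bs = length (J # zs)" and far: "far (l n) bs"
      then obtain \<alpha> as where bs: "bs = \<alpha> # as" "length as = k" by (cases bs) (auto simp: k_def)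
      have dist: "distinct as" "\<alpha> \<notin> set as" and far': "far (l n) as" using far bs by (auto simp: far_def)
      define K where "K = set as"
      have cK: "card K = k" using dist bs by (simp add: K_def distinct_card)
      define A where "A \<gamma> = window_set n (the (map_of (zip as zs) \<gamma>))" for \<gamma>
      have ev: "list_all2 (\<lambda>\<alpha> J. \<phi> \<alpha> \<omega> \<in> window_set n J) as zs \<longleftrightarrow> (\<forall>\<gamma>\<in>K. \<phi> \<gamma> \<omega> \<in> A \<gamma>)" for \<omega>
        unfolding K_def A_def by (rule list_all2_distinct_iff) (use bs dist in \<open>auto simp: k_def\<close>)
      define pE where "pE = prob {\<omega> \<in> space M. \<forall>\<gamma>\<in>K. \<phi> \<gamma> \<omega> \<in> A \<gamma>}"
      define pW where "pW = prob {\<omega> \<in> space M. \<phi> \<alpha> \<omega> \<in> window_set n (z, w) \<and> (\<forall>\<gamma>\<in>K. \<phi> \<gamma> \<omega> \<in> A \<gamma>)}"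
      define err where "err = real k * (2 * exp (- (ln (vol n))\<^sup>2 / (2 * v)))"
      have off: "green \<beta> \<gamma> \<le> \<epsilon> n" if "\<beta> \<in> insert \<alpha> K" "\<gamma> \<in> insert \<alpha> K" "\<beta> \<noteq> \<gamma>" for \<beta> \<gamma>
        by (rule dec) (use far that in \<open>auto simp: far_def bs K_def\<close>)
      have kv: "real (card K) * \<epsilon> n \<le> v / 2" "\<epsilon> n \<le> v / 2" "unit_centering (vol n) > 0" "ln (vol n) \<ge> 0"
        using k1 k2 cK u ln1 by auto
      obtain t where t: "sqrt (v - 2 * real k * (\<epsilon> n)\<^sup>2 / v) \<le> t" "t \<le> sqrt v"
        "pW \<le> (normal_tail (level n (z - \<delta> n) / t) - upper_tail n t (map_option (\<lambda>w. w + \<delta> n) w)) * pE + err"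
        "pW \<ge> (normal_tail (level n (z + \<delta> n) / t) - upper_tail n t (map_option (\<lambda>w. w - \<delta> n) w)) * pE - err"
        using conditioned_window[where A = A and n = n and z = z and w = w and \<epsilon> = "\<epsilon> n" and T = "ln (vol n)" and K = K and \<alpha> = \<alpha>,
            OF _ _ \<epsilon>0 kv(1,2) off kv(3,4) _ pr(1)] dist
        unfolding cK \<delta>_def[symmetric] pE_def[symmetric] pW_def[symmetric] err_def[symmetric]
        by (auto simp: K_def A_def)
      have tt: "\<tau> n \<le> t \<and> t \<le> sqrt v" using t(1,2) \<tau>_eq(2)[OF x] by simp
      define q where "q = vol n ^ k * pE"
      have q: "\<bar>q - \<Lambda>\<bar> < e1"
      proof -
        have "length as = length zs" using bs(2) by (simp add: k_def)
        with IH far' have "\<bar>vol n ^ length zs * prob {\<omega> \<in> space M. list_all2 (\<lambda>\<alpha> J. \<phi> \<alpha> \<omega> \<in> window_set n J) as zs}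
          - prod_list (map window_weight zs)\<bar> < e1" by blast
        then show ?thesis unfolding ev by (simp only: q_def pE_def \<Lambda>_def k_def)
      qed
      have q0: "q \<ge> 0" by (simp add: q_def pE_def vol_def)
      have V: "vol n \<ge> 0" by (simp add: vol_def)
      define err' where "err' = vol n ^ Suc k * err"
      have err': "\<bar>err'\<bar> < e1" using tr by (simp add: err'_def err_def)
      define p where "p = vol n * (normal_tail (level n (z - \<delta> n) / t) - upper_tail n t (map_option (\<lambda>w. w + \<delta> n) w))"
      have "\<bar>vol n * normal_tail (level n (z + - \<delta> n) / t) - exp (- z)\<bar> < e1 / 2"
        "\<bar>vol n * upper_tail n t (map_option (\<lambda>w. w + \<delta> n) w) - ww\<bar> < e1 / 2"
        using tm wp tt by blast+
      then have p: "p \<le> wt + e1" unfolding p_def wt right_diff_distrib abs_less_iff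
        by (simp only: add_uminus_conv_diff, linarith)
      define p' where "p' = vol n * (normal_tail (level n (z + \<delta> n) / t) - upper_tail n t (map_option (\<lambda>w. w - \<delta> n) w))"
      have "\<bar>vol n * normal_tail (level n (z + \<delta> n) / t) - exp (- z)\<bar> < e1 / 2"
        "\<bar>vol n * upper_tail n t (map_option (\<lambda>w. w + - \<delta> n) w) - ww\<bar> < e1 / 2"
        using tp wm tt by blast+
      then have p': "p' \<ge> wt - e1" unfolding p'_def wt right_diff_distrib abs_less_iff
        by (simp only: add_uminus_conv_diff, linarith)
      have "vol n ^ Suc k * pW \<le> vol n ^ Suc k * ((normal_tail (level n (z - \<delta> n) / t) - upper_tail n t (map_option (\<lambda>w. w + \<delta> n) w)) * pE + err)"
        using t(3) V by (intro mult_left_mono) auto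
      also have "\<dots> = p * q + err'" by (simp add: p_def q_def err'_def algebra_simps)
      also have "\<dots> \<le> (wt + e1) * q + err'" using p q0 by (intro add_right_mono mult_right_mono)
      also have "\<dots> \<le> (wt + e1) * (\<Lambda> + e1) + e1"
        using q err' wt0 e1 by (intro add_mono mult_left_mono) auto
      also have "\<dots> = wt * \<Lambda> + e1 * (wt + \<Lambda> + e1 + 1)" by (simp add: algebra_simps)
      also have "\<dots> \<le> wt * \<Lambda> + e1 * (wt + \<Lambda> + 2)" using e1 by (intro add_left_mono mult_left_mono) auto
      finally have up: "vol n ^ Suc k * pW \<le> wt * \<Lambda> + e1 * (wt + \<Lambda> + 2)" .
      have "wt * \<Lambda> - e1 * (wt + \<Lambda> + 2) \<le> wt * \<Lambda> - e1 * (wt + \<Lambda> + e1 + 1)"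
        using e1 by (intro diff_left_mono mult_left_mono) auto
      also have "\<dots> = wt * (\<Lambda> - e1) - e1 * (\<Lambda> + e1) - e1" by (simp add: algebra_simps)
      also have "\<dots> \<le> wt * q - e1 * q - err'"
        using q err' wt0 e1 by (intro diff_mono mult_left_mono) auto
      also have "\<dots> = (wt - e1) * q - err'" by (simp add: left_diff_distrib)
      also have "\<dots> \<le> p' * q - err'" using p' q0 by (intro diff_right_mono mult_right_mono)
      also have "\<dots> = vol n ^ Suc k * ((normal_tail (level n (z + \<delta> n) / t) - upper_tail n t (map_option (\<lambda>w. w - \<delta> n) w)) * pE - err)"
        by (simp add: p'_def q_def err'_def algebra_simps)
      also have "\<dots> \<le> vol n ^ Suc k * pW" using t(4) V by (intro mult_left_mono) auto
      finally have lo: "wt * \<Lambda> - e1 * (wt + \<Lambda> + 2) \<le> vol n ^ Suc k * pW" .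
      have "\<bar>vol n ^ Suc k * pW - wt * \<Lambda>\<bar> < e" using up lo e1e by (simp add: abs_less_iff)
      moreover have "prob {\<omega> \<in> space M. list_all2 (\<lambda>\<alpha> J. \<phi> \<alpha> \<omega> \<in> window_set n J) bs (J # zs)} = pW"
        unfolding pW_def bs J list_all2_Cons ev ..
      ultimately show "\<bar>vol n ^ length (J # zs) * prob {\<omega> \<in> space M. list_all2 (\<lambda>\<alpha> J. \<phi> \<alpha> \<omega> \<in> window_set n J) bs (J # zs)}
          - prod_list (map window_weight (J # zs))\<bar> < e"
        by (simp add: k_def wt_def \<Lambda>_def)
    qed
  qed
qed

end

section \<open>Exceedances at clustered sites\<close>

lemma separated_subset_exists:
  fixes S :: "(int ^ 'd::finite) set" and l :: real
  assumes "finite S" "l > 0"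
  shows "\<exists>R\<subseteq>S. (\<forall>x\<in>R. \<forall>y\<in>R. x \<noteq> y \<longrightarrow> l \<le> real (l1 (y - x))) \<and> (\<forall>x\<in>S. \<exists>y\<in>R. real (l1 (y - x)) < l)"
  using assms(1)
proof induction
  case (insert a S)
  then obtain R where R: "R \<subseteq> S" "\<forall>x\<in>R. \<forall>y\<in>R. x \<noteq> y \<longrightarrow> l \<le> real (l1 (y - x))" "\<forall>x\<in>S. \<exists>y\<in>R. real (l1 (y - x)) < l"
    by blast
  show ?case
  proof (cases "\<exists>y\<in>R. real (l1 (y - a)) < l")
    case True
    then show ?thesis using R by (intro exI[of _ R]) auto
  next
    case False
    have "\<forall>x\<in>insert a R. \<forall>y\<in>insert a R. x \<noteq> y \<longrightarrow> l \<le> real (l1 (y - x))"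
      using R(2) False l1_diff_commute[of a] by (auto simp: not_less)
    moreover have "\<forall>x\<in>insert a S. \<exists>y\<in>insert a R. real (l1 (y - x)) < l"
      using R(3) assms(2) l1_eq_0_iff[of "a - a"] by auto
    ultimately show ?thesis using R(1) by (intro exI[of _ "insert a R"]) auto
  qed
qed auto

text \<open>Choose the \<open>c\<close> points first; every entry of the list lies in the union of the \<open>c\<close> balls around them.\<close>

lemma card_lists_around_points:
  fixes V :: "(int ^ 'd::finite) set" and l :: real and c k :: nat
  assumes V: "finite V" and l: "l \<ge> 0"
  defines "T \<equiv> {as. set as \<subseteq> V \<and> length as = k \<and> (\<exists>R. R \<subseteq> set as \<and> card R = c \<and> (\<forall>x\<in>set as. \<exists>y\<in>R. real (l1 (y - x)) < l))}"
  shows "finite T" and "real (card T) \<le> real (card V) ^ c * (real c * (2 * l + 1) ^ CARD('d)) ^ k"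
proof -
  define L where "L = nat \<lfloor>l\<rfloor>"
  have L: "real L \<le> l" using l by (simp add: L_def)
  define ball where "ball y = {x :: int ^ 'd. l1 (x - y) \<le> L}" for y
  have finb: "finite (ball y)" for y unfolding ball_def by (rule finite_l1_ball)
  have in_ball: "x \<in> ball y" if "real (l1 (y - x)) < l" for x y
  proof -
    have "l1 (y - x) \<le> L" using that unfolding L_def by linarith
    then show ?thesis by (simp add: ball_def l1_diff_commute[of x y])
  qed
  define B where "B = (2 * L + 1) ^ CARD('d)"
  define P where "P rs = {as. set as \<subseteq> (\<Union>y\<in>set rs. ball y) \<and> length as = k}" for rs
  define RS where "RS = {rs. set rs \<subseteq> V \<and> length rs = c}"
  have finRS: "finite RS" unfolding RS_def by (rule finite_lists_length_eq[OF V])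
  have finP: "finite (P rs)" for rs unfolding P_def by (rule finite_lists_length_eq) (auto intro: finb)
  have sub: "T \<subseteq> (\<Union>rs\<in>RS. P rs)"
  proof
    fix as assume "as \<in> T"
    then obtain R where R: "set as \<subseteq> V" "length as = k" "R \<subseteq> set as" "card R = c" "\<forall>x\<in>set as. \<exists>y\<in>R. real (l1 (y - x)) < l"
      by (auto simp: T_def)
    have "finite R" using R(3) finite_subset by blast
    then obtain rs where rs: "set rs = R" "distinct rs" using finite_distinct_list by blast
    then have "length rs = c" using R(4) distinct_card by metis
    then have "rs \<in> RS" using rs R by (auto simp: RS_def)
    moreover have "as \<in> P rs" unfolding P_def using R(2,5) rs(1) in_ball by blast
    ultimately show "as \<in> (\<Union>rs\<in>RS. P rs)" by blast
  qed
  have finU: "finite (\<Union>rs\<in>RS. P rs)" using finRS finP by auto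
  show "finite T" by (rule finite_subset[OF sub finU])
  have "card (P rs) \<le> (c * B) ^ k" if "rs \<in> RS" for rs
  proof -
    have "card (\<Union>y\<in>set rs. ball y) \<le> (\<Sum>y\<in>set rs. card (ball y))" by (rule card_UN_le) simp
    also have "\<dots> \<le> (\<Sum>y\<in>set rs. B)" unfolding ball_def B_def by (intro sum_mono card_l1_ball)
    also have "\<dots> \<le> c * B" using that card_length[of rs] by (simp add: RS_def)
    finally have "card (\<Union>y\<in>set rs. ball y) ^ k \<le> (c * B) ^ k" by (rule power_mono) simp
    then show ?thesis unfolding P_def by (subst card_lists_length_eq) (auto intro: finb)
  qed
  then have "card (\<Union>rs\<in>RS. P rs) \<le> card RS * (c * B) ^ k"
    using card_UN_le[OF finRS, of P] sum_mono[of RS "\<lambda>rs. card (P rs)" "\<lambda>_. (c * B) ^ k"] by simp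
  also have "card RS = card V ^ c" unfolding RS_def by (rule card_lists_length_eq[OF V])
  finally have "card T \<le> card V ^ c * (c * B) ^ k"
    using card_mono[OF finU sub] by linarith
  then have "real (card T) \<le> real (card V ^ c * (c * B) ^ k)" by (rule of_nat_mono)
  also have "\<dots> = real (card V) ^ c * (real c * real B) ^ k" by simp
  also have "\<dots> \<le> real (card V) ^ c * (real c * (2 * l + 1) ^ CARD('d)) ^ k"
  proof -
    have "real B = (2 * real L + 1) ^ CARD('d)" by (simp add: B_def add.commute)
    also have "\<dots> \<le> (2 * l + 1) ^ CARD('d)" using L by (intro power_mono) auto
    finally show ?thesis by (intro mult_left_mono power_mono) auto
  qed
  finally show "real (card T) \<le> real (card V) ^ c * (real c * (2 * l + 1) ^ CARD('d)) ^ k" .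
qed

context transient_gff begin

text \<open>On the event the weighted sum of the fields with weight \<open>1\<close> on \<open>R\<close> and \<open>\<theta>\<close> on \<open>a\<close> is at least \<open>(c + \<theta>) * u\<close>.
  Its variance is small because at most one site of \<open>R\<close> is within \<open>l / 2\<close> of \<open>a\<close>, so at most one covariance is
  not bounded by \<open>\<epsilon>\<close>, and that one is at most \<open>\<rho> * v\<close>.\<close>

lemma prob_cluster_bound:
  fixes R :: "(int ^ 'd) set"
  assumes R: "finite R" "R \<noteq> {}" and a: "a \<notin> R"
    and sep: "\<forall>x\<in>R. \<forall>y\<in>R. x \<noteq> y \<longrightarrow> l \<le> real (l1 (y - x))"
    and dec: "\<And>\<alpha> \<beta> :: int ^ 'd. l / 2 \<le> real (l1 (\<beta> - \<alpha>)) \<Longrightarrow> green \<alpha> \<beta> \<le> \<epsilon>" and \<epsilon>: "\<epsilon> \<ge> 0" and l: "l > 0"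
    and \<rho>: "0 \<le> \<rho>" "\<rho> < 1" "\<And>\<alpha> \<beta> :: int ^ 'd. \<alpha> \<noteq> \<beta> \<Longrightarrow> green \<alpha> \<beta> \<le> \<rho> * v"
    and u: "u \<ge> 0"
  defines "c \<equiv> real (card R)" and "\<theta> \<equiv> 1 - \<rho>"
  shows "prob {\<omega> \<in> space M. \<forall>x\<in>insert a R. u \<le> \<phi> x \<omega>}
    \<le> exp (- ((c + \<theta>) * u)\<^sup>2 / (2 * (v * (c + \<theta>\<^sup>2 + 2 * \<theta> * \<rho>) + 3 * c\<^sup>2 * \<epsilon>)))"
proof -
  have c1: "c \<ge> 1" unfolding c_def using R by (simp add: Suc_leI card_gt_0_iff)
  have \<theta>: "0 < \<theta>" "\<theta> \<le> 1" using \<rho> by (auto simp: \<theta>_def)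
  define J where "J = insert a R"
  define w where "w x = (if x = a then \<theta> else 1)" for x
  have J: "finite J" using R by (simp add: J_def)
  have sumJ: "(\<Sum>x\<in>J. w x * f x) = \<theta> * f a + (\<Sum>x\<in>R. f x)" for f :: "int ^ 'd \<Rightarrow> real"
  proof -
    have "(\<Sum>x\<in>R. w x * f x) = (\<Sum>x\<in>R. f x)" using a by (intro sum.cong) (auto simp: w_def)
    then show ?thesis using R a by (simp add: J_def w_def)
  qed
  have quad: "quad w J = \<theta>\<^sup>2 * v + 2 * \<theta> * (\<Sum>x\<in>R. green a x) + (\<Sum>x\<in>R. \<Sum>y\<in>R. green x y)"
  proof -
    have "quad w J = (\<Sum>x\<in>J. w x * (\<Sum>y\<in>J. w y * green x y))"
      unfolding quad_def by (simp add: sum_distrib_left mult_ac)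
    also have "\<dots> = \<theta> * (\<theta> * green a a + (\<Sum>y\<in>R. green a y)) + (\<Sum>x\<in>R. \<theta> * green x a + (\<Sum>y\<in>R. green x y))"
      unfolding sumJ ..
    also have "(\<Sum>x\<in>R. \<theta> * green x a + (\<Sum>y\<in>R. green x y)) = \<theta> * (\<Sum>x\<in>R. green a x) + (\<Sum>x\<in>R. \<Sum>y\<in>R. green x y)"
      by (simp add: sum.distrib sum_distrib_left green_commute[of _ a])
    finally show ?thesis by (simp add: power2_eq_square algebra_simps)
  qed
  have s1: "(\<Sum>x\<in>R. \<Sum>y\<in>R. green x y) \<le> c * v + c\<^sup>2 * \<epsilon>"
  proof -
    have "(\<Sum>y\<in>R. green x y) \<le> v + c * \<epsilon>" if x: "x \<in> R" for x
    proof -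
      have "(\<Sum>y\<in>R. green x y) = v + (\<Sum>y\<in>R - {x}. green x y)"
        using sum.remove[OF R(1) x, of "green x"] by simp
      also have "(\<Sum>y\<in>R - {x}. green x y) \<le> (\<Sum>y\<in>R - {x}. \<epsilon>)"
      proof (rule sum_mono)
        fix y assume "y \<in> R - {x}"
        then have "l \<le> real (l1 (y - x))" using sep x by auto
        then show "green x y \<le> \<epsilon>" using l by (intro dec) linarith
      qed
      also have "\<dots> \<le> (\<Sum>y\<in>R. \<epsilon>)" using R \<epsilon> by (intro sum_mono2) auto
      also have "\<dots> = c * \<epsilon>" by (simp add: c_def)
      finally show ?thesis by simp
    qed
    then have "(\<Sum>x\<in>R. \<Sum>y\<in>R. green x y) \<le> (\<Sum>x\<in>R. v + c * \<epsilon>)" by (rule sum_mono)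
    then show ?thesis by (simp add: c_def power2_eq_square distrib_left)
  qed
  (* Two sites of R within distance l / 2 of a would be closer than l to each other. *)
  have s2: "(\<Sum>x\<in>R. green a x) \<le> \<rho> * v + c * \<epsilon>"
  proof (cases "\<exists>x\<in>R. real (l1 (x - a)) < l / 2")
    case True
    then obtain x0 where x0: "x0 \<in> R" "real (l1 (x0 - a)) < l / 2" by blast
    have "(\<Sum>x\<in>R. green a x) = green a x0 + (\<Sum>x\<in>R - {x0}. green a x)"
      using sum.remove[OF R(1) x0(1), of "green a"] by simp
    also have "green a x0 \<le> \<rho> * v" by (rule \<rho>(3)) (use x0 a in auto)
    also have "(\<Sum>x\<in>R - {x0}. green a x) \<le> (\<Sum>x\<in>R - {x0}. \<epsilon>)"
    proof (rule sum_mono)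
      fix x assume x: "x \<in> R - {x0}"
      have "l \<le> real (l1 (x - x0))" using sep x x0 by auto
      also have "l1 (x - x0) \<le> l1 (x - a) + l1 (a - x0)"
        using l1_triangle[of "x - a" "a - x0"] by simp
      then have "real (l1 (x - x0)) \<le> real (l1 (x - a)) + real (l1 (a - x0))" by linarith
      finally have "l / 2 \<le> real (l1 (x - a))" using x0(2) l1_diff_commute[of a x0] by simp
      then show "green a x \<le> \<epsilon>" by (rule dec)
    qed
    also have "\<dots> \<le> (\<Sum>x\<in>R. \<epsilon>)" using R \<epsilon> by (intro sum_mono2) auto
    also have "\<dots> = c * \<epsilon>" by (simp add: c_def)
    finally show ?thesis by simp
  next
    case False
    then have "(\<Sum>x\<in>R. green a x) \<le> (\<Sum>x\<in>R. \<epsilon>)" by (intro sum_mono dec) (auto simp: not_less)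
    also have "\<dots> \<le> \<rho> * v + c * \<epsilon>" using \<rho>(1) v_pos by (simp add: c_def)
    finally show ?thesis .
  qed
  have Vle: "quad w J \<le> v * (c + \<theta>\<^sup>2 + 2 * \<theta> * \<rho>) + 3 * c\<^sup>2 * \<epsilon>"
  proof -
    have "2 * \<theta> * (\<Sum>x\<in>R. green a x) \<le> 2 * \<theta> * (\<rho> * v + c * \<epsilon>)" using s2 \<theta> by (intro mult_left_mono) auto
    then have "2 * \<theta> * (\<Sum>x\<in>R. green a x) \<le> 2 * \<theta> * (\<rho> * v) + 2 * \<theta> * (c * \<epsilon>)" by (simp only: distrib_left)
    moreover have "2 * \<theta> * (c * \<epsilon>) \<le> 2 * c\<^sup>2 * \<epsilon>"
    proof -
      have "\<theta> * c \<le> c * c" using \<theta> c1 by (intro mult_right_mono) auto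
      then have "(\<theta> * c) * \<epsilon> \<le> (c * c) * \<epsilon>" using \<epsilon> by (rule mult_right_mono)
      then show ?thesis by (simp add: power2_eq_square)
    qed
    ultimately have "quad w J \<le> \<theta>\<^sup>2 * v + (2 * \<theta> * (\<rho> * v) + 2 * c\<^sup>2 * \<epsilon>) + (c * v + c\<^sup>2 * \<epsilon>)"
      unfolding quad using s1 by linarith
    also have "\<dots> = v * (c + \<theta>\<^sup>2 + 2 * \<theta> * \<rho>) + 3 * c\<^sup>2 * \<epsilon>" by (simp add: algebra_simps)
    finally show ?thesis .
  qed
  have "prob {\<omega> \<in> space M. \<forall>x\<in>insert a R. u \<le> \<phi> x \<omega>} \<le> prob {\<omega> \<in> space M. (c + \<theta>) * u \<le> lin w J \<omega>}"
  proof (intro finite_measure_mono subsetI)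
    fix \<omega> assume \<omega>: "\<omega> \<in> {\<omega> \<in> space M. \<forall>x\<in>insert a R. u \<le> \<phi> x \<omega>}"
    have "lin w J \<omega> = \<theta> * \<phi> a \<omega> + (\<Sum>x\<in>R. \<phi> x \<omega>)" unfolding lin_def sumJ ..
    also have "\<dots> \<ge> \<theta> * u + (\<Sum>x\<in>R. u)" using \<omega> \<theta> by (intro add_mono mult_left_mono sum_mono) auto
    finally show "\<omega> \<in> {\<omega> \<in> space M. (c + \<theta>) * u \<le> lin w J \<omega>}"
      using \<omega> by (simp add: c_def algebra_simps)
  qed measurable
  also have "\<dots> \<le> exp (- ((c + \<theta>) * u)\<^sup>2 / (2 * (v * (c + \<theta>\<^sup>2 + 2 * \<theta> * \<rho>) + 3 * c\<^sup>2 * \<epsilon>)))"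
  proof (rule lin_tail_le[OF J _ Vle])
    show "0 \<le> (c + \<theta>) * u" using c1 \<theta> u by simp
    have "0 < v * (c + \<theta>\<^sup>2 + 2 * \<theta> * \<rho>)" using v_pos c1 \<theta> \<rho>(1) by (intro mult_pos_pos add_pos_nonneg) auto
    then show "0 < v * (c + \<theta>\<^sup>2 + 2 * \<theta> * \<rho>) + 3 * c\<^sup>2 * \<epsilon>" using \<epsilon> by (intro add_pos_nonneg) auto
  qed
  finally show ?thesis .
qed

text \<open>The choice \<open>\<theta> = 1 - \<rho>\<close> of the weight: the difference of the two sides, after multiplication with the
  denominator, is \<open>\<theta>\<^sup>2 * \<rho>\<^sup>2\<close>.\<close>

lemma gain_inequality:
  fixes c \<rho> :: real
  assumes "c \<ge> 1" "0 \<le> \<rho>" "\<rho> < 1"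
  defines "\<theta> \<equiv> 1 - \<rho>"
  shows "c + \<theta>\<^sup>2 \<le> (c + \<theta>)\<^sup>2 / (c + \<theta>\<^sup>2 + 2 * \<theta> * \<rho>)"
proof -
  have pos: "c + \<theta>\<^sup>2 + 2 * \<theta> * \<rho> > 0" using assms by (auto intro!: add_pos_nonneg)
  have \<rho>: "\<rho> = 1 - \<theta>" by (simp add: \<theta>_def)
  have "(c + \<theta>)\<^sup>2 - (c + \<theta>\<^sup>2) * (c + \<theta>\<^sup>2 + 2 * \<theta> * \<rho>) = \<theta>\<^sup>2 * \<rho>\<^sup>2"
    unfolding \<rho> by (simp add: power2_eq_square algebra_simps)
  then have "(c + \<theta>\<^sup>2) * (c + \<theta>\<^sup>2 + 2 * \<theta> * \<rho>) \<le> (c + \<theta>)\<^sup>2"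
    using zero_le_mult_iff[of "\<theta>\<^sup>2" "\<rho>\<^sup>2"] by (smt (verit) zero_le_power2)
  then show ?thesis using pos by (simp add: pos_le_divide_eq)
qed

text \<open>Since the squared level is asymptotic to \<open>2 * v * ln N\<close>, the bound of \<open>prob_cluster_bound\<close> is a power of \<open>N\<close>
  whose exponent tends to at most \<open>- (c + \<theta>\<^sup>2)\<close>, by \<open>gain_inequality\<close>.  Half of the gain is given up to absorb the error terms.\<close>

lemma cluster_exponent:
  assumes \<epsilon>: "\<epsilon> \<longlonglongrightarrow> 0" and c: "c \<ge> 1" and \<rho>: "0 \<le> \<rho>" "\<rho> < 1"
  defines "\<theta> \<equiv> 1 - \<rho>"
  shows "\<forall>\<^sub>F n in sequentially. exp (- ((c + \<theta>) * level n z)\<^sup>2 / (2 * (v * (c + \<theta>\<^sup>2 + 2 * \<theta> * \<rho>) + 3 * c\<^sup>2 * \<epsilon> n)))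
    \<le> vol n powr (- (c + \<theta>\<^sup>2 / 2))"
proof -
  define D where "D = c + \<theta>\<^sup>2 + 2 * \<theta> * \<rho>"
  have \<theta>: "\<theta> > 0" using \<rho> by (simp add: \<theta>_def)
  have D: "D > 0" unfolding D_def using c \<theta> \<rho> by (intro add_pos_nonneg) auto
  let ?u = "\<lambda>n. unit_centering (vol n)"
  have lnvol: "filterlim (\<lambda>n. ln (vol n)) at_top sequentially"
    by (rule filterlim_compose[OF ln_at_top vol_at_top])
  have r1: "(\<lambda>n. ?u n / sqrt (2 * ln (vol n))) \<longlonglongrightarrow> 1"
    by (rule filterlim_compose[OF unit_centering_over_sqrt vol_at_top])
  have s_top: "filterlim (\<lambda>n. sqrt (2 * ln (vol n))) at_top sequentially"
    by (rule filterlim_compose[OF sqrt_at_top])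
       (rule filterlim_tendsto_pos_mult_at_top[OF tendsto_const _ lnvol], simp)
  have iu: "(\<lambda>n. inverse (?u n)) \<longlonglongrightarrow> 0" by (rule tendsto_inverse_0_at_top[OF unit_centering_vol_at_top])
  have isq: "(\<lambda>n. inverse (sqrt (2 * ln (vol n)))) \<longlonglongrightarrow> 0" by (rule tendsto_inverse_0_at_top[OF s_top])
  have X: "(\<lambda>n. (c + \<theta>)\<^sup>2 / (D + 3 * c\<^sup>2 * \<epsilon> n / v) * (?u n / sqrt (2 * ln (vol n)) + z * inverse (?u n) * inverse (sqrt (2 * ln (vol n))))\<^sup>2)
     \<longlonglongrightarrow> (c + \<theta>)\<^sup>2 / (D + 3 * c\<^sup>2 * 0 / v) * (1 + z * 0 * 0)\<^sup>2"
    by (intro tendsto_intros r1 iu isq \<epsilon>) (use v_pos D in auto)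
  have "c + \<theta>\<^sup>2 / 2 < c + \<theta>\<^sup>2" using \<theta> by simp
  also have "\<dots> \<le> (c + \<theta>)\<^sup>2 / D" unfolding D_def \<theta>_def by (rule gain_inequality[OF c \<rho>])
  finally have "\<forall>\<^sub>F n in sequentially. c + \<theta>\<^sup>2 / 2 <
     (c + \<theta>)\<^sup>2 / (D + 3 * c\<^sup>2 * \<epsilon> n / v) * (?u n / sqrt (2 * ln (vol n)) + z * inverse (?u n) * inverse (sqrt (2 * ln (vol n))))\<^sup>2"
    using order_tendstoD(1)[OF X] by simp
  moreover have "\<forall>\<^sub>F n in sequentially. ln (vol n) > 0"
    using filterlim_at_top_dense[THEN iffD1, OF lnvol, rule_format, of 0] .
  ultimately show ?thesis
  proof eventually_elim
    case (elim n)
    define L where "L = ln (vol n)"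
    have L: "L > 0" using elim by (simp add: L_def)
    have "vol n \<noteq> 0" using elim(2) by (metis less_irrefl ln_0)
    moreover have "vol n \<ge> 0" by (simp add: vol_def)
    ultimately have vn: "vol n > 0" by linarith
    let ?Y = "?u n / sqrt (2 * L) + z * inverse (?u n) * inverse (sqrt (2 * L))"
    have lev: "(level n z)\<^sup>2 = v * (2 * L) * ?Y\<^sup>2"
    proof -
      have "level n z = sqrt v * (sqrt (2 * L) * ?Y)"
      proof -
        have "?Y = (?u n + z / ?u n) / sqrt (2 * L)" by (simp add: distrib_right divide_inverse)
        then have "sqrt (2 * L) * ?Y = ?u n + z / ?u n" using L by simp
        then show ?thesis by (simp only: level_eq)
      qed
      then show ?thesis using L v_pos by (simp add: power_mult_distrib)
    qed
    have cancel: "A * (v * (2 * L) * Y) / (2 * v * W) = L * (A / W * Y)" for A Y W :: real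
      using v_pos by simp
    have "((c + \<theta>) * level n z)\<^sup>2 / (2 * (v * D + 3 * c\<^sup>2 * \<epsilon> n))
      = (c + \<theta>)\<^sup>2 * (v * (2 * L) * ?Y\<^sup>2) / (2 * v * (D + 3 * c\<^sup>2 * \<epsilon> n / v))"
      unfolding power_mult_distrib lev using v_pos by (simp add: distrib_left)
    also have "\<dots> = L * ((c + \<theta>)\<^sup>2 / (D + 3 * c\<^sup>2 * \<epsilon> n / v) * ?Y\<^sup>2)"
      by (rule cancel)
    also have "\<dots> \<ge> L * (c + \<theta>\<^sup>2 / 2)"
      using elim(1) L unfolding L_def[symmetric] by (intro mult_left_mono) auto
    finally have "- ((c + \<theta>) * level n z)\<^sup>2 / (2 * (v * D + 3 * c\<^sup>2 * \<epsilon> n)) \<le> - (c + \<theta>\<^sup>2 / 2) * L"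
      unfolding minus_divide_left[symmetric] mult_minus_left neg_le_iff_le by (simp only: mult.commute)
    then show ?case using vn by (simp add: powr_def D_def[symmetric] L_def[symmetric])
  qed
qed

end

section \<open>Close tuples are negligible\<close>

text \<open>Powers of \<open>n\<close> beat logarithms: this gives the last hypothesis of \<open>far_factorization\<close> when \<open>l n\<close> is a power of \<open>n\<close>.\<close>

lemma far_covariance_negligible:
  fixes \<delta> C D :: real
  assumes "\<delta> > 0" "C > 0" "D > 0"
  shows "((\<lambda>x. C / sqrt (1 + x powr \<delta> / 2) * (D * ln x) * sqrt (2 * (D * ln x))) \<longlongrightarrow> 0) at_top"
  using assms by real_asymp

context transient_gff begin

text \<open>The tuples to which \<open>far_factorization\<close> does not apply.\<close>

definition close_lists :: "real \<Rightarrow> nat \<Rightarrow> nat \<Rightarrow> (int ^ 'd) list set" where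
  "close_lists l n k = {as. set as \<subseteq> lattice_box n \<and> length as = k \<and> \<not> far l as}"

definition clustered_lists :: "real \<Rightarrow> nat \<Rightarrow> nat \<Rightarrow> nat \<Rightarrow> (int ^ 'd) list set" where
  "clustered_lists l n k c = {as. set as \<subseteq> lattice_box n \<and> length as = k \<and>
     (\<exists>R. R \<subseteq> set as \<and> card R = c \<and> (\<forall>x\<in>R. \<forall>y\<in>R. x \<noteq> y \<longrightarrow> l \<le> real (l1 (y - x))) \<and>
       (\<forall>x\<in>set as. \<exists>y\<in>R. real (l1 (y - x)) < l))}"

text \<open>Take a maximal separated set of entries.  If it had \<open>k\<close> elements, the list would be far.\<close>

lemma close_lists_subset_clustered:
  assumes "l > 0"
  shows "close_lists l n k \<subseteq> (\<Union>c\<in>{1..<k}. clustered_lists l n k c)"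
proof
  fix as assume as: "as \<in> close_lists l n k"
  obtain R where R: "R \<subseteq> set as" "\<forall>x\<in>R. \<forall>y\<in>R. x \<noteq> y \<longrightarrow> l \<le> real (l1 (y - x))"
    "\<forall>x\<in>set as. \<exists>y\<in>R. real (l1 (y - x)) < l"
    using separated_subset_exists[of "set as" l] assms by auto
  have finR: "finite R" using R(1) finite_subset by blast
  have "card R \<le> card (set as)" using R(1) by (intro card_mono) auto
  also have "\<dots> \<le> length as" by (rule card_length)
  finally have le: "card R \<le> k" using as by (simp add: close_lists_def)
  have "card R \<noteq> k"
  proof
    assume "card R = k"
    then have "card (set as) = length as" "card R = card (set as)"
      using card_length[of as] card_mono[OF _ R(1)] as by (auto simp: close_lists_def)
    then have "distinct as" "R = set as" using card_distinct[of as] card_subset_eq[OF _ R(1)] by auto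
    then have "far l as" using R(2) by (simp add: far_def)
    then show False using as by (simp add: close_lists_def)
  qed
  moreover have "card R \<noteq> 0"
  proof
    assume "card R = 0"
    then have "R = {}" using finR by simp
    then have "as = []" using R(3) by (cases as) auto
    then show False using as by (simp add: close_lists_def far_def)
  qed
  ultimately have "card R \<in> {1..<k}" using le by auto
  moreover have "as \<in> clustered_lists l n k (card R)" using as R by (auto simp: clustered_lists_def close_lists_def)
  ultimately show "as \<in> (\<Union>c\<in>{1..<k}. clustered_lists l n k c)" by blast
qed

lemma clustered_lists_card:
  assumes "l \<ge> 0"
  shows "finite (clustered_lists l n k c)" and "real (card (clustered_lists l n k c)) \<le> vol n ^ c * (real c * (2 * l + 1) ^ CARD('d)) ^ k"
proof -
  let ?T = "{as :: (int ^ 'd) list. set as \<subseteq> lattice_box n \<and> length as = k \<and> (\<exists>R. R \<subseteq> set as \<and> card R = c \<and> (\<forall>x\<in>set as. \<exists>y\<in>R. real (l1 (y - x)) < l))}"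
  have sub: "clustered_lists l n k c \<subseteq> ?T"
  proof
    fix as assume "as \<in> clustered_lists l n k c"
    then obtain R where "set as \<subseteq> lattice_box n" "length as = k" "R \<subseteq> set as" "card R = c" "\<forall>x\<in>set as. \<exists>y\<in>R. real (l1 (y - x)) < l"
      unfolding clustered_lists_def mem_Collect_eq by (elim exE conjE) (rule that)
    then show "as \<in> ?T" unfolding mem_Collect_eq by (intro conjI exI[of _ R])
  qed
  show "finite (clustered_lists l n k c)" by (rule finite_subset[OF sub card_lists_around_points(1)[OF finite_lattice_box assms]])
  have "real (card (clustered_lists l n k c)) \<le> real (card ?T)"
    using card_mono[OF card_lists_around_points(1)[OF finite_lattice_box assms] sub] by simp
  also have "\<dots> \<le> real (card (lattice_box n :: (int ^ 'd) set)) ^ c * (real c * (2 * l + 1) ^ CARD('d)) ^ k"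
    by (rule card_lists_around_points(2)[OF finite_lattice_box assms])
  finally show "real (card (clustered_lists l n k c)) \<le> vol n ^ c * (real c * (2 * l + 1) ^ CARD('d)) ^ k"
    by (simp add: card_lattice_box vol_def)
qed

text \<open>Because \<open>c < k\<close> and the entries are distinct, some entry \<open>a\<close> is not among the \<open>c\<close> separated ones.\<close>

lemma prob_clustered_list:
  assumes as: "as \<in> clustered_lists l n k c" "distinct as" and c: "1 \<le> c" "c < k"
    and dec: "\<And>\<alpha> \<beta> :: int ^ 'd. l / 2 \<le> real (l1 (\<beta> - \<alpha>)) \<Longrightarrow> green \<alpha> \<beta> \<le> \<epsilon>" and \<epsilon>: "\<epsilon> \<ge> 0" and l: "l > 0"
    and \<rho>: "0 \<le> \<rho>" "\<rho> < 1" "\<And>\<alpha> \<beta> :: int ^ 'd. \<alpha> \<noteq> \<beta> \<Longrightarrow> green \<alpha> \<beta> \<le> \<rho> * v"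
    and u: "u \<ge> 0"
  shows "prob {\<omega> \<in> space M. \<forall>x\<in>set as. u \<le> \<phi> x \<omega>}
    \<le> exp (- ((real c + (1 - \<rho>)) * u)\<^sup>2 / (2 * (v * (real c + (1 - \<rho>)\<^sup>2 + 2 * (1 - \<rho>) * \<rho>) + 3 * (real c)\<^sup>2 * \<epsilon>)))"
proof -
  obtain R where R: "R \<subseteq> set as" "card R = c" "\<forall>x\<in>R. \<forall>y\<in>R. x \<noteq> y \<longrightarrow> l \<le> real (l1 (y - x))"
    using as(1) by (auto simp: clustered_lists_def)
  have finR: "finite R" using R(1) finite_subset by blast
  have "card (set as) = k" using as by (simp add: clustered_lists_def distinct_card)
  then have "R \<noteq> set as" using R(2) c by auto
  then obtain a where a: "a \<in> set as" "a \<notin> R" using R(1) by blast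
  have "prob {\<omega> \<in> space M. \<forall>x\<in>set as. u \<le> \<phi> x \<omega>} \<le> prob {\<omega> \<in> space M. \<forall>x\<in>insert a R. u \<le> \<phi> x \<omega>}"
  proof (intro finite_measure_mono subsetI)
    show "{\<omega> \<in> space M. \<forall>x\<in>insert a R. u \<le> \<phi> x \<omega>} \<in> events" using finR by measurable
  qed (use R(1) a in auto)
  also have "\<dots> \<le> exp (- ((real (card R) + (1 - \<rho>)) * u)\<^sup>2 / (2 * (v * (real (card R) + (1 - \<rho>)\<^sup>2 + 2 * (1 - \<rho>) * \<rho>) + 3 * (real (card R))\<^sup>2 * \<epsilon>)))"
    by (rule prob_cluster_bound[OF finR _ a(2) R(3) dec \<epsilon> l \<rho> u]) (use R(2) c in auto)
  finally show ?thesis by (simp only: R(2))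
qed

lemma level_eventually_nonneg: "\<forall>\<^sub>F n in sequentially. 0 \<le> level n z"
proof -
  have u: "\<forall>\<^sub>F n in sequentially. unit_centering (vol n) > \<bar>z\<bar> + 1"
    using filterlim_at_top_dense[THEN iffD1, OF unit_centering_vol_at_top, rule_format, of "\<bar>z\<bar> + 1"] .
  then show ?thesis
  proof eventually_elim
    case (elim n)
    have "- z \<le> \<bar>z\<bar> * unit_centering (vol n)"
      using elim mult_left_mono[of 1 "unit_centering (vol n)" "\<bar>z\<bar>"] by linarith
    also have "\<dots> \<le> unit_centering (vol n) * unit_centering (vol n)"
      using elim by (intro mult_right_mono) auto
    finally have "- z / unit_centering (vol n) \<le> unit_centering (vol n)"
      using elim by (subst pos_divide_le_eq) auto
    then show ?case unfolding level_eq using v_pos by simp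
  qed
qed

text \<open>Both sums are compared with \<open>Q n\<close>, a power of \<open>3 * l\<close> coming from the number of clustered lists times the gain
  \<open>N powr (- \<theta>\<^sup>2 / 2)\<close>.  With \<open>l = n powr \<delta>\<close> and \<open>\<delta> = \<theta>\<^sup>2 / (4 * (k + 1))\<close> the first factor consumes at most half of
  the gain.  The same distances \<open>l\<close> and covariance bounds \<open>\<epsilon>\<close> serve for far tuples.\<close>

lemma close_lists_negligible:
  "\<exists>l \<epsilon>. (\<forall>n \<alpha> \<beta>. l n \<le> real (l1 (\<beta> - \<alpha> :: int ^ 'd)) \<longrightarrow> green \<alpha> \<beta> \<le> \<epsilon> n) \<and> (\<forall>n. 0 \<le> \<epsilon> n) \<and>
    (\<lambda>n. \<epsilon> n * ln (vol n) * unit_centering (vol n)) \<longlonglongrightarrow> 0 \<and>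
    (\<lambda>n. real (card (close_lists (l n) n k)) / vol n ^ k) \<longlonglongrightarrow> 0 \<and>
    (\<lambda>n. \<Sum>as | as \<in> close_lists (l n) n k \<and> distinct as. prob {\<omega> \<in> space M. \<forall>x\<in>set as. level n z \<le> \<phi> x \<omega>}) \<longlonglongrightarrow> 0"
proof -
  obtain \<rho> where \<rho>: "0 \<le> \<rho>" "\<rho> < 1" "\<And>\<alpha> \<beta> :: int ^ 'd. \<alpha> \<noteq> \<beta> \<Longrightarrow> green \<alpha> \<beta> \<le> \<rho> * v"
    using correlation_gap by blast
  obtain C where C: "C > 0" "\<And>\<alpha> \<beta> :: int ^ 'd. green \<alpha> \<beta> \<le> C / sqrt (1 + real (l1 (\<beta> - \<alpha>)))"
    using green_decay[OF dim] by blast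
  define \<theta> where "\<theta> = 1 - \<rho>"
  have \<theta>: "0 < \<theta>" "\<theta> \<le> 1" using \<rho> by (auto simp: \<theta>_def)
  define d where "d = real CARD('d)"
  have d: "d > 0" by (simp add: d_def)
  (* Chosen such that \<delta> * k \<le> \<theta>^2 / 4; the summand 1 avoids division by zero for k = 0. *)
  define \<delta> where "\<delta> = \<theta>\<^sup>2 / (4 * (real k + 1))"
  have \<delta>: "\<delta> > 0" using \<theta> by (simp add: \<delta>_def)
  define l where "l n = real n powr \<delta>" for n
  define \<epsilon> where "\<epsilon> n = C / sqrt (1 + l n / 2)" for n
  have \<epsilon>0: "0 \<le> \<epsilon> n" for n using C(1) by (simp add: \<epsilon>_def l_def)
  have dec2: "green \<alpha> \<beta> \<le> \<epsilon> n" if "l n / 2 \<le> real (l1 (\<beta> - \<alpha>))" for n and \<alpha> \<beta> :: "int ^ 'd"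
  proof -
    have "0 \<le> l n" by (simp add: l_def)
    then have "C / sqrt (1 + real (l1 (\<beta> - \<alpha>))) \<le> C / sqrt (1 + l n / 2)"
      using that C(1) by (intro divide_left_mono real_sqrt_le_mono mult_pos_pos) auto
    then show ?thesis using C(2)[of \<alpha> \<beta>] by (simp add: \<epsilon>_def)
  qed
  have dec: "green \<alpha> \<beta> \<le> \<epsilon> n" if "l n \<le> real (l1 (\<beta> - \<alpha>))" for n and \<alpha> \<beta> :: "int ^ 'd"
  proof (rule dec2)
    have "0 \<le> l n" by (simp add: l_def)
    then show "l n / 2 \<le> real (l1 (\<beta> - \<alpha>))" using that by linarith
  qed
  have ln_vol: "ln (vol n) = d * ln (real n)" if "n > 0" for n
    using that by (simp add: vol_def d_def ln_realpow)
  have lim_s: "(\<lambda>n. \<epsilon> n * ln (vol n) * sqrt (2 * ln (vol n))) \<longlonglongrightarrow> 0"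
  proof (rule Lim_transform_eventually)
    show "(\<lambda>n. C / sqrt (1 + real n powr \<delta> / 2) * (d * ln (real n)) * sqrt (2 * (d * ln (real n)))) \<longlonglongrightarrow> 0"
      by (rule filterlim_compose[OF far_covariance_negligible[OF \<delta> C(1) d] filterlim_real_sequentially])
    show "\<forall>\<^sub>F n in sequentially. C / sqrt (1 + real n powr \<delta> / 2) * (d * ln (real n)) * sqrt (2 * (d * ln (real n)))
      = \<epsilon> n * ln (vol n) * sqrt (2 * ln (vol n))"
      using eventually_gt_at_top[of 0] by eventually_elim (simp add: \<epsilon>_def l_def ln_vol)
  qed
  have lnvol: "filterlim (\<lambda>n. ln (vol n)) at_top sequentially"
    by (rule filterlim_compose[OF ln_at_top vol_at_top])
  have lim: "(\<lambda>n. \<epsilon> n * ln (vol n) * unit_centering (vol n)) \<longlonglongrightarrow> 0"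
  proof (rule Lim_transform_eventually)
    show "(\<lambda>n. (\<epsilon> n * ln (vol n) * sqrt (2 * ln (vol n))) * (unit_centering (vol n) / sqrt (2 * ln (vol n)))) \<longlonglongrightarrow> 0"
      using tendsto_mult[OF lim_s filterlim_compose[OF unit_centering_over_sqrt vol_at_top]] by simp
    show "\<forall>\<^sub>F n in sequentially. (\<epsilon> n * ln (vol n) * sqrt (2 * ln (vol n))) * (unit_centering (vol n) / sqrt (2 * ln (vol n)))
      = \<epsilon> n * ln (vol n) * unit_centering (vol n)"
      using filterlim_at_top_dense[THEN iffD1, OF lnvol, rule_format, of 0] by eventually_elim simp
  qed
  have \<epsilon>lim: "\<epsilon> \<longlonglongrightarrow> 0"
  proof (rule Lim_null_comparison[OF _ lim_s])
    show "\<forall>\<^sub>F n in sequentially. norm (\<epsilon> n) \<le> \<epsilon> n * ln (vol n) * sqrt (2 * ln (vol n))"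
      using filterlim_at_top_dense[THEN iffD1, OF lnvol, rule_format, of 1]
    proof eventually_elim
      case (elim n)
      have "1 * 1 \<le> ln (vol n) * sqrt (2 * ln (vol n))" using elim by (intro mult_mono) auto
      then have "\<epsilon> n * 1 \<le> \<epsilon> n * (ln (vol n) * sqrt (2 * ln (vol n)))" using \<epsilon>0[of n] by (intro mult_left_mono) auto
      then show ?case using \<epsilon>0[of n] by (simp add: mult.assoc)
    qed
  qed
  define Q where "Q n = (3 * real n powr \<delta>) ^ (CARD('d) * k) * vol n powr (- (\<theta>\<^sup>2 / 2))" for n
  have Q0: "0 \<le> Q n" for n by (simp add: Q_def)
  have Qlim: "Q \<longlonglongrightarrow> 0"
  proof (rule Lim_null_comparison)
    have "(\<lambda>n. real n powr (- (d * \<theta>\<^sup>2 / 4))) \<longlonglongrightarrow> 0"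
      by (rule tendsto_neg_powr[OF _ filterlim_real_sequentially]) (use d \<theta> in simp)
    then show "(\<lambda>n. 3 ^ (CARD('d) * k) * real n powr (- (d * \<theta>\<^sup>2 / 4))) \<longlonglongrightarrow> 0"
      by (rule tendsto_mult_right_zero)
    show "\<forall>\<^sub>F n in sequentially. norm (Q n) \<le> 3 ^ (CARD('d) * k) * real n powr (- (d * \<theta>\<^sup>2 / 4))"
      using eventually_ge_at_top[of 1]
    proof eventually_elim
      case (elim n)
      have a: "(real n powr \<delta>) ^ (CARD('d) * k) = real n powr (\<delta> * (d * real k))"
        using elim by (simp add: powr_realpow[symmetric] powr_powr d_def)
      have b: "vol n powr (- (\<theta>\<^sup>2 / 2)) = real n powr (- (d * \<theta>\<^sup>2 / 2))"
        using elim by (simp add: vol_def powr_realpow[symmetric] powr_powr d_def)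
      have "Q n = 3 ^ (CARD('d) * k) * real n powr (\<delta> * (d * real k) + - (d * \<theta>\<^sup>2 / 2))"
        unfolding Q_def power_mult_distrib a b powr_add by simp
      also have "\<dots> \<le> 3 ^ (CARD('d) * k) * real n powr (- (d * \<theta>\<^sup>2 / 4))"
      proof (intro mult_left_mono powr_mono)
        have "\<delta> * real k \<le> \<theta>\<^sup>2 / 4"
        proof -
          have "\<theta>\<^sup>2 * real k \<le> \<theta>\<^sup>2 * (real k + 1)" by (intro mult_left_mono) auto
          then show ?thesis unfolding \<delta>_def by (simp add: pos_divide_le_eq algebra_simps)
        qed
        then have "d * (\<delta> * real k) \<le> d * (\<theta>\<^sup>2 / 4)" using d by (intro mult_left_mono) auto
        then show "\<delta> * (d * real k) + - (d * \<theta>\<^sup>2 / 2) \<le> - (d * \<theta>\<^sup>2 / 4)" by (simp add: mult_ac)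
      qed (use elim in auto)
      finally show ?case using Q0[of n] by simp
    qed
  qed
  have Bk: "(real c * (2 * l n + 1) ^ CARD('d)) ^ k * vol n powr (- (\<theta>\<^sup>2 / 2)) \<le> real k ^ k * Q n"
    if "c \<in> {1..<k}" "n \<ge> 1" for c n
  proof -
    have l1: "1 \<le> l n" using that \<delta> by (simp add: l_def ge_one_powr_ge_zero)
    have "(real c * (2 * l n + 1) ^ CARD('d)) ^ k \<le> (real k * (3 * l n) ^ CARD('d)) ^ k"
      using that l1 by (intro power_mono mult_mono) auto
    also have "\<dots> = real k ^ k * (3 * l n) ^ (CARD('d) * k)" by (simp add: power_mult_distrib power_mult)
    finally show ?thesis unfolding Q_def l_def by (simp add: mult.assoc[symmetric] mult_right_mono)
  qed
  have lpos: "l n > 0" if "n \<ge> 1" for n using that by (simp add: l_def)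
  have fin_near: "finite (\<Union>c\<in>{1..<k}. clustered_lists (l n) n k c)" for n
    using clustered_lists_card(1)[of "l n"] by (auto simp: l_def)
  have lim4: "(\<lambda>n. real (card (close_lists (l n) n k)) / vol n ^ k) \<longlonglongrightarrow> 0"
  proof (rule Lim_null_comparison)
    show "(\<lambda>n. (real k * real k ^ k) * Q n) \<longlonglongrightarrow> 0" by (rule tendsto_mult_right_zero[OF Qlim])
    show "\<forall>\<^sub>F n in sequentially. norm (real (card (close_lists (l n) n k)) / vol n ^ k) \<le> (real k * real k ^ k) * Q n"
      using eventually_ge_at_top[of 1]
    proof eventually_elim
      case (elim n)
      have v1: "vol n \<ge> 1" using elim by (simp add: vol_def)
      have "card (close_lists (l n) n k) \<le> card (\<Union>c\<in>{1..<k}. clustered_lists (l n) n k c)"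
        by (rule card_mono[OF fin_near close_lists_subset_clustered[OF lpos[OF elim]]])
      also have "\<dots> \<le> (\<Sum>c\<in>{1..<k}. card (clustered_lists (l n) n k c))" by (rule card_UN_le) simp
      finally have "real (card (close_lists (l n) n k)) / vol n ^ k \<le> (\<Sum>c\<in>{1..<k}. real (card (clustered_lists (l n) n k c))) / vol n ^ k"
        using v1 by (intro divide_right_mono) (auto simp flip: of_nat_sum)
      also have "\<dots> = (\<Sum>c\<in>{1..<k}. real (card (clustered_lists (l n) n k c)) / vol n ^ k)" by (rule sum_divide_distrib)
      also have "\<dots> \<le> (\<Sum>c\<in>{1..<k}. real k ^ k * Q n)"
      proof (rule sum_mono)
        fix c assume c: "c \<in> {1..<k}"
        have "real (card (clustered_lists (l n) n k c)) / vol n ^ k \<le> (vol n ^ c * (real c * (2 * l n + 1) ^ CARD('d)) ^ k) / vol n ^ k"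
          using clustered_lists_card(2)[of "l n"] v1 by (intro divide_right_mono) (auto simp: l_def)
        also have "\<dots> = (real c * (2 * l n + 1) ^ CARD('d)) ^ k * (vol n ^ c / vol n ^ k)" by simp
        also have "vol n ^ c / vol n ^ k \<le> vol n powr (- (\<theta>\<^sup>2 / 2))"
        proof -
          have "vol n ^ c / vol n ^ k = vol n powr (real c - real k)"
            using v1 by (simp add: powr_diff powr_realpow)
          also have "\<dots> \<le> vol n powr (- (\<theta>\<^sup>2 / 2))"
          proof (rule powr_mono[OF _ v1])
            have "\<theta>\<^sup>2 \<le> 1" using \<theta> by (simp add: power_le_one)
            moreover have "real c + 1 \<le> real k" using c by auto
            ultimately show "real c - real k \<le> - (\<theta>\<^sup>2 / 2)" by linarith
          qed
          finally show ?thesis .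
        qed
        also have "(real c * (2 * l n + 1) ^ CARD('d)) ^ k * vol n powr (- (\<theta>\<^sup>2 / 2)) \<le> real k ^ k * Q n"
          by (rule Bk[OF c elim])
        finally show "real (card (clustered_lists (l n) n k c)) / vol n ^ k \<le> real k ^ k * Q n"
          by (simp add: mult_left_mono l_def)
      qed
      also have "\<dots> \<le> real k * (real k ^ k * Q n)"
        using Q0[of n] by (simp add: mult_right_mono)
      finally show ?case using v1 by (simp add: mult.assoc)
    qed
  qed
  have ev_c: "\<forall>\<^sub>F n in sequentially. \<forall>c\<in>{1..<k}.
     exp (- ((real c + \<theta>) * level n z)\<^sup>2 / (2 * (v * (real c + \<theta>\<^sup>2 + 2 * \<theta> * \<rho>) + 3 * (real c)\<^sup>2 * \<epsilon> n)))
      \<le> vol n powr (- (real c + \<theta>\<^sup>2 / 2))"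
    unfolding \<theta>_def
    by (intro eventually_ball_finite ballI cluster_exponent[OF \<epsilon>lim _ \<rho>(1,2)]) auto
  have lim5: "(\<lambda>n. \<Sum>as | as \<in> close_lists (l n) n k \<and> distinct as. prob {\<omega> \<in> space M. \<forall>x\<in>set as. level n z \<le> \<phi> x \<omega>}) \<longlonglongrightarrow> 0"
  proof (rule Lim_null_comparison)
    show "(\<lambda>n. (real k * real k ^ k) * Q n) \<longlonglongrightarrow> 0" by (rule tendsto_mult_right_zero[OF Qlim])
    show "\<forall>\<^sub>F n in sequentially. norm (\<Sum>as | as \<in> close_lists (l n) n k \<and> distinct as.
      prob {\<omega> \<in> space M. \<forall>x\<in>set as. level n z \<le> \<phi> x \<omega>}) \<le> (real k * real k ^ k) * Q n"
      using eventually_ge_at_top[of 1] ev_c level_eventually_nonneg[of z]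
    proof eventually_elim
      case (elim n)
      have v1: "vol n \<ge> 1" using elim(1) by (simp add: vol_def)
      define p where "p as = prob {\<omega> \<in> space M. \<forall>x\<in>set as. level n z \<le> \<phi> x \<omega>}" for as
      define b where "b c = vol n powr (- (real c + \<theta>\<^sup>2 / 2))" for c :: nat
      let ?D = "{as. as \<in> close_lists (l n) n k \<and> distinct as}"
      have finD: "finite ?D"
        by (rule finite_subset[OF _ fin_near[of n]]) (use close_lists_subset_clustered[OF lpos[OF elim(1)]] in blast)
      have pb: "p as \<le> (\<Sum>c\<in>{1..<k}. if as \<in> clustered_lists (l n) n k c then b c else 0)" if as: "as \<in> ?D" for as
      proof -
        obtain c where c: "c \<in> {1..<k}" "as \<in> clustered_lists (l n) n k c"
          using as close_lists_subset_clustered[OF lpos[OF elim(1)]] by blast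
        have "p as \<le> exp (- ((real c + (1 - \<rho>)) * level n z)\<^sup>2 / (2 * (v * (real c + (1 - \<rho>)\<^sup>2 + 2 * (1 - \<rho>) * \<rho>) + 3 * (real c)\<^sup>2 * \<epsilon> n)))"
          unfolding p_def
          by (rule prob_clustered_list[OF c(2) _ _ _ dec2 \<epsilon>0 lpos[OF elim(1)] \<rho> elim(3)]) (use as c in auto)
        also have "\<dots> \<le> b c" using elim(2) c(1) unfolding \<theta>_def[symmetric] b_def by blast
        also have "\<dots> = (if as \<in> clustered_lists (l n) n k c then b c else 0)" using c by simp
        also have "\<dots> \<le> (\<Sum>c\<in>{1..<k}. if as \<in> clustered_lists (l n) n k c then b c else 0)"
          by (rule member_le_sum) (use c in \<open>auto simp: b_def\<close>)
        finally show ?thesis .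
      qed
      have "(\<Sum>as\<in>?D. p as) \<le> (\<Sum>as\<in>?D. \<Sum>c\<in>{1..<k}. if as \<in> clustered_lists (l n) n k c then b c else 0)"
        by (intro sum_mono pb)
      also have "\<dots> = (\<Sum>c\<in>{1..<k}. \<Sum>as\<in>?D. if as \<in> clustered_lists (l n) n k c then b c else 0)" by (rule sum.swap)
      also have "\<dots> \<le> (\<Sum>c\<in>{1..<k}. real k ^ k * Q n)"
      proof (rule sum_mono)
        fix c assume c: "c \<in> {1..<k}"
        have "(\<Sum>as\<in>?D. if as \<in> clustered_lists (l n) n k c then b c else 0) = real (card (?D \<inter> clustered_lists (l n) n k c)) * b c"
          using finD by (simp add: sum.If_cases)
        also have "\<dots> \<le> real (card (clustered_lists (l n) n k c)) * b c"
          using card_mono[OF clustered_lists_card(1)[of "l n"], of "?D \<inter> clustered_lists (l n) n k c"]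
          by (intro mult_right_mono) (auto simp: l_def b_def)
        also have "\<dots> \<le> (vol n ^ c * (real c * (2 * l n + 1) ^ CARD('d)) ^ k) * b c"
          using clustered_lists_card(2)[of "l n"] by (intro mult_right_mono) (auto simp: l_def b_def)
        also have "\<dots> = (real c * (2 * l n + 1) ^ CARD('d)) ^ k * (vol n ^ c * b c)" by simp
        also have "vol n ^ c * b c = vol n powr (- (\<theta>\<^sup>2 / 2))"
          unfolding b_def using v1 by (simp add: powr_realpow[symmetric] powr_add[symmetric])
        also have "(real c * (2 * l n + 1) ^ CARD('d)) ^ k * vol n powr (- (\<theta>\<^sup>2 / 2)) \<le> real k ^ k * Q n"
          by (rule Bk[OF c elim(1)])
        finally show "(\<Sum>as\<in>?D. if as \<in> clustered_lists (l n) n k c then b c else 0) \<le> real k ^ k * Q n" .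
      qed
      also have "\<dots> \<le> real k * (real k ^ k * Q n)"
        using Q0[of n] by (simp add: mult_right_mono)
      finally have "(\<Sum>as\<in>?D. p as) \<le> real k * (real k ^ k * Q n)" .
      moreover have "0 \<le> (\<Sum>as\<in>?D. p as)" by (intro sum_nonneg) (simp add: p_def)
      ultimately show ?case by (simp add: p_def mult.assoc)
    qed
  qed
  show ?thesis using dec \<epsilon>0 lim lim4 lim5 by (intro exI[of _ l] exI[of _ \<epsilon>]) blast
qed

end

section \<open>Cells of the state space\<close>

abbreviation (input) "E_space \<equiv> (state_space :: ((real ^ 'd::finite) \<times> ereal) set)"

text \<open>The first component runs up to \<open>m\<close> itself because the cube is closed: the coordinate \<open>1\<close> has index \<open>m\<close>.\<close>

definition cell_index :: "nat \<Rightarrow> ((int ^ 'd::finite) \<times> int) set" where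
  "cell_index m = {(x, k). (\<forall>i. x $ i \<in> {0..int m}) \<and> k \<in> {- (int m * int m)..int m * int m}}"

text \<open>The last index \<open>m * m\<close> stands for the unbounded interval, which contains \<open>+\<infinity>\<close>.\<close>

definition height_cell :: "nat \<Rightarrow> int \<Rightarrow> ereal set" where
  "height_cell m k = (if k = int m * int m then {ereal (real m)..}
     else {ereal (real_of_int k / real m)..<ereal (real_of_int (k + 1) / real m)})"

definition cell :: "nat \<Rightarrow> (int ^ 'd::finite) \<times> int \<Rightarrow> ((real ^ 'd) \<times> ereal) set" where
  "cell m q = {p \<in> state_space. (\<forall>i. \<lfloor>real m * fst p $ i\<rfloor> = fst q $ i) \<and> snd p \<in> height_cell m (snd q)}"

definition slab :: "nat \<Rightarrow> ((real ^ 'd::finite) \<times> ereal) set" where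
  "slab K = cbox 0 1 \<times> {ereal (- real K)..}"

lemma finite_cell_index: "finite (cell_index m :: ((int ^ 'd::finite) \<times> int) set)"
proof -
  have "finite {x :: int ^ 'd. \<forall>i. x $ i \<in> {0..int m}}"
  proof -
    have "{x :: int ^ 'd. \<forall>i. x $ i \<in> {0..int m}} \<subseteq> vec_lambda ` (Pi\<^sub>E UNIV (\<lambda>_. {0..int m}))"
    proof
      fix x :: "int ^ 'd" assume "x \<in> {x. \<forall>i. x $ i \<in> {0..int m}}"
      then show "x \<in> vec_lambda ` (Pi\<^sub>E UNIV (\<lambda>_. {0..int m}))"
        by (intro image_eqI[of _ _ "vec_nth x"]) auto
    qed
    then show ?thesis by (rule finite_subset) (intro finite_imageI finite_PiE, auto)
  qed
  moreover have "(cell_index m :: ((int ^ 'd) \<times> int) set) = {x. \<forall>i. x $ i \<in> {0..int m}} \<times> {- (int m * int m)..int m * int m}"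
    by (auto simp: cell_index_def)
  ultimately show ?thesis by simp
qed

lemma compact_slab: "compact (slab K :: ((real ^ 'd::finite) \<times> ereal) set)"
  unfolding slab_def by (intro compact_Times compact_cbox) (simp add: compact_eq_closed)

lemma slab_subset: "slab K \<subseteq> E_space"
  by (auto simp: slab_def state_space_def intro: less_le_trans[of _ "ereal _"])

lemma cell_subset: "cell m q \<subseteq> E_space"
  by (auto simp: cell_def)

lemma slab_borel: "slab K \<in> sets borel"
  by (intro borel_closed compact_imp_closed compact_slab)

lemma slab_sets: "slab K \<in> sets (restrict_space borel E_space)"
  using slab_subset slab_borel by (auto simp: sets_restrict_space)

lemma height_cell_sets: "height_cell m k \<in> sets borel"
  by (auto simp: height_cell_def)

lemma cell_sets:
  fixes q :: "(int ^ 'd::finite) \<times> int"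
  shows "cell m q \<in> sets (restrict_space borel E_space)"
proof -
  have [measurable]: "(\<lambda>p :: (real ^ 'd) \<times> ereal. fst p $ i) \<in> borel_measurable borel" for i
    by (intro borel_measurable_continuous_onI continuous_intros)
  have [measurable]: "(\<lambda>p :: (real ^ 'd) \<times> ereal. snd p) \<in> borel_measurable borel"
    by (intro borel_measurable_continuous_onI continuous_intros)
  note height_cell_sets[measurable]
  have "{p \<in> space borel. (\<forall>i. \<lfloor>real m * fst p $ i\<rfloor> = fst q $ i) \<and> snd p \<in> height_cell m (snd q)} \<in> sets (borel :: ((real ^ 'd) \<times> ereal) measure)"
    by measurable
  moreover have "cell m q = E_space \<inter> {p \<in> space borel. (\<forall>i. \<lfloor>real m * fst p $ i\<rfloor> = fst q $ i) \<and> snd p \<in> height_cell m (snd q)}"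
    by (auto simp: cell_def)
  ultimately show ?thesis unfolding sets_restrict_space by blast
qed

lemma height_cells_disjoint:
  assumes "m > 0" "z \<in> height_cell m k" "z \<in> height_cell m k'" "k \<le> int m * int m" "k' \<le> int m * int m"
  shows "k = k'"
proof -
  have lt: False if k: "k < k'" "k' \<le> int m * int m" "z \<in> height_cell m k" "z \<in> height_cell m k'" for k k'
  proof -
    have "z < ereal (real_of_int (k + 1) / real m)" using k by (auto simp: height_cell_def)
    also have "\<dots> \<le> ereal (real_of_int k' / real m)" using k(1) by (simp add: divide_right_mono)
    also have "\<dots> \<le> z" using k(4) assms(1) by (auto simp: height_cell_def split: if_splits)
    finally show False by simp
  qed
  show ?thesis using lt[of k k'] lt[of k' k] assms by (cases k k' rule: linorder_cases) auto
qed

lemma cells_disjoint: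
  assumes "m > 0"
  shows "disjoint_family_on (cell m) (cell_index m :: ((int ^ 'd::finite) \<times> int) set)"
  unfolding disjoint_family_on_def
proof (intro ballI impI)
  fix q q' :: "(int ^ 'd) \<times> int" assume q: "q \<in> cell_index m" "q' \<in> cell_index m" "q \<noteq> q'"
  show "cell m q \<inter> cell m q' = {}"
  proof (rule ccontr)
    assume "cell m q \<inter> cell m q' \<noteq> {}"
    then obtain p where p: "p \<in> cell m q" "p \<in> cell m q'" by blast
    have "fst q = fst q'" using p by (auto simp: cell_def vec_eq_iff)
    moreover have "snd q = snd q'"
      by (rule height_cells_disjoint[OF assms, of "snd p"]) (use p q in \<open>auto simp: cell_def cell_index_def\<close>)
    ultimately show False using q(3) by (simp add: prod_eq_iff)
  qed
qed

text \<open>Every slab of integer depth \<open>K \<le> m\<close> is a union of cells of level \<open>m\<close>, since \<open>- K\<close> is a multiple of \<open>1 / m\<close>.\<close>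

lemma slab_eq_Union_cells:
  assumes "K \<le> m" "m > 0"
  shows "(slab K :: ((real ^ 'd::finite) \<times> ereal) set) = (\<Union>q\<in>{q \<in> cell_index m. - (int K * int m) \<le> snd q}. cell m q)" (is "_ = ?U")
proof (intro set_eqI iffI)
  fix p :: "(real ^ 'd) \<times> ereal" assume "p \<in> slab K"
  obtain t z where p: "p = (t, z)" by (cases p)
  have t: "0 \<le> t $ i" "t $ i \<le> 1" for i
    using \<open>p \<in> slab K\<close> p by (auto simp: slab_def mem_box_cart)
  have z: "ereal (- real K) \<le> z" using \<open>p \<in> slab K\<close> p by (auto simp: slab_def)
  have pE: "p \<in> state_space" using \<open>p \<in> slab K\<close> slab_subset by blast
  define x where "x = (\<chi> i. \<lfloor>real m * t $ i\<rfloor>)"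
  have x: "x $ i \<in> {0..int m}" for i
  proof -
    have "0 \<le> real m * t $ i" "real m * t $ i \<le> real m * 1" using t[of i] by (simp, intro mult_left_mono) simp_all
    then show ?thesis by (auto simp: x_def le_floor_iff floor_le_iff)
  qed
  have mm: "int K * int m \<le> int m * int m" using assms by (intro mult_right_mono) auto
  show "p \<in> ?U"
  proof (cases "ereal (real m) \<le> z")
    case True
    then have "p \<in> cell m (x, int m * int m)" using pE by (auto simp: cell_def p x_def height_cell_def)
    moreover have "(x, int m * int m) \<in> cell_index m" using x by (auto simp: cell_index_def)
    moreover have "- (int K * int m) \<le> int m * int m" by (rule order_trans[of _ 0]) simp_all
    ultimately show ?thesis by (intro UN_I[of "(x, int m * int m)"]) auto
  next
    case False
    then obtain y where y: "z = ereal y" using z by (cases z) auto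
    define k where "k = \<lfloor>real m * y\<rfloor>"
    have "real m * (- real K) \<le> real m * y" using z y by (intro mult_left_mono) auto
    then have k1: "- (int K * int m) \<le> k" by (simp add: k_def le_floor_iff mult.commute)
    have "real m * y < real m * real m" using False y assms by simp
    then have k2: "k < int m * int m" by (simp add: k_def floor_less_iff)
    have kk: "real_of_int k \<le> real m * y" "real m * y < real_of_int (k + 1)" by (auto simp: k_def)
    have "z \<in> height_cell m k"
      using k2 kk assms by (auto simp: height_cell_def y divide_le_eq less_divide_eq mult.commute)
    then have "p \<in> cell m (x, k)" using pE by (auto simp: cell_def p x_def)
    moreover have "(x, k) \<in> cell_index m" using x k1 k2 mm by (auto simp: cell_index_def)
    ultimately show ?thesis using k1 by (intro UN_I[of "(x, k)"]) auto
  qed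
next
  fix p :: "(real ^ 'd) \<times> ereal" assume "p \<in> ?U"
  then obtain q where q: "q \<in> cell_index m" "- (int K * int m) \<le> snd q" "p \<in> cell m q" by blast
  have "ereal (- real K) \<le> ereal (real_of_int (snd q) / real m)"
  proof -
    have "real_of_int (- (int K * int m)) \<le> real_of_int (snd q)" using q(2) by linarith
    then show ?thesis using assms by (simp add: le_divide_eq)
  qed
  also have "\<dots> \<le> snd p"
    using q(3) assms by (auto simp: cell_def height_cell_def split: if_splits)
  finally show "p \<in> slab K" using q(3) by (auto simp: cell_def slab_def state_space_def)
qed

lemma cell_Int_slab:
  assumes "K \<le> m" "m > 0" "q \<in> cell_index m" "cell m q \<inter> slab K \<noteq> {}"
  shows "cell m q \<subseteq> slab K"
proof -
  obtain p where p: "p \<in> cell m q" "p \<in> slab K" using assms(4) by blast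
  then obtain q' where q': "q' \<in> cell_index m" "- (int K * int m) \<le> snd q'" "p \<in> cell m q'"
    unfolding slab_eq_Union_cells[OF assms(1,2)] by blast
  have "q = q'"
    using cells_disjoint[OF assms(2)] assms(3) q'(1,3) p(1) unfolding disjoint_family_on_def by blast
  then show ?thesis unfolding slab_eq_Union_cells[OF assms(1,2)] using q' by blast
qed

lemma cell_subset_slab:
  assumes "m > 0" "q \<in> cell_index m"
  shows "cell m q \<subseteq> slab m"
proof -
  have "- (int m * int m) \<le> snd q" using assms(2) by (cases q) (simp add: cell_index_def)
  then show ?thesis unfolding slab_eq_Union_cells[OF order_refl assms(1)] using assms(2) by blast
qed

text \<open>The bounded cells shrink, and the unbounded cell moves to \<open>+\<infinity>\<close>; so two sequences in common cells of
  growing level have the same limit in the extended reals.\<close>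

lemma same_height_cell_tendsto:
  fixes x y :: "nat \<Rightarrow> ereal" and m :: "nat \<Rightarrow> nat" and k :: "nat \<Rightarrow> int"
  assumes x: "x \<longlonglongrightarrow> z" and m: "filterlim m at_top sequentially"
    and xk: "\<And>n. x n \<in> height_cell (m n) (k n)" and yk: "\<And>n. y n \<in> height_cell (m n) (k n)"
  shows "y \<longlonglongrightarrow> z"
proof -
  have mr: "filterlim (\<lambda>n. real (m n)) at_top sequentially"
    by (rule filterlim_compose[OF filterlim_real_sequentially m])
  have mbig: "\<forall>\<^sub>F n in sequentially. r < real (m n)" for r
    using filterlim_at_top_dense[THEN iffD1, OF mr, rule_format] .
  have inv: "(\<lambda>n. 1 / real (m n)) \<longlonglongrightarrow> 0"
    using tendsto_inverse_0_at_top[OF mr] by (simp add: divide_inverse)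
  have invsmall: "\<forall>\<^sub>F n in sequentially. 1 / real (m n) < r" if "r > 0" for r
    using order_tendstoD(2)[OF inv that] .
  show ?thesis
  proof (rule order_tendstoI)
    fix a assume "a < z"
    then obtain r2 where r2: "a < ereal r2" "ereal r2 < z" using ereal_dense2 by blast
    then obtain r1 where r1: "a < ereal r1" "ereal r1 < ereal r2" using ereal_dense2 by blast
    have "r2 - r1 > 0" using r1(2) by simp
    show "\<forall>\<^sub>F n in sequentially. a < y n"
      using order_tendstoD(1)[OF x r2(2)] mbig[of r1] mbig[of 0] invsmall[OF \<open>r2 - r1 > 0\<close>]
    proof eventually_elim
      case (elim n)
      have "ereal r1 < y n"
      proof (cases "k n = int (m n) * int (m n)")
        case True
        then have "ereal (real (m n)) \<le> y n" using yk[of n] by (simp add: height_cell_def)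
        moreover have "ereal r1 < ereal (real (m n))" using elim by simp
        ultimately show ?thesis by (rule less_le_trans[rotated])
      next
        case False
        have "x n < ereal (real_of_int (k n + 1) / real (m n))"
          using xk[of n] False by (simp add: height_cell_def)
        then have "ereal r2 < ereal (real_of_int (k n + 1) / real (m n))"
          by (rule less_trans[OF elim(1)])
        then have "r1 < real_of_int (k n) / real (m n)" using elim by (simp add: add_divide_distrib)
        moreover have "ereal (real_of_int (k n) / real (m n)) \<le> y n" using yk[of n] False by (simp add: height_cell_def)
        ultimately show ?thesis by (metis less_ereal.simps(1) less_le_trans)
      qed
      then show ?case using r1(1) by (rule less_trans[rotated])
    qed
  next
    fix a assume "z < a"
    then obtain r1 where r1: "z < ereal r1" "ereal r1 < a" using ereal_dense2 by blast
    then obtain r2 where r2: "ereal r1 < ereal r2" "ereal r2 < a" using ereal_dense2 by blast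
    have "r2 - r1 > 0" using r2(1) by simp
    show "\<forall>\<^sub>F n in sequentially. y n < a"
      using order_tendstoD(2)[OF x r1(1)] mbig[of r1] mbig[of 0] invsmall[OF \<open>r2 - r1 > 0\<close>]
    proof eventually_elim
      case (elim n)
      have nt: "k n \<noteq> int (m n) * int (m n)"
      proof
        assume "k n = int (m n) * int (m n)"
        then have "ereal (real (m n)) \<le> x n" using xk[of n] by (simp add: height_cell_def)
        also have "\<dots> < ereal r1" by (rule elim(1))
        finally show False using elim(2) by simp
      qed
      have "ereal (real_of_int (k n) / real (m n)) \<le> x n" using xk[of n] nt by (simp add: height_cell_def)
      then have "ereal (real_of_int (k n) / real (m n)) < ereal r1" using elim(1) by (rule le_less_trans)
      then have "real_of_int (k n + 1) / real (m n) < r2" using elim by (simp add: add_divide_distrib)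
      moreover have "y n < ereal (real_of_int (k n + 1) / real (m n))" using yk[of n] nt by (simp add: height_cell_def)
      ultimately have "y n < ereal r2" by (metis less_ereal.simps(1) less_trans)
      then show ?case using r2(2) by (rule less_trans)
    qed
  qed
qed

lemma same_cell_tendsto:
  fixes x y :: "nat \<Rightarrow> (real ^ 'd::finite) \<times> ereal"
  assumes x: "x \<longlonglongrightarrow> p" and m: "filterlim m at_top sequentially"
    and xq: "\<And>n. x n \<in> cell (m n) (q n)" and yq: "\<And>n. y n \<in> cell (m n) (q n)"
  shows "y \<longlonglongrightarrow> p"
proof -
  have mr: "filterlim (\<lambda>n. real (m n)) at_top sequentially"
    by (rule filterlim_compose[OF filterlim_real_sequentially m])
  have inv: "(\<lambda>n. 1 / real (m n)) \<longlonglongrightarrow> 0"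
    using tendsto_inverse_0_at_top[OF mr] by (simp add: divide_inverse)
  have mpos: "\<forall>\<^sub>F n in sequentially. 0 < real (m n)"
    using filterlim_at_top_dense[THEN iffD1, OF mr, rule_format] .
  have "(\<lambda>n. fst (y n)) \<longlonglongrightarrow> fst p"
  proof (rule vec_tendstoI)
    fix i
    have xi: "(\<lambda>n. fst (x n) $ i) \<longlonglongrightarrow> fst p $ i"
      by (intro tendsto_vec_nth tendsto_fst x)
    have "(\<lambda>n. fst (y n) $ i - fst (x n) $ i) \<longlonglongrightarrow> 0"
    proof (rule Lim_null_comparison[OF _ inv])
      show "\<forall>\<^sub>F n in sequentially. norm (fst (y n) $ i - fst (x n) $ i) \<le> 1 / real (m n)"
        using mpos
      proof eventually_elim
        case (elim n)
        have "\<lfloor>real (m n) * fst (y n) $ i\<rfloor> = \<lfloor>real (m n) * fst (x n) $ i\<rfloor>"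
          using xq[of n] yq[of n] by (simp add: cell_def)
        then have "\<bar>real (m n) * fst (y n) $ i - real (m n) * fst (x n) $ i\<bar> \<le> 1" by linarith
        then have "real (m n) * \<bar>fst (y n) $ i - fst (x n) $ i\<bar> \<le> 1"
          using elim by (simp add: right_diff_distrib[symmetric] abs_mult)
        then show ?case using elim by (simp add: pos_le_divide_eq mult.commute)
      qed
    qed
    from tendsto_add[OF this xi] show "(\<lambda>n. fst (y n) $ i) \<longlonglongrightarrow> fst p $ i" by simp
  qed
  moreover have "(\<lambda>n. snd (y n)) \<longlonglongrightarrow> snd p"
    by (rule same_height_cell_tendsto[OF tendsto_snd[OF x] m, of "\<lambda>n. snd (q n)"])
       (use xq yq in \<open>auto simp: cell_def\<close>)
  ultimately have "(\<lambda>n. (fst (y n), snd (y n))) \<longlonglongrightarrow> (fst p, snd p)" by (rule tendsto_Pair)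
  then show ?thesis by simp
qed

text \<open>A compact set of finite or infinite heights greater than \<open>-\<infinity>\<close> has a lowest height, which is greater than
  \<open>-\<infinity>\<close>.\<close>

lemma compact_support_in_slab:
  fixes f :: "(real ^ 'd::finite) \<times> ereal \<Rightarrow> real"
  assumes "f \<in> compact_support_functions state_space"
  shows "\<exists>K>0. \<forall>x\<in>state_space - slab K. f x = 0"
proof -
  obtain C where C: "compact C" "C \<subseteq> state_space" "\<forall>x\<in>state_space - C. f x = 0"
    using assms by (auto simp: compact_support_functions_def)
  show ?thesis
  proof (cases "C = {}")
    case True
    then show ?thesis using C by (intro exI[of _ 1]) auto
  next
    case False
    have "compact (snd ` C)" by (intro compact_continuous_image C continuous_intros)
    then obtain z where z: "z \<in> snd ` C" "\<forall>y\<in>snd ` C. z \<le> y"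
      using compact_attains_inf[of "snd ` C"] False by blast
    then have "z > - \<infinity>" using C(2) by (auto simp: state_space_def)
    then have "\<exists>r. ereal r \<le> z" by (cases z) auto
    then obtain r where r: "ereal r \<le> z" by blast
    obtain K :: nat where K: "- r < real K" using reals_Archimedean2 by blast
    have "C \<subseteq> slab (Suc K)"
    proof
      fix p assume p: "p \<in> C"
      have "ereal (- real (Suc K)) \<le> ereal r" using K by simp
      also have "\<dots> \<le> snd p" using r z(2) p by (meson imageI order_trans)
      finally show "p \<in> slab (Suc K)" using p C(2) by (auto simp: slab_def state_space_def)
    qed
    then show ?thesis using C(3) by (intro exI[of _ "Suc K"]) auto
  qed
qed

text \<open>Uniform continuity without a metric on the extended heights: a sequence of counterexamples has a
  convergent subsequence in a compact slab, and both of its members converge to the same point.\<close>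

lemma oscillation_on_cells:
  fixes f :: "(real ^ 'd::finite) \<times> ereal \<Rightarrow> real"
  assumes f: "f \<in> compact_support_functions state_space" and e: "e > 0"
  shows "\<exists>m0. \<forall>m\<ge>m0. \<forall>q\<in>cell_index m. \<forall>x\<in>cell m q. \<forall>y\<in>cell m q. \<bar>f x - f y\<bar> \<le> e"
proof (rule ccontr)
  assume "\<not> ?thesis"
  then have "\<forall>m0. \<exists>m q x y. m \<ge> m0 \<and> q \<in> cell_index m \<and> x \<in> cell m q \<and> y \<in> cell m q \<and> e < \<bar>f x - f y\<bar>"
    by (meson not_le)
  then obtain m q x y where mq: "\<And>n. m n \<ge> n" "\<And>n. q n \<in> cell_index (m n)"
    "\<And>n. x n \<in> cell (m n) (q n)" "\<And>n. y n \<in> cell (m n) (q n)" "\<And>n. e < \<bar>f (x n) - f (y n)\<bar>"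
    by metis
  obtain K where K: "K > 0" "\<forall>x\<in>state_space - slab K. f x = 0" using compact_support_in_slab[OF f] by blast
  have xslab: "x n \<in> slab K" if n: "n \<ge> K" for n
  proof -
    have "x n \<in> state_space" "y n \<in> state_space" using mq(3,4) cell_subset by blast+
    then have "x n \<in> slab K \<or> y n \<in> slab K" using K(2) mq(5)[of n] e by force
    then have "cell (m n) (q n) \<inter> slab K \<noteq> {}" using mq(3,4)[of n] by blast
    moreover have "K \<le> m n" "m n > 0" using mq(1)[of n] n K(1) by auto
    ultimately have "cell (m n) (q n) \<subseteq> slab K" using cell_Int_slab[OF _ _ mq(2)] by blast
    then show ?thesis using mq(3) by blast
  qed
  have "seq_compact (slab K :: ((real ^ 'd) \<times> ereal) set)" by (rule compact_imp_seq_compact[OF compact_slab])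
  then obtain p r where pr: "p \<in> slab K" "strict_mono r" "((\<lambda>n. x (n + K)) \<circ> r) \<longlonglongrightarrow> p"
    using xslab unfolding seq_compact_def by (metis le_add2)
  define s where "s n = r n + K" for n
  have xs: "(\<lambda>n. x (s n)) \<longlonglongrightarrow> p" using pr(3) by (simp add: o_def s_def)
  have "filterlim (\<lambda>n. m (s n)) at_top sequentially"
  proof (rule filterlim_at_top_mono[OF filterlim_ident])
    show "\<forall>\<^sub>F n in sequentially. n \<le> m (s n)"
    proof (rule always_eventually, rule allI)
      fix n show "n \<le> m (s n)" using seq_suble[OF pr(2), of n] mq(1)[of "s n"] by (simp add: s_def)
    qed
  qed
  then have ys: "(\<lambda>n. y (s n)) \<longlonglongrightarrow> p"
    by (rule same_cell_tendsto[OF xs, of _ "\<lambda>n. q (s n)"]) (rule mq)+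
  have cont: "continuous_on state_space f" using f by (simp add: compact_support_functions_def)
  have pE: "p \<in> state_space" using pr(1) slab_subset by blast
  have fx: "(\<lambda>n. f (x (s n))) \<longlonglongrightarrow> f p"
    by (rule continuous_on_tendsto_compose[OF cont xs pE]) (intro always_eventually allI subsetD[OF cell_subset mq(3)])
  have fy: "(\<lambda>n. f (y (s n))) \<longlonglongrightarrow> f p"
    by (rule continuous_on_tendsto_compose[OF cont ys pE]) (intro always_eventually allI subsetD[OF cell_subset mq(4)])
  have "(\<lambda>n. \<bar>f (x (s n)) - f (y (s n))\<bar>) \<longlonglongrightarrow> \<bar>f p - f p\<bar>"
    by (intro tendsto_intros fx fy)
  then have "\<forall>\<^sub>F n in sequentially. \<bar>f (x (s n)) - f (y (s n))\<bar> < e"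
    using e by (intro order_tendstoD(2)) auto
  then obtain n where "\<bar>f (x (s n)) - f (y (s n))\<bar> < e"
    using eventually_happens by force
  then show False using mq(5)[of "s n"] by simp
qed

section \<open>Cell counts and the vague topology\<close>

lemma radonD:
  assumes "\<mu> \<in> radon_point_measures E_space"
  shows "sets \<mu> = sets (restrict_space borel E_space)" "space \<mu> = E_space"
    and "A \<in> sets \<mu> \<Longrightarrow> emeasure \<mu> A \<in> insert \<infinity> (range of_nat)"
    and "compact K \<Longrightarrow> K \<subseteq> E_space \<Longrightarrow> emeasure \<mu> K < \<infinity>"
proof -
  show s: "sets \<mu> = sets (restrict_space borel E_space)" using assms by (simp add: radon_point_measures_def)
  then show "space \<mu> = E_space" using sets_eq_imp_space_eq[OF s] by (simp add: space_restrict_space)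
qed (use assms in \<open>auto simp: radon_point_measures_def\<close>)

lemma radon_cell_finite:
  assumes "\<mu> \<in> radon_point_measures E_space" "m > 0" "q \<in> cell_index m"
  shows "emeasure \<mu> (cell m q) < \<infinity>"
proof -
  have "emeasure \<mu> (cell m q) \<le> emeasure \<mu> (slab m)"
    using cell_subset_slab[OF assms(2,3)] slab_sets radonD(1)[OF assms(1)] by (intro emeasure_mono) auto
  also have "\<dots> < \<infinity>" by (rule radonD(4)[OF assms(1) compact_slab slab_subset])
  finally show ?thesis .
qed

text \<open>Both integrals are within \<open>e\<close> times the mass of the slab of the same sum over cells.\<close>

lemma integral_close_if_same_counts:
  fixes f :: "(real ^ 'd::finite) \<times> ereal \<Rightarrow> real"
  assumes f: "f \<in> compact_support_functions state_space"
    and K: "K \<le> m" "m > 0" "\<forall>x\<in>state_space - slab K. f x = 0"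
    and osc: "\<forall>q\<in>cell_index m. \<forall>x\<in>cell m q. \<forall>y\<in>cell m q. \<bar>f x - f y\<bar> \<le> e" and e: "e > 0"
    and \<mu>: "\<mu> \<in> radon_point_measures state_space" and \<nu>: "\<nu> \<in> radon_point_measures state_space"
    and same: "\<forall>q\<in>cell_index m. emeasure \<nu> (cell m q) = emeasure \<mu> (cell m q)"
  shows "\<bar>(\<integral>x. f x \<partial>\<nu>) - (\<integral>x. f x \<partial>\<mu>)\<bar> \<le> 2 * e * measure \<mu> (slab K)"
proof -
  define c where "c q = f (SOME x. x \<in> cell m q)" for q :: "(int ^ 'd) \<times> int"
  define h where "h x = (\<Sum>q\<in>cell_index m. c q * indicator (cell m q) x)" for x
  have h_cell: "h x = c q" if q: "q \<in> cell_index m" "x \<in> cell m q" for x q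
  proof -
    have "x \<notin> cell m q'" if "q' \<in> cell_index m - {q}" for q'
      using cells_disjoint[OF K(2)] q that unfolding disjoint_family_on_def by blast
    then have "(\<Sum>q'\<in>cell_index m - {q}. c q' * indicator (cell m q') x) = 0" by (intro sum.neutral) auto
    then show ?thesis unfolding h_def using q sum.remove[OF finite_cell_index q(1), of "\<lambda>q. c q * indicator (cell m q) x"] by simp
  qed
  have approx: "\<bar>f x - h x\<bar> \<le> e * indicator (slab K) x" if x: "x \<in> state_space" for x
  proof (cases "\<exists>q\<in>cell_index m. x \<in> cell m q")
    case True
    then obtain q where q: "q \<in> cell_index m" "x \<in> cell m q" by blast
    have some: "(SOME x. x \<in> cell m q) \<in> cell m q" using q(2) by (rule someI)
    show ?thesis
    proof (cases "x \<in> slab K")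
      case True
      have "\<bar>f x - c q\<bar> \<le> e" using osc q some unfolding c_def by blast
      then show ?thesis using True by (simp add: h_cell[OF q])
    next
      case False
      have "cell m q \<inter> slab K = {}"
        using cell_Int_slab[OF K(1,2) q(1)] q(2) False by blast
      then have "c q = 0" using some K(3) cell_subset unfolding c_def by blast
      moreover have "f x = 0" using K(3) x False by blast
      ultimately show ?thesis using False by (simp add: h_cell[OF q])
    qed
  next
    case False
    then have hx: "h x = 0" unfolding h_def by (intro sum.neutral) auto
    have "x \<notin> slab K" using False unfolding slab_eq_Union_cells[OF K(1,2)] by blast
    then show ?thesis using K(3) x hx by simp
  qed
  have main: "integrable \<kappa> f \<and> \<bar>(\<integral>x. f x \<partial>\<kappa>) - (\<Sum>q\<in>cell_index m. c q * measure \<kappa> (cell m q))\<bar> \<le> e * measure \<kappa> (slab K)"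
    if L: "\<kappa> \<in> radon_point_measures state_space" for \<kappa> :: "((real ^ 'd) \<times> ereal) measure"
  proof -
    note sets = radonD(1)[OF L] and space = radonD(2)[OF L]
    have cs: "cell m q \<in> sets \<kappa>" for q using cell_sets sets by simp
    have ss: "slab K \<in> sets \<kappa>" using slab_sets sets by simp
    have ic: "integrable \<kappa> (\<lambda>x. c q * indicator (cell m q) x)" if "q \<in> cell_index m" for q
      using cs radon_cell_finite[OF L K(2) that] by simp
    have ih: "integrable \<kappa> h" unfolding h_def[abs_def] by (intro Bochner_Integration.integrable_sum ic)
    have "emeasure \<kappa> (slab K) < \<infinity>" by (rule radonD(4)[OF L compact_slab slab_subset])
    then have isl: "integrable \<kappa> (\<lambda>x. e * indicator (slab K) x)" using ss by simp
    have "f \<in> borel_measurable (restrict_space borel state_space)"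
      using f by (intro borel_measurable_continuous_on_restrict) (simp add: compact_support_functions_def)
    then have fm: "f \<in> borel_measurable \<kappa>" using measurable_cong_sets[OF sets refl] by blast
    have id: "integrable \<kappa> (\<lambda>x. f x - h x)"
    proof (rule Bochner_Integration.integrable_bound[OF isl])
      show "(\<lambda>x. f x - h x) \<in> borel_measurable \<kappa>" using fm borel_measurable_integrable[OF ih] by measurable
      show "AE x in \<kappa>. norm (f x - h x) \<le> norm (e * indicator (slab K) x :: real)"
        using approx e space by (intro AE_I2) (simp add: abs_mult)
    qed
    have fi: "integrable \<kappa> f" using Bochner_Integration.integrable_add[OF id ih] by simp
    have "(\<integral>x. h x \<partial>\<kappa>) = (\<Sum>q\<in>cell_index m. \<integral>x. c q * indicator (cell m q) x \<partial>\<kappa>)"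
      unfolding h_def by (rule Bochner_Integration.integral_sum) (rule ic)
    also have "\<dots> = (\<Sum>q\<in>cell_index m. c q * measure \<kappa> (cell m q))"
      using cs sets.sets_into_space by (intro sum.cong refl) (simp add: Int_absorb2)
    finally have hI: "(\<integral>x. h x \<partial>\<kappa>) = (\<Sum>q\<in>cell_index m. c q * measure \<kappa> (cell m q))" .
    have "\<bar>(\<integral>x. f x \<partial>\<kappa>) - (\<integral>x. h x \<partial>\<kappa>)\<bar> = \<bar>\<integral>x. f x - h x \<partial>\<kappa>\<bar>"
      by (simp add: Bochner_Integration.integral_diff[OF fi ih])
    also have "\<dots> \<le> (\<integral>x. \<bar>f x - h x\<bar> \<partial>\<kappa>)" by (rule integral_abs_bound)
    also have "\<dots> \<le> (\<integral>x. e * indicator (slab K) x \<partial>\<kappa>)"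
      using approx space by (intro integral_mono isl integrable_abs[OF id]) auto
    also have "\<dots> = e * measure \<kappa> (slab K)" using ss sets.sets_into_space by (simp add: Int_absorb2)
    finally show ?thesis using fi hI by simp
  qed
  have slab_same: "emeasure \<nu> (slab K) = emeasure \<mu> (slab K)"
  proof -
    let ?I = "{q \<in> cell_index m. - (int K * int m) \<le> snd q}"
    have u: "emeasure \<kappa> (slab K) = (\<Sum>q\<in>?I. emeasure \<kappa> (cell m q))"
      if L: "\<kappa> \<in> radon_point_measures state_space" for \<kappa> :: "((real ^ 'd) \<times> ereal) measure"
      unfolding slab_eq_Union_cells[OF K(1,2)]
    proof (rule sum_emeasure[symmetric])
      show "disjoint_family_on (cell m) ?I"
        by (rule disjoint_family_on_mono[OF _ cells_disjoint[OF K(2)]]) auto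
      show "cell m ` ?I \<subseteq> sets \<kappa>" using cell_sets radonD(1)[OF L] by auto
    qed (rule finite_subset[OF _ finite_cell_index], auto)
    show ?thesis unfolding u[OF \<mu>] u[OF \<nu>] using same by (intro sum.cong) auto
  qed
  have "(\<Sum>q\<in>cell_index m. c q * measure \<nu> (cell m q)) = (\<Sum>q\<in>cell_index m. c q * measure \<mu> (cell m q))"
    using same by (intro sum.cong refl) (simp add: measure_def)
  moreover have "e * measure \<nu> (slab K) = e * measure \<mu> (slab K)" using slab_same by (simp add: measure_def)
  moreover have "2 * e * measure \<mu> (slab K) = e * measure \<mu> (slab K) + e * measure \<mu> (slab K)" by simp
  ultimately show ?thesis using conjunct2[OF main[OF \<mu>]] conjunct2[OF main[OF \<nu>]] by linarith
qed

definition same_counts :: "nat \<Rightarrow> ((real ^ 'd::finite) \<times> ereal) measure \<Rightarrow> ((real ^ 'd) \<times> ereal) measure set" where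
  "same_counts m \<mu> = {\<nu> \<in> radon_point_measures state_space. \<forall>q\<in>cell_index m. emeasure \<nu> (cell m q) = emeasure \<mu> (cell m q)}"

text \<open>It suffices to treat the generating sets of the topology, because the claim is preserved by finite
  intersections and arbitrary unions.\<close>

lemma count_neighbourhood:
  fixes \<mu> :: "((real ^ 'd::finite) \<times> ereal) measure"
  assumes G: "openin (vague_topology state_space) G" and \<mu>: "\<mu> \<in> G" "\<mu> \<in> radon_point_measures state_space"
  shows "\<exists>m0. \<forall>m\<ge>m0. same_counts m \<mu> \<subseteq> G"
proof -
  have "generate_topology_on {{\<mu> \<in> radon_point_measures state_space. (\<integral>x. f x \<partial>\<mu>) \<in> U} |f U.
      f \<in> compact_support_functions (state_space :: ((real ^ 'd) \<times> ereal) set) \<and> open U} G"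
    using G unfolding vague_topology_def by (rule openin_topology_generated_by)
  then show ?thesis using \<mu>(1)
  proof induction
    case (Int a b)
    then obtain m1 m2 where "\<forall>m\<ge>m1. same_counts m \<mu> \<subseteq> a" "\<forall>m\<ge>m2. same_counts m \<mu> \<subseteq> b" by auto
    then show ?case by (intro exI[of _ "max m1 m2"]) auto
  next
    case (UN \<K>)
    then obtain k where "k \<in> \<K>" "\<mu> \<in> k" by blast
    with UN.IH[of k] show ?case by blast
  next
    case (Basis s)
    then obtain f U where s: "s = {\<mu> \<in> radon_point_measures state_space. (\<integral>x. f x \<partial>\<mu>) \<in> U}"
      and f: "f \<in> compact_support_functions (state_space :: ((real ^ 'd) \<times> ereal) set)" and U: "open U" by blast
    have "(\<integral>x. f x \<partial>\<mu>) \<in> U" using Basis(2) s by simp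
    then obtain r where r: "r > 0" "\<And>y. dist y (\<integral>x. f x \<partial>\<mu>) < r \<Longrightarrow> y \<in> U"
      using U unfolding open_dist by blast
    obtain K where K: "K > 0" "\<forall>x\<in>state_space - slab K. f x = 0" using compact_support_in_slab[OF f] by blast
    define B where "B = measure \<mu> (slab K)"
    have B: "B \<ge> 0" by (simp add: B_def)
    define e where "e = r / (2 * (B + 1))"
    have e: "e > 0" using r B by (simp add: e_def)
    have eB: "2 * e * B < r"
    proof -
      have "2 * e * B < 2 * e * (B + 1)" using e by simp
      also have "\<dots> = e * (2 * (B + 1))" by simp
      also have "\<dots> = r"
        unfolding e_def by (rule nonzero_eq_divide_eq[THEN iffD1, OF _ refl]) (use B in simp)
      finally show ?thesis .
    qed
    obtain m0 where m0: "\<forall>m\<ge>m0. \<forall>q\<in>cell_index m. \<forall>x\<in>cell m q. \<forall>y\<in>cell m q. \<bar>f x - f y\<bar> \<le> e"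
      using oscillation_on_cells[OF f e] by blast
    have "same_counts m \<mu> \<subseteq> s" if m: "m \<ge> max m0 K" for m
    proof
      fix \<nu> assume \<nu>: "\<nu> \<in> same_counts m \<mu>"
      have km: "K \<le> m" "0 < m" "m0 \<le> m" using m K(1) by auto
      have osc: "\<forall>q\<in>cell_index m. \<forall>x\<in>cell m q. \<forall>y\<in>cell m q. \<bar>f x - f y\<bar> \<le> e" using m0 km(3) by blast
      have \<nu>': "\<nu> \<in> radon_point_measures state_space" "\<forall>q\<in>cell_index m. emeasure \<nu> (cell m q) = emeasure \<mu> (cell m q)"
        using \<nu> by (simp_all add: same_counts_def)
      have "\<bar>(\<integral>x. f x \<partial>\<nu>) - (\<integral>x. f x \<partial>\<mu>)\<bar> \<le> 2 * e * measure \<mu> (slab K)"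
        by (rule integral_close_if_same_counts[OF f km(1,2) K(2) osc e \<mu>(2) \<nu>'])
      then have "(\<integral>x. f x \<partial>\<nu>) \<in> U" using eB by (intro r(2)) (simp add: dist_real_def B_def)
      then show "\<nu> \<in> s" using \<nu> by (simp add: s same_counts_def)
    qed
    then show ?case by blast
  qed simp
qed

lemma zero_compact_support: "(\<lambda>_. 0) \<in> compact_support_functions E"
  by (auto simp: compact_support_functions_def intro!: exI[of _ "{}"])

lemma topspace_vague [simp]: "topspace (vague_topology E) = radon_point_measures E"
proof -
  have "{\<mu> \<in> radon_point_measures E. (\<integral>x. 0 \<partial>\<mu>) \<in> (UNIV :: real set)} = radon_point_measures E" by simp
  then show ?thesis
    unfolding vague_topology_def topology_generated_by_topspace
    using zero_compact_support[of E] by (auto intro!: exI[of _ "\<lambda>_. 0"] exI[of _ UNIV])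
qed

lemma space_borel_of [simp]: "space (borel_of T) = topspace T"
  unfolding borel_of_def by (rule space_measure_of) (auto dest: openin_subset)

lemma sets_borel_of_open: "openin T U \<Longrightarrow> U \<in> sets (borel_of T)"
  unfolding borel_of_def by (subst sets_measure_of) (auto dest: openin_subset)

lemma continuous_map_borel_measurable:
  fixes F :: "'a \<Rightarrow> real"
  assumes "continuous_map T euclideanreal F"
  shows "F \<in> borel_measurable (borel_of T)"
proof (rule borel_measurableI)
  fix S :: "real set" assume "open S"
  then have "openin T {x \<in> topspace T. F x \<in> S}"
    using openin_continuous_map_preimage[OF assms] by simp
  moreover have "F -` S \<inter> space (borel_of T) = {x \<in> topspace T. F x \<in> S}" by auto
  ultimately show "F -` S \<inter> space (borel_of T) \<in> sets (borel_of T)" by (simp add: sets_borel_of_open)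
qed

lemma measurable_borel_ofI:
  assumes "\<And>\<omega>. \<omega> \<in> space M \<Longrightarrow> X \<omega> \<in> topspace T"
    and "\<And>U. openin T U \<Longrightarrow> {\<omega> \<in> space M. X \<omega> \<in> U} \<in> sets M"
  shows "X \<in> M \<rightarrow>\<^sub>M borel_of T"
  unfolding borel_of_def
proof (rule measurable_measure_of)
  show "{U. openin T U} \<subseteq> Pow (topspace T)" by (auto dest: openin_subset)
  show "X \<in> space M \<rightarrow> topspace T" using assms(1) by blast
  fix U assume "U \<in> {U. openin T U}"
  then have "{\<omega> \<in> space M. X \<omega> \<in> U} \<in> sets M" using assms(2) by blast
  moreover have "X -` U \<inter> space M = {\<omega> \<in> space M. X \<omega> \<in> U}" by auto
  ultimately show "X -` U \<inter> space M \<in> sets M" by simp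
qed

section \<open>The extremal process as a random element\<close>

lemma sum_of_point_masses_eq_distr:
  assumes "finite I" "\<And>i. i \<in> I \<Longrightarrow> x i \<in> E"
  shows "sum_of_point_masses E I x = distr (count_space I) (restrict_space borel E) x"
proof (rule measure_eqI)
  have sp: "space (restrict_space borel E) = E" by (simp add: space_restrict_space)
  have sb: "sets (restrict_space borel E) \<subseteq> Pow E" using sets.space_closed[of "restrict_space borel E"] sp by simp
  have sets: "sets (sum_of_point_masses E I x) = sets (restrict_space borel E)"
    unfolding sum_of_point_masses_def sets_measure_of[OF sb]
    using sets.sigma_sets_eq[of "restrict_space borel E"] sp by simp
  show "sets (sum_of_point_masses E I x) = sets (distr (count_space I) (restrict_space borel E) x)"
    using sets by simp
  fix A assume "A \<in> sets (sum_of_point_masses E I x)"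
  then have A: "A \<in> sets (restrict_space borel E)" using sets by simp
  have xm: "x \<in> count_space I \<rightarrow>\<^sub>M restrict_space borel E" using assms(2) sp by auto
  have "emeasure (distr (count_space I) (restrict_space borel E) x) A = emeasure (count_space I) (x -` A \<inter> I)"
    using emeasure_distr[OF xm A] by simp
  also have "\<dots> = of_nat (card (x -` A \<inter> I))" using assms(1) by (subst emeasure_count_space_finite) auto
  also have "\<dots> = (\<Sum>i\<in>I. indicator A (x i))"
    using assms(1) by (simp add: indicator_def sum.If_cases Int_commute vimage_def Collect_conj_eq)
  finally show "emeasure (sum_of_point_masses E I x) A = emeasure (distr (count_space I) (restrict_space borel E) x) A"
    using emeasure_sum_of_point_masses[OF A] by simp
qed

lemma emeasure_sum_of_point_masses_card:
  assumes "finite I" "A \<in> sets (restrict_space borel E)"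
  shows "emeasure (sum_of_point_masses E I x) A = of_nat (card {i \<in> I. x i \<in> A})"
  unfolding emeasure_sum_of_point_masses[OF assms(2)]
  using assms(1) by (simp add: indicator_def sum.If_cases Collect_conj_eq)

lemma sum_of_point_masses_radon:
  fixes E :: "'a::t2_space set"
  assumes "finite I" "\<And>i. i \<in> I \<Longrightarrow> x i \<in> E"
  shows "sum_of_point_masses E I x \<in> radon_point_measures E"
proof -
  have sets: "sets (sum_of_point_masses E I x) = sets (restrict_space borel E)"
    by (simp add: sum_of_point_masses_eq_distr[OF assms])
  have "emeasure (sum_of_point_masses E I x) K < \<infinity>" if "compact K" "K \<subseteq> E" for K
  proof -
    have "K \<in> sets (restrict_space borel E)"
      using that borel_closed[OF compact_imp_closed[OF that(1)]] by (auto simp: sets_restrict_space)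
    then show ?thesis by (simp add: emeasure_sum_of_point_masses_card[OF assms(1)] of_nat_less_top)
  qed
  then show ?thesis
    unfolding radon_point_measures_def using sets assms(1) by (auto simp: emeasure_sum_of_point_masses_card)
qed

lemma integral_sum_of_point_masses:
  fixes f :: "'a::topological_space \<Rightarrow> real"
  assumes "finite I" "\<And>i. i \<in> I \<Longrightarrow> x i \<in> E" "continuous_on E f"
  shows "(\<integral>y. f y \<partial>sum_of_point_masses E I x) = (\<Sum>i\<in>I. f (x i))"
proof -
  have "x \<in> count_space I \<rightarrow>\<^sub>M restrict_space borel E" using assms(2) by (auto simp: space_restrict_space)
  moreover have "f \<in> borel_measurable (restrict_space borel E)" by (rule borel_measurable_continuous_on_restrict[OF assms(3)])
  ultimately have "(\<integral>y. f y \<partial>distr (count_space I) (restrict_space borel E) x) = (\<integral>i. f (x i) \<partial>count_space I)"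
    by (rule integral_distr)
  also have "\<dots> = (\<Sum>i\<in>I. f (x i))" by (rule lebesgue_integral_count_space_finite[OF assms(1)])
  finally show ?thesis by (simp only: sum_of_point_masses_eq_distr[OF assms(1,2)])
qed

lemma lattice_point_in_cube:
  assumes "\<alpha> \<in> lattice_box n"
  shows "(\<chi> i. real_of_int (\<alpha> $ i) / real n) \<in> cbox 0 (1 :: real ^ 'd::finite)"
proof -
  have "0 \<le> real_of_int (\<alpha> $ i) / real n \<and> real_of_int (\<alpha> $ i) / real n \<le> 1" for i
  proof -
    have "0 \<le> \<alpha> $ i" "\<alpha> $ i \<le> int n - 1" using assms by (auto simp: lattice_box_def)
    then show ?thesis by (auto simp: divide_le_eq_1)
  qed
  then show ?thesis by (simp add: mem_box_cart)
qed

lemma extremal_point_in_space: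
  "\<alpha> \<in> lattice_box n \<Longrightarrow> ((\<chi> i. real_of_int (\<alpha> $ i) / real n), ereal y) \<in> E_space"
  using lattice_point_in_cube[of \<alpha> n] by (auto simp: state_space_def)

text \<open>The process is a continuous function of the field in the product topology, since integrals of continuous
  functions are finite sums of continuous functions of the coordinates.  The index set being countable,
  the product Borel sets are those generated by the coordinates.\<close>

lemma extremal_process_measurable:
  fixes \<phi> :: "int ^ 'd::finite \<Rightarrow> 'w \<Rightarrow> real"
  assumes fin: "finite (lattice_box n :: (int ^ 'd) set)" and \<phi>: "\<And>\<alpha>. \<phi> \<alpha> \<in> borel_measurable M"
  shows "extremal_process \<phi> n \<in> M \<rightarrow>\<^sub>M borel_of (vague_topology state_space)"
proof -
  define a where "a = scaling (green (0 :: int ^ 'd) 0) (real (n ^ CARD('d)))"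
  define b where "b = centering (green (0 :: int ^ 'd) 0) (real (n ^ CARD('d)))"
  define pt where "pt x \<alpha> = ((\<chi> i. real_of_int (\<alpha> $ i) / real n) :: real ^ 'd, ereal ((x \<alpha> - b) / a))" for x :: "int ^ 'd \<Rightarrow> real" and \<alpha>
  define \<Psi> where "\<Psi> x = sum_of_point_masses state_space (lattice_box n) (pt x)" for x
  have ep: "extremal_process \<phi> n \<omega> = \<Psi> (\<lambda>\<alpha>. \<phi> \<alpha> \<omega>)" for \<omega>
    by (simp add: extremal_process_def Let_def \<Psi>_def pt_def[abs_def] a_def b_def)
  have ptE: "pt x \<alpha> \<in> state_space" if "\<alpha> \<in> lattice_box n" for x \<alpha>
    unfolding pt_def by (rule extremal_point_in_space[OF that])
  have radon: "\<Psi> x \<in> radon_point_measures state_space" for x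
    unfolding \<Psi>_def by (rule sum_of_point_masses_radon[OF fin ptE])
  have op: "open {x. \<Psi> x \<in> G}" if "openin (vague_topology state_space) G" for G
  proof -
    have "generate_topology_on {{\<mu> \<in> radon_point_measures state_space. (\<integral>x. f x \<partial>\<mu>) \<in> U} |f U.
        f \<in> compact_support_functions (state_space :: ((real ^ 'd) \<times> ereal) set) \<and> open U} G"
      using that unfolding vague_topology_def by (rule openin_topology_generated_by)
    then show ?thesis
    proof induction
      case (Int a b)
      then show ?case by (simp add: Collect_conj_eq open_Int)
    next
      case (UN K)
      have "{x. \<Psi> x \<in> \<Union>K} = (\<Union>k\<in>K. {x. \<Psi> x \<in> k})" by auto
      then show ?case using UN.IH by (simp add: open_UN)
    next
      case (Basis s)
      then obtain f U where s: "s = {\<mu> \<in> radon_point_measures state_space. (\<integral>x. f x \<partial>\<mu>) \<in> U}"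
        and f: "f \<in> compact_support_functions (state_space :: ((real ^ 'd) \<times> ereal) set)" and U: "open U" by blast
      have cf: "continuous_on state_space f" using f by (simp add: compact_support_functions_def)
      have "{x. \<Psi> x \<in> s} = (\<lambda>x. \<Sum>\<alpha>\<in>lattice_box n. f (pt x \<alpha>)) -` U"
        using radon integral_sum_of_point_masses[OF fin ptE cf] by (auto simp: s \<Psi>_def)
      moreover have "continuous_on UNIV (\<lambda>x. \<Sum>\<alpha>\<in>lattice_box n. f (pt x \<alpha>))"
      proof (rule continuous_on_sum)
        fix \<alpha> :: "int ^ 'd" assume \<alpha>: "\<alpha> \<in> lattice_box n"
        have "continuous_on UNIV (\<lambda>x :: int ^ 'd \<Rightarrow> real. pt x \<alpha>)"
        proof -
          have "pt x \<alpha> = ((\<chi> i. real_of_int (\<alpha> $ i) / real n), ereal ((x \<alpha> - b) * inverse a))" for x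
            by (simp add: pt_def divide_inverse)
          then show ?thesis
            by (simp only:) (intro continuous_intros continuous_on_ereal continuous_on_product_coordinates)
        qed
        then show "continuous_on UNIV (\<lambda>x. f (pt x \<alpha>))"
          by (rule continuous_on_compose2[OF cf]) (use ptE[OF \<alpha>] in auto)
      qed
      ultimately show ?case using U by (simp add: open_vimage)
    qed simp
  qed
  have meas: "(\<lambda>\<omega> \<alpha>. \<phi> \<alpha> \<omega>) \<in> M \<rightarrow>\<^sub>M (borel :: (int ^ 'd \<Rightarrow> real) measure)"
  proof -
    have "(\<lambda>\<omega> \<alpha>. \<phi> \<alpha> \<omega>) \<in> M \<rightarrow>\<^sub>M Pi\<^sub>M (UNIV :: (int ^ 'd) set) (\<lambda>_. borel)"
      by (rule measurable_PiM_single') (auto simp: \<phi>)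
    then show ?thesis by (simp add: measurable_cong_sets[OF refl sets_PiM_equal_borel])
  qed
  show ?thesis
  proof (rule measurable_borel_ofI)
    show "extremal_process \<phi> n \<omega> \<in> topspace (vague_topology state_space)" for \<omega> by (simp add: ep radon)
    fix G assume "openin (vague_topology (state_space :: ((real ^ 'd) \<times> ereal) set)) G"
    then have "{x. \<Psi> x \<in> G} \<in> sets borel" by (intro borel_open op)
    from measurable_sets[OF meas this] show "{\<omega> \<in> space M. extremal_process \<phi> n \<omega> \<in> G} \<in> sets M"
      by (simp add: ep vimage_def Int_def conj_commute)
  qed
qed

section \<open>Convergence in distribution from cell counts\<close>

text \<open>The count vector as an extensional function, so that there are only countably many values.\<close>

definition cell_counts :: "nat \<Rightarrow> ((real ^ 'd::finite) \<times> ereal) measure \<Rightarrow> ((int ^ 'd) \<times> int \<Rightarrow> nat)" where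
  "cell_counts m \<mu> = (\<lambda>q\<in>cell_index m. SOME k. emeasure \<mu> (cell m q) = of_nat k)"

lemma emeasure_cell_counts:
  assumes "\<mu> \<in> radon_point_measures E_space" "m > 0" "q \<in> cell_index m"
  shows "emeasure \<mu> (cell m q) = of_nat (cell_counts m \<mu> q)"
proof -
  have "cell m q \<in> sets \<mu>" using cell_sets radonD(1)[OF assms(1)] by simp
  then have "emeasure \<mu> (cell m q) \<in> insert \<infinity> (range of_nat)" by (rule radonD(3)[OF assms(1)])
  moreover have "emeasure \<mu> (cell m q) \<noteq> \<infinity>" using radon_cell_finite[OF assms] by simp
  ultimately have "\<exists>k. emeasure \<mu> (cell m q) = of_nat k" by auto
  then have "emeasure \<mu> (cell m q) = of_nat (SOME k. emeasure \<mu> (cell m q) = of_nat k)" by (rule someI_ex)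
  then show ?thesis using assms(3) by (simp add: cell_counts_def)
qed

lemma cell_counts_eq_iff:
  assumes "\<mu> \<in> radon_point_measures E_space" "m > 0" "w \<in> Pi\<^sub>E (cell_index m) (\<lambda>_. UNIV)"
  shows "cell_counts m \<mu> = w \<longleftrightarrow> (\<forall>q\<in>cell_index m. emeasure \<mu> (cell m q) = of_nat (w q))"
proof
  assume "\<forall>q\<in>cell_index m. emeasure \<mu> (cell m q) = of_nat (w q)"
  then have "cell_counts m \<mu> q = w q" if "q \<in> cell_index m" for q
    using emeasure_cell_counts[OF assms(1,2) that] that by simp
  then show "cell_counts m \<mu> = w"
    using assms(3) by (intro extensionalityI[of _ "cell_index m"]) (auto simp: cell_counts_def PiE_def)
qed (use emeasure_cell_counts[OF assms(1,2)] in auto)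

lemma same_counts_if_cell_counts_eq:
  assumes "\<mu> \<in> radon_point_measures E_space" "\<nu> \<in> radon_point_measures E_space" "m > 0"
    and "cell_counts m \<mu> = cell_counts m \<nu>"
  shows "\<nu> \<in> same_counts m \<mu>"
  using assms emeasure_cell_counts[OF assms(1,3)] emeasure_cell_counts[OF assms(2,3)]
  by (simp add: same_counts_def)

text \<open>Split according to the value of the count vector: on the finitely many values in \<open>W\<close> the function
  \<open>F\<close> is within \<open>e\<close> of a constant, and on the remaining event it is bounded by \<open>B\<close>.\<close>

lemma expectation_cell_approximation:
  fixes Z :: "'w \<Rightarrow> ((real ^ 'd::finite) \<times> ereal) measure" and F :: "_ \<Rightarrow> real"
  assumes M: "prob_space M" and Z: "Z \<in> M \<rightarrow>\<^sub>M borel_of (vague_topology state_space)"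
    and F: "F \<in> borel_measurable (borel_of (vague_topology state_space))"
    and B: "\<And>\<mu>. \<mu> \<in> radon_point_measures state_space \<Longrightarrow> \<bar>F \<mu>\<bar> \<le> B" "B \<ge> 0"
    and W: "finite W" and e: "e \<ge> 0"
    and osc: "\<And>w \<mu>. w \<in> W \<Longrightarrow> \<mu> \<in> radon_point_measures state_space \<Longrightarrow> cell_counts m \<mu> = w \<Longrightarrow> \<bar>F \<mu> - g w\<bar> \<le> e"
    and ev: "\<And>w. w \<in> W \<Longrightarrow> {\<omega> \<in> space M. cell_counts m (Z \<omega>) = w} \<in> sets M"
  defines "p \<equiv> \<lambda>w. measure M {\<omega> \<in> space M. cell_counts m (Z \<omega>) = w}"
  shows "\<bar>(\<integral>\<omega>. F (Z \<omega>) \<partial>M) - (\<Sum>w\<in>W. g w * p w)\<bar> \<le> e + B * (1 - (\<Sum>w\<in>W. p w))"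
proof -
  interpret prob_space M by fact
  let ?A = "\<lambda>w. {\<omega> \<in> space M. cell_counts m (Z \<omega>) = w}"
  have Zr: "Z \<omega> \<in> radon_point_measures state_space" if "\<omega> \<in> space M" for \<omega>
    using measurable_space[OF Z that] by simp
  have FZ: "(\<lambda>\<omega>. F (Z \<omega>)) \<in> borel_measurable M" by (rule measurable_compose[OF Z F])
  have iFZ: "integrable M (\<lambda>\<omega>. F (Z \<omega>))"
    by (rule integrable_const_bound[where B = B]) (use B Zr FZ in auto)
  define h where "h \<omega> = (\<Sum>w\<in>W. g w * indicator (?A w) \<omega>)" for \<omega>
  define u where "u \<omega> = e + B * (1 - (\<Sum>w\<in>W. indicator (?A w) \<omega>))" for \<omega>
  have ii: "integrable M (\<lambda>\<omega>. indicator (?A w) \<omega> :: real)" if "w \<in> W" for w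
    using ev[OF that] by (intro integrable_real_indicator) (auto simp: emeasure_eq_measure)
  have ih: "integrable M h" unfolding h_def[abs_def]
    by (intro Bochner_Integration.integrable_sum integrable_mult_right ii)
  have iu: "integrable M u" unfolding u_def[abs_def]
    by (intro Bochner_Integration.integrable_add Bochner_Integration.integrable_diff integrable_mult_right
        Bochner_Integration.integrable_sum ii) auto
  have hint: "(\<integral>\<omega>. h \<omega> \<partial>M) = (\<Sum>w\<in>W. g w * p w)"
    unfolding h_def p_def using ii ev
    by (subst Bochner_Integration.integral_sum) (auto intro!: integrable_mult_right)
  have uint: "(\<integral>\<omega>. u \<omega> \<partial>M) = e + B * (1 - (\<Sum>w\<in>W. p w))"
  proof -
    have s: "(\<integral>\<omega>. (\<Sum>w\<in>W. indicator (?A w) \<omega>) \<partial>M) = (\<Sum>w\<in>W. p w)"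
      unfolding p_def using ii ev by (subst Bochner_Integration.integral_sum) auto
    have isum: "integrable M (\<lambda>\<omega>. \<Sum>w\<in>W. indicator (?A w) \<omega> :: real)" by (intro Bochner_Integration.integrable_sum ii)
    show ?thesis unfolding u_def using isum s by (simp add: prob_space)
  qed
  have ptw: "\<bar>F (Z \<omega>) - h \<omega>\<bar> \<le> u \<omega>" if \<omega>: "\<omega> \<in> space M" for \<omega>
  proof (cases "cell_counts m (Z \<omega>) \<in> W")
    case True
    let ?w = "cell_counts m (Z \<omega>)"
    have "h \<omega> = (\<Sum>w\<in>W. if w = ?w then g ?w else 0)"
      unfolding h_def using \<omega> by (intro sum.cong) (auto simp: indicator_def)
    then have hw: "h \<omega> = g ?w" using True W by simp
    have "(\<Sum>w\<in>W. indicator (?A w) \<omega> :: real) = (\<Sum>w\<in>W. if w = ?w then 1 else 0)"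
      using \<omega> by (intro sum.cong) (auto simp: indicator_def)
    then have "u \<omega> = e" unfolding u_def using True W by simp
    then show ?thesis using osc[OF True Zr[OF \<omega>] refl] hw by simp
  next
    case False
    have "h \<omega> = 0" unfolding h_def using False by (intro sum.neutral) (auto simp: indicator_def)
    moreover have "(\<Sum>w\<in>W. indicator (?A w) \<omega> :: real) = 0"
      using False by (intro sum.neutral) (auto simp: indicator_def)
    ultimately show ?thesis using B(1)[OF Zr[OF \<omega>]] e by (simp add: u_def)
  qed
  have "\<bar>(\<integral>\<omega>. F (Z \<omega>) \<partial>M) - (\<integral>\<omega>. h \<omega> \<partial>M)\<bar> = \<bar>\<integral>\<omega>. F (Z \<omega>) - h \<omega> \<partial>M\<bar>"
    by (simp add: Bochner_Integration.integral_diff[OF iFZ ih])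
  also have "\<dots> \<le> (\<integral>\<omega>. \<bar>F (Z \<omega>) - h \<omega>\<bar> \<partial>M)" by (rule integral_abs_bound)
  also have "\<dots> \<le> (\<integral>\<omega>. u \<omega> \<partial>M)"
    by (intro integral_mono iu integrable_abs Bochner_Integration.integrable_diff iFZ ih ptw)
  finally show ?thesis by (simp only: hint uint)
qed

text \<open>Call a count vector good if \<open>F\<close> varies by at most \<open>e\<close> among the measures that have it.  By
  \<open>count_neighbourhood\<close>, the vector of the limit at each outcome is good from some level on, so at some level \<open>m\<close> it is good with
  probability close to one.  The vectors being countable, finitely many good ones carry nearly all the mass
  of the limit, hence eventually of the approximating laws as well.\<close>

lemma convergence_from_cell_counts:
  fixes X :: "nat \<Rightarrow> 'w \<Rightarrow> ((real ^ 'd::finite) \<times> ereal) measure" and Y :: "'p \<Rightarrow> ((real ^ 'd) \<times> ereal) measure"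
  assumes M: "prob_space M" and P: "prob_space P"
    and X: "\<And>n. X n \<in> M \<rightarrow>\<^sub>M borel_of (vague_topology state_space)"
    and Y: "Y \<in> P \<rightarrow>\<^sub>M borel_of (vague_topology state_space)"
    and evX: "\<And>n m q. m > 0 \<Longrightarrow> q \<in> cell_index m \<Longrightarrow> (\<lambda>\<omega>. emeasure (X n \<omega>) (cell m q)) \<in> borel_measurable M"
    and evY: "\<And>m q. m > 0 \<Longrightarrow> q \<in> cell_index m \<Longrightarrow> (\<lambda>\<omega>. emeasure (Y \<omega>) (cell m q)) \<in> borel_measurable P"
    and lim: "\<And>m w. m > 0 \<Longrightarrow> (\<lambda>n. measure M {\<omega> \<in> space M. \<forall>q\<in>cell_index m. emeasure (X n \<omega>) (cell m q) = of_nat (w q)})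
      \<longlonglongrightarrow> measure P {\<omega> \<in> space P. \<forall>q\<in>cell_index m. emeasure (Y \<omega>) (cell m q) = of_nat (w q)}"
  shows "converges_in_distribution (vague_topology state_space) M X P Y"
  unfolding converges_in_distribution_def
proof (intro conjI allI impI X Y)
  let ?T = "vague_topology (state_space :: ((real ^ 'd) \<times> ereal) set)"
  let ?R = "radon_point_measures (state_space :: ((real ^ 'd) \<times> ereal) set)"
  fix F :: "((real ^ 'd) \<times> ereal) measure \<Rightarrow> real"
  assume "continuous_map ?T euclideanreal F \<and> bounded (F ` topspace ?T)"
  then have Fc: "continuous_map ?T euclideanreal F" and "bounded (F ` ?R)" by auto
  then obtain B where B: "B > 0" "\<And>\<mu>. \<mu> \<in> ?R \<Longrightarrow> \<bar>F \<mu>\<bar> \<le> B" unfolding bounded_pos by auto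
  have Fm: "F \<in> borel_measurable (borel_of ?T)" by (rule continuous_map_borel_measurable[OF Fc])
  interpret M: prob_space M by fact
  interpret P: prob_space P by fact
  have Xr: "X n \<omega> \<in> ?R" if "\<omega> \<in> space M" for n \<omega> using measurable_space[OF X that] by simp
  have Yr: "Y \<omega> \<in> ?R" if "\<omega> \<in> space P" for \<omega> using measurable_space[OF Y that] by simp
  let ?V = "\<lambda>m. Pi\<^sub>E (cell_index m) (\<lambda>_. UNIV :: nat set) :: ((int ^ 'd) \<times> int \<Rightarrow> nat) set"
  have countV: "countable (?V m)" for m by (intro countable_PiE finite_cell_index) auto
  have ccV: "cell_counts m \<mu> \<in> ?V m" for m and \<mu> :: "((real ^ 'd) \<times> ereal) measure" by (auto simp: cell_counts_def)
  have eqX: "{\<omega> \<in> space M. cell_counts m (X n \<omega>) = w} = {\<omega> \<in> space M. \<forall>q\<in>cell_index m. emeasure (X n \<omega>) (cell m q) = of_nat (w q)}"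
    if "m > 0" "w \<in> ?V m" for m n w
    using cell_counts_eq_iff[OF Xr that] by auto
  have eqY: "{\<omega> \<in> space P. cell_counts m (Y \<omega>) = w} = {\<omega> \<in> space P. \<forall>q\<in>cell_index m. emeasure (Y \<omega>) (cell m q) = of_nat (w q)}"
    if "m > 0" "w \<in> ?V m" for m w
    using cell_counts_eq_iff[OF Yr that] by auto
  have sX: "{\<omega> \<in> space M. cell_counts m (X n \<omega>) = w} \<in> sets M" if "m > 0" "w \<in> ?V m" for m n w
    unfolding eqX[OF that]
  proof (rule sets.sets_Collect_finite_All[OF _ finite_cell_index])
    fix q :: "(int ^ 'd) \<times> int" assume q: "q \<in> cell_index m"
    show "{\<omega> \<in> space M. emeasure (X n \<omega>) (cell m q) = of_nat (w q)} \<in> sets M"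
      using evX[OF that(1) q, of n] by measurable
  qed
  have sY: "{\<omega> \<in> space P. cell_counts m (Y \<omega>) = w} \<in> sets P" if "m > 0" "w \<in> ?V m" for m w
    unfolding eqY[OF that]
  proof (rule sets.sets_Collect_finite_All[OF _ finite_cell_index])
    fix q :: "(int ^ 'd) \<times> int" assume q: "q \<in> cell_index m"
    show "{\<omega> \<in> space P. emeasure (Y \<omega>) (cell m q) = of_nat (w q)} \<in> sets P"
      using evY[OF that(1) q] by measurable
  qed
  show "(\<lambda>n. \<integral>\<omega>. F (X n \<omega>) \<partial>M) \<longlonglongrightarrow> (\<integral>\<omega>. F (Y \<omega>) \<partial>P)"
  proof (rule LIMSEQ_I)
    fix r :: real assume r: "r > 0"
    (* The final estimate is 3 * e + 2 * B * e; e < 1 makes the set of good vectors nonempty. *)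
    define e where "e = min (1 / 4) (r / (4 + 6 * B))"
    have e: "e > 0" "e \<le> 1 / 4"
      using r B by (simp add: e_def) (simp only: e_def min.cobounded1)
    have er: "e * (4 + 6 * B) \<le> r"
    proof -
      have "e * (4 + 6 * B) \<le> r / (4 + 6 * B) * (4 + 6 * B)" using B by (intro mult_right_mono) (auto simp: e_def)
      also have "\<dots> = r" using B by simp
      finally show ?thesis .
    qed
    define Good where "Good m = {w \<in> ?V m. \<forall>\<mu>\<in>?R. \<forall>\<nu>\<in>?R. cell_counts m \<mu> = w \<and> cell_counts m \<nu> = w \<longrightarrow> \<bar>F \<mu> - F \<nu>\<bar> \<le> e}" for m
    define A where "A m = {\<omega> \<in> space P. cell_counts m (Y \<omega>) \<in> Good m}" for m
    have countG: "countable (Good m)" for m by (rule countable_subset[OF _ countV[of m]]) (auto simp: Good_def)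
    have AU: "A m = (\<Union>w\<in>Good m. {\<omega> \<in> space P. cell_counts m (Y \<omega>) = w})" for m by (auto simp: A_def)
    have sA: "A m \<in> sets P" if "m > 0" for m
      unfolding AU using sY[OF that] by (intro sets.countable_UN'[OF countG]) (auto simp: Good_def)
    have evA: "\<exists>m0. \<forall>m\<ge>m0. \<omega> \<in> A (Suc m)" if \<omega>: "\<omega> \<in> space P" for \<omega>
    proof -
      define G where "G = {\<mu> \<in> topspace ?T. F \<mu> \<in> {F (Y \<omega>) - e / 2 <..< F (Y \<omega>) + e / 2}}"
      have "openin ?T G" unfolding G_def by (rule openin_continuous_map_preimage[OF Fc]) simp
      moreover have "Y \<omega> \<in> G" using Yr[OF \<omega>] e by (simp add: G_def)
      ultimately obtain m0 where m0: "\<forall>m\<ge>m0. same_counts m (Y \<omega>) \<subseteq> G"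
        using count_neighbourhood Yr[OF \<omega>] by blast
      have "\<omega> \<in> A (Suc m)" if m: "m \<ge> m0" for m
      proof -
        have near: "\<bar>F \<mu> - F (Y \<omega>)\<bar> < e / 2" if "\<mu> \<in> ?R" "cell_counts (Suc m) \<mu> = cell_counts (Suc m) (Y \<omega>)" for \<mu>
        proof -
          have "\<mu> \<in> same_counts (Suc m) (Y \<omega>)"
            by (rule same_counts_if_cell_counts_eq[OF Yr[OF \<omega>] that(1)]) (use that in auto)
          moreover have "same_counts (Suc m) (Y \<omega>) \<subseteq> G" using m0 m by simp
          ultimately have "\<mu> \<in> G" by blast
          then have "F \<mu> \<in> {F (Y \<omega>) - e / 2 <..< F (Y \<omega>) + e / 2}" by (simp add: G_def)
          then show ?thesis by (simp only: greaterThanLessThan_iff) linarith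
        qed
        have "\<bar>F \<mu> - F \<nu>\<bar> \<le> e"
          if "\<mu> \<in> ?R" "\<nu> \<in> ?R" "cell_counts (Suc m) \<mu> = cell_counts (Suc m) (Y \<omega>)" "cell_counts (Suc m) \<nu> = cell_counts (Suc m) (Y \<omega>)" for \<mu> \<nu>
          using near[OF that(1,3)] near[OF that(2,4)] by linarith
        then have "cell_counts (Suc m) (Y \<omega>) \<in> Good (Suc m)" using ccV by (simp add: Good_def)
        then show ?thesis using \<omega> by (simp add: A_def)
      qed
      then show ?thesis by blast
    qed
    (* The vector is good at all levels beyond k. *)
    define D where "D k = (\<Inter>m\<in>{k..}. A (Suc m))" for k
    have sD: "D k \<in> sets P" for k unfolding D_def by (intro sets.countable_INT') (auto intro: sA)
    have "incseq D" unfolding D_def by (intro monoI) (auto intro!: INT_anti_mono)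
    moreover have "range D \<subseteq> sets P" using sD by blast
    ultimately have "(\<lambda>k. P.prob (D k)) \<longlonglongrightarrow> P.prob (\<Union>k. D k)"
      by (intro P.finite_Lim_measure_incseq)
    moreover have "(\<Union>k. D k) = space P"
    proof
      show "(\<Union>k. D k) \<subseteq> space P" using sD sets.sets_into_space by blast
      show "space P \<subseteq> (\<Union>k. D k)"
      proof
        fix \<omega> assume "\<omega> \<in> space P"
        then obtain m0 where "\<forall>m\<ge>m0. \<omega> \<in> A (Suc m)" using evA by blast
        then show "\<omega> \<in> (\<Union>k. D k)" unfolding D_def by blast
      qed
    qed
    ultimately have "(\<lambda>k. P.prob (D k)) \<longlonglongrightarrow> 1" by (simp add: P.prob_space)
    then have "\<forall>\<^sub>F k in sequentially. 1 - e < P.prob (D k)" using e by (intro order_tendstoD(1)) auto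
    then obtain k where k: "1 - e < P.prob (D k)" using eventually_happens by force
    define m where "m = Suc k"
    have m: "m > 0" by (simp add: m_def)
    have "P.prob (D k) \<le> P.prob (A m)"
      unfolding m_def by (intro P.finite_measure_mono sA) (auto simp: D_def)
    then have pA: "1 - e < P.prob (A m)" using k by linarith
    have Gne: "Good m \<noteq> {}"
    proof
      assume "Good m = {}"
      then have "A m = {}" by (simp add: A_def)
      then show False using pA e by simp
    qed
    define U where "U j = (\<Union>i<j. {\<omega> \<in> space P. cell_counts m (Y \<omega>) = from_nat_into (Good m) i})" for j :: nat
    have GV: "from_nat_into (Good m) i \<in> ?V m" for i
      using from_nat_into[OF Gne, of i] by (simp add: Good_def)
    have "range U \<subseteq> sets P" unfolding U_def using sY[OF m GV] by auto
    moreover have "incseq U" unfolding U_def by (intro monoI UN_mono) auto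
    ultimately have "(\<lambda>j. P.prob (U j)) \<longlonglongrightarrow> P.prob (\<Union>j. U j)" by (rule P.finite_Lim_measure_incseq)
    moreover have "(\<Union>j. U j) = A m"
    proof -
      have "A m = (\<Union>w\<in>range (from_nat_into (Good m)). {\<omega> \<in> space P. cell_counts m (Y \<omega>) = w})"
        unfolding AU range_from_nat_into[OF Gne countG] ..
      then show ?thesis unfolding U_def by auto
    qed
    ultimately have "\<forall>\<^sub>F j in sequentially. 1 - e < P.prob (U j)" using pA by (intro order_tendstoD(1)) auto
    then obtain j where j: "1 - e < P.prob (U j)" using eventually_happens by force
    define W where "W = from_nat_into (Good m) ` {..<j}"
    have finW: "finite W" by (simp add: W_def)
    have WG: "W \<subseteq> Good m" unfolding W_def using from_nat_into[OF Gne] by blast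
    have WV: "w \<in> ?V m" if "w \<in> W" for w using WG that by (auto simp: Good_def)
    define pX where "pX n w = M.prob {\<omega> \<in> space M. cell_counts m (X n \<omega>) = w}" for n w
    define pY where "pY w = P.prob {\<omega> \<in> space P. cell_counts m (Y \<omega>) = w}" for w
    have "U j = (\<Union>w\<in>W. {\<omega> \<in> space P. cell_counts m (Y \<omega>) = w})" by (auto simp: U_def W_def)
    also have "P.prob \<dots> = (\<Sum>w\<in>W. pY w)"
      unfolding pY_def
      by (rule P.finite_measure_finite_Union[OF finW]) (use sY[OF m WV] in \<open>auto simp: disjoint_family_on_def\<close>)
    finally have sumY: "1 - e < (\<Sum>w\<in>W. pY w)" using j by simp
    define g where "g w = F (SOME \<mu>. \<mu> \<in> ?R \<and> cell_counts m \<mu> = w)" for w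
    (* The default value 0 for vectors without a measure keeps the bound B. *)
    define g' where "g' w = (if \<exists>\<mu>. \<mu> \<in> ?R \<and> cell_counts m \<mu> = w then g w else 0)" for w
    have osc: "\<bar>F \<mu> - g' w\<bar> \<le> e" if w: "w \<in> W" and \<mu>: "\<mu> \<in> ?R" "cell_counts m \<mu> = w" for w \<mu>
    proof -
      have ex: "\<exists>\<mu>. \<mu> \<in> ?R \<and> cell_counts m \<mu> = w" using \<mu> by blast
      then have "(SOME \<mu>. \<mu> \<in> ?R \<and> cell_counts m \<mu> = w) \<in> ?R \<and> cell_counts m (SOME \<mu>. \<mu> \<in> ?R \<and> cell_counts m \<mu> = w) = w"
        by (rule someI_ex)
      moreover have "w \<in> Good m" using WG w by blast
      ultimately have "\<bar>F \<mu> - g w\<bar> \<le> e" unfolding g_def Good_def using \<mu> by blast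
      then show ?thesis using ex by (simp add: g'_def)
    qed
    have gB: "\<bar>g' w\<bar> \<le> B" for w
    proof (cases "\<exists>\<mu>. \<mu> \<in> ?R \<and> cell_counts m \<mu> = w")
      case True
      then have "(SOME \<mu>. \<mu> \<in> ?R \<and> cell_counts m \<mu> = w) \<in> ?R" using someI_ex[OF True] by blast
      then show ?thesis using True B(2) by (simp add: g'_def g_def)
    next
      case False
      then have "g' w = 0" unfolding g'_def by (rule if_not_P)
      then show ?thesis using B(1) by simp
    qed
    have apX: "\<bar>(\<integral>\<omega>. F (X n \<omega>) \<partial>M) - (\<Sum>w\<in>W. g' w * pX n w)\<bar> \<le> e + B * (1 - (\<Sum>w\<in>W. pX n w))" for n
      unfolding pX_def
      by (rule expectation_cell_approximation[OF M X Fm B(2) _ finW _ osc]) (use B e sX[OF m WV] in auto)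
    have apY: "\<bar>(\<integral>\<omega>. F (Y \<omega>) \<partial>P) - (\<Sum>w\<in>W. g' w * pY w)\<bar> \<le> e + B * (1 - (\<Sum>w\<in>W. pY w))"
      unfolding pY_def
      by (rule expectation_cell_approximation[OF P Y Fm B(2) _ finW _ osc]) (use B e sY[OF m WV] in auto)
    have limw: "(\<lambda>n. pX n w) \<longlonglongrightarrow> pY w" if "w \<in> W" for w
      unfolding pX_def pY_def eqX[OF m WV[OF that]] eqY[OF m WV[OF that]] by (rule lim[OF m])
    have l1: "(\<lambda>n. \<Sum>w\<in>W. pX n w) \<longlonglongrightarrow> (\<Sum>w\<in>W. pY w)" by (intro tendsto_sum limw)
    have l2: "(\<lambda>n. \<Sum>w\<in>W. g' w * pX n w) \<longlonglongrightarrow> (\<Sum>w\<in>W. g' w * pY w)" by (intro tendsto_intros limw)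
    have "\<forall>\<^sub>F n in sequentially. 1 - e < (\<Sum>w\<in>W. pX n w)" by (rule order_tendstoD(1)[OF l1 sumY])
    moreover have "\<forall>\<^sub>F n in sequentially. dist (\<Sum>w\<in>W. g' w * pX n w) (\<Sum>w\<in>W. g' w * pY w) < e"
      by (rule tendstoD[OF l2 e(1)])
    ultimately have "\<forall>\<^sub>F n in sequentially. norm ((\<integral>\<omega>. F (X n \<omega>) \<partial>M) - (\<integral>\<omega>. F (Y \<omega>) \<partial>P)) < r"
    proof eventually_elim
      case (elim n)
      have "B * (1 - (\<Sum>w\<in>W. pX n w)) \<le> B * e" using elim B by (intro mult_left_mono) auto
      moreover have "B * (1 - (\<Sum>w\<in>W. pY w)) \<le> B * e" using sumY B by (intro mult_left_mono) auto
      ultimately have "\<bar>(\<integral>\<omega>. F (X n \<omega>) \<partial>M) - (\<integral>\<omega>. F (Y \<omega>) \<partial>P)\<bar> < 3 * e + 2 * (B * e)"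
        using apX[of n] apY elim(2) unfolding dist_real_def by linarith
      also have "\<dots> \<le> e * (4 + 6 * B)"
      proof -
        have "0 \<le> B * e" using B e by simp
        then show ?thesis using e by (simp add: algebra_simps)
      qed
      finally show ?case using er by simp
    qed
    then show "\<exists>no. \<forall>n\<ge>no. norm ((\<integral>\<omega>. F (X n \<omega>) \<partial>M) - (\<integral>\<omega>. F (Y \<omega>) \<partial>P)) < r"
      unfolding eventually_sequentially .
  qed
qed

section \<open>Poisson limits from factorial moments\<close>

text \<open>An interchange of limits: \<open>n\<close> goes to infinity first and the truncation order \<open>J\<close> afterwards.\<close>

lemma tendsto_by_approximation:
  fixes x :: "nat \<Rightarrow> real" and a b :: "nat \<Rightarrow> nat \<Rightarrow> real"
  assumes le: "\<And>J n. \<bar>x n - a J n\<bar> \<le> b J n"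
    and a: "\<And>J. a J \<longlonglongrightarrow> A J" and b: "\<And>J. b J \<longlonglongrightarrow> B J"
    and A: "A \<longlonglongrightarrow> L" and B: "B \<longlonglongrightarrow> 0"
  shows "x \<longlonglongrightarrow> L"
proof (rule LIMSEQ_I)
  fix r :: real assume r: "r > 0"
  have "\<forall>\<^sub>F J in sequentially. dist (A J) L < r / 4" using tendstoD[OF A, of "r / 4"] r by simp
  moreover have "\<forall>\<^sub>F J in sequentially. dist (B J) 0 < r / 4" using tendstoD[OF B, of "r / 4"] r by simp
  ultimately have "\<forall>\<^sub>F J in sequentially. dist (A J) L < r / 4 \<and> dist (B J) 0 < r / 4" by (rule eventually_conj)
  then obtain J where J: "dist (A J) L < r / 4" "dist (B J) 0 < r / 4"
    using eventually_happens by force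
  have "\<forall>\<^sub>F n in sequentially. dist (a J n) (A J) < r / 4" using tendstoD[OF a, of "r / 4"] r by simp
  moreover have "\<forall>\<^sub>F n in sequentially. dist (b J n) (B J) < r / 4" using tendstoD[OF b, of "r / 4"] r by simp
  ultimately have "\<forall>\<^sub>F n in sequentially. norm (x n - L) < r"
  proof eventually_elim
    case (elim n)
    then show ?case using J le[of n J] unfolding dist_real_def real_norm_def by linarith
  qed
  then show "\<exists>no. \<forall>n\<ge>no. norm (x n - L) < r" unfolding eventually_sequentially .
qed

lemma exists_list_with_counts:
  assumes "finite Q"
  shows "\<exists>cs. set cs \<subseteq> Q \<and> (\<forall>q\<in>Q. count_list cs q = w q)"
  using assms
proof (induction Q)
  case (insert x Q)
  then obtain cs where cs: "set cs \<subseteq> Q" "\<forall>q\<in>Q. count_list cs q = w q" by blast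
  have r: "count_list (replicate k x) q = (if x = q then k else 0)" for k q by (induction k) auto
  have "count_list cs x = 0" using cs(1) insert(2) by (auto simp: count_list_0_iff)
  then show ?case using cs insert(2)
    by (intro exI[of _ "replicate (w x) x @ cs"]) (auto simp: r)
qed simp

lemma prod_list_eq_prod_power:
  fixes f :: "'q \<Rightarrow> real"
  assumes "finite Q" "set cs \<subseteq> Q"
  shows "prod_list (map f cs) = (\<Prod>q\<in>Q. f q ^ count_list cs q)"
  using assms(2)
proof (induction cs)
  case (Cons c cs)
  have "(\<Prod>q\<in>Q. f q ^ count_list (c # cs) q) = (\<Prod>q\<in>Q. (if q = c then f c else 1) * f q ^ count_list cs q)"
    by (intro prod.cong) auto
  also have "\<dots> = f c * (\<Prod>q\<in>Q. f q ^ count_list cs q)"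
    using Cons.prems assms(1) by (simp add: prod.distrib)
  finally show ?case using Cons by simp
qed simp

context prob_space begin

lemma list_all2_event:
  assumes "\<And>\<alpha> q. q \<in> set cs \<Longrightarrow> {\<omega> \<in> space M. R \<alpha> q \<omega>} \<in> events"
  shows "{\<omega> \<in> space M. list_all2 (\<lambda>\<alpha> q. R \<alpha> q \<omega>) as cs} \<in> events"
  using assms
proof (induction as cs rule: list_induct2')
  case (4 a as c cs)
  have "{\<omega> \<in> space M. R a c \<omega>} \<in> events" by (rule 4(2)) simp
  moreover have "{\<omega> \<in> space M. list_all2 (\<lambda>\<alpha> q. R \<alpha> q \<omega>) as cs} \<in> events" by (rule 4(1)) (rule 4(2), simp)
  ultimately have "{\<omega> \<in> space M. R a c \<omega>} \<inter> {\<omega> \<in> space M. list_all2 (\<lambda>\<alpha> q. R \<alpha> q \<omega>) as cs} \<in> events" by (rule sets.Int)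
  moreover have "{\<omega> \<in> space M. list_all2 (\<lambda>\<alpha> q. R \<alpha> q \<omega>) (a # as) (c # cs)}
      = {\<omega> \<in> space M. R a c \<omega>} \<inter> {\<omega> \<in> space M. list_all2 (\<lambda>\<alpha> q. R \<alpha> q \<omega>) as cs}" by auto
  ultimately show ?case by (simp only:)
qed simp_all

text \<open>The number of selections is a sum of indicators over all tuples of distinct elements.\<close>

lemma expectation_card_selections:
  fixes S :: "'q \<Rightarrow> 'a \<Rightarrow> 'i set"
  assumes B: "finite B" and SB: "\<And>q \<omega>. q \<in> set cs \<Longrightarrow> S q \<omega> \<subseteq> B"
    and ev: "\<And>\<alpha> q. q \<in> set cs \<Longrightarrow> {\<omega> \<in> space M. \<alpha> \<in> S q \<omega>} \<in> events"
  shows "integrable M (\<lambda>\<omega>. real (card (selections (map (\<lambda>q. S q \<omega>) cs))))" (is ?i)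
    and "expectation (\<lambda>\<omega>. real (card (selections (map (\<lambda>q. S q \<omega>) cs)))) =
      (\<Sum>as | set as \<subseteq> B \<and> length as = length cs \<and> distinct as. prob {\<omega> \<in> space M. list_all2 (\<lambda>\<alpha> q. \<alpha> \<in> S q \<omega>) as cs})" (is ?e)
proof -
  let ?L = "{as. set as \<subseteq> B \<and> length as = length cs \<and> distinct as}"
  let ?A = "\<lambda>as. {\<omega> \<in> space M. list_all2 (\<lambda>\<alpha> q. \<alpha> \<in> S q \<omega>) as cs}"
  have finL: "finite ?L" by (rule finite_subset[OF _ finite_lists_length_eq[OF B, of "length cs"]]) auto
  have evA: "?A as \<in> events" for as by (rule list_all2_event) (rule ev)
  have ii: "integrable M (\<lambda>\<omega>. indicator (?A as) \<omega> :: real)" for as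
    using evA by (intro integrable_real_indicator) (auto simp: emeasure_eq_measure)
  have eq: "real (card (selections (map (\<lambda>q. S q \<omega>) cs))) = (\<Sum>as\<in>?L. indicator (?A as) \<omega>)" if \<omega>: "\<omega> \<in> space M" for \<omega>
  proof -
    have sub: "set as \<subseteq> B" if "list_all2 (\<lambda>\<alpha> q. \<alpha> \<in> S q \<omega>) as cs" for as
    proof
      fix x assume "x \<in> set as"
      then obtain i where i: "i < length as" "x = as ! i" by (auto simp: in_set_conv_nth)
      then have "x \<in> S (cs ! i) \<omega>" "cs ! i \<in> set cs" using that by (auto simp: list_all2_conv_all_nth)
      then show "x \<in> B" using SB by blast
    qed
    have "selections (map (\<lambda>q. S q \<omega>) cs) = {as \<in> ?L. \<omega> \<in> ?A as}"
      using sub \<omega> by (auto simp: selections_def list_all2_map2 dest: list_all2_lengthD)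
    then show ?thesis using finL by (simp add: indicator_def sum.If_cases Int_def)
  qed
  have "integrable M (\<lambda>\<omega>. \<Sum>as\<in>?L. indicator (?A as) \<omega> :: real)" by (intro Bochner_Integration.integrable_sum ii)
  then show ?i using eq by (subst Bochner_Integration.integrable_cong[OF refl eq]) auto
  have "expectation (\<lambda>\<omega>. real (card (selections (map (\<lambda>q. S q \<omega>) cs)))) = expectation (\<lambda>\<omega>. \<Sum>as\<in>?L. indicator (?A as) \<omega>)"
    by (rule Bochner_Integration.integral_cong[OF refl eq])
  also have "\<dots> = (\<Sum>as\<in>?L. expectation (indicator (?A as)))"
    by (rule Bochner_Integration.integral_sum) (rule ii)
  also have "\<dots> = (\<Sum>as\<in>?L. prob (?A as))"
    by (intro sum.cong refl) (simp add: Int_absorb2)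
  finally show ?e .
qed

text \<open>\<open>Nu cs j n\<close> counts selections that have, besides the labels \<open>cs\<close>, \<open>j\<close> free slots in the union of all cells.  By linearity
  its expectation tends to \<open>l ^ j\<close> times the product for \<open>cs\<close>, where \<open>l\<close> is the total intensity.
  Inserting this into \<open>bonferroni_counts\<close>, the alternating sums tend to the series of \<open>exp (- l)\<close> and the error bound to a
  term of the series of \<open>exp l\<close>.\<close>

theorem poisson_limit_of_factorial_moments:
  fixes S :: "nat \<Rightarrow> 'q \<Rightarrow> 'a \<Rightarrow> 'i set" and \<mu> :: "'q \<Rightarrow> real"
  assumes Q: "finite Q" and disj: "\<And>n \<omega>. disjoint_family_on (\<lambda>q. S n q \<omega>) Q"
    and B: "\<And>n. finite (B n)" and SB: "\<And>n q \<omega>. q \<in> Q \<Longrightarrow> S n q \<omega> \<subseteq> B n"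
    and ev: "\<And>n \<alpha> q. q \<in> Q \<Longrightarrow> {\<omega> \<in> space M. \<alpha> \<in> S n q \<omega>} \<in> events"
    and mom: "\<And>cs. set cs \<subseteq> Q \<Longrightarrow>
      (\<lambda>n. expectation (\<lambda>\<omega>. real (card (selections (map (\<lambda>q. S n q \<omega>) cs))))) \<longlonglongrightarrow> prod_list (map \<mu> cs)"
  shows "(\<lambda>n. prob {\<omega> \<in> space M. \<forall>q\<in>Q. card (S n q \<omega>) = w q}) \<longlonglongrightarrow> (\<Prod>q\<in>Q. exp (- \<mu> q) * \<mu> q ^ w q / fact (w q))"
proof -
  define Nu where "Nu cs j n \<omega> = real (card (selections (replicate j (\<Union>q\<in>Q. S n q \<omega>) @ map (\<lambda>q. S n q \<omega>) cs)))" for cs j n \<omega>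
  define l where "l = (\<Sum>q\<in>Q. \<mu> q)"
  have finS: "finite (S n q \<omega>)" if "q \<in> Q" for n q \<omega> using SB[OF that] B finite_subset by blast
  have step: "Nu cs (Suc j) n = (\<lambda>\<omega>. \<Sum>q\<in>Q. Nu (q # cs) j n \<omega>)" if "set cs \<subseteq> Q" for cs j n
  proof
    fix \<omega>
    have "card (selections (replicate j (\<Union>q\<in>Q. S n q \<omega>) @ (\<Union>q\<in>Q. S n q \<omega>) # map (\<lambda>q. S n q \<omega>) cs))
      = (\<Sum>q\<in>Q. card (selections (replicate j (\<Union>q\<in>Q. S n q \<omega>) @ S n q \<omega> # map (\<lambda>q. S n q \<omega>) cs)))"
      by (rule card_selections_insert_Union[OF Q disj]) (use finS Q that in \<open>auto split: if_splits\<close>)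
    then show "Nu cs (Suc j) n \<omega> = (\<Sum>q\<in>Q. Nu (q # cs) j n \<omega>)"
      by (simp add: Nu_def replicate_append_same[symmetric] del: replicate_append_same)
  qed
  have ints: "integrable M (Nu cs j n)" if "set cs \<subseteq> Q" for cs j n
    using that
  proof (induction j arbitrary: cs)
    case 0
    have "integrable M (\<lambda>\<omega>. real (card (selections (map (\<lambda>q. S n q \<omega>) cs))))"
      by (rule expectation_card_selections(1)[OF B SB ev]) (use 0 in auto)
    then show ?case by (simp add: Nu_def[abs_def])
  next
    case (Suc j)
    show ?case unfolding step[OF Suc.prems]
      by (intro Bochner_Integration.integrable_sum Suc.IH) (use Suc.prems in auto)
  qed
  have lims: "(\<lambda>n. expectation (Nu cs j n)) \<longlonglongrightarrow> l ^ j * prod_list (map \<mu> cs)" if "set cs \<subseteq> Q" for cs j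
    using that
  proof (induction j arbitrary: cs)
    case 0
    then show ?case using mom[OF 0] by (simp add: Nu_def)
  next
    case (Suc j)
    have sub: "set (q # cs) \<subseteq> Q" if "q \<in> Q" for q using that Suc.prems by simp
    have "(\<lambda>n. \<Sum>q\<in>Q. expectation (Nu (q # cs) j n)) \<longlonglongrightarrow> (\<Sum>q\<in>Q. l ^ j * prod_list (map \<mu> (q # cs)))"
      by (intro tendsto_sum Suc.IH sub)
    moreover have "(\<Sum>q\<in>Q. l ^ j * prod_list (map \<mu> (q # cs))) = l ^ Suc j * prod_list (map \<mu> cs)"
      by (simp add: l_def sum_distrib_left sum_distrib_right mult_ac)
    moreover have "expectation (Nu cs (Suc j) n) = (\<Sum>q\<in>Q. expectation (Nu (q # cs) j n))" for n
      unfolding step[OF Suc.prems] by (rule Bochner_Integration.integral_sum) (intro ints sub)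
    ultimately show ?case by simp
  qed
  (* A list of labels that realizes the prescribed counts. *)
  obtain cs where cs: "set cs \<subseteq> Q" "\<forall>q\<in>Q. count_list cs q = w q" using exists_list_with_counts[OF Q] by blast
  define c :: real where "c = (\<Prod>q\<in>Q. fact (w q))"
  define D where "D n = {\<omega> \<in> space M. \<forall>q\<in>Q. card (S n q \<omega>) = w q}" for n
  have evD: "D n \<in> events" for n
    unfolding D_def
  proof (rule sets.sets_Collect_finite_All[OF _ Q])
    fix q assume q: "q \<in> Q"
    have "(\<lambda>\<omega>. real (card (selections (map (\<lambda>q. S n q \<omega>) [q])))) \<in> borel_measurable M"
      using expectation_card_selections(1)[of "B n" "[q]" "S n"] B SB[OF q] ev[OF q] by auto
    moreover have "real (card (selections (map (\<lambda>q. S n q \<omega>) [q]))) = real (card (S n q \<omega>))" for \<omega>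
      using finS[OF q] by (simp, subst card_selections_Cons) auto
    ultimately have "(\<lambda>\<omega>. real (card (S n q \<omega>))) \<in> borel_measurable M" by simp
    then have "{\<omega> \<in> space M. real (card (S n q \<omega>)) = real (w q)} \<in> events" by measurable
    then show "{\<omega> \<in> space M. card (S n q \<omega>) = w q} \<in> events" by simp
  qed
  have bonf: "\<bar>c * indicator (D n) \<omega> - (\<Sum>j\<le>J. (-1) ^ j * Nu cs j n \<omega> / fact j)\<bar> \<le> Nu cs (Suc J) n \<omega> / fact (Suc J)"
    if \<omega>: "\<omega> \<in> space M" for J n \<omega>
  proof -
    have "(if \<forall>q\<in>Q. card (S n q \<omega>) = count_list cs q then \<Prod>q\<in>Q. fact (count_list cs q) else 0) = c * indicator (D n) \<omega>"
      using cs \<omega> by (auto simp: c_def D_def indicator_def intro!: prod.cong)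
    then show ?thesis using bonferroni_counts[OF Q disj finS cs(1), of n \<omega> J] by (simp only: Nu_def)
  qed
  have bound: "\<bar>c * prob (D n) - (\<Sum>j\<le>J. (-1) ^ j * expectation (Nu cs j n) / fact j)\<bar> \<le> expectation (Nu cs (Suc J) n) / fact (Suc J)" for J n
  proof -
    have iD: "integrable M (\<lambda>\<omega>. c * indicator (D n) \<omega>)"
      using evD by (intro integrable_mult_right integrable_real_indicator) (auto simp: emeasure_eq_measure)
    have ij: "integrable M (\<lambda>\<omega>. (-1) ^ j * Nu cs j n \<omega> / fact j)" for j
      by (intro Bochner_Integration.integrable_divide integrable_mult_right ints cs(1))
    have isum: "integrable M (\<lambda>\<omega>. \<Sum>j\<le>J. (-1) ^ j * Nu cs j n \<omega> / fact j)"
      by (intro Bochner_Integration.integrable_sum ij)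
    have i3: "integrable M (\<lambda>\<omega>. Nu cs (Suc J) n \<omega> / fact (Suc J))"
      by (intro Bochner_Integration.integrable_divide ints cs(1))
    have "c * prob (D n) - (\<Sum>j\<le>J. (-1) ^ j * expectation (Nu cs j n) / fact j)
      = expectation (\<lambda>\<omega>. c * indicator (D n) \<omega> - (\<Sum>j\<le>J. (-1) ^ j * Nu cs j n \<omega> / fact j))"
      using evD sets.sets_into_space[OF evD]
      by (simp add: Bochner_Integration.integral_diff[OF iD isum] Bochner_Integration.integral_sum[OF ij] Int_absorb2)
    also have "\<bar>\<dots>\<bar> \<le> expectation (\<lambda>\<omega>. \<bar>c * indicator (D n) \<omega> - (\<Sum>j\<le>J. (-1) ^ j * Nu cs j n \<omega> / fact j)\<bar>)"
      by (rule integral_abs_bound)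
    also have "\<dots> \<le> expectation (\<lambda>\<omega>. Nu cs (Suc J) n \<omega> / fact (Suc J))"
      by (intro integral_mono integrable_abs Bochner_Integration.integrable_diff iD isum i3 bonf)
    also have "\<dots> = expectation (Nu cs (Suc J) n) / fact (Suc J)" by simp
    finally show ?thesis .
  qed
  let ?P = "prod_list (map \<mu> cs)"
  have "(\<lambda>n. c * prob (D n)) \<longlonglongrightarrow> exp (- l) * ?P"
  proof (rule tendsto_by_approximation[OF bound])
    show "(\<lambda>n. \<Sum>j\<le>J. (-1) ^ j * expectation (Nu cs j n) / fact j) \<longlonglongrightarrow> (\<Sum>j\<le>J. (-1) ^ j * (l ^ j * ?P) / fact j)" for J
      by (intro tendsto_sum tendsto_divide tendsto_mult tendsto_const lims cs(1)) simp
    show "(\<lambda>n. expectation (Nu cs (Suc J) n) / fact (Suc J)) \<longlonglongrightarrow> l ^ Suc J * ?P / fact (Suc J)" for J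
      by (intro tendsto_divide tendsto_const lims cs(1)) simp
    have "(\<lambda>j. (- l) ^ j /\<^sub>R fact j) sums exp (- l)" by (rule exp_converges)
    then have "(\<lambda>J. (\<Sum>j\<le>J. (- l) ^ j /\<^sub>R fact j) * ?P) \<longlonglongrightarrow> exp (- l) * ?P"
      unfolding sums_def_le by (intro tendsto_mult tendsto_const)
    moreover have "(\<Sum>j\<le>J. (- l) ^ j /\<^sub>R fact j) * ?P = (\<Sum>j\<le>J. (-1) ^ j * (l ^ j * ?P) / fact j)" for J
      unfolding sum_distrib_right by (intro sum.cong refl) (simp add: power_minus[of l] divide_inverse)
    ultimately show "(\<lambda>J. \<Sum>j\<le>J. (-1) ^ j * (l ^ j * ?P) / fact j) \<longlonglongrightarrow> exp (- l) * ?P" by simp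
    have "(\<lambda>j. l ^ j /\<^sub>R fact j) \<longlonglongrightarrow> 0" by (rule summable_LIMSEQ_zero[OF summable_exp_generic])
    then have "(\<lambda>j. l ^ j / fact j) \<longlonglongrightarrow> 0" by (simp add: divide_inverse mult.commute)
    then have "(\<lambda>J. l ^ Suc J / fact (Suc J)) \<longlonglongrightarrow> 0" by (rule LIMSEQ_Suc)
    then have "(\<lambda>J. l ^ Suc J / fact (Suc J) * ?P) \<longlonglongrightarrow> 0 * ?P" by (intro tendsto_mult tendsto_const)
    then show "(\<lambda>J. l ^ Suc J * ?P / fact (Suc J)) \<longlonglongrightarrow> 0" by simp
  qed
  moreover have c: "c \<noteq> 0" by (simp add: c_def Q)
  ultimately have "(\<lambda>n. c * prob (D n) / c) \<longlonglongrightarrow> exp (- l) * ?P / c" by (intro tendsto_divide tendsto_const) auto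
  moreover have "exp (- l) * ?P / c = (\<Prod>q\<in>Q. exp (- \<mu> q) * \<mu> q ^ w q / fact (w q))"
  proof -
    have "?P = (\<Prod>q\<in>Q. \<mu> q ^ w q)" using prod_list_eq_prod_power[OF Q cs(1)] cs(2) by simp
    moreover have "exp (- l) = (\<Prod>q\<in>Q. exp (- \<mu> q))" using Q by (simp add: l_def sum_negf[symmetric] exp_sum)
    ultimately show ?thesis by (simp add: c_def prod.distrib prod_dividef)
  qed
  ultimately show ?thesis using c by (simp add: D_def)
qed

end

section \<open>Factorial moments of the cell counts\<close>

definition cell_window :: "nat \<Rightarrow> int \<Rightarrow> window" where
  "cell_window m k = (real_of_int k / real m, if k = int m * int m then None else Some (real_of_int (k + 1) / real m))"

text \<open>The Lebesgue measure of the spatial part of the cell, which is zero for cells on the upper faces of the cube.\<close>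

definition cell_base :: "nat \<Rightarrow> (int ^ 'd::finite) \<times> int \<Rightarrow> real" where
  "cell_base m q = (\<Prod>i\<in>UNIV. if fst q $ i < int m then 1 / real m else 0)"

definition cell_mass :: "nat \<Rightarrow> (int ^ 'd::finite) \<times> int \<Rightarrow> real" where
  "cell_mass m q = cell_base m q * window_weight (cell_window m (snd q))"

definition cell_points :: "nat \<Rightarrow> nat \<Rightarrow> (int ^ 'd::finite) \<times> int \<Rightarrow> (int ^ 'd) set" where
  "cell_points n m q = {\<alpha> \<in> lattice_box n. \<forall>i. \<lfloor>real m * (real_of_int (\<alpha> $ i) / real n)\<rfloor> = fst q $ i}"

lemma cell_window_proper: "m > 0 \<Longrightarrow> proper_window (cell_window m k)"
  by (simp add: cell_window_def divide_right_mono)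

definition grid_block :: "nat \<Rightarrow> nat \<Rightarrow> int \<Rightarrow> int set" where
  "grid_block n m k = {x. 0 \<le> x \<and> x \<le> int n - 1 \<and> \<lfloor>real m * (real_of_int x / real n)\<rfloor> = k}"

lemma finite_grid_block: "finite (grid_block n m k)"
  by (rule finite_subset[of _ "{0..int n - 1}"]) (auto simp: grid_block_def)

text \<open>A half-open block of consecutive integers; rounding both ends up explains the error of at most one in its
  cardinality.\<close>

lemma grid_block_eq:
  assumes "n > 0" "m > 0" "0 \<le> k" "k < int m"
  shows "grid_block n m k = {\<lceil>real_of_int k * (real n / real m)\<rceil>..<\<lceil>(real_of_int k + 1) * (real n / real m)\<rceil>}"
proof -
  have fl: "\<lfloor>real m * (real_of_int x / real n)\<rfloor> = k \<longleftrightarrow>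
      \<lceil>real_of_int k * (real n / real m)\<rceil> \<le> x \<and> x < \<lceil>(real_of_int k + 1) * (real n / real m)\<rceil>" for x
  proof -
    have "\<lfloor>real m * (real_of_int x / real n)\<rfloor> = k \<longleftrightarrow> real_of_int k \<le> real m * (real_of_int x / real n) \<and> real m * (real_of_int x / real n) < real_of_int k + 1"
      by (simp only: floor_eq_iff)
    also have "real_of_int k \<le> real m * (real_of_int x / real n) \<longleftrightarrow> real_of_int k * (real n / real m) \<le> real_of_int x"
      using assms by (simp add: field_simps)
    also have "real m * (real_of_int x / real n) < real_of_int k + 1 \<longleftrightarrow> real_of_int x < (real_of_int k + 1) * (real n / real m)"
      using assms by (simp add: field_simps)
    finally show ?thesis by (simp only: ceiling_le_iff less_ceiling_iff)
  qed
  have "0 \<le> x \<and> x \<le> int n - 1"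
    if x: "\<lceil>real_of_int k * (real n / real m)\<rceil> \<le> x" "x < \<lceil>(real_of_int k + 1) * (real n / real m)\<rceil>" for x
  proof -
    have "0 \<le> real_of_int k * (real n / real m)" using assms by simp
    also have "\<dots> \<le> real_of_int x" using x(1) by (simp only: ceiling_le_iff)
    finally have "0 \<le> x" by simp
    have "real_of_int x < (real_of_int k + 1) * (real n / real m)" using x(2) by (simp only: less_ceiling_iff)
    also have "\<dots> \<le> real m * (real n / real m)"
    proof (intro mult_right_mono)
      have "k + 1 \<le> int m" using assms by simp
      then have "real_of_int (k + 1) \<le> real_of_int (int m)" by (simp only: of_int_le_iff)
      then show "real_of_int k + 1 \<le> real m" by simp
    qed simp
    also have "\<dots> = real n" using assms by simp
    finally have "x < int n" by linarith
    then show ?thesis using \<open>0 \<le> x\<close> by simp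
  qed
  then show ?thesis unfolding grid_block_def fl by auto
qed

lemma card_grid_block_tendsto:
  assumes m: "m > 0" and k: "k \<in> {0..int m}"
  shows "(\<lambda>n. real (card (grid_block n m k)) / real n) \<longlonglongrightarrow> (if k < int m then 1 / real m else 0)"
proof (cases "k < int m")
  case True
  have "(\<lambda>n. real (card (grid_block n m k)) / real n - 1 / real m) \<longlonglongrightarrow> 0"
  proof (rule Lim_null_comparison)
    show "\<forall>\<^sub>F n in sequentially. norm (real (card (grid_block n m k)) / real n - 1 / real m) \<le> 1 / real n"
      using eventually_gt_at_top[of 0]
    proof eventually_elim
      case (elim n)
      let ?a = "real_of_int k * (real n / real m)" and ?b = "(real_of_int k + 1) * (real n / real m)"
      have ab: "?b = ?a + real n / real m" by (simp add: algebra_simps add_divide_distrib)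
      have "?a \<le> ?b" unfolding ab by simp
      then have "\<lceil>?a\<rceil> \<le> \<lceil>?b\<rceil>" by (rule ceiling_mono)
      moreover have "grid_block n m k = {\<lceil>?a\<rceil>..<\<lceil>?b\<rceil>}" using k True by (intro grid_block_eq elim m) auto
      ultimately have "real (card (grid_block n m k)) = real_of_int \<lceil>?b\<rceil> - real_of_int \<lceil>?a\<rceil>" by simp
      then have "\<bar>real (card (grid_block n m k)) - real n / real m\<bar> \<le> 1"
        using ab le_of_int_ceiling[of ?a] le_of_int_ceiling[of ?b] ceiling_correct[of ?a] ceiling_correct[of ?b] by linarith
      then have "\<bar>real (card (grid_block n m k)) - real n / real m\<bar> / real n \<le> 1 / real n"
        by (rule divide_right_mono) simp
      moreover have "\<bar>real (card (grid_block n m k)) - real n / real m\<bar> / real n = \<bar>real (card (grid_block n m k)) / real n - 1 / real m\<bar>"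
      proof -
        have "(real (card (grid_block n m k)) - real n / real m) / real n = real (card (grid_block n m k)) / real n - 1 / real m"
          using elim by (simp add: diff_divide_distrib)
        then show ?thesis by (metis abs_divide abs_of_nat)
      qed
      ultimately show ?case by simp
    qed
    show "(\<lambda>n. 1 / real n) \<longlonglongrightarrow> 0" by (rule lim_1_over_n)
  qed
  then have "(\<lambda>n. real (card (grid_block n m k)) / real n - 1 / real m + 1 / real m) \<longlonglongrightarrow> 0 + 1 / real m"
    by (intro tendsto_add tendsto_const)
  then show ?thesis using True by simp
next
  case False
  then have km: "k = int m" using k by simp
  have "grid_block n m k = {}" for n
  proof (rule equals0I)
    fix x assume "x \<in> grid_block n m k"
    then have x: "0 \<le> x" "x \<le> int n - 1" "\<lfloor>real m * (real_of_int x / real n)\<rfloor> = int m" by (auto simp: grid_block_def km)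
    have n: "real n > 0" using x by auto
    have "real_of_int x / real n < 1" using x n by (simp add: divide_less_eq)
    then have "real m * (real_of_int x / real n) < real m * 1" using m by (intro mult_strict_left_mono) auto
    then have "\<lfloor>real m * (real_of_int x / real n)\<rfloor> < int m" by (simp add: floor_less_iff)
    then show False using x(3) by simp
  qed
  then show ?thesis using False by simp
qed

lemma cell_points_eq: "cell_points n m q = {x :: int ^ 'd::finite. \<forall>i. x $ i \<in> grid_block n m (fst q $ i)}"
  by (auto simp: cell_points_def grid_block_def lattice_box_def)

lemma finite_cell_points: "finite (cell_points n m q)"
  unfolding cell_points_eq by (rule finite_card_vec_box) (rule finite_grid_block)

lemma card_cell_points_tendsto:
  fixes q :: "(int ^ 'd::finite) \<times> int"
  assumes m: "m > 0" and q: "q \<in> cell_index m"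
  shows "(\<lambda>n. real (card (cell_points n m q)) / real (n ^ CARD('d))) \<longlonglongrightarrow> cell_base m q"
proof -
  have "card (cell_points n m q) = (\<Prod>i\<in>UNIV. card (grid_block n m (fst q $ i)))" for n
    unfolding cell_points_eq by (rule finite_card_vec_box) (rule finite_grid_block)
  then have "real (card (cell_points n m q)) / real (n ^ CARD('d)) = (\<Prod>i\<in>UNIV. real (card (grid_block n m (fst q $ i))) / real n)" for n
    by (simp add: prod_dividef)
  moreover have "(\<lambda>n. \<Prod>i\<in>UNIV. real (card (grid_block n m (fst q $ i))) / real n) \<longlonglongrightarrow> cell_base m q"
    unfolding cell_base_def
    by (intro tendsto_prod card_grid_block_tendsto m) (use q in \<open>auto simp: cell_index_def\<close>)
  ultimately show ?thesis by simp
qed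

lemma card_list_all2_prod:
  assumes "\<And>q. finite (C q)"
  shows "finite {as. list_all2 (\<lambda>a q. a \<in> C q) as cs}"
    and "card {as. list_all2 (\<lambda>a q. a \<in> C q) as cs} = prod_list (map (\<lambda>q. card (C q)) cs)"
proof -
  have "finite {as. list_all2 (\<lambda>a q. a \<in> C q) as cs} \<and> card {as. list_all2 (\<lambda>a q. a \<in> C q) as cs} = prod_list (map (\<lambda>q. card (C q)) cs)"
  proof (induction cs)
    case (Cons c cs)
    let ?T = "{as. list_all2 (\<lambda>a q. a \<in> C q) as cs}"
    have eq: "{as. list_all2 (\<lambda>a q. a \<in> C q) as (c # cs)} = (\<lambda>(a, as). a # as) ` (C c \<times> ?T)"
      by (auto simp: list_all2_Cons2)
    have "inj_on (\<lambda>(a, as). a # as) (C c \<times> ?T)" by (auto simp: inj_on_def)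
    then show ?case unfolding eq using Cons assms by (simp add: card_image card_cartesian_product)
  qed auto
  then show "finite {as. list_all2 (\<lambda>a q. a \<in> C q) as cs}"
    "card {as. list_all2 (\<lambda>a q. a \<in> C q) as cs} = prod_list (map (\<lambda>q. card (C q)) cs)" by auto
qed

lemma prod_list_tendsto:
  fixes f :: "nat \<Rightarrow> 'q \<Rightarrow> real"
  assumes "\<And>q. q \<in> set cs \<Longrightarrow> (\<lambda>n. f n q) \<longlonglongrightarrow> g q"
  shows "(\<lambda>n. prod_list (map (f n) cs)) \<longlonglongrightarrow> prod_list (map g cs)"
  using assms by (induction cs) (auto intro!: tendsto_mult)

context transient_gff begin

definition extremal_point :: "nat \<Rightarrow> int ^ 'd \<Rightarrow> 'w \<Rightarrow> (real ^ 'd) \<times> ereal" where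
  "extremal_point n \<alpha> \<omega> = ((\<chi> i. real_of_int (\<alpha> $ i) / real n), ereal ((\<phi> \<alpha> \<omega> - centering v (vol n)) / scaling v (vol n)))"

definition points_in_cell :: "nat \<Rightarrow> nat \<Rightarrow> (int ^ 'd) \<times> int \<Rightarrow> 'w \<Rightarrow> (int ^ 'd) set" where
  "points_in_cell n m q \<omega> = {\<alpha> \<in> lattice_box n. extremal_point n \<alpha> \<omega> \<in> cell m q}"

lemma points_in_cell_event: "{\<omega> \<in> space M. \<alpha> \<in> points_in_cell n m q \<omega>} \<in> events"
proof -
  let ?H = "{\<omega> \<in> space M. ereal ((\<phi> \<alpha> \<omega> - centering v (vol n)) / scaling v (vol n)) \<in> height_cell m (snd q)}"
  have "(\<lambda>\<omega>. ereal ((\<phi> \<alpha> \<omega> - centering v (vol n)) / scaling v (vol n))) \<in> borel_measurable M" by measurable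
  from measurable_sets[OF this height_cell_sets[of m "snd q"]] have H: "?H \<in> events"
    by (simp add: vimage_def Int_def conj_commute)
  let ?c = "\<alpha> \<in> lattice_box n \<and> (\<forall>i. \<lfloor>real m * (real_of_int (\<alpha> $ i) / real n)\<rfloor> = fst q $ i)"
  have "\<alpha> \<in> points_in_cell n m q \<omega> \<longleftrightarrow> ?c \<and> ereal ((\<phi> \<alpha> \<omega> - centering v (vol n)) / scaling v (vol n)) \<in> height_cell m (snd q)" for \<omega>
    using extremal_point_in_space[of \<alpha> n] by (auto simp: points_in_cell_def cell_def extremal_point_def)
  then have "{\<omega> \<in> space M. \<alpha> \<in> points_in_cell n m q \<omega>} = (if ?c then ?H else {})" by auto
  then show ?thesis using H by (cases ?c) simp_all
qed

text \<open>Valid as soon as the centering, hence the scaling, is positive; only then do conditions on the rescaled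
  field become conditions on the field in the same direction.\<close>

lemma points_in_cell_eq:
  assumes u: "unit_centering (vol n) > 0" and m: "m > 0"
  shows "points_in_cell n m q \<omega> = {\<alpha> \<in> cell_points n m q. \<phi> \<alpha> \<omega> \<in> window_set n (cell_window m (snd q))}"
proof -
  define a where "a = scaling v (vol n)"
  define b where "b = centering v (vol n)"
  have a: "a > 0" using u v_pos by (simp add: a_def scaling_eq)
  have lev: "level n z = b + a * z" for z by (simp add: level_def a_def b_def)
  have h: "ereal ((y - b) / a) \<in> height_cell m k \<longleftrightarrow> y \<in> window_set n (cell_window m k)" for y k
  proof -
    have le: "r \<le> (y - b) / a \<longleftrightarrow> level n r \<le> y" for r unfolding lev using a by (simp add: field_simps)
    have lt: "(y - b) / a < r \<longleftrightarrow> y < level n r" for r unfolding lev using a by (simp add: field_simps)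
    show ?thesis
    proof (cases "k = int m * int m")
      case True
      then have "real_of_int k / real m = real m" using m by simp
      then show ?thesis using True by (simp add: height_cell_def cell_window_def le)
    next
      case False
      then show ?thesis by (simp add: height_cell_def cell_window_def le lt)
    qed
  qed
  show ?thesis
    using h extremal_point_in_space
    by (auto simp: points_in_cell_def cell_points_def cell_def extremal_point_def a_def b_def)
qed

text \<open>The expectation is a sum over tuples of distinct sites in the prescribed cubes, which splits into far and close tuples.\<close>

lemma factorial_moments_converge:
  assumes m: "m > 0" and cs: "set cs \<subseteq> cell_index m"
  shows "(\<lambda>n. expectation (\<lambda>\<omega>. real (card (selections (map (\<lambda>q. points_in_cell n m q \<omega>) cs))))) \<longlonglongrightarrow> prod_list (map (cell_mass m) cs)"
proof -
  define k where "k = length cs"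
  define zs where "zs = map (\<lambda>q. cell_window m (snd q)) cs"
  define W where "W = prod_list (map window_weight zs)"
  obtain l \<epsilon> where dec: "\<And>n \<alpha> \<beta>. l n \<le> real (l1 (\<beta> - \<alpha> :: int ^ 'd)) \<Longrightarrow> green \<alpha> \<beta> \<le> \<epsilon> n" and \<epsilon>: "\<And>n. 0 \<le> \<epsilon> n"
    and lim: "(\<lambda>n. \<epsilon> n * ln (vol n) * unit_centering (vol n)) \<longlonglongrightarrow> 0"
    and close_card: "(\<lambda>n. real (card (close_lists (l n) n k)) / vol n ^ k) \<longlonglongrightarrow> 0"
    and close_prob: "(\<lambda>n. \<Sum>as | as \<in> close_lists (l n) n k \<and> distinct as. prob {\<omega> \<in> space M. \<forall>x\<in>set as. level n (- real m) \<le> \<phi> x \<omega>}) \<longlonglongrightarrow> 0"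
    using close_lists_negligible[of k "- real m"] by blast
  define T where "T n = {as :: (int ^ 'd) list. list_all2 (\<lambda>a q. a \<in> cell_points n m q) as cs}" for n
  define p where "p n as = prob {\<omega> \<in> space M. list_all2 (\<lambda>\<alpha> J. \<phi> \<alpha> \<omega> \<in> window_set n J) as zs}" for n as
  have finT: "finite (T n)" for n unfolding T_def by (rule card_list_all2_prod) (rule finite_cell_points)
  have lenT: "length as = k" "set as \<subseteq> lattice_box n" if "as \<in> T n" for as n
    using that by (auto simp: T_def k_def list_all2_conv_all_nth cell_points_def in_set_conv_nth)
  have finL: "finite {as :: (int ^ 'd) list. set as \<subseteq> lattice_box n \<and> length as = k}" for n
    by (rule finite_lists_length_eq[OF finite_lattice_box])
  have finC: "finite (close_lists (l n) n k)" for n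
    by (rule finite_subset[OF _ finL[of n]]) (auto simp: close_lists_def)
  (* Far tuples contribute the limit and close ones nothing; distinctness of far tuples is automatic. *)
  define Far where "Far n = {as \<in> T n. far (l n) as}" for n
  define Near where "Near n = {as \<in> T n. distinct as \<and> \<not> far (l n) as}" for n
  have finF: "finite (Far n)" "finite (Near n)" for n using finT by (auto simp: Far_def Near_def)
  have distF: "distinct as" if "as \<in> Far n" for as n using that by (simp add: Far_def far_def)
  have upos: "\<forall>\<^sub>F n in sequentially. 0 < unit_centering (vol n)"
    using filterlim_at_top_dense[THEN iffD1, OF unit_centering_vol_at_top, rule_format] .
  have npos: "\<forall>\<^sub>F n in sequentially. 0 < (n :: nat)" by (rule eventually_gt_at_top)
  have split: "\<forall>\<^sub>F n in sequentially. expectation (\<lambda>\<omega>. real (card (selections (map (\<lambda>q. points_in_cell n m q \<omega>) cs))))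
      = (\<Sum>as\<in>Far n. p n as) + (\<Sum>as\<in>Near n. p n as)"
    using upos
  proof eventually_elim
    case (elim n)
    let ?L = "{as :: (int ^ 'd) list. set as \<subseteq> lattice_box n \<and> length as = length cs \<and> distinct as}"
    have finL': "finite ?L" by (rule finite_subset[OF _ finL[of n]]) (auto simp: k_def)
    have lp: "list_all2 (\<lambda>\<alpha> q. \<alpha> \<in> points_in_cell n m q \<omega>) as cs \<longleftrightarrow>
        as \<in> T n \<and> list_all2 (\<lambda>\<alpha> J. \<phi> \<alpha> \<omega> \<in> window_set n J) as zs" for as \<omega>
      unfolding points_in_cell_eq[OF elim m] T_def zs_def list_all2_map2
      by (auto simp: list_all2_conv_all_nth)
    have prob_eq: "prob {\<omega> \<in> space M. list_all2 (\<lambda>\<alpha> q. \<alpha> \<in> points_in_cell n m q \<omega>) as cs} = (if as \<in> T n then p n as else 0)" for as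
      unfolding lp p_def by simp
    have "expectation (\<lambda>\<omega>. real (card (selections (map (\<lambda>q. points_in_cell n m q \<omega>) cs))))
      = (\<Sum>as\<in>?L. prob {\<omega> \<in> space M. list_all2 (\<lambda>\<alpha> q. \<alpha> \<in> points_in_cell n m q \<omega>) as cs})"
      by (rule expectation_card_selections(2)[OF finite_lattice_box _ points_in_cell_event]) (auto simp: points_in_cell_def)
    also have "\<dots> = (\<Sum>as\<in>?L. if as \<in> T n then p n as else 0)" by (intro sum.cong refl prob_eq)
    also have "\<dots> = (\<Sum>as\<in>?L \<inter> T n. p n as)" using finL' by (simp add: sum.inter_restrict)
    also have "?L \<inter> T n = Far n \<union> Near n"
      using lenT(1) subsetD[OF lenT(2)] distF by (auto simp: Far_def Near_def k_def)
    also have "(\<Sum>as\<in>Far n \<union> Near n. p n as) = (\<Sum>as\<in>Far n. p n as) + (\<Sum>as\<in>Near n. p n as)"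
      using finF by (intro sum.union_disjoint) (auto simp: Far_def Near_def)
    finally show ?case .
  qed
  (* Every window starts at height - m or above. *)
  have near: "(\<lambda>n. \<Sum>as\<in>Near n. p n as) \<longlonglongrightarrow> 0"
  proof (rule tendsto_sandwich[OF _ _ tendsto_const close_prob])
    show "\<forall>\<^sub>F n in sequentially. 0 \<le> (\<Sum>as\<in>Near n. p n as)" by (intro always_eventually allI sum_nonneg) (simp add: p_def)
    show "\<forall>\<^sub>F n in sequentially. (\<Sum>as\<in>Near n. p n as)
        \<le> (\<Sum>as | as \<in> close_lists (l n) n k \<and> distinct as. prob {\<omega> \<in> space M. \<forall>x\<in>set as. level n (- real m) \<le> \<phi> x \<omega>})"
      using upos
    proof eventually_elim
      case (elim n)
      let ?C = "{as. as \<in> close_lists (l n) n k \<and> distinct as}"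
      have sub: "Near n \<subseteq> ?C" using lenT(1) subsetD[OF lenT(2)] by (auto simp: Near_def close_lists_def)
      have "p n as \<le> prob {\<omega> \<in> space M. \<forall>x\<in>set as. level n (- real m) \<le> \<phi> x \<omega>}" if as: "as \<in> Near n" for as
        unfolding p_def
      proof (rule finite_measure_mono)
        show "{\<omega> \<in> space M. \<forall>x\<in>set as. level n (- real m) \<le> \<phi> x \<omega>} \<in> events"
          by (rule sets.sets_Collect_finite_All) auto
        have low: "level n (- real m) \<le> y" if J: "J \<in> set zs" and y: "y \<in> window_set n J" for J y
        proof -
          obtain q where q: "q \<in> set cs" "J = cell_window m (snd q)" using J by (auto simp: zs_def)
          have "q \<in> cell_index m" using q(1) cs by blast
          then have "- (int m * int m) \<le> snd q" by (cases q) (simp add: cell_index_def)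
          then have "real_of_int (- (int m * int m)) \<le> real_of_int (snd q)" by (simp only: of_int_le_iff)
          then have "- real m \<le> real_of_int (snd q) / real m" using m by (simp add: le_divide_eq)
          then have "- real m / unit_centering (vol n) \<le> real_of_int (snd q) / real m / unit_centering (vol n)"
            using elim by (intro divide_right_mono) auto
          then have "level n (- real m) \<le> level n (real_of_int (snd q) / real m)"
            unfolding level_eq using v_pos by (intro mult_left_mono add_left_mono) auto
          also have "\<dots> \<le> y" using y by (simp add: q(2) cell_window_def)
          finally show ?thesis .
        qed
        show "{\<omega> \<in> space M. list_all2 (\<lambda>\<alpha> J. \<phi> \<alpha> \<omega> \<in> window_set n J) as zs} \<subseteq> {\<omega> \<in> space M. \<forall>x\<in>set as. level n (- real m) \<le> \<phi> x \<omega>}"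
        proof (intro subsetI CollectI conjI ballI)
          fix \<omega> x assume \<omega>: "\<omega> \<in> {\<omega> \<in> space M. list_all2 (\<lambda>\<alpha> J. \<phi> \<alpha> \<omega> \<in> window_set n J) as zs}"
          assume "x \<in> set as"
          then obtain i where i: "i < length as" "x = as ! i" by (auto simp: in_set_conv_nth)
          then have "\<phi> x \<omega> \<in> window_set n (zs ! i)" "zs ! i \<in> set zs" using \<omega> by (auto simp: list_all2_conv_all_nth)
          then show "level n (- real m) \<le> \<phi> x \<omega>" using low by blast
        qed auto
      qed
      then have "(\<Sum>as\<in>Near n. p n as) \<le> (\<Sum>as\<in>Near n. prob {\<omega> \<in> space M. \<forall>x\<in>set as. level n (- real m) \<le> \<phi> x \<omega>})"
        by (rule sum_mono)
      also have "\<dots> \<le> (\<Sum>as\<in>?C. prob {\<omega> \<in> space M. \<forall>x\<in>set as. level n (- real m) \<le> \<phi> x \<omega>})"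
        using finC[of n] by (intro sum_mono2 sub) auto
      finally show ?case .
    qed
  qed
  have cardT: "(\<lambda>n. real (card (T n)) / vol n ^ k) \<longlonglongrightarrow> prod_list (map (cell_base m) cs)"
  proof -
    have "real (card (T n)) / vol n ^ k = prod_list (map (\<lambda>q. real (card (cell_points n m q)) / real (n ^ CARD('d))) cs)" for n
    proof -
      have "real (card (T n)) = prod_list (map (\<lambda>q. real (card (cell_points n m q))) cs)"
        unfolding T_def card_list_all2_prod(2)[OF finite_cell_points] by (induction cs) auto
      moreover have "prod_list (map f ds) / c ^ length ds = prod_list (map (\<lambda>q. f q / c) ds)"
        for f and c :: real and ds :: "((int ^ 'd) \<times> int) list" by (induction ds) (auto simp: times_divide_times_eq[symmetric] simp del: times_divide_times_eq)
      ultimately show ?thesis by (simp add: k_def vol_def)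
    qed
    moreover have "(\<lambda>n. prod_list (map (\<lambda>q. real (card (cell_points n m q)) / real (n ^ CARD('d))) cs)) \<longlonglongrightarrow> prod_list (map (cell_base m) cs)"
      by (intro prod_list_tendsto card_cell_points_tendsto m) (use cs in auto)
    ultimately show ?thesis by simp
  qed
  (* The close tuples are too few to change the number of far tuples. *)
  have cardF: "(\<lambda>n. real (card (Far n)) / vol n ^ k) \<longlonglongrightarrow> prod_list (map (cell_base m) cs)"
  proof (rule tendsto_sandwich[OF _ _ _ cardT])
    have "(\<lambda>n. real (card (T n)) / vol n ^ k - real (card (close_lists (l n) n k)) / vol n ^ k) \<longlonglongrightarrow> prod_list (map (cell_base m) cs) - 0"
      by (intro tendsto_diff cardT close_card)
    then show "(\<lambda>n. real (card (T n)) / vol n ^ k - real (card (close_lists (l n) n k)) / vol n ^ k) \<longlonglongrightarrow> prod_list (map (cell_base m) cs)" by simp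
    have v0: "0 \<le> vol n ^ k" for n by (simp add: vol_def)
    have "T n \<subseteq> Far n \<union> close_lists (l n) n k" for n using lenT(1) subsetD[OF lenT(2)] by (auto simp: Far_def close_lists_def)
    then have "card (T n) \<le> card (Far n) + card (close_lists (l n) n k)" for n
      using card_mono[of "Far n \<union> close_lists (l n) n k" "T n"] card_Un_le[of "Far n" "close_lists (l n) n k"] finF finC
      by (meson finite_UnI order_trans)
    then have c: "real (card (T n)) - real (card (close_lists (l n) n k)) \<le> real (card (Far n))" for n
      by (smt (verit) of_nat_add of_nat_le_iff)
    show "\<forall>\<^sub>F n in sequentially. real (card (T n)) / vol n ^ k - real (card (close_lists (l n) n k)) / vol n ^ k \<le> real (card (Far n)) / vol n ^ k"
      unfolding diff_divide_distrib[symmetric] using divide_right_mono[OF c v0] by simp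
    have "card (Far n) \<le> card (T n)" for n by (rule card_mono[OF finT]) (auto simp: Far_def)
    then show "\<forall>\<^sub>F n in sequentially. real (card (Far n)) / vol n ^ k \<le> real (card (T n)) / vol n ^ k"
      by (intro always_eventually allI divide_right_mono v0) simp
  qed
  have W: "prod_list (map (cell_mass m) cs) = W * prod_list (map (cell_base m) cs)"
    unfolding W_def zs_def by (induction cs) (auto simp: cell_mass_def)
  have far: "(\<lambda>n. \<Sum>as\<in>Far n. p n as) \<longlonglongrightarrow> prod_list (map (cell_mass m) cs)"
  proof -
    have "(\<lambda>n. (\<Sum>as\<in>Far n. p n as) - W * (real (card (Far n)) / vol n ^ k)) \<longlonglongrightarrow> 0"
    proof (rule LIMSEQ_I)
      fix r :: real assume r: "r > 0"
      have zs_proper: "\<forall>J\<in>set zs. proper_window J" using cell_window_proper[OF m] by (auto simp: zs_def)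
      have r2: "r / 2 > 0" using r by simp
      have lz: "length zs = k" by (simp add: zs_def k_def)
      have "\<forall>\<^sub>F n in sequentially. \<forall>as. length as = length zs \<and> far (l n) as \<longrightarrow>
          \<bar>vol n ^ length zs * p n as - W\<bar> < r / 2"
        unfolding p_def W_def by (rule far_factorization[OF _ \<epsilon> lim zs_proper r2]) (rule dec)
      then have "\<forall>\<^sub>F n in sequentially. norm ((\<Sum>as\<in>Far n. p n as) - W * (real (card (Far n)) / vol n ^ k) - 0) < r"
        using npos
      proof eventually_elim
        case (elim n)
        have vp: "vol n ^ k > 0" using vol_pos[OF elim(2)] by simp
        have each: "\<bar>p n as - W / vol n ^ k\<bar> \<le> r / 2 / vol n ^ k" if as: "as \<in> Far n" for as
        proof -
          have "length as = length zs \<and> far (l n) as" using as lenT lz by (auto simp: Far_def)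
          then have "\<bar>vol n ^ k * p n as - W\<bar> < r / 2" using elim(1) lz by auto
          then have "\<bar>vol n ^ k * p n as - W\<bar> / vol n ^ k \<le> r / 2 / vol n ^ k" using vp by (intro divide_right_mono) auto
          moreover have "\<bar>vol n ^ k * p n as - W\<bar> / vol n ^ k = \<bar>p n as - W / vol n ^ k\<bar>"
          proof -
            have "(vol n ^ k * p n as - W) / vol n ^ k = p n as - W / vol n ^ k" using less_imp_neq[OF vp] unfolding diff_divide_distrib by (simp del: power_eq_0_iff)
            then show ?thesis using vp by (metis abs_divide abs_of_pos)
          qed
          ultimately show ?thesis by simp
        qed
        have "(\<Sum>as\<in>Far n. p n as) - W * (real (card (Far n)) / vol n ^ k) = (\<Sum>as\<in>Far n. p n as - W / vol n ^ k)"
          by (simp add: sum_subtractf)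
        also have "\<bar>\<dots>\<bar> \<le> (\<Sum>as\<in>Far n. r / 2 / vol n ^ k)"
          by (rule order_trans[OF sum_abs]) (intro sum_mono each)
        also have "\<dots> = r / 2 * (real (card (Far n)) / vol n ^ k)" by simp
        also have "\<dots> \<le> r / 2 * 1"
        proof (intro mult_left_mono)
          have "card (Far n) \<le> card {as :: (int ^ 'd) list. set as \<subseteq> lattice_box n \<and> length as = k}"
            using lenT(1) subsetD[OF lenT(2)] by (intro card_mono[OF finL]) (auto simp: Far_def)
          also have "\<dots> = (n ^ CARD('d)) ^ k"
            by (simp only: card_lists_length_eq[OF finite_lattice_box] card_lattice_box)
          finally have "real (card (Far n)) \<le> vol n ^ k" unfolding vol_def by (metis of_nat_le_iff of_nat_power)
          then show "real (card (Far n)) / vol n ^ k \<le> 1" using vp by (simp add: divide_le_eq_1)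
        qed (use r in auto)
        finally show ?case using r by simp
      qed
      then show "\<exists>no. \<forall>n\<ge>no. norm ((\<Sum>as\<in>Far n. p n as) - W * (real (card (Far n)) / vol n ^ k) - 0) < r"
        unfolding eventually_sequentially .
    qed
    then have "(\<lambda>n. ((\<Sum>as\<in>Far n. p n as) - W * (real (card (Far n)) / vol n ^ k)) + W * (real (card (Far n)) / vol n ^ k))
        \<longlonglongrightarrow> 0 + W * prod_list (map (cell_base m) cs)"
      by (intro tendsto_add tendsto_mult tendsto_const cardF)
    then show ?thesis by (simp add: W)
  qed
  have "(\<lambda>n. (\<Sum>as\<in>Far n. p n as) + (\<Sum>as\<in>Near n. p n as)) \<longlonglongrightarrow> prod_list (map (cell_mass m) cs) + 0"
    by (intro tendsto_add far near)
  then have "(\<lambda>n. (\<Sum>as\<in>Far n. p n as) + (\<Sum>as\<in>Near n. p n as)) \<longlonglongrightarrow> prod_list (map (cell_mass m) cs)" by simp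
  then show ?thesis
    by (rule Lim_transform_eventually) (use split in \<open>auto elim: eventually_mono\<close>)
qed

lemma cell_counts_converge:
  assumes m: "m > 0"
  shows "(\<lambda>n. prob {\<omega> \<in> space M. \<forall>q\<in>cell_index m. card (points_in_cell n m q \<omega>) = w q})
    \<longlonglongrightarrow> (\<Prod>q\<in>cell_index m. exp (- cell_mass m q) * cell_mass m q ^ w q / fact (w q))"
proof (rule poisson_limit_of_factorial_moments[where B = lattice_box])
  show "disjoint_family_on (\<lambda>q. points_in_cell n m q \<omega>) (cell_index m)" for n \<omega>
    using cells_disjoint[OF m] unfolding disjoint_family_on_def points_in_cell_def by blast
  show "(\<lambda>n. expectation (\<lambda>\<omega>. real (card (selections (map (\<lambda>q. points_in_cell n m q \<omega>) cs))))) \<longlonglongrightarrow> prod_list (map (cell_mass m) cs)"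
    if "set cs \<subseteq> cell_index m" for cs by (rule factorial_moments_converge[OF m that])
  show "{\<omega> \<in> space M. \<alpha> \<in> points_in_cell n m q \<omega>} \<in> events" for \<alpha> n q by (rule points_in_cell_event)
qed (auto simp: finite_cell_index finite_lattice_box points_in_cell_def)

end

section \<open>The Poisson limit\<close>

lemma exp_density_atLeast: "emeasure (density lborel (\<lambda>z. ennreal (exp (- z)))) {a..} = ennreal (exp (- a))"
proof -
  have "emeasure (density lborel (\<lambda>z. ennreal (exp (- z)))) {a..} = (\<integral>\<^sup>+z. ennreal (exp (- z)) * indicator {a..} z \<partial>lborel)"
    by (rule emeasure_density) auto
  also have "\<dots> = ennreal (0 - (- exp (- a)))"
  proof (rule nn_integral_FTC_atLeast)
    show "((\<lambda>z::real. - exp (- z)) \<longlongrightarrow> 0) at_top" by real_asymp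
    show "((\<lambda>z. - exp (- z)) has_real_derivative exp (- x)) (at x)" for x :: real
      by (auto intro!: derivative_eq_intros)
  qed auto
  finally show ?thesis by simp
qed

lemma exp_density_atLeastLessThan:
  assumes "a \<le> b"
  shows "emeasure (density lborel (\<lambda>z. ennreal (exp (- z)))) {a..<b} = ennreal (exp (- a) - exp (- b))"
proof -
  have "{a..<b} = {a..} - {b..}" by auto
  moreover have "emeasure (density lborel (\<lambda>z. ennreal (exp (- z)))) ({a..} - {b..}) = ennreal (exp (- a)) - ennreal (exp (- b))"
    using assms by (subst emeasure_Diff) (auto simp: exp_density_atLeast)
  ultimately show ?thesis by (simp add: ennreal_minus)
qed

lemma height_cell_intensity:
  assumes m: "m > 0"
  shows "emeasure (density lborel (\<lambda>z. ennreal (exp (- z)))) {z. ereal z \<in> height_cell m k} = ennreal (window_weight (cell_window m k))"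
proof (cases "k = int m * int m")
  case True
  then have "{z. ereal z \<in> height_cell m k} = {real_of_int k / real m..}" using m by (auto simp: height_cell_def)
  then show ?thesis using True by (simp add: exp_density_atLeast cell_window_def)
next
  case False
  then have "{z. ereal z \<in> height_cell m k} = {real_of_int k / real m..<real_of_int (k + 1) / real m}"
    by (auto simp: height_cell_def)
  moreover have "real_of_int k / real m \<le> real_of_int (k + 1) / real m" by (intro divide_right_mono) auto
  ultimately show ?thesis using False exp_density_atLeastLessThan by (simp add: cell_window_def)
qed

text \<open>The set lies between an open and a closed box with the same corners.  On the upper faces the upper corner is
  capped at \<open>1\<close>, which makes the box degenerate.\<close>

lemma grid_cube_volume:
  fixes q :: "(int ^ 'd::finite) \<times> int"
  assumes m: "m > 0" and q: "q \<in> cell_index m"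
  defines "A \<equiv> {t :: real ^ 'd. t \<in> cbox 0 1 \<and> (\<forall>i. \<lfloor>real m * t $ i\<rfloor> = fst q $ i)}"
  shows "A \<in> sets borel" and "emeasure lborel A = ennreal (cell_base m q)"
proof -
  have [measurable]: "(\<lambda>t :: real ^ 'd. t $ i) \<in> borel_measurable borel" for i by (simp add: borel_measurable_continuous_onI)
  have "{t \<in> space borel. t \<in> cbox 0 1 \<and> (\<forall>i. \<lfloor>real m * t $ i\<rfloor> = fst q $ i)} \<in> sets (borel :: (real ^ 'd) measure)" by measurable
  then show A: "A \<in> sets borel" by (simp add: A_def)
  define l :: "real ^ 'd" where "l = (\<chi> i. real_of_int (fst q $ i) / real m)"
  define u :: "real ^ 'd" where "u = (\<chi> i. min (real_of_int (fst q $ i + 1) / real m) 1)"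
  have qi: "0 \<le> fst q $ i" "fst q $ i \<le> int m" for i using q by (auto simp: cell_index_def)
  have l01: "0 \<le> l $ i" "l $ i \<le> 1" for i using qi[of i] m by (simp_all add: l_def divide_le_eq_1)
  have lu: "l $ i \<le> u $ i" for i using l01[of i] by (auto simp: l_def u_def intro: divide_right_mono)
  have fl: "\<lfloor>real m * t\<rfloor> = j \<longleftrightarrow> real_of_int j / real m \<le> t \<and> t < real_of_int (j + 1) / real m" for t j
    using m by (simp add: floor_eq_iff field_simps)
  have s1: "box l u \<subseteq> A"
  proof
    fix t assume t: "t \<in> box l u"
    then have "l $ i < t $ i" "t $ i < u $ i" for i by (auto simp: mem_box_cart)
    then have "l $ i \<le> t $ i \<and> t $ i < real_of_int (fst q $ i + 1) / real m \<and> t $ i \<le> 1" for i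
      using less_imp_le[of "l $ i" "t $ i"] by (simp add: u_def less_imp_le)
    moreover from this have "0 \<le> t $ i" for i using l01[of i] order_trans by blast
    ultimately show "t \<in> A" unfolding A_def by (simp add: mem_box_cart fl l_def)
  qed
  have s2: "A \<subseteq> cbox l u" by (auto simp: A_def mem_box_cart fl l_def u_def less_imp_le)
  have eqbox: "emeasure lborel (box l u) = emeasure lborel (cbox l u)"
    by (simp add: emeasure_lborel_box_eq emeasure_lborel_cbox_eq)
  have "emeasure lborel A = emeasure lborel (cbox l u)"
  proof (rule antisym)
    show "emeasure lborel A \<le> emeasure lborel (cbox l u)" by (rule emeasure_mono[OF s2]) simp
    show "emeasure lborel (cbox l u) \<le> emeasure lborel A"
      unfolding eqbox[symmetric] by (rule emeasure_mono[OF s1]) (simp add: A)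
  qed
  also have "\<dots> = ennreal (measure lborel (cbox l u))"
    by (rule emeasure_eq_ennreal_measure) (simp add: emeasure_lborel_cbox_eq)
  also have "measure lborel (cbox l u) = (\<Prod>i\<in>UNIV. u $ i - l $ i)"
    by (rule content_cbox_cart) (use lu in \<open>auto simp: interval_ne_empty_cart\<close>)
  also have "\<dots> = cell_base m q"
    unfolding cell_base_def
  proof (intro prod.cong refl)
    fix i
    show "u $ i - l $ i = (if fst q $ i < int m then 1 / real m else 0)"
    proof (cases "fst q $ i < int m")
      case True
      then have "real_of_int (fst q $ i + 1) \<le> real_of_int (int m)" by (simp only: of_int_le_iff)
      then have "real_of_int (fst q $ i + 1) / real m \<le> 1" using m by (simp add: divide_le_eq_1)
      then show ?thesis using True by (simp add: u_def l_def add_divide_distrib)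
    next
      case False
      then have "fst q $ i = int m" using qi[of i] by simp
      then show ?thesis using m by (simp add: u_def l_def le_divide_eq)
    qed
  qed
  finally show "emeasure lborel A = ennreal (cell_base m q)" .
qed

lemma limit_intensity_cell:
  fixes q :: "(int ^ 'd::finite) \<times> int"
  assumes m: "m > 0" and q: "q \<in> cell_index m"
  shows "emeasure limit_intensity (cell m q) = ennreal (cell_mass m q)"
proof -
  let ?A = "{t :: real ^ 'd. t \<in> cbox 0 1 \<and> (\<forall>i. \<lfloor>real m * t $ i\<rfloor> = fst q $ i)}"
  let ?B = "{z. ereal z \<in> height_cell m (snd q)}"
  let ?L = "restrict_space lborel (cbox 0 1 :: (real ^ 'd) set)"
  let ?D = "density lborel (\<lambda>z::real. ennreal (exp (- z)))"
  interpret D: sigma_finite_measure ?D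
    by (subst sigma_finite_measure.sigma_finite_iff_density_finite) (auto intro: sigma_finite_lborel)
  have spL: "space ?L = cbox 0 1" by (simp add: space_restrict_space)
  have meas: "(\<lambda>(t, z). (t, ereal z)) \<in> ?L \<Otimes>\<^sub>M ?D \<rightarrow>\<^sub>M restrict_space borel state_space"
  proof (rule measurable_restrict_space2)
    show "(\<lambda>(t, z). (t, ereal z)) \<in> space (?L \<Otimes>\<^sub>M ?D) \<rightarrow> state_space"
      by (auto simp: space_pair_measure spL state_space_def)
    have "(\<lambda>t. t) \<in> ?L \<rightarrow>\<^sub>M borel"
      by (intro measurable_restrict_space1 measurable_ident_sets) simp
    then have f: "(\<lambda>x. fst x) \<in> ?L \<Otimes>\<^sub>M ?D \<rightarrow>\<^sub>M borel" by (rule measurable_compose[OF measurable_fst])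
    have "(\<lambda>x. snd x) \<in> ?L \<Otimes>\<^sub>M ?D \<rightarrow>\<^sub>M borel" using measurable_snd[of ?L ?D] by simp
    then have "(\<lambda>x. ereal (snd x)) \<in> ?L \<Otimes>\<^sub>M ?D \<rightarrow>\<^sub>M borel" by measurable
    with f have "(\<lambda>x. (fst x, ereal (snd x))) \<in> ?L \<Otimes>\<^sub>M ?D \<rightarrow>\<^sub>M borel \<Otimes>\<^sub>M borel" by (rule measurable_Pair)
    then show "(\<lambda>(t, z). (t, ereal z)) \<in> ?L \<Otimes>\<^sub>M ?D \<rightarrow>\<^sub>M borel" by (simp add: borel_prod case_prod_unfold)
  qed
  have B: "?B \<in> sets ?D"
    using measurable_sets[of ereal borel borel, OF _ height_cell_sets[of m "snd q"]] by (simp add: vimage_def)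
  have A: "?A \<in> sets ?L" using grid_cube_volume(1)[OF m q] by (auto simp: sets_restrict_space)
  have "emeasure limit_intensity (cell m q) = emeasure (?L \<Otimes>\<^sub>M ?D) ((\<lambda>(t, z). (t, ereal z)) -` cell m q \<inter> space (?L \<Otimes>\<^sub>M ?D))"
    unfolding limit_intensity_def by (rule emeasure_distr[OF meas cell_sets])
  also have "(\<lambda>(t, z). (t, ereal z)) -` cell m q \<inter> space (?L \<Otimes>\<^sub>M ?D) = ?A \<times> ?B"
    by (auto simp: space_pair_measure spL cell_def state_space_def)
  also have "emeasure (?L \<Otimes>\<^sub>M ?D) (?A \<times> ?B) = emeasure ?L ?A * emeasure ?D ?B"
    by (rule D.emeasure_pair_measure_Times[OF A B])
  also have "emeasure ?L ?A = emeasure lborel ?A" by (rule emeasure_restrict_space) auto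
  also have "\<dots> * emeasure ?D ?B = ennreal (cell_mass m q)"
    unfolding grid_cube_volume(2)[OF m q] height_cell_intensity[OF m] cell_mass_def
    by (rule ennreal_mult[symmetric])
      (auto simp: cell_base_def intro!: prod_nonneg window_weight_nonneg cell_window_proper m)
  finally show ?thesis .
qed

lemma cell_mass_nonneg: "m > 0 \<Longrightarrow> 0 \<le> cell_mass m q"
  by (auto simp: cell_mass_def cell_base_def intro!: mult_nonneg_nonneg prod_nonneg window_weight_nonneg cell_window_proper)

text \<open>Cells are disjoint, so their counts are independent Poisson variables.  The definition speaks about families
  indexed by initial segments of the natural numbers, so the cells are enumerated first.\<close>

lemma poisson_cell_counts:
  fixes \<eta> :: "'p \<Rightarrow> ((real ^ 'd::finite) \<times> ereal) measure"
  assumes \<eta>: "poisson_random_measure P state_space limit_intensity \<eta>" and m: "m > 0"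
  shows "q \<in> cell_index m \<Longrightarrow> (\<lambda>\<omega>. emeasure (\<eta> \<omega>) (cell m q)) \<in> borel_measurable P"
    and "measure P {\<omega> \<in> space P. \<forall>q\<in>cell_index m. emeasure (\<eta> \<omega>) (cell m q) = of_nat (w q)}
      = (\<Prod>q\<in>cell_index m. exp (- cell_mass m q) * cell_mass m q ^ w q / fact (w q))"
proof -
  interpret P: prob_space P using \<eta> by (simp add: poisson_random_measure_def)
  define Q where "Q = (cell_index m :: ((int ^ 'd) \<times> int) set)"
  obtain h where h: "bij_betw h {0..<card Q} Q"
    using ex_bij_betw_nat_finite[OF finite_cell_index[of m]] unfolding Q_def by blast
  let ?I = "{..<card Q}"
  have h': "bij_betw h ?I Q" using h by (simp add: atLeast0LessThan)
  have ne: "?I \<noteq> {}"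
  proof -
    have "(0, 0) \<in> Q" by (auto simp: Q_def cell_index_def)
    then have "card Q > 0" using finite_cell_index[of m] by (auto simp: Q_def card_gt_0_iff)
    then show ?thesis by auto
  qed
  have hQ: "h i \<in> cell_index m" if "i \<in> ?I" for i using bij_betwE[OF h'] that unfolding Q_def by blast
  have disj: "disjoint_family_on (\<lambda>i. cell m (h i)) ?I"
    unfolding disjoint_family_on_def
  proof (intro ballI impI)
    fix i j assume ij: "i \<in> ?I" "j \<in> ?I" "i \<noteq> j"
    then have "h i \<noteq> h j" using h' by (auto simp: bij_betw_def inj_on_def)
    then show "cell m (h i) \<inter> cell m (h j) = {}"
      using cells_disjoint[OF m] hQ ij unfolding disjoint_family_on_def by blast
  qed
  have indep: "\<forall>N::nat. \<forall>A. (\<forall>i<N. A i \<in> sets (restrict_space borel state_space)) \<and> disjoint_family_on A {..<N} \<longrightarrow>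
      P.indep_vars (\<lambda>_. borel) (\<lambda>i \<omega>. emeasure (\<eta> \<omega>) (A i)) {..<N}"
    using \<eta> unfolding poisson_random_measure_def by (elim conjE) assumption
  have ind: "P.indep_vars (\<lambda>_. borel) (\<lambda>i \<omega>. emeasure (\<eta> \<omega>) (cell m (h i))) ?I"
    by (rule mp[OF spec[OF spec[OF indep, of "card Q"], of "\<lambda>i. cell m (h i)"]]) (intro conjI allI impI cell_sets disj)
  have meas: "(\<lambda>\<omega>. emeasure (\<eta> \<omega>) (cell m q)) \<in> borel_measurable P" if "q \<in> cell_index m" for q
  proof -
    have "q \<in> h ` ?I" using that bij_betw_imp_surj_on[OF h'] unfolding Q_def by (simp only:)
    then obtain i where "i \<in> ?I" "q = h i" by (rule imageE)
    moreover have "\<forall>i\<in>?I. (\<lambda>\<omega>. emeasure (\<eta> \<omega>) (cell m (h i))) \<in> borel_measurable P"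
      using ind unfolding P.indep_vars_def2 by (rule conjunct1)
    ultimately show ?thesis by simp
  qed
  then show "(\<lambda>\<omega>. emeasure (\<eta> \<omega>) (cell m q)) \<in> borel_measurable P" if "q \<in> cell_index m" using that .
  have marg: "P.prob {\<omega> \<in> space P. emeasure (\<eta> \<omega>) (cell m q) = of_nat (w q)} = exp (- cell_mass m q) * cell_mass m q ^ w q / fact (w q)"
    if q: "q \<in> cell_index m" for q
  proof -
    have "measure limit_intensity (cell m q) = cell_mass m q"
      using limit_intensity_cell[OF m q] cell_mass_nonneg[OF m, of q] by (simp add: measure_def)
    moreover have "emeasure limit_intensity (cell m q) < \<infinity>" by (simp add: limit_intensity_cell[OF m q])
    moreover have "\<forall>A \<in> sets (restrict_space borel state_space). emeasure limit_intensity A < \<infinity> \<longrightarrow>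
        (\<forall>k::nat. P.prob {\<omega> \<in> space P. emeasure (\<eta> \<omega>) A = of_nat k} =
                  exp (- measure limit_intensity A) * measure limit_intensity A ^ k / fact k)"
      using \<eta> unfolding poisson_random_measure_def by (elim conjE) assumption
    ultimately show ?thesis using cell_sets[of m q] by simp
  qed
  have vim: "(\<lambda>\<omega>. emeasure (\<eta> \<omega>) (cell m q)) -` {of_nat (w q)} \<inter> space P = {\<omega> \<in> space P. emeasure (\<eta> \<omega>) (cell m q) = of_nat (w q)}" for q
    by auto
  have "{\<omega> \<in> space P. \<forall>q\<in>cell_index m. emeasure (\<eta> \<omega>) (cell m q) = of_nat (w q)}
      = (\<Inter>i\<in>?I. (\<lambda>\<omega>. emeasure (\<eta> \<omega>) (cell m (h i))) -` {of_nat (w (h i))} \<inter> space P)" (is "?lhs = ?rhs")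
  proof -
    have "cell_index m = h ` ?I" using h' by (simp add: Q_def bij_betw_def)
    then show ?thesis using ne by auto
  qed
  also have "P.prob \<dots> = (\<Prod>i\<in>?I. P.prob ((\<lambda>\<omega>. emeasure (\<eta> \<omega>) (cell m (h i))) -` {of_nat (w (h i))} \<inter> space P))"
    by (rule P.indep_varsD[OF ind ne]) auto
  also have "\<dots> = (\<Prod>i\<in>?I. exp (- cell_mass m (h i)) * cell_mass m (h i) ^ w (h i) / fact (w (h i)))"
    unfolding vim by (intro prod.cong refl marg hQ)
  also have "\<dots> = (\<Prod>q\<in>Q. exp (- cell_mass m q) * cell_mass m q ^ w q / fact (w q))"
    by (rule prod.reindex_bij_betw[OF h'])
  finally show "P.prob {\<omega> \<in> space P. \<forall>q\<in>cell_index m. emeasure (\<eta> \<omega>) (cell m q) = of_nat (w q)}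
      = (\<Prod>q\<in>cell_index m. exp (- cell_mass m q) * cell_mass m q ^ w q / fact (w q))" by (simp add: Q_def)
qed

lemma (in transient_gff) extremal_process_cell_count:
  "emeasure (extremal_process \<phi> n \<omega>) (cell m q) = of_nat (card (points_in_cell n m q \<omega>))"
  by (simp only: extremal_process_def Let_def emeasure_sum_of_point_masses_card[OF finite_lattice_box cell_sets]
      points_in_cell_def extremal_point_def v_def vol_def)

theorem theorem1:
  fixes M :: "'w measure" and \<phi> :: "int ^ 'd::finite \<Rightarrow> 'w \<Rightarrow> real"
    and P :: "'p measure" and \<eta> :: "'p \<Rightarrow> ((real ^ 'd) \<times> ereal) measure"
  assumes "CARD('d) \<ge> 3"
    and "discrete_gff M \<phi>"
    and "poisson_random_measure P state_space limit_intensity \<eta>"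
  shows "converges_in_distribution (vague_topology state_space) M (extremal_process \<phi>) P \<eta>"
proof -
  interpret transient_gff M \<phi> by unfold_locales (use assms in auto)
  show ?thesis
  proof (rule convergence_from_cell_counts)
    show "prob_space M" by (rule prob_space_axioms)
    show "prob_space P" "\<eta> \<in> P \<rightarrow>\<^sub>M borel_of (vague_topology state_space)"
      using assms(3) by (simp_all add: poisson_random_measure_def)
    show "extremal_process \<phi> n \<in> M \<rightarrow>\<^sub>M borel_of (vague_topology state_space)" for n
      by (rule extremal_process_measurable[OF finite_lattice_box phi_measurable])
    show "(\<lambda>\<omega>. emeasure (extremal_process \<phi> n \<omega>) (cell m q)) \<in> borel_measurable M" for n m and q :: "(int ^ 'd) \<times> int"
    proof -
      have "(\<lambda>\<omega>. \<Sum>\<alpha>\<in>lattice_box n. indicator {\<omega> \<in> space M. \<alpha> \<in> points_in_cell n m q \<omega>} \<omega> :: ennreal) \<in> borel_measurable M"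
        by (intro borel_measurable_sum borel_measurable_indicator points_in_cell_event)
      moreover have "(\<Sum>\<alpha>\<in>lattice_box n. indicator {\<omega> \<in> space M. \<alpha> \<in> points_in_cell n m q \<omega>} \<omega>) = emeasure (extremal_process \<phi> n \<omega>) (cell m q)"
        if "\<omega> \<in> space M" for \<omega>
      proof -
        have "lattice_box n \<inter> {\<alpha>. \<alpha> \<in> points_in_cell n m q \<omega>} = points_in_cell n m q \<omega>" by (auto simp: points_in_cell_def)
        then show ?thesis using that by (simp add: extremal_process_cell_count indicator_def sum_of_bool_eq finite_lattice_box)
      qed
      ultimately show ?thesis by (simp cong: measurable_cong)
    qed
    show "(\<lambda>\<omega>. emeasure (\<eta> \<omega>) (cell m q)) \<in> borel_measurable P" if "m > 0" "q \<in> cell_index m" for m and q :: "(int ^ 'd) \<times> int"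
      by (rule poisson_cell_counts(1)[OF assms(3) that])
    show "(\<lambda>n. measure M {\<omega> \<in> space M. \<forall>q\<in>cell_index m. emeasure (extremal_process \<phi> n \<omega>) (cell m q) = of_nat (w q)})
      \<longlonglongrightarrow> measure P {\<omega> \<in> space P. \<forall>q\<in>cell_index m. emeasure (\<eta> \<omega>) (cell m q) = of_nat (w q)}"
      if "m > 0" for m and w :: "(int ^ 'd) \<times> int \<Rightarrow> nat"
      unfolding poisson_cell_counts(2)[OF assms(3) that] extremal_process_cell_count of_nat_eq_iff
      by (rule cell_counts_converge[OF that])
  qed
qed

end
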